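(* Let $T>0$, $s>\frac52$, and $2\le p\le\infty$. Let $u\in C([0,T],H^s(\mathbb{R}))$ be a strong solution of the Cauchy problem $$u_t-u_{txx}=\partial_x(2+\partial_x)[(2-\partial_x)u]^2,\qquad u(0,x)=u_0(x),$$ such that $u|_{t=0}=u_0$ satisfies $$u_0\phi\in L^p(\mathbb{R}),\qquad (\partial_x u_0)\phi\in L^p(\mathbb{R}),\qquad (\partial_{xx}u_0)\phi\in L^p(\mathbb{R}),$$ where $\phi$ is an admissible weight function, with associated sub-multiplicative weight $v$ and constants $C_0$, $A$ as in the definition of admissibility. Then, for all $t\in[0,T]$, $$\|u(t)\phi\|_p+\|\partial_x u(t)\phi\|_p+\|\partial_{xx}u(t)\phi\|_p\le\Big(\|u_0\phi\|_p+\|\partial_x u_0\,\phi\|_p+\|\partial_{xx}u_0\,\phi\|_p\Big)e^{CMt},$$ for some constant $C>0$ depending only on $v$ and $\phi$ (through $A$, $C_0$, $\inf_{x\in\mathbb{R}}v(x)$ and $\int_{\mathbb{R}}\frac{v(x)}{e^{|x|}}\,dx$), where $$M\equiv\sup_{t\in[0,T]}\big(\|u(t)\|_\infty+\|\partial_x u(t)\|_\infty+\|\partial_{xx}u(t)\|_\infty\big)<\infty.$$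
   Context: $\|\cdot\|_p$ is the norm of $L^p(\mathbb{R})$. The Cauchy problem is equivalent to $$u_t=4uu_x+G\star\big[\partial_x(2u_x^2+6u^2)+\partial_x^2(u_x^2)\big],\qquad u(0,x)=u_0(x),$$ with $G(x)=\frac12e^{-|x|}$ (so $G\star f=(1-\partial_x^2)^{-1}f$) and $\star$ the convolution in $x$. A weight function is a non-negative function. A weight function $v:\mathbb{R}\to\mathbb{R}$ is sub-multiplicative if $v(x+y)\le v(x)v(y)$ for all $x,y\in\mathbb{R}$. Given a sub-multiplicative function $v$, a positive function $\phi$ is $v$-moderate if there is $C_0>0$ such that $\phi(x+y)\le C_0\,v(x)\phi(y)$ for all $x,y\in\mathbb{R}$. An admissible weight function is a locally absolutely continuous function $\phi:\mathbb{R}\to\mathbb{R}$ such that: (1) $\phi$ is $v$-moderate (with constant $C_0$) for some sub-multiplicative weight function $v$ satisfying $\inf_{x\in\mathbb{R}}v(x)>0$ and $\int_{\mathbb{R}}\frac{v(x)}{e^{|x|}}\,dx<\infty$; (2) $|\phi'(x)|\le A|\phi(x)|$ for some $A>0$ and a.e. $x\in\mathbb{R}$. *)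

theory Defs
  imports "HOL-Probability.Essential_Supremum"
begin

text \<open>Elements of function spaces are represented by functions \<open>real \<Rightarrow> _\<close>; the notions built on them are
  invariant under changes on Lebesgue null sets.  The norm takes the value \<open>\<infinity>\<close> off \<open>L\<^sup>p\<close>,
  so a finite upper bound on it carries membership in \<open>L\<^sup>p\<close>.\<close>

definition Lp_norm :: "ennreal \<Rightarrow> (real \<Rightarrow> 'a::real_normed_vector) \<Rightarrow> ennreal" where
  "Lp_norm p f =
     (if p = \<infinity> then esssup lebesgue (\<lambda>x. ennreal (norm (f x)))
      else if integrable lebesgue (\<lambda>x. norm (f x) powr enn2real p)
      then ennreal ((LINT x|lebesgue. norm (f x) powr enn2real p) powr (1 / enn2real p))
      else \<infinity>)"

definition Lp :: "ennreal \<Rightarrow> (real \<Rightarrow> 'a::real_normed_vector) set" where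
  "Lp p = {f. f \<in> borel_measurable lebesgue \<and> Lp_norm p f < \<infinity>}"

text \<open>Real-valued Schwartz functions suffice as test functions, since the complex ones are
  their complex linear combinations.\<close>

definition schwartz :: "(real \<Rightarrow> real) \<Rightarrow> bool" where
  "schwartz \<psi> \<longleftrightarrow>
     (\<forall>n x. (deriv ^^ n) \<psi> field_differentiable (at x)) \<and>
     (\<forall>k n. bounded (range (\<lambda>x. x ^ k * (deriv ^^ n) \<psi> x)))"

definition tempered_fun :: "(real \<Rightarrow> 'a::{banach, second_countable_topology}) \<Rightarrow> bool" where
  "tempered_fun f \<longleftrightarrow>
     f \<in> borel_measurable lebesgue \<and>
     (\<forall>\<psi>. schwartz \<psi> \<longrightarrow> integrable lebesgue (\<lambda>x. \<psi> x *\<^sub>R f x))"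

definition dist_of :: "(real \<Rightarrow> 'a::{banach, second_countable_topology}) \<Rightarrow> (real \<Rightarrow> real) \<Rightarrow> 'a" where
  "dist_of f \<psi> = (LINT x|lebesgue. \<psi> x *\<^sub>R f x)"

definition dist_deriv :: "((real \<Rightarrow> real) \<Rightarrow> 'a::real_vector) \<Rightarrow> (real \<Rightarrow> real) \<Rightarrow> 'a" where
  "dist_deriv \<Lambda> \<psi> = - \<Lambda> (deriv \<psi>)"

definition has_weak_deriv :: "(real \<Rightarrow> real) \<Rightarrow> (real \<Rightarrow> real) \<Rightarrow> bool" where
  "has_weak_deriv f g \<longleftrightarrow>
     tempered_fun f \<and> tempered_fun g \<and>
     (\<forall>\<psi>. schwartz \<psi> \<longrightarrow> dist_of g \<psi> = dist_deriv (dist_of f) \<psi>)"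

text \<open>Well defined up to null sets.\<close>

definition weak_deriv :: "(real \<Rightarrow> real) \<Rightarrow> real \<Rightarrow> real" where
  "weak_deriv f = (SOME g. has_weak_deriv f g)"

definition schwartz_fourier :: "(real \<Rightarrow> real) \<Rightarrow> real \<Rightarrow> complex" where
  "schwartz_fourier \<psi> \<xi> = (LINT x|lebesgue. \<psi> x *\<^sub>R cis (- (x * \<xi>)))"

text \<open>The Fourier transform is taken in the sense of tempered distributions,
  \<open>\<langle>f^, \<psi>\<rangle> = \<langle>f, \<psi>^\<rangle>\<close>.\<close>

definition has_fourier :: "(real \<Rightarrow> real) \<Rightarrow> (real \<Rightarrow> complex) \<Rightarrow> bool" where
  "has_fourier f g \<longleftrightarrow>
     tempered_fun f \<and> tempered_fun g \<and>
     (\<forall>\<psi>. schwartz \<psi> \<longrightarrow>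
        dist_of g \<psi> = (LINT x|lebesgue. f x *\<^sub>R schwartz_fourier \<psi> x))"

definition fourier :: "(real \<Rightarrow> real) \<Rightarrow> real \<Rightarrow> complex" where
  "fourier f = (SOME g. has_fourier f g)"

text \<open>Only \<open>H\<^sup>s\<close> for \<open>s \<ge> 0\<close> is meant, as a subspace of \<open>L\<^sup>2\<close>;
  existence of the Fourier transform is then automatic and only guards the choice in \<open>fourier\<close>.\<close>

definition bessel_fourier :: "real \<Rightarrow> (real \<Rightarrow> real) \<Rightarrow> real \<Rightarrow> complex" where
  "bessel_fourier s f \<xi> = (1 + \<xi>\<^sup>2) powr (s / 2) *\<^sub>R fourier f \<xi>"

definition Hs_norm :: "real \<Rightarrow> (real \<Rightarrow> real) \<Rightarrow> ennreal" where
  "Hs_norm s f = Lp_norm 2 (bessel_fourier s f)"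

definition Hs :: "real \<Rightarrow> (real \<Rightarrow> real) set" where
  "Hs s = {f. f \<in> Lp 2 \<and> (\<exists>g. has_fourier f g) \<and> bessel_fourier s f \<in> Lp 2}"

definition continuous_Hs :: "real \<Rightarrow> real \<Rightarrow> (real \<Rightarrow> real \<Rightarrow> real) \<Rightarrow> bool" where
  "continuous_Hs s T w \<longleftrightarrow>
     (\<forall>t\<in>{0..T}. w t \<in> Hs s) \<and>
     (\<forall>t\<in>{0..T}. ((\<lambda>\<tau>. Hs_norm s (\<lambda>x. w \<tau> x - w t x)) \<longlongrightarrow> 0) (at t within {0..T}))"

definition has_time_deriv_Hs ::
    "real \<Rightarrow> real \<Rightarrow> (real \<Rightarrow> real \<Rightarrow> real) \<Rightarrow> (real \<Rightarrow> real \<Rightarrow> real) \<Rightarrow> bool" where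
  "has_time_deriv_Hs s T w w' \<longleftrightarrow>
     (\<forall>t\<in>{0..T}. ((\<lambda>\<tau>. Hs_norm s (\<lambda>x. (w \<tau> x - w t x) / (\<tau> - t) - w' t x)) \<longlongrightarrow> 0)
        (at t within {0..T}))"

text \<open>For \<open>s > 5/2\<close> both sides of
  \<open>u\<^sub>t - u\<^sub>t\<^sub>x\<^sub>x = \<partial>\<^sub>x (2 + \<partial>\<^sub>x) [(2 - \<partial>\<^sub>x) u]\<^sup>2\<close> lie in \<open>H\<^sup>s\<^sup>-\<^sup>3\<close>, which may contain genuine
  distributions; the equation is therefore an identity of tempered distributions at each time.
  A strong solution belongs to \<open>C([0,T], H\<^sup>s) \<inter> C\<^sup>1([0,T], H\<^sup>s\<^sup>-\<^sup>1)\<close>.\<close>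

definition pde_at :: "(real \<Rightarrow> real) \<Rightarrow> (real \<Rightarrow> real) \<Rightarrow> bool" where
  "pde_at u ut \<longleftrightarrow>
     (let R = dist_of (\<lambda>x. (2 * u x - weak_deriv u x)\<^sup>2)
      in \<forall>\<psi>. schwartz \<psi> \<longrightarrow>
           dist_of ut \<psi> - dist_deriv (dist_deriv (dist_of ut)) \<psi> =
           dist_deriv (\<lambda>\<eta>. 2 * R \<eta> + dist_deriv R \<eta>) \<psi>)"

definition strong_solution ::
    "real \<Rightarrow> real \<Rightarrow> (real \<Rightarrow> real \<Rightarrow> real) \<Rightarrow> (real \<Rightarrow> real) \<Rightarrow> bool" where
  "strong_solution T s u u0 \<longleftrightarrow>
     continuous_Hs s T u \<and>
     (\<exists>ut. continuous_Hs (s - 1) T ut \<and> has_time_deriv_Hs (s - 1) T u ut \<and>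
           (\<forall>t\<in>{0..T}. pde_at (u t) (ut t))) \<and>
     (AE x in lebesgue. u 0 x = u0 x)"

definition weight_function :: "(real \<Rightarrow> real) \<Rightarrow> bool" where
  "weight_function v \<longleftrightarrow> (\<forall>x. 0 \<le> v x)"

definition submultiplicative :: "(real \<Rightarrow> real) \<Rightarrow> bool" where
  "submultiplicative v \<longleftrightarrow> (\<forall>x y. v (x + y) \<le> v x * v y)"

definition moderate :: "(real \<Rightarrow> real) \<Rightarrow> real \<Rightarrow> (real \<Rightarrow> real) \<Rightarrow> bool" where
  "moderate v C0 \<phi> \<longleftrightarrow>
     (\<forall>x. 0 < \<phi> x) \<and> 0 < C0 \<and> (\<forall>x y. \<phi> (x + y) \<le> C0 * v x * \<phi> y)"

definition absolutely_continuous_on_interval :: "real \<Rightarrow> real \<Rightarrow> (real \<Rightarrow> real) \<Rightarrow> bool" where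
  "absolutely_continuous_on_interval a b f \<longleftrightarrow>
     (\<forall>e>0. \<exists>d>0. \<forall>(n::nat) l r.
        (\<forall>i<n. a \<le> l i \<and> l i \<le> r i \<and> r i \<le> b) \<and>
        disjoint_family_on (\<lambda>i. {l i<..<r i}) {..<n} \<and>
        (\<Sum>i<n. r i - l i) < d \<longrightarrow>
        (\<Sum>i<n. \<bar>f (r i) - f (l i)\<bar>) < e)"

definition locally_absolutely_continuous :: "(real \<Rightarrow> real) \<Rightarrow> bool" where
  "locally_absolutely_continuous f \<longleftrightarrow>
     (\<forall>a b. a \<le> b \<longrightarrow> absolutely_continuous_on_interval a b f)"

definition admissible_weight ::
    "(real \<Rightarrow> real) \<Rightarrow> (real \<Rightarrow> real) \<Rightarrow> real \<Rightarrow> real \<Rightarrow> bool" where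
  "admissible_weight \<phi> v C0 A \<longleftrightarrow>
     locally_absolutely_continuous \<phi> \<and>
     weight_function v \<and> submultiplicative v \<and>
     moderate v C0 \<phi> \<and>
     0 < (INF x. v x) \<and>
     integrable lebesgue (\<lambda>x. v x / exp \<bar>x\<bar>) \<and>
     0 < A \<and>
     (AE x in lebesgue. \<exists>D. (\<phi> has_real_derivative D) (at x) \<and> \<bar>D\<bar> \<le> A * \<bar>\<phi> x\<bar>)"

end

theory Submission
  imports Defs "HOL-Computational_Algebra.Polynomial" "HOL-Probability.Characteristic_Functions" "HOL-Probability.Sinc_Integral"
    "HOL-Real_Asymp.Real_Asymp"
begin

text \<open>For \<open>s > 5/2\<close> the Sobolev embedding makes \<open>u, u\<^sub>x, u\<^sub>x\<^sub>x\<close> bounded and Hoelder continuous and gives \<open>u\<^sub>t\<close> a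
  continuous \<open>x\<close>-derivative.  Inverting \<open>1 - \<partial>\<^sub>x\<^sup>2\<close> by \<open>G\<close> bounds \<open>u\<^sub>t\<close> and \<open>u\<^sub>t\<^sub>x\<close> pointwise by \<open>M\<close> times
  \<open>|u| + |u\<^sub>x| + |u\<^sub>x\<^sub>x|\<close> and its convolution with \<open>G\<close>, and \<open>u\<^sub>x\<^sub>x\<close> is transported with velocity
  \<open>4 u - 2 u\<^sub>x\<close> under a forcing of the same size.  For an integrable truncation of \<open>\<phi>\<close> and \<open>2 \<le> q < \<infinity>\<close>
  the \<open>L\<^sup>q\<close> energies can be differentiated: the transport term is integrated by parts using
  \<open>|\<phi>'| \<le> A \<phi>\<close>, and the convolution is controlled by Young's inequality with the kernel
  \<open>v e\<^sup>-\<^sup>|\<^sup>x\<^sup>|\<close>, as \<open>\<phi>\<close> is \<open>v\<close>-moderate.  Gronwall's lemma gives a rate independent of \<open>q\<close> and of the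
  truncation, so that both can be removed.\<close>

section \<open>Weights of exponential growth\<close>

text \<open>Two demands shape the estimates: the rate must be linear in M and free of q. Linearity
  holds because the nonlinearity is quadratic: in each product one factor is bounded by M, and only
  the other enters the weighted norm. Freedom from q holds because differentiating the integral of
  |W|^q w^q in time yields a factor q, while the integration by parts falls on w^q, whose growth
  rate is q times that of w; the two factors cancel when the q-th root is differentiated. The
  obstacle is a loss of derivatives. With R = (2 u - u_x)^2 the equation for u_xx contains R_xx,
  hence u_xxx, which need not exist for s close to 5/2. But R_x = (4 u - 2 u_x) (2 u_x - u_xx), so
  u_xxx enters only through a transport term, and this survives in a form that needs no third
  derivative. The weight must be truncated because a bounded solution may have infinite weighted
  energy at positive times as far as is known beforehand. The truncation has to keep growth rate and
  moderateness constants bounded, otherwise the rate would depend on its level.\<close>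

text \<open>\<open>f\<close> itself is not absolutely continuous.  The null set on which its derivative is not controlled
  is covered by an open set of small measure, over which the dominating increments of \<open>g\<close> are small.\<close>

lemma ae_nonincreasing_if_ac_dominated:
  fixes f g :: "real \<Rightarrow> real"
  assumes ab: "a \<le> b" and ac: "absolutely_continuous_on_interval a b g"
    and dom: "\<And>x y. a \<le> x \<Longrightarrow> x \<le> y \<Longrightarrow> y \<le> b \<Longrightarrow> f y - f x \<le> K * \<bar>g y - g x\<bar>"
    and der: "AE x in lebesgue. \<exists>D\<le>0. (f has_real_derivative D) (at x)"
  shows "f b \<le> f a"
proof -
  \<comment> \<open>\<open>K\<close> carries no sign condition; the positive substitute is needed
    when the sum of the increments of \<open>g\<close> is replaced by its bound
    \<open>e\<close>.\<close>
  define K' where "K' = \<bar>K\<bar> + 1"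
  have K': "K' > 0" "\<And>z. K * \<bar>z\<bar> \<le> K' * \<bar>z\<bar>"
    unfolding K'_def by (auto intro!: mult_right_mono)
  have main: "f b - f a \<le> e * (b - a) + K' * e" if e: "e > 0" for e
  proof -
    obtain d where d: "d > 0" and acd: "\<And>n l r. (\<forall>i<n::nat. a \<le> l i \<and> l i \<le> r i \<and> r i \<le> b) \<Longrightarrow>
        disjoint_family_on (\<lambda>i. {l i<..<r i}) {..<n} \<Longrightarrow> (\<Sum>i<n. r i - l i) < d \<Longrightarrow>
        (\<Sum>i<n. \<bar>g (r i) - g (l i)\<bar>) < e"
      using ac e unfolding absolutely_continuous_on_interval_def by meson
    obtain N where N: "N \<in> null_sets lebesgue" "{x. \<not> (\<exists>D\<le>0. (f has_real_derivative D) (at x))} \<subseteq> N"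
      using der unfolding eventually_ae_filter by (auto simp del: not_ex)
    obtain Q where Q: "open Q" "N \<subseteq> Q" "Q - N \<in> lmeasurable" "emeasure lebesgue (Q - N) < ennreal d"
      by (rule sets_lebesgue_outer_open[OF null_setsD2[OF N(1)] d])
    have mO: "emeasure lebesgue Q < ennreal d"
    proof -
      have "emeasure lebesgue Q = emeasure lebesgue (Q - N)"
        using N(1) Q(1) by (simp add: emeasure_Diff_null_set)
      with Q(4) show ?thesis by simp
    qed
    \<comment> \<open>The radius of a gauge. At a point of \<open>N\<close> the ball stays inside
      \<open>Q\<close>; elsewhere it gives the straddle estimate, in which the interval contains the
      point anywhere and not only as an endpoint.\<close>
    have "\<exists>r>0. (x \<in> N \<longrightarrow> ball x r \<subseteq> Q) \<and>
        (x \<notin> N \<longrightarrow> (\<forall>u v. u \<le> x \<and> x \<le> v \<and> {u..v} \<subseteq> ball x r \<longrightarrow> f v - f u \<le> e * (v - u)))" for x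
    proof (cases "x \<in> N")
      case True
      then show ?thesis using Q openE[of Q x] by blast
    next
      case False
      then obtain D where D: "D \<le> 0" "(f has_real_derivative D) (at x)" using N by auto
      then obtain r where r: "r > 0" "\<And>y. norm (y - x) < r \<Longrightarrow> norm (f y - f x - D * (y - x)) \<le> e * norm (y - x)"
        using e unfolding has_field_derivative_def has_derivative_at_alt by blast
      have "f v - f u \<le> e * (v - u)" if h: "u \<le> x" "x \<le> v" "{u..v} \<subseteq> ball x r" for u v
      proof -
        have "u \<in> {u..v}" "v \<in> {u..v}" using h(1,2) by auto
        with h(3) have uv: "u \<in> ball x r" "v \<in> ball x r" by blast+
        then have "\<bar>f v - f x - D * (v - x)\<bar> \<le> e * (v - x)" "\<bar>f u - f x - D * (u - x)\<bar> \<le> e * (x - u)"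
          using r(2)[of u] r(2)[of v] h by (auto simp: dist_real_def abs_minus_commute)
        moreover have "D * (v - x) \<le> 0" "D * (x - u) \<le> 0"
          using D(1) h by (auto simp: mult_nonpos_nonneg)
        ultimately show ?thesis by (simp add: algebra_simps abs_le_iff)
      qed
      with r False show ?thesis by blast
    qed
    then obtain r where r: "\<And>x. r x > 0" "\<And>x. x \<in> N \<Longrightarrow> ball x (r x) \<subseteq> Q"
      "\<And>x u v. x \<notin> N \<Longrightarrow> u \<le> x \<Longrightarrow> x \<le> v \<Longrightarrow> {u..v} \<subseteq> ball x (r x) \<Longrightarrow> f v - f u \<le> e * (v - u)"
      by metis
    \<comment> \<open>Cousin's lemma gives a fine tagged division. Intervals tagged in
      \<open>N\<close> lie in \<open>Q\<close> and have total length below \<open>d\<close>, so that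
      absolute continuity of \<open>g\<close> controls them; the others obey the straddle
      estimate.\<close>
    have "gauge (\<lambda>x. ball x (r x))" using r(1) by (simp add: gauge_ball_dependent)
    then obtain p where p: "p tagged_division_of {a..b}" "(\<lambda>x. ball x (r x)) fine p"
      using fine_division_exists_real by blast
    note pD = tagged_division_ofD[OF p(1)]
    have K: "\<exists>u v. K = {u..v} \<and> u \<le> x \<and> x \<le> v \<and> a \<le> u \<and> v \<le> b" if xK: "(x, K) \<in> p" for x K
    proof -
      obtain u v where uv: "K = cbox u v" using pD(4)[OF xK] by blast
      then have "K = {u..v}" by simp
      moreover from this have "u \<le> x" "x \<le> v" using pD(2)[OF xK] by auto
      moreover from calculation have "u \<in> {a..b}" "v \<in> {a..b}" using pD(3)[OF xK] by auto
      ultimately show ?thesis by auto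
    qed
    let ?F = "\<lambda>(x::real,K::real set). f (Sup K) - f (Inf K)"
    let ?G = "\<lambda>(x::real,K::real set). \<bar>g (Sup K) - g (Inf K)\<bar>"
    let ?L = "\<lambda>(x::real,K::real set). Sup K - Inf K"
    let ?A = "{q\<in>p. fst q \<in> N}" and ?B = "{q\<in>p. fst q \<notin> N}"
    have fin: "finite p" using pD(1) .
    have L0: "?L q \<ge> 0" if "q \<in> p" for q using K that by (cases q) fastforce
    have B: "sum ?F ?B \<le> e * (b - a)"
    proof -
      have "sum ?F ?B \<le> sum (\<lambda>q. e * ?L q) ?B"
      proof (rule sum_mono, clarsimp)
        fix x K assume h: "(x, K) \<in> p" "x \<notin> N"
        then obtain u v where uv: "K = {u..v}" "u \<le> x" "x \<le> v" using K by blast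
        moreover have "K \<subseteq> ball x (r x)" using fineD[OF p(2) h(1)] .
        ultimately show "f (Sup K) - f (Inf K) \<le> e * (Sup K - Inf K)" using r(3)[OF h(2)] by simp
      qed
      also have "\<dots> \<le> sum (\<lambda>q. e * ?L q) p"
        using fin L0 e by (intro sum_mono2) auto
      also have "\<dots> = e * (b - a)"
        using additive_tagged_division_1[OF ab p(1), of "\<lambda>x. x"] by (simp add: sum_distrib_left[symmetric])
      finally show ?thesis .
    qed
    have A: "sum ?G ?A < e"
    proof -
      have finA: "finite ?A" using fin by simp
      obtain h n where h: "bij_betw h {..<n::nat} ?A"
        using ex_bij_betw_nat_finite[OF finA] unfolding atLeast0LessThan by blast
      define l where "l i = Inf (snd (h i))" for i
      define rr where "rr i = Sup (snd (h i))" for i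
      have hi: "h i \<in> p" "fst (h i) \<in> N" if "i < n" for i using h that by (auto simp: bij_betw_def)
      have hK: "snd (h i) = {l i..rr i}" "l i \<le> rr i" "a \<le> l i" "rr i \<le> b" if i: "i < n" for i
      proof -
        obtain u v where uv: "snd (h i) = {u..v}" "u \<le> fst (h i)" "fst (h i) \<le> v" "a \<le> u" "v \<le> b"
          using K[of "fst (h i)" "snd (h i)"] hi[OF i] by auto
        then show "snd (h i) = {l i..rr i}" "l i \<le> rr i" "a \<le> l i" "rr i \<le> b"
          unfolding l_def rr_def by auto
      qed
      have disj: "disjoint_family_on (\<lambda>i. {l i<..<rr i}) {..<n}"
        unfolding disjoint_family_on_def
      proof clarify
        fix i j assume ij: "i < n" "j < n" "i \<noteq> j"
        then have "h i \<noteq> h j" using h by (auto simp: bij_betw_def inj_on_def)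
        then have "interior (snd (h i)) \<inter> interior (snd (h j)) = {}"
          using pD(5)[of "fst (h i)" "snd (h i)" "fst (h j)" "snd (h j)"] hi[OF ij(1)] hi[OF ij(2)]
          by (simp add: prod_eq_iff)
        then show "{l i<..<rr i} \<inter> {l j<..<rr j} = {}"
          using hK(1)[OF ij(1)] hK(1)[OF ij(2)] by simp
      qed
      have "ennreal (\<Sum>i<n. rr i - l i) = (\<Sum>i<n. emeasure lebesgue {l i<..<rr i})"
        using hK(2) by (subst sum_ennreal[symmetric]) auto
      also have "\<dots> = emeasure lebesgue (\<Union>i<n. {l i<..<rr i})"
        using disj by (intro sum_emeasure) auto
      also have "\<dots> \<le> emeasure lebesgue Q"
      proof (rule emeasure_mono)
        show "(\<Union>i<n. {l i<..<rr i}) \<subseteq> Q"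
        proof (rule UN_least)
          fix i assume i: "i \<in> {..<n}"
          have "{l i<..<rr i} \<subseteq> snd (h i)" using hK(1) i by auto
          also have "\<dots> \<subseteq> ball (fst (h i)) (r (fst (h i)))"
            using fineD[OF p(2), of "fst (h i)" "snd (h i)"] hi(1)[of i] i by simp
          also have "\<dots> \<subseteq> Q" using r(2) hi(2) i by auto
          finally show "{l i<..<rr i} \<subseteq> Q" .
        qed
        show "Q \<in> sets lebesgue" using Q(1) by simp
      qed
      also note mO
      finally have lt: "(\<Sum>i<n. rr i - l i) < d" by (subst (asm) ennreal_less_iff) (auto intro!: sum_nonneg simp: hK(2))
      have "(\<Sum>i<n. \<bar>g (rr i) - g (l i)\<bar>) < e"
        by (rule acd[OF _ disj lt]) (use hK in auto)
      also have "(\<Sum>i<n. \<bar>g (rr i) - g (l i)\<bar>) = (\<Sum>i<n. ?G (h i))"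
        by (simp add: l_def rr_def case_prod_beta)
      also have "\<dots> = sum ?G ?A" by (rule sum.reindex_bij_betw[OF h])
      finally show ?thesis .
    qed
    have "f b - f a = sum ?F p" using additive_tagged_division_1[OF ab p(1), of f] by simp
    also have "\<dots> = sum ?F ?A + sum ?F ?B"
      using fin by (subst sum.union_disjoint[symmetric]) (auto intro!: sum.cong)
    also have "sum ?F ?A \<le> sum (\<lambda>q. K' * ?G q) ?A"
    proof (rule sum_mono, clarsimp)
      fix x L assume h: "(x, L) \<in> p" "x \<in> N"
      then obtain u v where uv: "L = {u..v}" "u \<le> x" "x \<le> v" "a \<le> u" "v \<le> b" using K by blast
      then show "f (Sup L) - f (Inf L) \<le> K' * \<bar>g (Sup L) - g (Inf L)\<bar>"
        using dom[of u v] K'(2)[of "g v - g u"] by simp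
    qed
    also have "\<dots> = K' * sum ?G ?A" by (simp add: sum_distrib_left)
    also have "\<dots> \<le> K' * e" using A K'(1) by simp
    finally show ?thesis using B by linarith
  qed
  show ?thesis
  proof (rule ccontr)
    assume "\<not> f b \<le> f a"
    then have pos: "f b - f a > 0" by simp
    define D where "D = b - a + K'"
    define e where "e = (f b - f a) / (2 * D)"
    have den: "D > 0" using ab K' by (simp add: D_def)
    then have e0: "e > 0" using pos by (simp add: e_def)
    have "e * D = (f b - f a) / 2"
      using den by (simp add: e_def)
    then have "e * (b - a) + K' * e = (f b - f a) / 2"
      by (simp add: D_def algebra_simps)
    with main[OF e0] pos show False by simp
  qed
qed

text \<open>Gronwall's inequality for the weight: where the derivative bound holds,
  \<open>\<phi> x * exp (- A * x)\<close> and \<open>- \<phi> x * exp (A * x)\<close> have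
  nonpositive derivatives, and on a bounded interval their increments are dominated by those of
  \<phi>, which is absolutely continuous.\<close>

lemma weight_exp_growth:
  fixes \<phi> :: "real \<Rightarrow> real"
  assumes ac: "locally_absolutely_continuous \<phi>" and pos: "\<And>x. 0 < \<phi> x" and A: "0 < A"
    and der: "AE x in lebesgue. \<exists>D. (\<phi> has_real_derivative D) (at x) \<and> \<bar>D\<bar> \<le> A * \<bar>\<phi> x\<bar>"
  shows "\<phi> x \<le> exp (A * \<bar>x - y\<bar>) * \<phi> y"
proof -
  have *: "\<phi> v \<le> exp (A * (v - u)) * \<phi> u" "\<phi> u \<le> exp (A * (v - u)) * \<phi> v" if uv: "u \<le> v" for u v
  proof -
    have acuv: "absolutely_continuous_on_interval u v \<phi>"
      using ac uv by (simp add: locally_absolutely_continuous_def)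
    have "(\<lambda>x. \<phi> x * exp (- A * x)) v \<le> (\<lambda>x. \<phi> x * exp (- A * x)) u"
    proof (rule ae_nonincreasing_if_ac_dominated[OF uv acuv, where K = "exp (- A * u)"])
      fix x y assume h: "u \<le> x" "x \<le> y" "y \<le> v"
      have "exp (- A * y) \<le> exp (- A * x)" "exp (- A * y) \<le> exp (- A * u)" using A h by auto
      then have "\<phi> x * exp (- A * y) \<le> \<phi> x * exp (- A * x)"
          "\<bar>\<phi> y - \<phi> x\<bar> * exp (- A * y) \<le> \<bar>\<phi> y - \<phi> x\<bar> * exp (- A * u)"
        using pos[of x] by (auto intro!: mult_left_mono)
      moreover have "(\<phi> y - \<phi> x) * exp (- A * y) \<le> \<bar>\<phi> y - \<phi> x\<bar> * exp (- A * y)"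
        by (intro mult_right_mono) auto
      ultimately show "\<phi> y * exp (- A * y) - \<phi> x * exp (- A * x) \<le> exp (- A * u) * \<bar>\<phi> y - \<phi> x\<bar>"
        by (simp add: algebra_simps)
    next
      show "AE x in lebesgue. \<exists>D\<le>0. ((\<lambda>x. \<phi> x * exp (- A * x)) has_real_derivative D) (at x)"
        using der
      proof eventually_elim
        case (elim x)
        then obtain D where D: "(\<phi> has_real_derivative D) (at x)" "D \<le> A * \<phi> x" using pos[of x] by auto
        have "((\<lambda>x. \<phi> x * exp (- A * x)) has_real_derivative (D - A * \<phi> x) * exp (- A * x)) (at x)"
          by (auto intro!: derivative_eq_intros D simp: algebra_simps)
        moreover have "(D - A * \<phi> x) * exp (- A * x) \<le> 0" using D by (simp add: mult_nonpos_nonneg)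
        ultimately show ?case by blast
      qed
    qed
    then show "\<phi> v \<le> exp (A * (v - u)) * \<phi> u" by (simp add: exp_minus exp_diff field_simps)
    have "(\<lambda>x. - \<phi> x * exp (A * x)) v \<le> (\<lambda>x. - \<phi> x * exp (A * x)) u"
    proof (rule ae_nonincreasing_if_ac_dominated[OF uv acuv, where K = "exp (A * v)"])
      fix x y assume h: "u \<le> x" "x \<le> y" "y \<le> v"
      have "exp (A * x) \<le> exp (A * y)" "exp (A * y) \<le> exp (A * v)" using A h by auto
      then have "\<phi> x * exp (A * x) \<le> \<phi> x * exp (A * y)"
          "\<bar>\<phi> y - \<phi> x\<bar> * exp (A * y) \<le> \<bar>\<phi> y - \<phi> x\<bar> * exp (A * v)"
        using pos[of x] by (auto intro!: mult_left_mono)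
      moreover have "(\<phi> x - \<phi> y) * exp (A * y) \<le> \<bar>\<phi> y - \<phi> x\<bar> * exp (A * y)"
        by (intro mult_right_mono) auto
      ultimately show "- \<phi> y * exp (A * y) - - \<phi> x * exp (A * x) \<le> exp (A * v) * \<bar>\<phi> y - \<phi> x\<bar>"
        by (simp add: algebra_simps)
    next
      show "AE x in lebesgue. \<exists>D\<le>0. ((\<lambda>x. - \<phi> x * exp (A * x)) has_real_derivative D) (at x)"
        using der
      proof eventually_elim
        case (elim x)
        then obtain D where D: "(\<phi> has_real_derivative D) (at x)" "- D \<le> A * \<phi> x" using pos[of x] by auto
        have "((\<lambda>x. - \<phi> x * exp (A * x)) has_real_derivative - (D + A * \<phi> x) * exp (A * x)) (at x)"
          by (auto intro!: derivative_eq_intros D simp: algebra_simps)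
        moreover have "- (D + A * \<phi> x) * exp (A * x) \<le> 0" using D by (simp add: mult_nonpos_nonneg)
        ultimately show ?case by blast
      qed
    qed
    then show "\<phi> u \<le> exp (A * (v - u)) * \<phi> v" by (simp add: exp_diff field_simps)
  qed
  show ?thesis using *[of x y] *[of y x] by (cases "x \<le> y") (auto simp: abs_if)
qed

section \<open>Inequalities for weighted norms\<close>

text \<open>Convexity: the graph of x^p lies above its tangent at \<open>c\<close>. Because
  \<open>c\<close> is free, this single inequality yields Hoelder, Minkowski and the Jensen step of
  Young's convolution inequality below.\<close>

lemma young_tangent:
  fixes p :: real
  assumes "1 < p" "0 \<le> c" "0 \<le> x"
  shows "p * (c powr (p - 1) * x) \<le> x powr p + (p - 1) * c powr p"
proof -
  have "x * c powr (p - 1) \<le> x powr p / p + (c powr (p - 1)) powr (p / (p - 1)) / (p / (p - 1))"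
    by (rule Youngs_inequality) (use assms in \<open>auto simp: field_simps\<close>)
  also have "(c powr (p - 1)) powr (p / (p - 1)) = c powr p"
    using assms by (simp add: powr_powr)
  finally show ?thesis using assms by (simp add: field_simps)
qed

text \<open>The measure is arbitrary because the weight is put into a density for the energy
  estimates and into the function for the final norms. If the \<open>p\<close>-th power is not
  integrable the value is 0, so comparisons of norms are meaningful only together with
  integrability.\<close>

definition wnorm :: "'a measure \<Rightarrow> real \<Rightarrow> ('a \<Rightarrow> real) \<Rightarrow> real" where
  "wnorm M p f = (LINT x|M. \<bar>f x\<bar> powr p) powr (1 / p)"

lemma wnorm_nonneg: "0 \<le> wnorm M p f"
  by (simp add: wnorm_def)

lemma wnorm_powr: "0 < p \<Longrightarrow> wnorm M p f powr p = (LINT x|M. \<bar>f x\<bar> powr p)"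
  by (simp add: wnorm_def powr_powr)

text \<open>The pairing of the (p-1)-st power with \<open>g\<close> is the one produced by
  differentiating the energy. It follows by integrating the tangent inequality after both functions
  have been normalised.\<close>

lemma holder_wnorm:
  fixes p :: real
  assumes p: "1 < p" and [measurable]: "f \<in> borel_measurable M" "g \<in> borel_measurable M"
    and f: "integrable M (\<lambda>x. \<bar>f x\<bar> powr p)" and g: "integrable M (\<lambda>x. \<bar>g x\<bar> powr p)"
  shows "integrable M (\<lambda>x. \<bar>f x\<bar> powr (p - 1) * \<bar>g x\<bar>)"
    and "(LINT x|M. \<bar>f x\<bar> powr (p - 1) * \<bar>g x\<bar>) \<le> wnorm M p f powr (p - 1) * wnorm M p g"
proof -
  have Y: "\<bar>f x\<bar> powr (p - 1) * \<bar>g x\<bar> \<le> (1 / p) * \<bar>g x\<bar> powr p + ((p - 1) / p) * \<bar>f x\<bar> powr p" for x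
    using young_tangent[OF p, of "\<bar>f x\<bar>" "\<bar>g x\<bar>"] p by (simp add: field_simps)
  show int: "integrable M (\<lambda>x. \<bar>f x\<bar> powr (p - 1) * \<bar>g x\<bar>)"
    by (rule Bochner_Integration.integrable_bound[where f = "\<lambda>x. (1 / p) * \<bar>g x\<bar> powr p + ((p - 1) / p) * \<bar>f x\<bar> powr p"])
      (use f g Y p in \<open>auto intro!: AE_I2 order_trans[OF Y] abs_ge_self\<close>)
  let ?F = "wnorm M p f" and ?G = "wnorm M p g"
  \<comment> \<open>Enlarging both norms by \<open>e\<close> allows division even if one of them
    vanishes; \<open>e\<close> tends to 0 at the end.\<close>
  have e: "(LINT x|M. \<bar>f x\<bar> powr (p - 1) * \<bar>g x\<bar>) \<le> (?F + e) powr (p - 1) * (?G + e)" if e: "e > 0" for e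
  proof -
    define s where "s = ?F + e"
    define t where "t = ?G + e"
    have st: "s > 0" "t > 0" "?F \<le> s" "?G \<le> t" using e wnorm_nonneg[of M p f] wnorm_nonneg[of M p g] by (auto simp: s_def t_def)
    have pt: "\<bar>f x\<bar> powr (p - 1) * \<bar>g x\<bar> \<le>
        s powr (p - 1) * t * ((1 / p / t powr p) * \<bar>g x\<bar> powr p + ((p - 1) / p / s powr p) * \<bar>f x\<bar> powr p)" for x
    proof -
      have "(\<bar>f x\<bar> / s) powr (p - 1) * (\<bar>g x\<bar> / t) \<le> (1 / p) * (\<bar>g x\<bar> / t) powr p + ((p - 1) / p) * (\<bar>f x\<bar> / s) powr p"
        using young_tangent[OF p, of "\<bar>f x\<bar> / s" "\<bar>g x\<bar> / t"] st p by (simp add: field_simps)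
      then show ?thesis using st by (simp add: powr_divide field_simps)
    qed
    have "(LINT x|M. \<bar>f x\<bar> powr (p - 1) * \<bar>g x\<bar>) \<le> (LINT x|M.
        s powr (p - 1) * t * ((1 / p / t powr p) * \<bar>g x\<bar> powr p + ((p - 1) / p / s powr p) * \<bar>f x\<bar> powr p))"
      using f g by (intro integral_mono int pt) auto
    also have "\<dots> = s powr (p - 1) * t * ((1 / p / t powr p) * ?G powr p + ((p - 1) / p / s powr p) * ?F powr p)"
      using f g p by (simp add: wnorm_powr)
    also have "\<dots> \<le> s powr (p - 1) * t * ((1 / p / t powr p) * t powr p + ((p - 1) / p / s powr p) * s powr p)"
      using st p wnorm_nonneg by (intro mult_left_mono add_mono powr_mono2) auto
    also have "\<dots> = s powr (p - 1) * t" using st p by (simp add: field_simps)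
    finally show ?thesis by (simp add: s_def t_def)
  qed
  have lim: "((\<lambda>e. (?F + e) powr (p - 1) * (?G + e)) \<longlongrightarrow> (?F + 0) powr (p - 1) * (?G + 0)) (at_right 0)"
    using p wnorm_nonneg by (intro tendsto_intros tendsto_powr2) (auto simp: eventually_at_right_less intro!: eventually_at_rightI[of 0 1])
  show "(LINT x|M. \<bar>f x\<bar> powr (p - 1) * \<bar>g x\<bar>) \<le> ?F powr (p - 1) * ?G"
    by (rule tendsto_lowerbound[OF lim[simplified]]) (auto intro!: eventually_at_rightI[of 0 1] e)
qed

text \<open>The tangent inequality is taken at the convex combination itself and averaged with the
  weights \<open>a\<close> and \<open>b\<close>; the linear parts then add up to
  \<open>p * c powr p\<close>.\<close>

lemma powr_convex_comb:
  fixes p :: real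
  assumes p: "1 < p" and ab: "0 \<le> a" "0 \<le> b" "a + b = 1" and "0 \<le> x" "0 \<le> y"
  shows "(a * x + b * y) powr p \<le> a * x powr p + b * y powr p"
proof -
  define c where "c = a * x + b * y"
  have c: "0 \<le> c" using assms by (simp add: c_def)
  have "a * (p * (c powr (p - 1) * x)) + b * (p * (c powr (p - 1) * y))
      \<le> a * (x powr p + (p - 1) * c powr p) + b * (y powr p + (p - 1) * c powr p)"
    using young_tangent[OF p c] assms by (intro add_mono mult_left_mono) auto
  also have "a * (p * (c powr (p - 1) * x)) + b * (p * (c powr (p - 1) * y)) = p * (c powr (p - 1) * c)"
    by (simp add: c_def algebra_simps)
  also have "c powr (p - 1) * c = c powr p"
    using c p by (cases "c = 0") (auto simp: powr_mult_base powr_diff)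
  also have "a * (x powr p + (p - 1) * c powr p) + b * (y powr p + (p - 1) * c powr p)
      = a * x powr p + b * y powr p + (a + b) * ((p - 1) * c powr p)" by (simp add: algebra_simps)
  finally show ?thesis using ab by (simp add: c_def algebra_simps)
qed

lemma wnorm_mono:
  assumes "1 < p" "integrable M (\<lambda>x. \<bar>f x\<bar> powr p)" "integrable M (\<lambda>x. \<bar>g x\<bar> powr p)" "\<And>x. \<bar>f x\<bar> \<le> \<bar>g x\<bar>"
  shows "wnorm M p f \<le> wnorm M p g"
  unfolding wnorm_def using assms by (intro powr_mono2 integral_mono) auto

text \<open>The sum of absolute values is \<open>s + t\<close> times a convex combination of
  \<open>\<bar>f x\<bar> / s\<close> and \<open>\<bar>g x\<bar> / t\<close>; convexity is used with
  \<open>s\<close> and \<open>t\<close> slightly larger than the two norms.\<close>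

lemma minkowski_wnorm:
  fixes p :: real
  assumes p: "1 < p" and [measurable]: "f \<in> borel_measurable M" "g \<in> borel_measurable M"
    and f: "integrable M (\<lambda>x. \<bar>f x\<bar> powr p)" and g: "integrable M (\<lambda>x. \<bar>g x\<bar> powr p)"
  shows "integrable M (\<lambda>x. \<bar>f x + g x\<bar> powr p)"
    and "wnorm M p (\<lambda>x. f x + g x) \<le> wnorm M p f + wnorm M p g"
proof -
  let ?F = "wnorm M p f" and ?G = "wnorm M p g"
  have pt: "\<bar>f x + g x\<bar> powr p \<le> (s + t) powr p * (s / (s + t) / s powr p * \<bar>f x\<bar> powr p + t / (s + t) / t powr p * \<bar>g x\<bar> powr p)"
    if st: "s > 0" "t > 0" for s t x
  proof -
    have "\<bar>f x + g x\<bar> powr p \<le> (\<bar>f x\<bar> + \<bar>g x\<bar>) powr p" using p by (intro powr_mono2) auto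
    also have "\<bar>f x\<bar> + \<bar>g x\<bar> = (s + t) * (s / (s + t) * (\<bar>f x\<bar> / s) + t / (s + t) * (\<bar>g x\<bar> / t))"
    proof -
      have "s / (s + t) * (\<bar>f x\<bar> / s) + t / (s + t) * (\<bar>g x\<bar> / t) = (\<bar>f x\<bar> + \<bar>g x\<bar>) / (s + t)"
        using st by (simp add: add_divide_distrib)
      then show ?thesis using st by simp
    qed
    also have "\<dots> powr p = (s + t) powr p * (s / (s + t) * (\<bar>f x\<bar> / s) + t / (s + t) * (\<bar>g x\<bar> / t)) powr p"
      using st by (subst powr_mult) auto
    also have "\<dots> \<le> (s + t) powr p * (s / (s + t) * (\<bar>f x\<bar> / s) powr p + t / (s + t) * (\<bar>g x\<bar> / t) powr p)"
      using st p by (intro mult_left_mono powr_convex_comb) (auto simp: add_divide_distrib[symmetric])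
    finally show ?thesis using st by (simp add: powr_divide)
  qed
  show int: "integrable M (\<lambda>x. \<bar>f x + g x\<bar> powr p)"
    by (rule Bochner_Integration.integrable_bound[where f = "\<lambda>x. (1 + 1) powr p * (1 / (1 + 1) / 1 powr p * \<bar>f x\<bar> powr p + 1 / (1 + 1) / 1 powr p * \<bar>g x\<bar> powr p)"])
      (use f g pt[of 1 1] in \<open>auto intro!: AE_I2 order_trans[OF pt[of 1 1]]\<close>)
  have e: "wnorm M p (\<lambda>x. f x + g x) \<le> ?F + ?G + e" if e: "e > 0" for e
  proof -
    define s where "s = ?F + e / 2"
    define t where "t = ?G + e / 2"
    have st: "s > 0" "t > 0" "?F \<le> s" "?G \<le> t" using e wnorm_nonneg[of M p f] wnorm_nonneg[of M p g] by (auto simp: s_def t_def)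
    have "(LINT x|M. \<bar>f x + g x\<bar> powr p) \<le> (LINT x|M.
        (s + t) powr p * (s / (s + t) / s powr p * \<bar>f x\<bar> powr p + t / (s + t) / t powr p * \<bar>g x\<bar> powr p))"
      using f g by (intro integral_mono int pt st) auto
    also have "\<dots> = (s + t) powr p * (s / (s + t) / s powr p * ?F powr p + t / (s + t) / t powr p * ?G powr p)"
      using f g p by (simp add: wnorm_powr)
    also have "\<dots> \<le> (s + t) powr p * (s / (s + t) / s powr p * s powr p + t / (s + t) / t powr p * t powr p)"
      using st p wnorm_nonneg by (intro mult_left_mono add_mono powr_mono2) auto
    also have "\<dots> = (s + t) powr p" using st p by (simp add: add_divide_distrib[symmetric])
    finally have "wnorm M p (\<lambda>x. f x + g x) \<le> ((s + t) powr p) powr (1 / p)"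
      unfolding wnorm_def using p by (intro powr_mono2) (auto intro!: integral_nonneg_AE)
    also have "\<dots> = s + t" using st p by (simp add: powr_powr)
    finally show ?thesis by (simp add: s_def t_def)
  qed
  show "wnorm M p (\<lambda>x. f x + g x) \<le> ?F + ?G"
    by (rule field_le_epsilon) (rule e)
qed

lemma wnorm_cmult: "0 < p \<Longrightarrow> wnorm M p (\<lambda>x. c * f x) = \<bar>c\<bar> * wnorm M p f"
  by (simp add: wnorm_def abs_mult powr_mult powr_powr)

text \<open>Young's inequality for an integrable kernel and an L^p function: Jensen's inequality at
  each point, then Tonelli. The bound on \<open>F\<close> only serves to make the convolution
  converge at every point.\<close>

lemma convolution_powr_bound:
  fixes \<kappa> F :: "real \<Rightarrow> real"
  assumes p: "1 < p" and J: "0 < J"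
    and [measurable]: "\<kappa> \<in> borel_measurable borel" "F \<in> borel_measurable borel"
    and k0: "\<And>x. 0 \<le> \<kappa> x" and F0: "\<And>x. 0 \<le> F x" and FB: "\<And>x. F x \<le> B"
    and kJ: "(\<integral>\<^sup>+x. ennreal (\<kappa> x) \<partial>lborel) \<le> ennreal J"
  shows "integrable lborel (\<lambda>y. \<kappa> (x - y) * F y)"
    and "(\<integral>\<^sup>+x. ennreal ((LINT y|lborel. \<kappa> (x - y) * F y) powr p) \<partial>lborel)
      \<le> ennreal (J powr p) * (\<integral>\<^sup>+x. ennreal (F x powr p) \<partial>lborel)"
proof -
  have ki: "integrable lborel \<kappa>"
    using kJ k0 by (intro integrableI_bounded) (auto simp: less_top[symmetric] top_unique)
  have kr: "integrable lborel (\<lambda>y. \<kappa> (x - y))" for x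
    using lborel_integrable_real_affine[OF ki, of "-1" x] by simp
  have kI: "(LINT y|lborel. \<kappa> (x - y)) \<le> J" for x
  proof -
    have "(LINT y|lborel. \<kappa> (x - y)) = (LINT y|lborel. \<kappa> y)"
      using lborel_integral_real_affine[of "-1" \<kappa> x] by simp
    also have "ennreal \<dots> \<le> ennreal J"
      using kJ k0 ki by (subst nn_integral_eq_integral[symmetric]) auto
    finally show ?thesis using J by (simp add: ennreal_le_iff)
  qed
  have bnd: "integrable lborel (\<lambda>y. \<kappa> (x - y) * H y)"
    if [measurable]: "H \<in> borel_measurable borel" and H: "\<And>y. 0 \<le> H y" "\<And>y. H y \<le> C" for H :: "real \<Rightarrow> real" and C x
  proof (rule Bochner_Integration.integrable_bound[where f = "\<lambda>y. C * \<kappa> (x - y)"])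
    have "\<bar>\<kappa> (x - y) * H y\<bar> \<le> \<bar>C * \<kappa> (x - y)\<bar>" for y
      using mult_right_mono[OF H(2)[of y] k0[of "x - y"]] k0[of "x - y"] H(1)[of y] order_trans[OF H(1)[of y] H(2)[of y]]
      by (simp add: abs_mult mult.commute)
    then show "AE y in lborel. norm (\<kappa> (x - y) * H y) \<le> norm (C * \<kappa> (x - y))" by simp
  qed (use kr in auto)
  show i1: "integrable lborel (\<lambda>y. \<kappa> (x - y) * F y)" for x
    by (rule bnd[where C = B]) (use F0 FB in auto)
  have i2: "integrable lborel (\<lambda>y. \<kappa> (x - y) * F y powr p)" for x
    by (rule bnd[where C = "B powr p"]) (use p in \<open>auto intro!: powr_mono2 F0 FB\<close>)
  define A where "A x = (LINT y|lborel. \<kappa> (x - y) * F y)" for x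
  have A0: "A x \<ge> 0" for x unfolding A_def using k0 F0 by (intro integral_nonneg_AE) auto
  have pt: "A x powr p \<le> J powr (p - 1) * (LINT y|lborel. \<kappa> (x - y) * F y powr p)" for x
  proof -
    \<comment> \<open>The contact point of the tangent is the mean of \<open>F\<close> under the
      kernel, computed as if its mass were exactly \<open>J\<close>; this replaces Jensen's
      inequality when only an upper bound of the mass is known.\<close>
    define c where "c = A x / J"
    have c: "c \<ge> 0" using A0 J by (simp add: c_def)
    have cc: "c powr (p - 1) * A x = c powr p * J"
      using c J p A0[of x] by (cases "c = 0") (auto simp: c_def powr_diff)
    have "p * (c powr p * J) = (LINT y|lborel. (p * c powr (p - 1)) * (\<kappa> (x - y) * F y))"
      using i1 cc by (simp add: A_def)
    also have "\<dots> \<le> (LINT y|lborel. \<kappa> (x - y) * F y powr p + (p - 1) * c powr p * \<kappa> (x - y))"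
    proof (rule integral_mono)
      fix y
      have "\<kappa> (x - y) * (p * (c powr (p - 1) * F y)) \<le> \<kappa> (x - y) * (F y powr p + (p - 1) * c powr p)"
        by (intro mult_left_mono young_tangent p c F0 k0)
      then show "(p * c powr (p - 1)) * (\<kappa> (x - y) * F y) \<le> \<kappa> (x - y) * F y powr p + (p - 1) * c powr p * \<kappa> (x - y)"
        by (simp add: algebra_simps)
    qed (use i1 i2 kr in auto)
    also have "\<dots> = (LINT y|lborel. \<kappa> (x - y) * F y powr p) + (p - 1) * c powr p * (LINT y|lborel. \<kappa> (x - y))"
      using i2 kr by simp
    also have "\<dots> \<le> (LINT y|lborel. \<kappa> (x - y) * F y powr p) + (p - 1) * c powr p * J"
      using kI p by (intro add_left_mono mult_left_mono) auto
    finally have "c powr p * J \<le> (LINT y|lborel. \<kappa> (x - y) * F y powr p)"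
      by (simp add: algebra_simps)
    then have "J powr (p - 1) * (c powr p * J) \<le> J powr (p - 1) * (LINT y|lborel. \<kappa> (x - y) * F y powr p)"
      by (intro mult_left_mono) auto
    moreover have "J powr (p - 1) * (c powr p * J) = A x powr p"
      using J A0 by (simp add: c_def powr_divide powr_diff)
    ultimately show ?thesis by simp
  qed
  have "(\<integral>\<^sup>+x. ennreal (A x powr p) \<partial>lborel)
      \<le> (\<integral>\<^sup>+x. ennreal (J powr (p - 1)) * (\<integral>\<^sup>+y. ennreal (\<kappa> (x - y)) * ennreal (F y powr p) \<partial>lborel) \<partial>lborel)"
  proof (rule nn_integral_mono)
    fix x
    have "ennreal (A x powr p) \<le> ennreal (J powr (p - 1)) * ennreal (LINT y|lborel. \<kappa> (x - y) * F y powr p)"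
      using pt[of x] by (simp add: ennreal_mult'[symmetric] ennreal_leI)
    also have "ennreal (LINT y|lborel. \<kappa> (x - y) * F y powr p) = (\<integral>\<^sup>+y. ennreal (\<kappa> (x - y)) * ennreal (F y powr p) \<partial>lborel)"
      using i2 k0 by (subst nn_integral_eq_integral[symmetric]) (auto simp: ennreal_mult')
    finally show "ennreal (A x powr p) \<le> ennreal (J powr (p - 1)) * (\<integral>\<^sup>+y. ennreal (\<kappa> (x - y)) * ennreal (F y powr p) \<partial>lborel)" .
  qed
  also have "\<dots> = ennreal (J powr (p - 1)) * (\<integral>\<^sup>+x. \<integral>\<^sup>+y. ennreal (\<kappa> (x - y)) * ennreal (F y powr p) \<partial>lborel \<partial>lborel)"
    by (rule nn_integral_cmult) measurable
  also have "\<dots> \<le> ennreal (J powr (p - 1)) * (ennreal J * (\<integral>\<^sup>+y. ennreal (F y powr p) \<partial>lborel))"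
  proof (rule mult_left_mono)
  have "(\<integral>\<^sup>+x. \<integral>\<^sup>+y. ennreal (\<kappa> (x - y)) * ennreal (F y powr p) \<partial>lborel \<partial>lborel)
      = (\<integral>\<^sup>+y. \<integral>\<^sup>+x. ennreal (\<kappa> (x - y)) * ennreal (F y powr p) \<partial>lborel \<partial>lborel)"
    by (rule lborel_pair.Fubini'[symmetric]) measurable
  also have "\<dots> = (\<integral>\<^sup>+y. (\<integral>\<^sup>+x. ennreal (\<kappa> x) \<partial>lborel) * ennreal (F y powr p) \<partial>lborel)"
  proof (rule nn_integral_cong)
    fix y
    have "(\<integral>\<^sup>+x. ennreal (\<kappa> x) \<partial>lborel) = (\<integral>\<^sup>+x. ennreal (\<kappa> (x - y)) \<partial>lborel)"
      by (subst nn_integral_real_affine[where c = 1 and t = "- y"]) auto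
    then show "(\<integral>\<^sup>+x. ennreal (\<kappa> (x - y)) * ennreal (F y powr p) \<partial>lborel) = (\<integral>\<^sup>+x. ennreal (\<kappa> x) \<partial>lborel) * ennreal (F y powr p)"
      by (simp add: nn_integral_multc)
  qed
  also have "\<dots> \<le> (\<integral>\<^sup>+y. ennreal J * ennreal (F y powr p) \<partial>lborel)"
    by (intro nn_integral_mono mult_right_mono kJ) auto
  also have "\<dots> = ennreal J * (\<integral>\<^sup>+y. ennreal (F y powr p) \<partial>lborel)"
    by (rule nn_integral_cmult) measurable
  finally show "(\<integral>\<^sup>+x. \<integral>\<^sup>+y. ennreal (\<kappa> (x - y)) * ennreal (F y powr p) \<partial>lborel \<partial>lborel)
      \<le> ennreal J * (\<integral>\<^sup>+y. ennreal (F y powr p) \<partial>lborel)" .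
  qed simp
  also have "\<dots> = ennreal (J powr p) * (\<integral>\<^sup>+y. ennreal (F y powr p) \<partial>lborel)"
    using J by (simp add: mult.assoc[symmetric] ennreal_mult'[symmetric] powr_diff)
  finally show "(\<integral>\<^sup>+x. ennreal ((LINT y|lborel. \<kappa> (x - y) * F y) powr p) \<partial>lborel)
      \<le> ennreal (J powr p) * (\<integral>\<^sup>+x. ennreal (F x powr p) \<partial>lborel)"
    by (simp add: A_def)
qed

section \<open>Energies along transport equations\<close>

text \<open>As \<open>sgn 0 = 0\<close>, one formula covers the origin, where the difference
  quotient \<open>sgn h * \<bar>h\<bar> powr (p - 1)\<close> tends to 0 because \<open>p\<close>
  exceeds 1.\<close>

lemma abs_powr_has_derivative:
  fixes p :: real
  assumes p: "1 < p"
  shows "((\<lambda>x. \<bar>x\<bar> powr p) has_real_derivative p * \<bar>x\<bar> powr (p - 1) * sgn x) (at x)"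
proof (cases "x = 0")
  case True
  have "((\<lambda>h::real. \<bar>h\<bar> powr (p - 1)) \<longlongrightarrow> \<bar>0\<bar> powr (p - 1)) (at 0)"
    using p by (intro tendsto_powr2 tendsto_intros) (auto intro!: always_eventually)
  note lim0 = this
  have "((\<lambda>h::real. sgn h * \<bar>h\<bar> powr (p - 1)) \<longlongrightarrow> 0) (at 0)"
  proof (rule Lim_null_comparison[rotated])
    show "\<forall>\<^sub>F h::real in at 0. norm (sgn h * \<bar>h\<bar> powr (p - 1)) \<le> \<bar>h\<bar> powr (p - 1)"
      by (rule always_eventually) (auto simp: abs_mult sgn_if)
  qed (use p lim0 in simp)
  moreover have "eventually (\<lambda>h::real. sgn h * \<bar>h\<bar> powr (p - 1) = (\<bar>0 + h\<bar> powr p - \<bar>0\<bar> powr p) / h) (at 0)"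
    using p by (auto simp: eventually_at_filter powr_diff sgn_if intro!: always_eventually)
  ultimately have "((\<lambda>h::real. (\<bar>0 + h\<bar> powr p - \<bar>0\<bar> powr p) / h) \<longlongrightarrow> 0) (at 0)"
    by (rule Lim_transform_eventually)
  then show ?thesis using True by (simp add: DERIV_def)
next
  case False
  have "((\<lambda>x. (sgn x * x) powr p) has_real_derivative p * \<bar>x\<bar> powr (p - 1) * sgn x) (at x)"
    if "sgn x = c" for c
  proof -
    have "c * x > 0" "c * x = \<bar>x\<bar>" "sgn x = c" using that False by (auto simp: sgn_if split: if_splits)
    then have "((\<lambda>x. (c * x) powr p) has_real_derivative p * \<bar>x\<bar> powr (p - 1) * sgn x) (at x)"
      by (auto intro!: derivative_eq_intros)
    moreover have "eventually (\<lambda>y. sgn y = c) (nhds x)"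
      using that False eventually_nhds_in_open[of "{0<..}" x] eventually_nhds_in_open[of "{..<0}" x]
      by (cases "x > 0") (auto elim!: eventually_mono)
    ultimately show ?thesis
      by (subst DERIV_cong_ev[where g = "\<lambda>x. (c * x) powr p"]) (auto elim!: eventually_mono)
  qed
  then show ?thesis by (simp add: sgn_mult_abs abs_sgn mult.commute)
qed

lemma abs_powr_lipschitz:
  fixes p :: real
  assumes p: "1 < p" and "\<bar>x\<bar> \<le> C" "\<bar>y\<bar> \<le> C"
  shows "\<bar>\<bar>x\<bar> powr p - \<bar>y\<bar> powr p\<bar> \<le> p * C powr (p - 1) * \<bar>x - y\<bar>"
proof -
  have "norm ((\<lambda>x. \<bar>x\<bar> powr p) x - (\<lambda>x. \<bar>x\<bar> powr p) y) \<le> (p * C powr (p - 1)) * norm (x - y)"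
  proof (rule field_differentiable_bound[where S = "{-C..C}"])
    fix z assume z: "z \<in> {-C..C}"
    show "((\<lambda>x. \<bar>x\<bar> powr p) has_field_derivative p * \<bar>z\<bar> powr (p - 1) * sgn z) (at z within {-C..C})"
      by (rule has_field_derivative_at_within[OF abs_powr_has_derivative[OF p]])
    have "\<bar>z\<bar> powr (p - 1) \<le> C powr (p - 1)" using z p by (intro powr_mono2) auto
    then show "norm (p * \<bar>z\<bar> powr (p - 1) * sgn z) \<le> p * C powr (p - 1)"
      using p by (auto simp: abs_mult sgn_if)
  qed (use assms in auto)
  then show ?thesis by simp
qed

text \<open>The shift \<open>e\<close> keeps the \<open>p\<close>-th root differentiable where the energy vanishes.\<close>

lemma abs_powr_deriv_le_imp:
  "(e :: real) > 0 \<Longrightarrow> 1 < p \<Longrightarrow> (E has_real_derivative D) (at t within S) \<Longrightarrow> 0 \<le> E t \<Longrightarrow>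
   D \<le> p * (E t powr ((p - 1) / p)) * \<theta> \<Longrightarrow> 0 \<le> \<theta> \<Longrightarrow>
   \<exists>D'\<le>\<theta>. ((\<lambda>t. (E t + e) powr (1 / p)) has_real_derivative D') (at t within S)"
proof (intro exI conjI)
  assume a: "e > 0" "1 < p" "(E has_real_derivative D) (at t within S)" "0 \<le> E t"
    "D \<le> p * (E t powr ((p - 1) / p)) * \<theta>" "0 \<le> \<theta>"
  show "((\<lambda>t. (E t + e) powr (1 / p)) has_real_derivative (1 / p) * (E t + e) powr (1 / p - 1) * D) (at t within S)"
    using a by (auto intro!: derivative_eq_intros)
  have "(1 / p) * (E t + e) powr (1 / p - 1) * D \<le> (1 / p) * (E t + e) powr (1 / p - 1) * (p * ((E t + e) powr ((p - 1) / p)) * \<theta>)"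
    using a by (intro mult_left_mono order_trans[OF a(5)] mult_right_mono powr_mono2) auto
  also have "\<dots> = ((E t + e) powr (1 / p - 1) * (E t + e) powr ((p - 1) / p)) * \<theta>" using a by simp
  also have "(E t + e) powr (1 / p - 1) * (E t + e) powr ((p - 1) / p) = 1"
    using a by (subst powr_add[symmetric]) (simp add: field_simps)
  finally show "(1 / p) * (E t + e) powr (1 / p - 1) * D \<le> \<theta>" by simp
qed

text \<open>An integration by parts with coefficients that are only Lipschitz: the difference quotient of \<open>F\<close>
  is moved onto \<open>a \<rho>\<close> by translation before the limit is taken.\<close>

lemma transport_energy_bound:
  fixes F F' a \<rho> :: "real \<Rightarrow> real"
  assumes FD: "\<And>x. (F has_real_derivative F' x) (at x)" and F'B: "\<And>x. \<bar>F' x\<bar> \<le> L" and F'c: "continuous_on UNIV F'"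
    and F0: "\<And>x. 0 \<le> F x" and FB: "\<And>x. F x \<le> C"
    and a0: "\<And>x. \<bar>a x\<bar> \<le> a0" and a1: "\<And>x y. \<bar>a x - a y\<bar> \<le> a1 * \<bar>x - y\<bar>"
    and \<rho>0: "\<And>x. 0 < \<rho> x" and \<rho>q: "\<And>x y. \<rho> x \<le> exp (q * \<bar>x - y\<bar>) * \<rho> y" and q: "0 \<le> q"
    and \<rho>i: "integrable lborel \<rho>"
  shows "(LINT x|lborel. F' x * a x * \<rho> x) \<le> (a1 + q * a0) * (LINT x|lborel. F x * \<rho> x)"
proof -
  have [measurable]: "F' \<in> borel_measurable borel" "\<rho> \<in> borel_measurable borel"
    using F'c \<rho>i by (auto intro: borel_measurable_continuous_onI)
  have "continuous_on UNIV F" using FD by (meson DERIV_isCont continuous_at_imp_continuous_on)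
  then have [measurable]: "F \<in> borel_measurable borel" by (rule borel_measurable_continuous_onI)
  have a1': "0 \<le> a1" using a1[of 1 0] by (metis abs_ge_zero abs_one diff_zero mult.right_neutral order_trans)
  have "continuous_on UNIV a"
    by (rule lipschitz_on_continuous_on[of a1]) (auto simp: lipschitz_on_def dist_real_def a1 a1')
  then have [measurable]: "a \<in> borel_measurable borel" by (rule borel_measurable_continuous_onI)
  have a00: "0 \<le> a0" using a0[of 0] by simp
  have \<rho>i': "integrable lborel (\<lambda>x. \<rho> (x + c))" for c
    using lborel_integrable_real_affine[OF \<rho>i, of 1 c] by (simp add: add.commute)
  have int: "integrable lborel (\<lambda>x. G x * r x)" if "G \<in> borel_measurable borel" "\<And>x. \<bar>G x\<bar> \<le> K" "integrable lborel r" for G r :: "real \<Rightarrow> real" and K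
  proof (rule Bochner_Integration.integrable_bound[where f = "\<lambda>x. K * r x"])
    show "AE x in lborel. norm (G x * r x) \<le> norm (K * r x)"
    proof (rule AE_I2)
      fix x have "\<bar>G x\<bar> \<le> \<bar>K\<bar>" using that(2)[of x] by simp
      then show "norm (G x * r x) \<le> norm (K * r x)" by (simp add: abs_mult mult_right_mono)
    qed
  qed (use that in auto)
  have FB': "\<bar>F x\<bar> \<le> C" for x using F0[of x] FB[of x] by simp
  have Fa: "\<bar>F x * a y\<bar> \<le> C * a0" for x y
    using FB' a0 by (auto simp: abs_mult intro!: mult_mono order_trans[OF abs_ge_zero FB'])
  define h where "h n = 1 / real (Suc n)" for n
  have h0: "h n > 0" for n by (simp add: h_def)
  have hlim: "h \<longlonglongrightarrow> 0" unfolding h_def by (rule lim_inverse_n'[THEN LIMSEQ_Suc])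
  let ?I = "\<lambda>n. LINT x|lborel. (F (x + h n) - F x) / h n * a x * \<rho> x"
  have lim: "?I \<longlonglongrightarrow> (LINT x|lborel. F' x * a x * \<rho> x)"
  proof (rule integral_dominated_convergence[where w = "\<lambda>x. L * a0 * \<rho> x"])
    show "AE x in lborel. (\<lambda>n. (F (x + h n) - F x) / h n * a x * \<rho> x) \<longlonglongrightarrow> F' x * a x * \<rho> x"
    proof (rule AE_I2)
      fix x
      have "((\<lambda>k. (F (x + k) - F x) / k) \<longlongrightarrow> F' x) (at 0)" using FD[of x] by (simp add: DERIV_def)
      moreover have "filterlim h (at 0) sequentially"
        using hlim h0 by (auto simp: filterlim_at less_imp_neq[THEN not_sym] intro!: always_eventually)
      ultimately have "(\<lambda>n. (F (x + h n) - F x) / h n) \<longlonglongrightarrow> F' x" by (rule filterlim_compose)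
      then show "(\<lambda>n. (F (x + h n) - F x) / h n * a x * \<rho> x) \<longlonglongrightarrow> F' x * a x * \<rho> x"
        by (intro tendsto_mult[OF tendsto_mult[OF _ tendsto_const] tendsto_const])
    qed
    fix n
    show "AE x in lborel. norm ((F (x + h n) - F x) / h n * a x * \<rho> x) \<le> L * a0 * \<rho> x"
    proof (rule AE_I2)
      fix x
      have "norm (F (x + h n) - F x) \<le> L * norm (x + h n - x)"
        by (rule field_differentiable_bound[where S = UNIV]) (use FD F'B in auto)
      then have "\<bar>(F (x + h n) - F x) / h n\<bar> \<le> L" using h0[of n] by (simp add: field_simps)
      then have "\<bar>(F (x + h n) - F x) / h n\<bar> * \<bar>a x\<bar> * \<rho> x \<le> L * a0 * \<rho> x"
        using \<rho>0[of x] a0[of x] F'B[of x] by (intro mult_right_mono mult_mono) auto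
      then show "norm ((F (x + h n) - F x) / h n * a x * \<rho> x) \<le> L * a0 * \<rho> x"
        using \<rho>0[of x] by (simp add: abs_mult)
    qed
  qed (use \<rho>i in auto)
  let ?E = "LINT x|lborel. F x * \<rho> x"
  \<comment> \<open>Bounds the change of \<open>a \<rho>\<close> over a backward step
    \<open>h n\<close>, relative to \<open>\<rho> x\<close>. The quotient \<open>k n / h n\<close>
    tends to \<open>a1 + q * a0\<close>, the constant of the claim.\<close>
  define k where "k n = a1 * h n * exp (q * h n) + a0 * (exp (q * h n) - 1)" for n
  have bound: "?I n \<le> (a1 * exp (q * h n) + a0 * ((exp (q * h n) - 1) / h n)) * ?E" for n
  proof -
    have i1: "integrable lborel (\<lambda>x. F (x + c) * a x * \<rho> x)" for c
      by (rule int[OF _ Fa \<rho>i]) measurable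
    have i2: "integrable lborel (\<lambda>x. F x * a (x - c) * \<rho> (x - c))" for c
      using int[OF _ Fa \<rho>i', of "\<lambda>x. x" "\<lambda>x. x - c" "- c"] by simp
    have i3: "integrable lborel (\<lambda>x. F x * \<rho> x)"
      by (rule int[OF _ FB' \<rho>i]) measurable
    have "?I n = (LINT x|lborel. F (x + h n) * a x * \<rho> x - F (x + 0) * a x * \<rho> x) / h n"
      by (subst integral_divide_zero[symmetric]) (auto intro!: Bochner_Integration.integral_cong simp: field_simps)
    also have "\<dots> = ((LINT x|lborel. F (x + h n) * a x * \<rho> x) - (LINT x|lborel. F (x + 0) * a x * \<rho> x)) / h n"
      using i1[of "h n"] i1[of 0] by (subst Bochner_Integration.integral_diff) auto
    also have "(LINT x|lborel. F (x + h n) * a x * \<rho> x) = (LINT x|lborel. F x * a (x - h n) * \<rho> (x - h n))"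
      by (subst lborel_integral_real_affine[where c = 1 and t = "- h n"]) (auto simp: algebra_simps)
    also have "\<dots> - (LINT x|lborel. F (x + 0) * a x * \<rho> x) = (LINT x|lborel. F x * a (x - h n) * \<rho> (x - h n) - F x * a x * \<rho> x)"
      using i2 i1[of 0] by (subst Bochner_Integration.integral_diff) auto
    also have "\<dots> \<le> (LINT x|lborel. k n * (F x * \<rho> x))"
    proof (rule integral_mono)
      fix x
      have r1: "\<rho> (x - h n) \<le> exp (q * h n) * \<rho> x" using \<rho>q[of "x - h n" x] h0[of n] by simp
      have r2: "\<rho> x \<le> exp (q * h n) * \<rho> (x - h n)" using \<rho>q[of x "x - h n"] h0[of n] by simp
      have e1: "exp (q * h n) \<ge> 1" using q h0[of n] by simp
      have "\<rho> x - \<rho> (x - h n) \<le> (exp (q * h n) - 1) * \<rho> (x - h n)" using r2 by (simp add: algebra_simps)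
      \<comment> \<open>The growth condition compares with the value at \<open>x - h n\<close>. If
        that value is the larger one, the left side is negative and nothing has to be shown.\<close>
      moreover have "\<rho> x - \<rho> (x - h n) \<le> (exp (q * h n) - 1) * \<rho> x"
      proof (cases "\<rho> (x - h n) \<le> \<rho> x")
        case True
        then show ?thesis using calculation e1 by (meson diff_ge_0_iff_ge mult_left_mono order_trans)
      next
        case False
        moreover have "0 \<le> (exp (q * h n) - 1) * \<rho> x" using e1 \<rho>0[of x] by simp
        ultimately show ?thesis by linarith
      qed
      ultimately have r3: "\<bar>\<rho> (x - h n) - \<rho> x\<bar> \<le> (exp (q * h n) - 1) * \<rho> x"
        using r1 by (simp add: abs_le_iff algebra_simps)
      have "a (x - h n) * \<rho> (x - h n) - a x * \<rho> x = (a (x - h n) - a x) * \<rho> (x - h n) + a x * (\<rho> (x - h n) - \<rho> x)"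
        by (simp add: algebra_simps)
      also have "(a (x - h n) - a x) * \<rho> (x - h n) \<le> (a1 * h n) * (exp (q * h n) * \<rho> x)"
      proof (rule mult_mono)
        show "a (x - h n) - a x \<le> a1 * h n" using a1[of "x - h n" x] h0[of n] by simp
      qed (use r1 a1' h0[of n] \<rho>0[of "x - h n"] in auto)
      also have "a x * (\<rho> (x - h n) - \<rho> x) \<le> a0 * ((exp (q * h n) - 1) * \<rho> x)"
      proof -
        have "a x * (\<rho> (x - h n) - \<rho> x) \<le> \<bar>a x\<bar> * \<bar>\<rho> (x - h n) - \<rho> x\<bar>" by (metis abs_ge_self abs_mult)
        also have "\<dots> \<le> a0 * ((exp (q * h n) - 1) * \<rho> x)" using r3 a0[of x] a00 by (intro mult_mono) auto
        finally show ?thesis .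
      qed
      finally have "a (x - h n) * \<rho> (x - h n) - a x * \<rho> x \<le> (a1 * h n * exp (q * h n) + a0 * (exp (q * h n) - 1)) * \<rho> x"
        by (simp only: distrib_right mult.assoc)
      then have "a (x - h n) * \<rho> (x - h n) - a x * \<rho> x \<le> k n * \<rho> x" by (simp only: k_def)
      from mult_left_mono[OF this F0[of x]]
      show "F x * a (x - h n) * \<rho> (x - h n) - F x * a x * \<rho> x \<le> k n * (F x * \<rho> x)"
        by (simp add: algebra_simps)
    qed (use i2 i1[of 0] i3 in auto)
    also have "\<dots> = k n * ?E" using i3 by simp
    finally have "?I n \<le> k n * ?E / h n"
      using h0[of n] by (simp add: divide_right_mono)
    also have "\<dots> = (a1 * exp (q * h n) + a0 * ((exp (q * h n) - 1) / h n)) * ?E"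
    proof -
      have "k n / h n = a1 * exp (q * h n) + a0 * ((exp (q * h n) - 1) / h n)"
        using h0[of n] by (simp add: k_def add_divide_distrib)
      then show ?thesis by (metis times_divide_eq_left)
    qed
    finally show ?thesis .
  qed
  have "((\<lambda>x. exp (q * x)) has_real_derivative q) (at 0)" by (auto intro!: derivative_eq_intros)
  then have "((\<lambda>k. (exp (q * (0 + k)) - exp (q * 0)) / k) \<longlongrightarrow> q) (at 0)" unfolding DERIV_def .
  moreover have "filterlim h (at 0) sequentially"
    using hlim h0 by (auto simp: filterlim_at less_imp_neq[THEN not_sym] intro!: always_eventually)
  ultimately have "(\<lambda>n. (exp (q * h n) - 1) / h n) \<longlonglongrightarrow> q"
    using filterlim_compose by fastforce
  then have "(\<lambda>n. (a1 * exp (q * h n) + a0 * ((exp (q * h n) - 1) / h n)) * ?E) \<longlonglongrightarrow> (a1 * exp (q * 0) + a0 * q) * ?E"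
    by (intro tendsto_intros hlim)
  from LIMSEQ_le[OF lim this] bound show ?thesis by (auto simp: mult.commute)
qed

text \<open>Difference quotients of the integrand are dominated by a constant: the
  \<open>p\<close>-th power is Lipschitz on \<open>{-C..C}\<close> and \<open>W\<close> is Lipschitz
  in time at \<open>t\<close>, uniformly in \<open>x\<close>. Finiteness of the measure makes this
  constant integrable.\<close>

lemma (in finite_measure) energy_time_derivative:
  fixes W :: "real \<Rightarrow> 'a \<Rightarrow> real"
  assumes p: "1 < p" and t: "t \<in> S" and [measurable]: "\<And>\<tau>. \<tau> \<in> S \<Longrightarrow> W \<tau> \<in> borel_measurable M"
    and WB: "\<And>\<tau> x. \<tau> \<in> S \<Longrightarrow> \<bar>W \<tau> x\<bar> \<le> C" and WL: "\<And>\<tau> x. \<tau> \<in> S \<Longrightarrow> \<bar>W \<tau> x - W t x\<bar> \<le> L * \<bar>\<tau> - t\<bar>"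
    and WD: "\<And>x. ((\<lambda>\<tau>. W \<tau> x) has_real_derivative W' x) (at t within S)"
    and [measurable]: "W' \<in> borel_measurable M"
  shows "((\<lambda>\<tau>. LINT x|M. \<bar>W \<tau> x\<bar> powr p) has_real_derivative
      (LINT x|M. p * \<bar>W t x\<bar> powr (p - 1) * sgn (W t x) * W' x)) (at t within S)"
  unfolding has_field_derivative_iff tendsto_at_iff_sequentially
proof (intro allI impI)
  fix X assume X: "\<forall>i. X i \<in> S - {t}" "X \<longlonglongrightarrow> t"
  have int: "integrable M (\<lambda>x. \<bar>W \<tau> x\<bar> powr p)" if "\<tau> \<in> S" for \<tau>
    by (rule integrable_const_bound[where B = "C powr p"]) (use p WB[OF that] that in \<open>auto intro!: AE_I2 powr_mono2\<close>)
  let ?Q = "\<lambda>i x. (\<bar>W (X i) x\<bar> powr p - \<bar>W t x\<bar> powr p) / (X i - t)"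
  have XS: "X i \<in> S" "X i \<noteq> t" for i using X by auto
  have "(\<lambda>i. LINT x|M. ?Q i x) \<longlonglongrightarrow> (LINT x|M. p * \<bar>W t x\<bar> powr (p - 1) * sgn (W t x) * W' x)"
  proof (rule integral_dominated_convergence[where w = "\<lambda>_. p * C powr (p - 1) * L"])
    show "AE x in M. (\<lambda>i. ?Q i x) \<longlonglongrightarrow> p * \<bar>W t x\<bar> powr (p - 1) * sgn (W t x) * W' x"
    proof (rule AE_I2)
      fix x
      have "((\<lambda>\<tau>. \<bar>W \<tau> x\<bar> powr p) has_real_derivative (p * \<bar>W t x\<bar> powr (p - 1) * sgn (W t x)) * W' x) (at t within S)"
        by (rule DERIV_chain2[OF abs_powr_has_derivative[OF p] WD])
      then have "((\<lambda>\<tau>. (\<bar>W \<tau> x\<bar> powr p - \<bar>W t x\<bar> powr p) / (\<tau> - t)) \<longlongrightarrow> p * \<bar>W t x\<bar> powr (p - 1) * sgn (W t x) * W' x) (at t within S)"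
        unfolding has_field_derivative_iff .
      then show "(\<lambda>i. ?Q i x) \<longlonglongrightarrow> p * \<bar>W t x\<bar> powr (p - 1) * sgn (W t x) * W' x"
        unfolding tendsto_at_iff_sequentially using X by (auto simp: o_def)
    qed
    fix i
    show "AE x in M. norm (?Q i x) \<le> p * C powr (p - 1) * L"
    proof (rule AE_I2)
      fix x
      have "\<bar>\<bar>W (X i) x\<bar> powr p - \<bar>W t x\<bar> powr p\<bar> \<le> p * C powr (p - 1) * \<bar>W (X i) x - W t x\<bar>"
        by (rule abs_powr_lipschitz[OF p WB[OF XS(1)] WB[OF t]])
      also have "\<dots> \<le> p * C powr (p - 1) * (L * \<bar>X i - t\<bar>)"
        using p by (intro mult_left_mono WL XS) auto
      finally show "norm (?Q i x) \<le> p * C powr (p - 1) * L"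
        using XS(2)[of i] by (simp add: pos_divide_le_eq mult.assoc)
    qed
    show "?Q i \<in> borel_measurable M" using XS(1) t by measurable
  qed (use t in auto)
  moreover have "(LINT x|M. ?Q i x) = ((LINT x|M. \<bar>W (X i) x\<bar> powr p) - (LINT x|M. \<bar>W t x\<bar> powr p)) / (X i - t)" for i
    using int[OF XS(1)] int[OF t] by simp
  ultimately show "((\<lambda>\<tau>. ((LINT x|M. \<bar>W \<tau> x\<bar> powr p) - (LINT x|M. \<bar>W t x\<bar> powr p)) / (\<tau> - t)) \<circ> X)
      \<longlonglongrightarrow> (LINT x|M. p * \<bar>W t x\<bar> powr (p - 1) * sgn (W t x) * W' x)"
    by (simp only: o_def)
qed

lemma wnorm_integrable_bounded:
  fixes f :: "'a \<Rightarrow> real" and p C :: real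
  assumes "1 < p" "finite_measure M" "f \<in> borel_measurable M" "\<And>x. \<bar>f x\<bar> \<le> C"
  shows "integrable M (\<lambda>x. \<bar>f x\<bar> powr p)"
  by (rule finite_measure.integrable_const_bound[OF assms(2), where B = "C powr p"])
    (use assms in \<open>auto intro!: AE_I2 powr_mono2\<close>)

text \<open>The transport part of the integrand is the velocity times the x-derivative of the
  \<open>p\<close>-th power of |W|, to which the integration by parts applies with growth rate
  \<open>p * B\<close>; the forcing part is a Hoelder pairing. Both carry the factor
  \<open>p\<close>, which the \<open>p\<close>-th root will cancel.\<close>

lemma transport_energy_derivative:
  fixes W :: "real \<Rightarrow> real \<Rightarrow> real" and a g \<rho> :: "real \<Rightarrow> real"
  assumes p: "1 < p" and t: "t \<in> S"
    and Wc: "\<And>\<tau>. \<tau> \<in> S \<Longrightarrow> continuous_on UNIV (W \<tau>)"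
    and WB: "\<And>\<tau> x. \<tau> \<in> S \<Longrightarrow> \<bar>W \<tau> x\<bar> \<le> C" and WL: "\<And>\<tau> x. \<tau> \<in> S \<Longrightarrow> \<bar>W \<tau> x - W t x\<bar> \<le> L * \<bar>\<tau> - t\<bar>"
    and WD: "\<And>x. ((\<lambda>\<tau>. W \<tau> x) has_real_derivative a x * Wx x + g x) (at t within S)"
    and Wx: "\<And>x. (W t has_real_derivative Wx x) (at x)" "\<And>x. \<bar>Wx x\<bar> \<le> Lx" "continuous_on UNIV Wx"
    and g: "continuous_on UNIV g" "\<And>x. \<bar>g x\<bar> \<le> Cg"
    and a0: "\<And>x. \<bar>a x\<bar> \<le> a0" and a1: "\<And>x y. \<bar>a x - a y\<bar> \<le> a1 * \<bar>x - y\<bar>"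
    and \<rho>0: "\<And>x. 0 < \<rho> x" and \<rho>q: "\<And>x y. \<rho> x \<le> exp (p * B * \<bar>x - y\<bar>) * \<rho> y" and B: "0 \<le> B"
    and \<rho>i: "integrable lborel \<rho>"
  defines "M \<equiv> density lborel (\<lambda>x. ennreal (\<rho> x))"
  shows "\<exists>D. ((\<lambda>\<tau>. LINT x|M. \<bar>W \<tau> x\<bar> powr p) has_real_derivative D) (at t within S) \<and>
    D \<le> p * wnorm M p (W t) powr (p - 1) * ((a1 + B * a0) * wnorm M p (W t) + wnorm M p g)"
proof -
  have [measurable]: "\<rho> \<in> borel_measurable borel" using \<rho>i by auto
  have fin: "finite_measure M"
  proof (rule finite_measureI)
    have "emeasure M (space M) = (\<integral>\<^sup>+x. ennreal (\<rho> x) \<partial>lborel)"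
      by (simp add: M_def emeasure_density)
    also have "\<dots> < \<infinity>" using \<rho>i \<rho>0 by (subst nn_integral_eq_integral) (auto intro: less_imp_le)
    finally show "emeasure M (space M) \<noteq> \<infinity>" by simp
  qed
  interpret finite_measure M by (rule fin)
  have sM[simp]: "borel_measurable M = (borel_measurable borel :: (real \<Rightarrow> real) set)" by (simp add: M_def measurable_def)
  have cm: "f \<in> borel_measurable borel" if "continuous_on UNIV f" for f :: "real \<Rightarrow> real"
    using that by (rule borel_measurable_continuous_onI)
  have Mint: "(LINT x|M. f x) = (LINT x|lborel. f x * \<rho> x)" if "f \<in> borel_measurable borel" for f
    using that \<rho>0 unfolding M_def by (subst integral_density) (auto intro: less_imp_le simp: mult.commute)
  have a1': "0 \<le> a1" using a1[of 1 0] by (metis abs_ge_zero abs_one diff_zero mult.right_neutral order_trans)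
  have ac: "continuous_on UNIV a"
    by (rule lipschitz_on_continuous_on[of a1]) (auto simp: lipschitz_on_def dist_real_def a1 a1')
  note [measurable] = cm[OF Wc[OF t]] cm[OF Wx(3)] cm[OF g(1)] cm[OF ac]
  define D where "D = (LINT x|M. p * \<bar>W t x\<bar> powr (p - 1) * sgn (W t x) * (a x * Wx x + g x))"
  have der: "((\<lambda>\<tau>. LINT x|M. \<bar>W \<tau> x\<bar> powr p) has_real_derivative D) (at t within S)"
    unfolding D_def by (rule energy_time_derivative[OF p t _ WB WL WD]) (auto intro: cm Wc)
  have C0: "0 \<le> C" and Cg0: "0 \<le> Cg" and Lx0: "0 \<le> Lx" and a00: "0 \<le> a0"
    using WB[OF t, of 0] g(2)[of 0] Wx(2)[of 0] a0[of 0] by auto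
  let ?F' = "\<lambda>x. p * \<bar>W t x\<bar> powr (p - 1) * sgn (W t x) * Wx x"
  have powb: "\<bar>W t x\<bar> powr (p - 1) \<le> C powr (p - 1)" for x using WB[OF t] p by (intro powr_mono2) auto
  have F'B: "\<bar>?F' x\<bar> \<le> p * C powr (p - 1) * 1 * Lx" for x
    using p Wx(2)[of x] powb[of x] Lx0 unfolding abs_mult by (intro mult_mono) (auto simp: abs_sgn_eq)
  have iW: "integrable M (\<lambda>x. \<bar>W t x\<bar> powr p)"
    by (rule wnorm_integrable_bounded[OF p fin _ WB[OF t]]) simp
  have ig: "integrable M (\<lambda>x. \<bar>g x\<bar> powr p)"
    by (rule wnorm_integrable_bounded[OF p fin _ g(2)]) simp
  have h1: "integrable M (\<lambda>x. \<bar>W t x\<bar> powr (p - 1) * \<bar>g x\<bar>)"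
    and h2: "(LINT x|M. \<bar>W t x\<bar> powr (p - 1) * \<bar>g x\<bar>) \<le> wnorm M p (W t) powr (p - 1) * wnorm M p g"
    using holder_wnorm[OF p _ _ iW ig] by auto
  have iF: "integrable M (\<lambda>x. ?F' x * a x)"
  proof (rule integrable_const_bound)
    show "AE x in M. norm (?F' x * a x) \<le> (p * C powr (p - 1) * 1 * Lx) * a0"
    proof (rule AE_I2)
      fix x
      show "norm (?F' x * a x) \<le> (p * C powr (p - 1) * 1 * Lx) * a0"
        unfolding real_norm_def abs_mult[of "?F' x" "a x"] using p Lx0 by (intro mult_mono F'B a0) auto
    qed
  qed simp
  have "((\<lambda>x. \<bar>W t x\<bar> powr p) has_real_derivative ?F' x) (at x)" for x
    using DERIV_chain2[OF abs_powr_has_derivative[OF p] Wx(1)] .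
  have "(LINT x|lborel. ?F' x * a x * \<rho> x) \<le> (a1 + (p * B) * a0) * (LINT x|lborel. \<bar>W t x\<bar> powr p * \<rho> x)"
  proof (rule transport_energy_bound)
    show "((\<lambda>x. \<bar>W t x\<bar> powr p) has_real_derivative ?F' x) (at x)" for x
      using DERIV_chain2[OF abs_powr_has_derivative[OF p] Wx(1)] .
    show "continuous_on UNIV ?F'"
    proof -
      have "continuous_on UNIV (\<lambda>y::real. \<bar>y\<bar> powr (p - 1) * sgn y)"
      proof -
        have "isCont (\<lambda>y::real. \<bar>y\<bar> powr (p - 1) * sgn y) y" for y
        proof (cases "y = 0")
          case True
          have "((\<lambda>h::real. \<bar>h\<bar> powr (p - 1)) \<longlongrightarrow> \<bar>0\<bar> powr (p - 1)) (at 0)"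
            using p by (intro tendsto_powr2 tendsto_intros) (auto intro!: always_eventually)
          then have "((\<lambda>h::real. \<bar>h\<bar> powr (p - 1) * sgn h) \<longlongrightarrow> 0) (at 0)"
            by (intro Lim_null_comparison[where g = "\<lambda>h. \<bar>h\<bar> powr (p - 1)" and f = "\<lambda>h. \<bar>h\<bar> powr (p - 1) * sgn h"])
              (use p in \<open>auto simp: abs_mult sgn_if\<close>)
          then show ?thesis using True by (simp add: isCont_def)
        next
          case False
          then show ?thesis unfolding isCont_def
            by (intro tendsto_mult tendsto_powr tendsto_rabs tendsto_sgn tendsto_ident_at tendsto_const) auto
        qed
        then show ?thesis by (simp add: continuous_at_imp_continuous_on)
      qed
      from continuous_on_compose2[OF this Wc[OF t]]
      have "continuous_on UNIV (\<lambda>x. \<bar>W t x\<bar> powr (p - 1) * sgn (W t x))" by simp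
      from continuous_on_mult[OF continuous_on_mult[OF continuous_on_const[of _ p] this] Wx(3)]
      show ?thesis by (simp add: mult.assoc)
    qed
    show "\<bar>W t x\<bar> powr p \<le> C powr p" for x using WB[OF t] p by (intro powr_mono2) auto
  qed (use F'B a0 a1 \<rho>0 \<rho>q \<rho>i p B in \<open>auto simp: mult.assoc\<close>)
  then have tr: "(LINT x|M. ?F' x * a x) \<le> (a1 + p * B * a0) * wnorm M p (W t) powr p"
    using p by (simp add: Mint wnorm_powr)
  have "D \<le> (LINT x|M. ?F' x * a x + p * (\<bar>W t x\<bar> powr (p - 1) * \<bar>g x\<bar>))"
    unfolding D_def
  proof (rule integral_mono)
    show "integrable M (\<lambda>x. p * \<bar>W t x\<bar> powr (p - 1) * sgn (W t x) * (a x * Wx x + g x))"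
    proof (rule integrable_const_bound)
      have "\<bar>a x * Wx x + g x\<bar> \<le> a0 * Lx + Cg" for x
        using a0[of x] Wx(2)[of x] g(2)[of x] a00 by (intro order_trans[OF abs_triangle_ineq] add_mono) (auto simp: abs_mult intro!: mult_mono)
      then show "AE x in M. norm (p * \<bar>W t x\<bar> powr (p - 1) * sgn (W t x) * (a x * Wx x + g x)) \<le> p * C powr (p - 1) * 1 * (a0 * Lx + Cg)"
        using p powb a00 Lx0 Cg0 unfolding real_norm_def abs_mult by (intro AE_I2 mult_mono) (auto simp: abs_sgn_eq)
    qed simp
    show "integrable M (\<lambda>x. ?F' x * a x + p * (\<bar>W t x\<bar> powr (p - 1) * \<bar>g x\<bar>))"
      using iF h1 by simp
    fix x
    have "sgn (W t x) * g x \<le> \<bar>g x\<bar>" by (auto simp: sgn_if)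
    then have "p * \<bar>W t x\<bar> powr (p - 1) * (sgn (W t x) * g x) \<le> p * \<bar>W t x\<bar> powr (p - 1) * \<bar>g x\<bar>"
      using p by (intro mult_left_mono) auto
    then show "p * \<bar>W t x\<bar> powr (p - 1) * sgn (W t x) * (a x * Wx x + g x) \<le> ?F' x * a x + p * (\<bar>W t x\<bar> powr (p - 1) * \<bar>g x\<bar>)"
      by (simp add: algebra_simps)
  qed
  also have "\<dots> = (LINT x|M. ?F' x * a x) + p * (LINT x|M. \<bar>W t x\<bar> powr (p - 1) * \<bar>g x\<bar>)"
    using iF h1 by simp
  also have "\<dots> \<le> (a1 + p * B * a0) * wnorm M p (W t) powr p + p * (wnorm M p (W t) powr (p - 1) * wnorm M p g)"
    using tr h2 p by (intro add_mono mult_left_mono) auto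
  \<comment> \<open>The Lipschitz constant of the velocity comes without a factor \<open>p\<close>;
    it is enlarged to \<open>p * a1\<close> so that \<open>p\<close> can be taken out of
    everything.\<close>
  also have "(a1 + p * B * a0) * wnorm M p (W t) powr p \<le> (p * a1 + p * B * a0) * wnorm M p (W t) powr p"
    using mult_right_mono[of 1 p a1] p a1' by (intro mult_right_mono add_right_mono) auto
  also have "wnorm M p (W t) powr p = wnorm M p (W t) powr (p - 1) * wnorm M p (W t)"
    using wnorm_nonneg[of M p "W t"] p by (cases "wnorm M p (W t) = 0") (auto simp: powr_diff)
  finally show ?thesis using der by (intro exI[of _ D]) (simp add: algebra_simps)
qed

section \<open>Schwartz functions and weak derivatives\<close>

text \<open>This class is closed under differentiation, so that the Schwartz bounds need to be checked only
  for the functions themselves.\<close>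

definition gauss_trig :: "real poly \<Rightarrow> real poly \<Rightarrow> real \<Rightarrow> real \<Rightarrow> real \<Rightarrow> real \<Rightarrow> real" where
  "gauss_trig P Q c b s x = (poly P x * cos (c * x) + poly Q x * sin (c * x)) * exp (b * x - s * x\<^sup>2)"

lemma gauss_trig_has_derivative:
  "(gauss_trig P Q c b s has_real_derivative
    gauss_trig (pderiv P + smult c Q + [:b, - 2 * s:] * P) (pderiv Q - smult c P + [:b, - 2 * s:] * Q) c b s x) (at x)"
  unfolding gauss_trig_def
  by (auto intro!: derivative_eq_intros poly_DERIV simp: algebra_simps power2_eq_square)

text \<open>Polynomials grow at most exponentially, so the function is bounded by a multiple of
  exp(m |x| - s x^2); completing the square bounds the exponent by m^2 / (4 s).\<close>

lemma gauss_trig_bounded: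
  assumes s: "0 < s"
  shows "bounded (range (gauss_trig P Q c b s))"
proof -
  have poly: "\<exists>C k. 0 \<le> C \<and> 0 \<le> k \<and> (\<forall>x. \<bar>poly P x\<bar> \<le> C * exp (k * \<bar>x\<bar>))" for P :: "real poly"
  proof (induction P)
    case 0
    then show ?case by (intro exI[of _ 0]) auto
  next
    case (pCons a P)
    then obtain C k where Ck: "0 \<le> C" "0 \<le> k" "\<And>x. \<bar>poly P x\<bar> \<le> C * exp (k * \<bar>x\<bar>)" by blast
    have "\<bar>poly (pCons a P) x\<bar> \<le> (\<bar>a\<bar> + C) * exp ((k + 1) * \<bar>x\<bar>)" for x
    proof -
      have "\<bar>poly (pCons a P) x\<bar> \<le> \<bar>a\<bar> + \<bar>x\<bar> * \<bar>poly P x\<bar>" by (simp add: abs_mult[symmetric] abs_triangle_ineq)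
      also have "\<bar>x\<bar> * \<bar>poly P x\<bar> \<le> exp \<bar>x\<bar> * (C * exp (k * \<bar>x\<bar>))"
        using Ck exp_ge_add_one_self[of "\<bar>x\<bar>"] by (intro mult_mono) (auto simp del: exp_ge_add_one_self)
      also have "\<bar>a\<bar> \<le> \<bar>a\<bar> * exp ((k + 1) * \<bar>x\<bar>)" using Ck(2) by (simp add: mult_le_cancel_left1)
      finally show ?thesis by (simp add: algebra_simps exp_add)
    qed
    then show ?case using Ck by (intro exI[of _ "\<bar>a\<bar> + C"] exI[of _ "k + 1"]) auto
  qed
  obtain C k where P: "0 \<le> C" "0 \<le> k" "\<And>x. \<bar>poly P x\<bar> \<le> C * exp (k * \<bar>x\<bar>)" using poly by blast
  obtain D l where Q: "0 \<le> D" "0 \<le> l" "\<And>x. \<bar>poly Q x\<bar> \<le> D * exp (l * \<bar>x\<bar>)" using poly by blast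
  define m where "m = k + l + \<bar>b\<bar>"
  have "norm (gauss_trig P Q c b s x) \<le> (C + D) * exp (m\<^sup>2 / (4 * s))" for x
  proof -
    have "\<bar>poly P x * cos (c * x) + poly Q x * sin (c * x)\<bar> \<le> \<bar>poly P x\<bar> * 1 + \<bar>poly Q x\<bar> * 1"
      by (intro order_trans[OF abs_triangle_ineq] add_mono) (auto simp: abs_mult intro!: mult_left_le)
    also have "\<dots> \<le> C * exp ((k + l) * \<bar>x\<bar>) + D * exp ((k + l) * \<bar>x\<bar>)"
    proof -
      have "C * exp (k * \<bar>x\<bar>) \<le> C * exp ((k + l) * \<bar>x\<bar>)" "D * exp (l * \<bar>x\<bar>) \<le> D * exp ((k + l) * \<bar>x\<bar>)"
        using P(1,2) Q(1,2) by (auto intro!: mult_left_mono mult_right_mono)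
      then show ?thesis using P(3)[of x] Q(3)[of x] by linarith
    qed
    finally have 1: "\<bar>poly P x * cos (c * x) + poly Q x * sin (c * x)\<bar> \<le> (C + D) * exp ((k + l) * \<bar>x\<bar>)"
      by (simp add: algebra_simps)
    have "norm (gauss_trig P Q c b s x) \<le> ((C + D) * exp ((k + l) * \<bar>x\<bar>)) * exp (b * x - s * x\<^sup>2)"
      unfolding gauss_trig_def real_norm_def abs_mult using 1 by (intro mult_mono) auto
    also have "\<dots> = (C + D) * exp ((k + l) * \<bar>x\<bar> + (b * x - s * x\<^sup>2))" by (simp add: exp_add)
    also have "\<dots> \<le> (C + D) * exp (m\<^sup>2 / (4 * s))"
    proof -
      have "b * x \<le> \<bar>b\<bar> * \<bar>x\<bar>" by (metis abs_ge_self abs_mult)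
      then have "(k + l) * \<bar>x\<bar> + (b * x - s * x\<^sup>2) \<le> m * \<bar>x\<bar> - s * \<bar>x\<bar>\<^sup>2" by (simp add: m_def algebra_simps)
      also have "\<dots> \<le> m\<^sup>2 / (4 * s)"
      proof -
        have "0 \<le> (2 * s * \<bar>x\<bar> - m)\<^sup>2" by simp
        then have "4 * s * (m * \<bar>x\<bar> - s * \<bar>x\<bar>\<^sup>2) \<le> m\<^sup>2" by (simp add: power2_eq_square algebra_simps)
        then show ?thesis using s by (simp add: pos_le_divide_eq mult.commute)
      qed
      finally show ?thesis using P Q by (intro mult_left_mono) auto
    qed
    finally show ?thesis .
  qed
  then show ?thesis unfolding bounded_iff by blast
qed

lemma schwartz_gauss_trig:
  assumes s: "0 < s"
  shows "schwartz (gauss_trig P Q c b s)"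
proof -
  have der: "\<exists>P' Q'. (deriv ^^ n) (gauss_trig P Q c b s) = gauss_trig P' Q' c b s" for n
  proof (induction n)
    case (Suc n)
    then obtain P' Q' where PQ: "(deriv ^^ n) (gauss_trig P Q c b s) = gauss_trig P' Q' c b s" by blast
    have "deriv (gauss_trig P' Q' c b s) =
      gauss_trig (pderiv P' + smult c Q' + [:b, - 2 * s:] * P') (pderiv Q' - smult c P' + [:b, - 2 * s:] * Q') c b s"
      by (rule ext) (rule DERIV_imp_deriv[OF gauss_trig_has_derivative])
    then show ?case using PQ by auto
  qed auto
  show ?thesis unfolding schwartz_def
  proof (intro conjI allI)
    fix n x
    obtain P' Q' where "(deriv ^^ n) (gauss_trig P Q c b s) = gauss_trig P' Q' c b s" using der by blast
    then show "(deriv ^^ n) (gauss_trig P Q c b s) field_differentiable at x"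
      using gauss_trig_has_derivative field_differentiable_def by metis
  next
    fix k n
    obtain P' Q' where PQ: "(deriv ^^ n) (gauss_trig P Q c b s) = gauss_trig P' Q' c b s" using der by blast
    have eq: "(\<lambda>x. x ^ k * (deriv ^^ n) (gauss_trig P Q c b s) x) = gauss_trig (monom 1 k * P') (monom 1 k * Q') c b s"
      unfolding PQ by (rule ext) (simp add: gauss_trig_def poly_monom algebra_simps)
    show "bounded (range (\<lambda>x. x ^ k * (deriv ^^ n) (gauss_trig P Q c b s) x))"
      unfolding eq by (rule gauss_trig_bounded[OF s])
  qed
qed

lemma schwartz_normal_density:
  fixes c \<sigma> :: real
  assumes \<sigma>: "0 < \<sigma>"
  shows "schwartz (normal_density c \<sigma>)"
proof -
  have "normal_density c \<sigma> = gauss_trig [:exp (- c\<^sup>2 / (2 * \<sigma>\<^sup>2)) / sqrt (2 * pi * \<sigma>\<^sup>2):] 0 0 (c / \<sigma>\<^sup>2) (1 / (2 * \<sigma>\<^sup>2))"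
  proof
    fix x
    have "- (x - c)\<^sup>2 / (2 * \<sigma>\<^sup>2) = - c\<^sup>2 / (2 * \<sigma>\<^sup>2) + (c / \<sigma>\<^sup>2 * x - 1 / (2 * \<sigma>\<^sup>2) * x\<^sup>2)"
      using \<sigma> by (simp add: field_simps power2_eq_square)
    then have "exp (- (x - c)\<^sup>2 / (2 * \<sigma>\<^sup>2)) = exp (- c\<^sup>2 / (2 * \<sigma>\<^sup>2)) * exp (c / \<sigma>\<^sup>2 * x - 1 / (2 * \<sigma>\<^sup>2) * x\<^sup>2)"
      by (simp only: exp_add)
    then show "normal_density c \<sigma> x = gauss_trig [:exp (- c\<^sup>2 / (2 * \<sigma>\<^sup>2)) / sqrt (2 * pi * \<sigma>\<^sup>2):] 0 0 (c / \<sigma>\<^sup>2) (1 / (2 * \<sigma>\<^sup>2)) x"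
      unfolding normal_density_def gauss_trig_def by simp
  qed
  then show ?thesis using schwartz_gauss_trig[of "1 / (2 * \<sigma>\<^sup>2)"] \<sigma> by simp
qed

lemma schwartz_has_derivative:
  assumes "schwartz \<psi>"
  shows "(\<psi> has_real_derivative deriv \<psi> x) (at x)"
proof -
  have "(deriv ^^ 0) \<psi> field_differentiable at x" using assms unfolding schwartz_def by blast
  then show ?thesis by (simp add: DERIV_deriv_iff_field_differentiable)
qed

lemma schwartz_deriv:
  assumes "schwartz \<psi>"
  shows "schwartz (deriv \<psi>)"
proof -
  have "(deriv ^^ n) (deriv \<psi>) = (deriv ^^ Suc n) \<psi>" for n by (simp only: funpow_Suc_right o_def)
  then show ?thesis using assms unfolding schwartz_def by metis
qed

lemma schwartz_continuous: "schwartz \<psi> \<Longrightarrow> continuous_on UNIV \<psi>"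
  by (meson DERIV_isCont continuous_at_imp_continuous_on schwartz_has_derivative)

lemma schwartz_measurable: "schwartz \<psi> \<Longrightarrow> \<psi> \<in> borel_measurable borel"
  by (rule borel_measurable_continuous_onI[OF schwartz_continuous])

text \<open>Of the Schwartz bounds on the function itself only this majorant is used: it is
  integrable and vanishes at infinity.\<close>

lemma schwartz_decay:
  assumes "schwartz \<psi>"
  obtains C where "\<And>x. \<bar>\<psi> x\<bar> \<le> C * inverse (1 + x\<^sup>2)" "0 \<le> C"
proof -
  have "bounded (range (\<lambda>x. x ^ 0 * (deriv ^^ 0) \<psi> x))" "bounded (range (\<lambda>x. x ^ 2 * (deriv ^^ 0) \<psi> x))"
    using assms unfolding schwartz_def by blast+
  then obtain A B where AB: "\<And>x. \<bar>\<psi> x\<bar> \<le> A" "\<And>x. \<bar>x\<^sup>2 * \<psi> x\<bar> \<le> B"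
    by (auto simp: bounded_iff)
  have "\<bar>\<psi> x\<bar> \<le> (A + B) * inverse (1 + x\<^sup>2)" for x
  proof -
    have "\<bar>\<psi> x\<bar> * (1 + x\<^sup>2) \<le> A + B" using AB[of x] by (simp add: abs_mult algebra_simps)
    moreover have "0 < 1 + x\<^sup>2" by (simp add: add_pos_nonneg)
    ultimately show ?thesis by (simp add: field_simps)
  qed
  moreover have "0 \<le> A + B" using AB[of 0] by auto
  ultimately show ?thesis using that by blast
qed

lemma integrable_inverse_1_plus_square_lborel: "integrable lborel (\<lambda>x::real. inverse (1 + x\<^sup>2))"
  using integrable_inverse_1_plus_square by (simp add: set_integrable_def einterval_def)

lemma schwartz_mult_integrable:
  fixes f :: "real \<Rightarrow> real"
  assumes \<psi>: "schwartz \<psi>" and [measurable]: "f \<in> borel_measurable borel" and f: "\<And>x. \<bar>f x\<bar> \<le> B"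
  shows "integrable lborel (\<lambda>x. \<psi> x * f x)"
proof -
  obtain C where C: "\<And>x. \<bar>\<psi> x\<bar> \<le> C * inverse (1 + x\<^sup>2)" "0 \<le> C" using schwartz_decay[OF \<psi>] by blast
  note [measurable] = schwartz_measurable[OF \<psi>]
  have B: "0 \<le> B" using f[of 0] by linarith
  show ?thesis
  proof (rule Bochner_Integration.integrable_bound[where f = "\<lambda>x. (C * B) * inverse (1 + x\<^sup>2)"])
    show "AE x in lborel. norm (\<psi> x * f x) \<le> norm ((C * B) * inverse (1 + x\<^sup>2))"
    proof (rule AE_I2)
      fix x
      have "\<bar>\<psi> x\<bar> * \<bar>f x\<bar> \<le> (C * inverse (1 + x\<^sup>2)) * B"
        using C f by (intro mult_mono) auto
      then show "norm (\<psi> x * f x) \<le> norm ((C * B) * inverse (1 + x\<^sup>2))"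
        using B C(2) by (simp add: abs_mult mult_ac)
    qed
  qed (use integrable_inverse_1_plus_square_lborel in auto)
qed

lemma schwartz_tendsto_0:
  assumes "schwartz \<psi>"
  shows "(\<psi> \<longlongrightarrow> 0) at_top" "(\<psi> \<longlongrightarrow> 0) at_bot"
proof -
  obtain C where C: "\<And>x. \<bar>\<psi> x\<bar> \<le> C * inverse (1 + x\<^sup>2)" "0 \<le> C" using schwartz_decay[OF assms] by blast
  have top: "((\<lambda>x::real. C * inverse (1 + x\<^sup>2)) \<longlongrightarrow> 0) at_top"
    by (intro tendsto_mult_right_zero tendsto_inverse_0_at_top filterlim_tendsto_add_at_top[OF tendsto_const]
      filterlim_pow_at_top filterlim_ident) simp
  then have "((\<lambda>x::real. C * inverse (1 + x\<^sup>2)) \<longlongrightarrow> 0) at_bot"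
    by (simp add: filterlim_at_bot_mirror)
  note top this
  then show "(\<psi> \<longlongrightarrow> 0) at_top" "(\<psi> \<longlongrightarrow> 0) at_bot"
    by (auto intro!: Lim_null_comparison[where g = "\<lambda>x. C * inverse (1 + x\<^sup>2)"] always_eventually C(1))
qed

lemma schwartz_integration_by_parts:
  fixes F F' :: "real \<Rightarrow> real"
  assumes \<psi>: "schwartz \<psi>" and F: "\<And>x. (F has_real_derivative F' x) (at x)" and F'c: "continuous_on UNIV F'"
    and B: "\<And>x. \<bar>F x\<bar> \<le> B" "\<And>x. \<bar>F' x\<bar> \<le> B'"
  shows "(LINT x|lborel. \<psi> x * F' x) = - (LINT x|lborel. deriv \<psi> x * F x)"
proof -
  have Fc: "continuous_on UNIV F" using F by (meson DERIV_isCont continuous_at_imp_continuous_on)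
  have [measurable]: "F \<in> borel_measurable borel" "F' \<in> borel_measurable borel"
    using Fc F'c by (auto intro: borel_measurable_continuous_onI)
  have i1: "integrable lborel (\<lambda>x. \<psi> x * F' x)" by (rule schwartz_mult_integrable[OF \<psi> _ B(2)]) simp
  have i2: "integrable lborel (\<lambda>x. deriv \<psi> x * F x)" by (rule schwartz_mult_integrable[OF schwartz_deriv[OF \<psi>] _ B(1)]) simp
  have lim: "((\<lambda>x. \<psi> x * F x) \<longlongrightarrow> 0) at_top" "((\<lambda>x. \<psi> x * F x) \<longlongrightarrow> 0) at_bot"
  proof -
    have "((\<lambda>x. \<bar>\<psi> x\<bar> * B) \<longlongrightarrow> 0) at_top" "((\<lambda>x. \<bar>\<psi> x\<bar> * B) \<longlongrightarrow> 0) at_bot"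
      using schwartz_tendsto_0[OF \<psi>] by (auto intro!: tendsto_mult_left_zero tendsto_rabs_zero)
    then show "((\<lambda>x. \<psi> x * F x) \<longlongrightarrow> 0) at_top" "((\<lambda>x. \<psi> x * F x) \<longlongrightarrow> 0) at_bot"
      by (auto intro!: Lim_null_comparison[where g = "\<lambda>x. \<bar>\<psi> x\<bar> * B"] always_eventually mult_left_mono B(1) simp: abs_mult)
  qed
  have "(LBINT x=-\<infinity>..\<infinity>. \<psi> x * F' x + deriv \<psi> x * F x) = 0 - 0"
  proof (rule interval_integral_FTC_integrable)
    show "((\<lambda>x. \<psi> x * F x) has_vector_derivative \<psi> x * F' x + deriv \<psi> x * F x) (at x)" for x
      using DERIV_mult[OF schwartz_has_derivative[OF \<psi>] F]
      by (simp add: has_real_derivative_iff_has_vector_derivative[symmetric] add.commute mult.commute)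
    have "continuous_on UNIV (\<lambda>x. \<psi> x * F' x + deriv \<psi> x * F x)"
      by (intro continuous_intros schwartz_continuous \<psi> schwartz_deriv Fc F'c)
    then show "isCont (\<lambda>x. \<psi> x * F' x + deriv \<psi> x * F x) x" for x
      by (simp add: continuous_on_eq_continuous_at)
    show "set_integrable lborel (einterval (- \<infinity>) \<infinity>) (\<lambda>x. \<psi> x * F' x + deriv \<psi> x * F x)"
      using i1 i2 by (simp add: set_integrable_def einterval_def)
    show "(((\<lambda>x. \<psi> x * F x) \<circ> real_of_ereal) \<longlongrightarrow> 0) (at_right (- \<infinity>))"
      using lim(2) by (simp add: ereal_tendsto_simps)
    show "(((\<lambda>x. \<psi> x * F x) \<circ> real_of_ereal) \<longlongrightarrow> 0) (at_left \<infinity>)"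
      using lim(1) by (simp add: ereal_tendsto_simps)
  qed simp
  then have "(LINT x|lborel. \<psi> x * F' x + deriv \<psi> x * F x) = 0"
    by (simp add: interval_lebesgue_integral_def einterval_def set_lebesgue_integral_def)
  then show ?thesis using i1 i2 by simp
qed

section \<open>Identification of functions almost everywhere by Gaussian averages\<close>

text \<open>On \<open>{- real n..real n}\<close> the positive and the negative part of
  \<open>d\<close> are densities of finite Borel measures. Their distribution functions differ by
  integrals of \<open>d\<close> over intervals, hence not at all, so the measures and therefore the
  densities agree.\<close>

lemma ae_zero_if_interval_integrals_zero:
  fixes d :: "real \<Rightarrow> real"
  assumes [measurable]: "d \<in> borel_measurable borel"
    and di: "\<And>a b. a < b \<Longrightarrow> integrable lborel (\<lambda>x. indicator {a..b} x * d x)"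
    and d0: "\<And>a b. a < b \<Longrightarrow> (LINT x|lborel. indicator {a..b} x * d x) = 0"
  shows "AE x in lborel. d x = 0"
proof -
  have "AE x in lborel. x \<in> {- real n..real n} \<longrightarrow> d x = 0" for n
  proof (cases "n = 0")
    case True
    have "AE x in lborel. x \<noteq> (0 :: real)" by (rule AE_lborel_singleton)
    then show ?thesis by eventually_elim (use True in auto)
  next
    case False
    let ?I = "{- real n..real n}"
    define f where "f x = indicator ?I x * max 0 (d x)" for x
    define g where "g x = indicator ?I x * max 0 (- d x)" for x
    have [measurable]: "f \<in> borel_measurable borel" unfolding f_def[abs_def] by measurable
    have [measurable]: "g \<in> borel_measurable borel" unfolding g_def[abs_def] by measurable
    have nn: "0 \<le> f x" "0 \<le> g x" for x by (auto simp: f_def g_def)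
    have iI: "integrable lborel (\<lambda>x. indicator ?I x * d x)" using di[of "- real n" "real n"] False by simp
    have fi: "integrable lborel f"
      by (rule Bochner_Integration.integrable_bound[OF iI]) (auto simp: f_def indicator_def)
    have gi: "integrable lborel g"
      by (rule Bochner_Integration.integrable_bound[OF iI]) (auto simp: g_def indicator_def)
    have fbm: "finite_borel_measure (density lborel (\<lambda>x. ennreal (h x)))"
      if "integrable lborel h" "\<And>x. 0 \<le> h x" for h :: "real \<Rightarrow> real"
    proof -
      have [measurable]: "h \<in> borel_measurable borel" using that(1) by auto
      show ?thesis
      proof (intro finite_borel_measure.intro finite_borel_measure_axioms.intro finite_measureI)
        have "emeasure (density lborel (\<lambda>x. ennreal (h x))) (space (density lborel (\<lambda>x. ennreal (h x)))) = (\<integral>\<^sup>+x. ennreal (h x) \<partial>lborel)"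
          by (simp add: emeasure_density)
        also have "\<dots> < \<infinity>" using that by (subst nn_integral_eq_integral) auto
        finally show "emeasure (density lborel (\<lambda>x. ennreal (h x))) (space (density lborel (\<lambda>x. ennreal (h x)))) \<noteq> \<infinity>" by simp
      qed simp
    qed
    have meas: "measure (density lborel (\<lambda>x. ennreal (h x))) {..y} = (LINT x|lborel. indicator {..y} x * h x)"
      if "integrable lborel h" "\<And>x. 0 \<le> h x" for h :: "real \<Rightarrow> real" and y
    proof -
      have [measurable]: "h \<in> borel_measurable borel" using that(1) by auto
      have m1: "integrable lborel (\<lambda>x. indicator {..y} x * h x)"
        using integrable_mult_indicator[of "{..y}" lborel h] that(1) by simp
      have m2: "emeasure (density lborel (\<lambda>x. ennreal (h x))) {..y} = (\<integral>\<^sup>+x. ennreal (indicator {..y} x * h x) \<partial>lborel)"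
        by (subst emeasure_density) (auto intro!: nn_integral_cong simp: indicator_def)
      have "AE x in lborel. 0 \<le> indicator {..y} x * h x" using that(2) by simp
      then show ?thesis
        unfolding measure_def m2 by (simp add: nn_integral_eq_integral[OF m1] enn2real_ennreal integral_nonneg_AE)
    qed
    have "density lborel (\<lambda>x. ennreal (f x)) = density lborel (\<lambda>x. ennreal (g x))"
    proof (rule cdf_unique'[OF fbm[OF fi nn(1)] fbm[OF gi nn(2)]], rule ext)
      fix y
      have fy: "integrable lborel (\<lambda>x. indicator {..y} x * f x)" "integrable lborel (\<lambda>x. indicator {..y} x * g x)"
        using integrable_mult_indicator[of "{..y}" lborel f] integrable_mult_indicator[of "{..y}" lborel g] fi gi by auto
      have "(LINT x|lborel. indicator {..y} x * f x) - (LINT x|lborel. indicator {..y} x * g x)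
          = (LINT x|lborel. indicator {- real n..min (real n) y} x * d x)"
        unfolding Bochner_Integration.integral_diff[OF fy, symmetric]
        by (rule Bochner_Integration.integral_cong) (auto simp: f_def g_def indicator_def)
      also have "\<dots> = 0"
      proof (cases "- real n < min (real n) y")
        case True
        then show ?thesis by (rule d0)
      next
        case F: False
        have "AE x in lborel. indicator {- real n..min (real n) y} x * d x = 0"
          using AE_lborel_singleton[of "- real n"] by eventually_elim (use F in \<open>auto simp: indicator_def\<close>)
        then have "(LINT x|lborel. indicator {- real n..min (real n) y} x * d x) = (LINT x::real|lborel. 0)"
          by (intro integral_cong_AE) auto
        then show ?thesis by simp
      qed
      finally show "cdf (density lborel (\<lambda>x. ennreal (f x))) y = cdf (density lborel (\<lambda>x. ennreal (g x))) y"
        unfolding cdf_def meas[OF fi nn(1)] meas[OF gi nn(2)] by simp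
    qed
    then have "AE x in lborel. ennreal (f x) = ennreal (g x)"
      by (intro sigma_finite_measure.density_unique[OF sigma_finite_lborel]) auto
    then show ?thesis
      by eventually_elim (use nn in \<open>auto simp: f_def g_def indicator_def max_def split: if_splits\<close>)
  qed
  then have "AE x in lborel. \<forall>n. x \<in> {- real n..real n} \<longrightarrow> d x = 0" unfolding AE_all_countable by blast
  then show ?thesis
  proof eventually_elim
    case (elim x)
    obtain n where "\<bar>x\<bar> \<le> real n" using real_arch_simple by blast
    then show ?case using elim by (auto simp: abs_le_iff)
  qed
qed

lemma borel_measurable_normal_density_mean[measurable (raw)]:
  fixes f g :: "'a \<Rightarrow> real"
  assumes [measurable]: "f \<in> borel_measurable M" "g \<in> borel_measurable M"
  shows "(\<lambda>x. normal_density (f x) s (g x)) \<in> borel_measurable M"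
  unfolding normal_density_def by measurable

text \<open>The Gaussian averages of \<open>d\<close> are integrated over the centres
  \<open>c\<close> in an interval. Fubini turns this into an integral of \<open>d\<close> against a
  smoothed indicator; letting the width tend to 0 on both sides gives equal integrals of
  \<open>d\<close> and \<open>H\<close> over every interval. As \<open>d\<close> is only known to be
  integrable against a Gaussian, the smoothed indicators need a Gaussian majorant.\<close>

lemma mollifier_limit_AE:
  fixes d H :: "real \<Rightarrow> real"
  assumes [measurable]: "d \<in> borel_measurable borel" "H \<in> borel_measurable borel"
    and gi: "integrable lborel (\<lambda>x. normal_density 0 2 x * d x)"
    and lim: "\<And>c. (\<lambda>n. LINT x|lborel. normal_density c (1 / real (Suc n)) x * d x) \<longlonglongrightarrow> H c"
    and bdd: "\<And>a b. \<exists>B. \<forall>n. \<forall>c\<in>{a..b}. \<bar>LINT x|lborel. normal_density c (1 / real (Suc n)) x * d x\<bar> \<le> B"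
  shows "AE x in lborel. d x = H x"
proof -
  define h where "h n = 1 / real (Suc n)" for n
  have h0: "0 < h n" "h n \<le> 1" for n by (auto simp: h_def)
  have hlim: "h \<longlonglongrightarrow> 0" unfolding h_def by (rule lim_inverse_n'[THEN LIMSEQ_Suc])
  have main: "integrable lborel (\<lambda>x. indicator {a..b} x * d x) \<and> integrable lborel (\<lambda>x. indicator {a..b} x * H x) \<and>
      (LINT x|lborel. indicator {a..b} x * d x) = (LINT x|lborel. indicator {a..b} x * H x)" if ab: "a < b" for a b
  proof -
    \<comment> \<open>The indicator of \<open>{a..b}\<close> smoothed at the scale
      \<open>h n\<close>; it tends to the indicator off the two endpoints.\<close>
    define k where "k n x = (LINT c|lborel. indicator {a..b} c * normal_density c (h n) x)" for n x
    have sym: "normal_density c s x = normal_density x s c" for c s x :: real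
      by (simp add: normal_density_def power2_commute)
    have kz: "k n x = (LINT z|lborel. indicator {a..b} (x + h n * z) * std_normal_density z)" for n x
    proof -
      have "k n x = \<bar>h n\<bar> *\<^sub>R (LINT z|lborel. indicator {a..b} (x + h n * z) * normal_density x (h n) (x + h n * z))"
        unfolding k_def sym[of _ _ x] using h0[of n] by (subst lborel_integral_real_affine[where c = "h n" and t = x]) auto
      also have "\<dots> = (LINT z|lborel. indicator {a..b} (x + h n * z) * (h n * normal_density x (h n) (x + h n * z)))"
        using h0[of n] by (simp add: mult.left_commute)
      also have "\<dots> = (LINT z|lborel. indicator {a..b} (x + h n * z) * std_normal_density z)"
      proof -
        have "h n * normal_density x (h n) (x + h n * z) = std_normal_density z" for z
          using h0[of n] by (simp add: normal_density_def real_sqrt_mult power_mult_distrib)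
        then show ?thesis by simp
      qed
      finally show ?thesis .
    qed
    define m where "m = max \<bar>a\<bar> \<bar>b\<bar>"
    define K where "K = exp (m\<^sup>2 / 4) * sqrt 2 * sqrt (8 * pi)"
    \<comment> \<open>The standard Gaussian is split into two factors of half the exponent: one
      stays integrable in \<open>z\<close>, the other pays for the decay in \<open>x\<close>. On the
      support |x + h z| is at most \<open>m\<close> and \<open>h\<close> at most 1, so x^2 / 8 is
      bounded by m^2 / 4 + z^2 / 4.\<close>
    have stdn: "std_normal_density z = sqrt 2 * exp (- z\<^sup>2 / 4) * normal_density 0 (sqrt 2) z" for z
    proof -
      define e where "e = exp (- z\<^sup>2 / 4)"
      have "exp (- z\<^sup>2 / 2) = e * e" by (simp add: e_def exp_add[symmetric])
      then have 1: "std_normal_density z = e * e / (sqrt 2 * sqrt pi)" by (simp add: normal_density_def real_sqrt_mult)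
      have 2: "normal_density 0 (sqrt 2) z = e / (2 * sqrt pi)" by (simp add: normal_density_def real_sqrt_mult e_def)
      show ?thesis unfolding 1 2 e_def[symmetric] by (simp add: field_simps)
    qed
    have n02: "exp (- x\<^sup>2 / 8) = sqrt (8 * pi) * normal_density 0 2 x" for x by (simp add: normal_density_def)
    have kbd: "0 \<le> k n x \<and> k n x \<le> K * normal_density 0 2 x" for n x
    proof
      show "0 \<le> k n x" unfolding k_def by (intro integral_nonneg_AE) auto
      have pt: "indicator {a..b} (x + h n * z) * std_normal_density z \<le> (K * normal_density 0 2 x) * normal_density 0 (sqrt 2) z" for z
      proof (cases "x + h n * z \<in> {a..b}")
        case True
        then have "\<bar>x + h n * z\<bar> \<le> m" by (auto simp: m_def)
        then have 1: "(x + h n * z)\<^sup>2 \<le> m\<^sup>2" by (metis abs_ge_zero abs_le_square_iff abs_of_nonneg order_trans)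
        have "(h n * z)\<^sup>2 \<le> z\<^sup>2"
          using h0[of n] by (simp add: power_mult_distrib mult_left_le_one_le power_le_one)
        moreover have "x\<^sup>2 \<le> 2 * (x + h n * z)\<^sup>2 + 2 * (h n * z)\<^sup>2"
          using zero_le_power2[of "x + 2 * (h n * z)"] by (simp add: power2_eq_square algebra_simps)
        ultimately have "x\<^sup>2 / 8 \<le> m\<^sup>2 / 4 + z\<^sup>2 / 4" using 1 by linarith
        then have "exp (- z\<^sup>2 / 4) \<le> exp (m\<^sup>2 / 4 - x\<^sup>2 / 8)" by simp
        also have "\<dots> = exp (m\<^sup>2 / 4) * (sqrt (8 * pi) * normal_density 0 2 x)"
          unfolding n02[symmetric] by (simp add: exp_add[symmetric])
        finally have "(sqrt 2 * normal_density 0 (sqrt 2) z) * exp (- z\<^sup>2 / 4)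
            \<le> (sqrt 2 * normal_density 0 (sqrt 2) z) * (exp (m\<^sup>2 / 4) * (sqrt (8 * pi) * normal_density 0 2 x))"
          by (intro mult_left_mono) auto
        then show ?thesis using True unfolding stdn K_def by (simp add: mult_ac)
      qed (auto simp: K_def)
      have "k n x \<le> (LINT z|lborel. (K * normal_density 0 2 x) * normal_density 0 (sqrt 2) z)"
        unfolding kz
      proof (rule integral_mono)
        show "integrable lborel (\<lambda>z. indicator {a..b} (x + h n * z) * std_normal_density z)"
          by (rule Bochner_Integration.integrable_bound[where f = "std_normal_density"]) (auto simp: indicator_def)
      qed (use pt in auto)
      then show "k n x \<le> K * normal_density 0 2 x" by simp
    qed
    have klim: "(\<lambda>n. k n x) \<longlonglongrightarrow> indicator {a..b} x" if x: "x \<noteq> a" "x \<noteq> b" for x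
    proof -
      have "(\<lambda>n. LINT z|lborel. indicator {a..b} (x + h n * z) * std_normal_density z) \<longlonglongrightarrow> (LINT z|lborel. indicator {a..b} x * std_normal_density z)"
      proof (rule integral_dominated_convergence[where w = std_normal_density])
        show "AE z in lborel. (\<lambda>n. indicator {a..b} (x + h n * z) * std_normal_density z) \<longlonglongrightarrow> indicator {a..b} x * std_normal_density z"
        proof (rule AE_I2)
          fix z
          have l: "(\<lambda>n. x + h n * z) \<longlonglongrightarrow> x + 0 * z" by (intro tendsto_intros hlim)
          have "eventually (\<lambda>n. indicator {a..b} (x + h n * z) = (indicator {a..b} x :: real)) sequentially"
          proof -
            have ev: "eventually (\<lambda>n. x + h n * z \<in> U) sequentially" if "open U" "x \<in> U" for U
              using topological_tendstoD[OF l] that by simp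
            consider "x < a" | "b < x" | "a < x" "x < b" using x by linarith
            then show ?thesis
            proof cases
              case 1 then show ?thesis using ev[of "{..<a}"] by (auto elim!: eventually_mono simp: indicator_def)
            next
              case 2 then show ?thesis using ev[of "{b<..}"] by (auto elim!: eventually_mono simp: indicator_def)
            next
              case 3 then show ?thesis using ev[of "{a<..<b}"] by (auto elim!: eventually_mono simp: indicator_def)
            qed
          qed
          then have "(\<lambda>n. indicator {a..b} (x + h n * z) :: real) \<longlonglongrightarrow> indicator {a..b} x" by (rule tendsto_eventually)
          then show "(\<lambda>n. indicator {a..b} (x + h n * z) * std_normal_density z) \<longlonglongrightarrow> indicator {a..b} x * std_normal_density z"
            by (rule tendsto_mult_right)
        qed
      qed (auto simp: indicator_def)
      then show ?thesis unfolding kz by simp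
    qed
    have gi': "integrable lborel (\<lambda>x. \<bar>normal_density 0 2 x * d x\<bar>)" using gi by (rule integrable_abs)
    have km[measurable]: "k n \<in> borel_measurable borel" for n unfolding k_def by measurable
    have kdi: "integrable lborel (\<lambda>x. k n x * d x)" for n
    proof (rule Bochner_Integration.integrable_bound[where f = "\<lambda>x. K * \<bar>normal_density 0 2 x * d x\<bar>"])
      show "AE x in lborel. norm (k n x * d x) \<le> norm (K * \<bar>normal_density 0 2 x * d x\<bar>)"
      proof (rule AE_I2)
        fix x
        have "\<bar>k n x\<bar> * \<bar>d x\<bar> \<le> (K * normal_density 0 2 x) * \<bar>d x\<bar>" using kbd[of n x] by (intro mult_right_mono) auto
        then show "norm (k n x * d x) \<le> norm (K * \<bar>normal_density 0 2 x * d x\<bar>)" by (simp add: abs_mult K_def mult_ac)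
      qed
    qed (use gi' in auto)
    have fub: "(LINT c|lborel. indicator {a..b} c * (LINT x|lborel. normal_density c (h n) x * d x)) = (LINT x|lborel. k n x * d x)" for n
    proof -
      let ?f = "\<lambda>x c. indicator {a..b} c * normal_density c (h n) x * d x"
      have int: "integrable lborel (\<lambda>c. indicator {a..b} c * normal_density c (h n) x)" for x
        unfolding sym[of _ _ x] using integrable_mult_indicator[of "{a..b}" lborel "normal_density x (h n)"] h0[of n] by simp
      have "integrable (lborel \<Otimes>\<^sub>M lborel) (case_prod ?f)"
      proof (rule lborel_pair.Fubini_integrable)
        show "case_prod ?f \<in> borel_measurable (lborel \<Otimes>\<^sub>M lborel)"
          by measurable
        have "(LINT c|lborel. norm (?f x c)) = k n x * \<bar>d x\<bar>" for x
        proof -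
          have "(LINT c|lborel. norm (?f x c)) = (LINT c|lborel. (indicator {a..b} c * normal_density c (h n) x) * \<bar>d x\<bar>)"
            by (simp add: abs_mult)
          then show ?thesis unfolding k_def by simp
        qed
        moreover have "integrable lborel (\<lambda>x. k n x * \<bar>d x\<bar>)"
          by (rule Bochner_Integration.integrable_bound[OF kdi[of n]]) (auto simp: abs_mult)
        ultimately show "integrable lborel (\<lambda>x. LINT y|lborel. norm (case (x, y) of (x, c) \<Rightarrow> ?f x c))" by simp
        show "AE x in lborel. integrable lborel (\<lambda>y. case (x, y) of (x, c) \<Rightarrow> ?f x c)"
          using int by simp
      qed
      from lborel_pair.Fubini_integral[OF this]
      have E: "(LINT c|lborel. LINT x|lborel. ?f x c) = (LINT x|lborel. LINT c|lborel. ?f x c)" .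
      have A: "(LINT x|lborel. ?f x c) = indicator {a..b} c * (LINT x|lborel. normal_density c (h n) x * d x)" for c
        by (simp add: mult.assoc)
      have B: "(LINT c|lborel. ?f x c) = k n x * d x" for x unfolding k_def by simp
      show ?thesis using E by (simp only: A B)
    qed
    have l1: "(\<lambda>n. LINT x|lborel. k n x * d x) \<longlonglongrightarrow> (LINT x|lborel. indicator {a..b} x * d x)"
      and i1: "integrable lborel (\<lambda>x. indicator {a..b} x * d x)"
    proof -
      have ae: "AE x in lborel. (\<lambda>n. k n x * d x) \<longlonglongrightarrow> indicator {a..b} x * d x"
        using AE_lborel_singleton[of a] AE_lborel_singleton[of b]
        by eventually_elim (intro tendsto_mult klim tendsto_const)
      have bd: "AE x in lborel. norm (k n x * d x) \<le> K * \<bar>normal_density 0 2 x * d x\<bar>" for n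
      proof (rule AE_I2)
        fix x
        have "\<bar>k n x\<bar> * \<bar>d x\<bar> \<le> (K * normal_density 0 2 x) * \<bar>d x\<bar>" using kbd[of n x] by (intro mult_right_mono) auto
        then show "norm (k n x * d x) \<le> K * \<bar>normal_density 0 2 x * d x\<bar>" by (simp add: abs_mult mult_ac)
      qed
      show "(\<lambda>n. LINT x|lborel. k n x * d x) \<longlonglongrightarrow> (LINT x|lborel. indicator {a..b} x * d x)"
        by (rule integral_dominated_convergence[OF _ _ _ ae bd]) (use gi' in auto)
      show "integrable lborel (\<lambda>x. indicator {a..b} x * d x)"
        by (rule integrable_dominated_convergence[OF _ _ _ ae bd]) (use gi' in auto)
    qed
    obtain B where B: "\<And>n c. c \<in> {a..b} \<Longrightarrow> \<bar>LINT x|lborel. normal_density c (h n) x * d x\<bar> \<le> B"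
      using bdd[of a b] unfolding h_def by blast
    have iB: "integrable lborel (\<lambda>c. B * indicator {a..b} c)"
      by (intro integrable_mult_right integrable_real_indicator) (auto simp: emeasure_lborel_Icc_eq)
    have ae2: "AE c in lborel. (\<lambda>n. indicator {a..b} c * (LINT x|lborel. normal_density c (h n) x * d x)) \<longlonglongrightarrow> indicator {a..b} c * H c"
      using lim unfolding h_def by (intro AE_I2 tendsto_mult tendsto_const)
    have bd2: "AE c in lborel. norm (indicator {a..b} c * (LINT x|lborel. normal_density c (h n) x * d x)) \<le> B * indicator {a..b} c" for n
      using B by (auto simp: indicator_def)
    have m2: "(\<lambda>c. indicator {a..b} c * (LINT x|lborel. normal_density c (h n) x * d x)) \<in> borel_measurable lborel" for n
      by measurable
    have l2: "(\<lambda>n. LINT c|lborel. indicator {a..b} c * (LINT x|lborel. normal_density c (h n) x * d x)) \<longlonglongrightarrow> (LINT x|lborel. indicator {a..b} x * H x)"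
      by (rule integral_dominated_convergence[OF _ m2 iB ae2 bd2]) auto
    have i2: "integrable lborel (\<lambda>x. indicator {a..b} x * H x)"
      by (rule integrable_dominated_convergence[OF _ m2 iB ae2 bd2]) auto
    from LIMSEQ_unique[OF l1 l2[unfolded fub]] i1 i2 show ?thesis by blast
  qed
  have "AE x in lborel. d x - H x = 0"
  proof (rule ae_zero_if_interval_integrals_zero)
    fix a b :: real assume "a < b"
    note m = main[OF this]
    then have "integrable lborel (\<lambda>x. indicator {a..b} x * d x - indicator {a..b} x * H x)" by (intro Bochner_Integration.integrable_diff) auto
    then show "integrable lborel (\<lambda>x. indicator {a..b} x * (d x - H x))" by (simp add: right_diff_distrib)
    show "(LINT x|lborel. indicator {a..b} x * (d x - H x)) = 0"
      unfolding right_diff_distrib using m by (subst Bochner_Integration.integral_diff) auto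
  qed simp
  then show ?thesis by eventually_elim simp
qed

section \<open>Borel versions and weak derivatives\<close>

lemma borel_version_lebesgue:
  fixes g :: "real \<Rightarrow> real"
  assumes "g \<in> borel_measurable lebesgue"
  obtains g0 where "g0 \<in> borel_measurable borel" "AE x in lebesgue. g x = g0 x"
  using completion_ex_borel_measurable_real[OF assms] by (auto dest: AE_completion)

text \<open>Norms and distributions are defined over the completed measure, whereas Fubini,
  translations and densities are used over \<open>lborel\<close>; passing to a Borel version
  connects the two.\<close>

lemma integral_lebesgue_borel_version:
  fixes f F :: "real \<Rightarrow> real"
  assumes "f \<in> borel_measurable lebesgue" "F \<in> borel_measurable borel" "AE x in lebesgue. f x = F x"
  shows "integrable lebesgue f \<longleftrightarrow> integrable lborel F" "(LINT x|lebesgue. f x) = (LINT x|lborel. F x)"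
proof -
  have F: "F \<in> borel_measurable lebesgue" using assms(2) by (simp add: measurable_completion)
  show "integrable lebesgue f \<longleftrightarrow> integrable lborel F"
    using integrable_cong_AE[OF assms(1) F assms(3)] assms(2) by (simp add: integrable_completion)
  show "(LINT x|lebesgue. f x) = (LINT x|lborel. F x)"
    using integral_cong_AE[OF assms(1) F assms(3)] assms(2) by (simp add: integral_completion)
qed

lemma dist_of_borel_version:
  fixes f F :: "real \<Rightarrow> real"
  assumes "f \<in> borel_measurable lebesgue" "F \<in> borel_measurable borel" "AE x in lebesgue. f x = F x" "schwartz \<psi>"
  shows "integrable lebesgue (\<lambda>x. \<psi> x *\<^sub>R f x) \<longleftrightarrow> integrable lborel (\<lambda>x. \<psi> x * F x)"
    and "dist_of f \<psi> = (LINT x|lborel. \<psi> x * F x)"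
proof -
  note [measurable] = schwartz_measurable[OF assms(4)] assms(2)
  have m: "\<psi> \<in> borel_measurable lebesgue" by (rule measurable_completion) simp
  have 1: "(\<lambda>x. \<psi> x *\<^sub>R f x) \<in> borel_measurable lebesgue" using m assms(1) by simp
  have 2: "(\<lambda>x. \<psi> x * F x) \<in> borel_measurable borel" by simp
  have 3: "AE x in lebesgue. \<psi> x *\<^sub>R f x = \<psi> x * F x" using assms(3) by eventually_elim simp
  show "integrable lebesgue (\<lambda>x. \<psi> x *\<^sub>R f x) \<longleftrightarrow> integrable lborel (\<lambda>x. \<psi> x * F x)"
    by (rule integral_lebesgue_borel_version(1)[OF 1 2 3])
  show "dist_of f \<psi> = (LINT x|lborel. \<psi> x * F x)"
    unfolding dist_of_def by (rule integral_lebesgue_borel_version(2)[OF 1 2 3])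
qed

text \<open>Gaussians of every centre and width are test functions, so all averages of
  \<open>d\<close> vanish and the mollifier limit is 0.\<close>

lemma schwartz_null_imp_AE_zero:
  fixes d :: "real \<Rightarrow> real"
  assumes [measurable]: "d \<in> borel_measurable borel"
    and int: "\<And>\<psi>. schwartz \<psi> \<Longrightarrow> integrable lborel (\<lambda>x. \<psi> x * d x)"
    and z: "\<And>\<psi>. schwartz \<psi> \<Longrightarrow> (LINT x|lborel. \<psi> x * d x) = 0"
  shows "AE x in lborel. d x = 0"
proof (rule mollifier_limit_AE)
  have s: "schwartz (normal_density c (1 / real (Suc n)))" for c n by (rule schwartz_normal_density) simp
  show "integrable lborel (\<lambda>x. normal_density 0 2 x * d x)" by (rule int[OF schwartz_normal_density]) simp
  show "(\<lambda>n. LINT x|lborel. normal_density c (1 / real (Suc n)) x * d x) \<longlonglongrightarrow> 0" for c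
    unfolding z[OF s] by simp
  show "\<exists>B. \<forall>n. \<forall>c\<in>{a..b}. \<bar>LINT x|lborel. normal_density c (1 / real (Suc n)) x * d x\<bar> \<le> B" for a b
    unfolding z[OF s] by auto
qed auto

text \<open>Justifies the choice in \<open>weak_deriv\<close>: any two candidates agree off a null
  set.\<close>

lemma has_weak_deriv_unique:
  assumes "has_weak_deriv f g" "has_weak_deriv f g'"
  shows "AE x in lebesgue. g x = g' x"
proof -
  have m: "g \<in> borel_measurable lebesgue" "g' \<in> borel_measurable lebesgue"
    using assms by (auto simp: has_weak_deriv_def tempered_fun_def)
  obtain k where k: "k \<in> borel_measurable borel" "AE x in lebesgue. g x = k x" using borel_version_lebesgue[OF m(1)] .
  obtain k' where k': "k' \<in> borel_measurable borel" "AE x in lebesgue. g' x = k' x" using borel_version_lebesgue[OF m(2)] .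
  have "AE x in lborel. k x - k' x = 0"
  proof (rule schwartz_null_imp_AE_zero)
    fix \<psi> assume \<psi>: "schwartz \<psi>"
    have i: "integrable lborel (\<lambda>x. \<psi> x * k x)" "integrable lborel (\<lambda>x. \<psi> x * k' x)"
      using assms \<psi> dist_of_borel_version(1)[OF m(1) k \<psi>] dist_of_borel_version(1)[OF m(2) k' \<psi>]
      by (auto simp: has_weak_deriv_def tempered_fun_def)
    then show "integrable lborel (\<lambda>x. \<psi> x * (k x - k' x))" by (simp add: right_diff_distrib)
    have "dist_of g \<psi> = dist_of g' \<psi>" using assms \<psi> by (simp add: has_weak_deriv_def)
    then show "(LINT x|lborel. \<psi> x * (k x - k' x)) = 0"
      using dist_of_borel_version(2)[OF m(1) k \<psi>] dist_of_borel_version(2)[OF m(2) k' \<psi>] i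
      by (simp add: right_diff_distrib)
  qed (use k k' in simp)
  then have "AE x in lebesgue. k x - k' x = 0" by (rule AE_completion)
  with k(2) k'(2) show ?thesis by eventually_elim simp
qed

text \<open>Integration by parts exhibits \<open>F'\<close> as a weak derivative, and uniqueness
  identifies the chosen one with it. Since \<open>f\<close> has to agree with \<open>F\<close> only
  almost everywhere, the lemma can be applied again to \<open>weak_deriv f\<close>.\<close>

lemma weak_deriv_classical:
  fixes f F F' :: "real \<Rightarrow> real"
  assumes f: "f \<in> borel_measurable lebesgue" and ae: "AE x in lebesgue. f x = F x"
    and F: "\<And>x. (F has_real_derivative F' x) (at x)" and F'c: "continuous_on UNIV F'"
    and B: "\<And>x. \<bar>F x\<bar> \<le> B" "\<And>x. \<bar>F' x\<bar> \<le> B'"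
  shows "AE x in lebesgue. weak_deriv f x = F' x" "weak_deriv f \<in> borel_measurable lebesgue"
proof -
  have Fc: "continuous_on UNIV F" using F by (meson DERIV_isCont continuous_at_imp_continuous_on)
  have m: "F \<in> borel_measurable borel" "F' \<in> borel_measurable borel"
    using Fc F'c by (auto intro: borel_measurable_continuous_onI)
  have m': "F' \<in> borel_measurable lebesgue" using m(2) by (simp add: measurable_completion)
  have "has_weak_deriv f F'"
    unfolding has_weak_deriv_def tempered_fun_def
  proof (intro conjI allI impI f m')
    fix \<psi> assume \<psi>: "schwartz \<psi>"
    show "integrable lebesgue (\<lambda>x. \<psi> x *\<^sub>R f x)"
      using dist_of_borel_version(1)[OF f m(1) ae \<psi>] schwartz_mult_integrable[OF \<psi> m(1) B(1)] by simp
    show "integrable lebesgue (\<lambda>x. \<psi> x *\<^sub>R F' x)"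
      using dist_of_borel_version(1)[OF m' m(2) _ \<psi>] schwartz_mult_integrable[OF \<psi> m(2) B(2)] by simp
    show "dist_of F' \<psi> = dist_deriv (dist_of f) \<psi>"
      using dist_of_borel_version(2)[OF m' m(2) _ \<psi>] dist_of_borel_version(2)[OF f m(1) ae schwartz_deriv[OF \<psi>]]
        schwartz_integration_by_parts[OF \<psi> F F'c B] by (simp add: dist_deriv_def)
  qed
  then have "has_weak_deriv f (weak_deriv f)" unfolding weak_deriv_def by (rule someI[where P = "has_weak_deriv f"])
  with \<open>has_weak_deriv f F'\<close> show "AE x in lebesgue. weak_deriv f x = F' x"
    by (intro has_weak_deriv_unique)
  show "weak_deriv f \<in> borel_measurable lebesgue"
    using \<open>has_weak_deriv f (weak_deriv f)\<close> by (simp add: has_weak_deriv_def tempered_fun_def)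
qed

section \<open>Fourier inversion and Sobolev embedding\<close>

text \<open>The characteristic function of the standard normal law, rescaled by \<sigma>; the
  normalisation 2 pi is that of the inversion formula.\<close>

lemma gauss_fourier_integral:
  assumes \<sigma>: "0 < \<sigma>"
  shows "integrable lborel (\<lambda>\<xi>. exp (- (\<sigma>\<^sup>2 * \<xi>\<^sup>2 / 2)) *\<^sub>R cis (t * \<xi>))"
    and "(LINT \<xi>|lborel. exp (- (\<sigma>\<^sup>2 * \<xi>\<^sup>2 / 2)) *\<^sub>R cis (t * \<xi>)) = of_real (2 * pi * normal_density 0 \<sigma> t)"
proof -
  have nd: "exp (- (\<sigma>\<^sup>2 * \<xi>\<^sup>2 / 2)) = (sqrt (2 * pi) / \<sigma>) * (\<sigma> * std_normal_density (\<sigma> * \<xi>))" for \<xi>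
    using \<sigma> by (simp add: std_normal_density_def power_mult_distrib real_sqrt_mult)
  have i0: "integrable lborel (\<lambda>z. std_normal_density z *\<^sub>R cis (r * z))" for r
    by (rule Bochner_Integration.integrable_bound[where f = std_normal_density]) (auto simp: cis_conv_exp)
  have "char std_normal_distribution r = (LINT z|lborel. std_normal_density z *\<^sub>R cis (r * z))" for r
    unfolding char_def by (subst integral_density) (auto simp: cis_conv_exp)
  then have ch: "(LINT z|lborel. std_normal_density z *\<^sub>R cis (r * z)) = of_real (exp (- (r\<^sup>2) / 2))" for r
    by (simp add: char_std_normal_distribution)
  have eq: "exp (- (\<sigma>\<^sup>2 * \<xi>\<^sup>2 / 2)) *\<^sub>R cis (t * \<xi>)
      = (sqrt (2 * pi) / \<sigma>) *\<^sub>R (\<sigma> *\<^sub>R (std_normal_density (0 + \<sigma> * \<xi>) *\<^sub>R cis ((t / \<sigma>) * (0 + \<sigma> * \<xi>))))" for \<xi>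
    unfolding nd using \<sigma> by simp
  have i1: "integrable lborel (\<lambda>\<xi>. std_normal_density (0 + \<sigma> * \<xi>) *\<^sub>R cis ((t / \<sigma>) * (0 + \<sigma> * \<xi>)))"
    using lborel_integrable_real_affine[OF i0[of "t / \<sigma>"], of \<sigma> 0] \<sigma> by simp
  show "integrable lborel (\<lambda>\<xi>. exp (- (\<sigma>\<^sup>2 * \<xi>\<^sup>2 / 2)) *\<^sub>R cis (t * \<xi>))"
    unfolding eq by (intro integrable_scaleR_right i1)
  have "(LINT \<xi>|lborel. exp (- (\<sigma>\<^sup>2 * \<xi>\<^sup>2 / 2)) *\<^sub>R cis (t * \<xi>))
      = (sqrt (2 * pi) / \<sigma>) *\<^sub>R (\<bar>\<sigma>\<bar> *\<^sub>R (LINT \<xi>|lborel. std_normal_density (0 + \<sigma> * \<xi>) *\<^sub>R cis ((t / \<sigma>) * (0 + \<sigma> * \<xi>))))"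
    unfolding eq using \<sigma> by (simp only: integral_scaleR_right abs_of_pos)
  also have "\<bar>\<sigma>\<bar> *\<^sub>R (LINT \<xi>|lborel. std_normal_density (0 + \<sigma> * \<xi>) *\<^sub>R cis ((t / \<sigma>) * (0 + \<sigma> * \<xi>)))
      = (LINT z|lborel. std_normal_density z *\<^sub>R cis ((t / \<sigma>) * z))"
    using \<sigma> by (subst lborel_integral_real_affine[where c = \<sigma> and t = 0 and f = "\<lambda>z. std_normal_density z *\<^sub>R cis ((t / \<sigma>) * z)"]) auto
  also have "\<dots> = of_real (exp (- ((t / \<sigma>)\<^sup>2) / 2))" by (rule ch)
  also have "(sqrt (2 * pi) / \<sigma>) *\<^sub>R complex_of_real (exp (- ((t / \<sigma>)\<^sup>2) / 2)) = of_real (2 * pi * normal_density 0 \<sigma> t)"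
  proof -
    have "sqrt (2 * pi) * sqrt (2 * pi) = 2 * pi" by simp
    then have "sqrt (2 * pi) / \<sigma> = 2 * pi / sqrt (2 * pi * \<sigma>\<^sup>2)"
      using \<sigma> by (simp add: real_sqrt_mult field_simps)
    then have "sqrt (2 * pi) / \<sigma> * exp (- ((t / \<sigma>)\<^sup>2) / 2) = 2 * pi * normal_density 0 \<sigma> t"
      using \<sigma> by (simp add: normal_density_def power_divide)
    then show ?thesis by (metis of_real_mult scaleR_conv_of_real)
  qed
  finally show "(LINT \<xi>|lborel. exp (- (\<sigma>\<^sup>2 * \<xi>\<^sup>2 / 2)) *\<^sub>R cis (t * \<xi>)) = of_real (2 * pi * normal_density 0 \<sigma> t)" .
qed

text \<open>The distributional definition is tested with a Gaussian times cos(c \<xi>) and times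
  sin(c \<xi>), test functions being real. Their transforms are combinations of Gaussian bumps at
  \<open>c\<close> and \<open>- c\<close>, so regularised inversion at \<open>c\<close> is an
  average of \<open>f\<close> near \<open>c\<close>.\<close>

lemma has_fourier_gauss:
  assumes fg: "has_fourier f g" and \<sigma>: "0 < \<sigma>"
  shows "(LINT \<xi>|lebesgue. exp (- (\<sigma>\<^sup>2 * \<xi>\<^sup>2 / 2)) *\<^sub>R (g \<xi> * cis (c * \<xi>)))
    = of_real (2 * pi * (LINT x|lebesgue. normal_density c \<sigma> x * f x))"
proof -
  let ?e = "\<lambda>\<xi>. exp (- (\<sigma>\<^sup>2 * \<xi>\<^sup>2 / 2))"
  define C where "C = gauss_trig 1 0 c 0 (\<sigma>\<^sup>2 / 2)"
  define S where "S = gauss_trig 0 1 c 0 (\<sigma>\<^sup>2 / 2)"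
  have C: "C \<xi> = ?e \<xi> * cos (c * \<xi>)" and S: "S \<xi> = ?e \<xi> * sin (c * \<xi>)" for \<xi>
    by (simp_all add: C_def S_def gauss_trig_def)
  have sch: "schwartz C" "schwartz S" using \<sigma> by (auto simp: C_def S_def intro!: schwartz_gauss_trig)
  define N where "N c x = normal_density c \<sigma> x" for c x
  have N: "normal_density 0 \<sigma> (c - x) = N c x" "normal_density 0 \<sigma> (- (c + x)) = N (- c) x" for x
    by (simp_all add: N_def normal_density_def power2_commute add.commute)
  note g1 = gauss_fourier_integral(1)[OF \<sigma>] and g2 = gauss_fourier_integral(2)[OF \<sigma>]
  have TC: "schwartz_fourier C x = of_real (pi * (N c x + N (- c) x))" for x
  proof -
    have key: "cos (c * \<xi>) *\<^sub>R cis (- (\<xi> * x)) = (1 / 2) *\<^sub>R (cis ((c - x) * \<xi>) + cis (- (c + x) * \<xi>))" for \<xi>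
      by (simp add: complex_eq_iff algebra_simps cos_diff cos_add sin_diff sin_add)
    have eq: "C \<xi> *\<^sub>R cis (- (\<xi> * x)) = (1 / 2) *\<^sub>R (?e \<xi> *\<^sub>R cis ((c - x) * \<xi>) + ?e \<xi> *\<^sub>R cis (- (c + x) * \<xi>))" for \<xi>
      unfolding C by (simp only: scaleR_scaleR[symmetric] key scaleR_left_commute scaleR_add_right)
    have m: "(\<lambda>\<xi>. C \<xi> *\<^sub>R cis (- (\<xi> * x))) \<in> borel_measurable lborel"
      unfolding eq by (rule borel_measurable_integrable[OF integrable_scaleR_right[OF Bochner_Integration.integrable_add[OF g1 g1]]])
    have "schwartz_fourier C x = (LINT \<xi>|lborel. C \<xi> *\<^sub>R cis (- (\<xi> * x)))"
      unfolding schwartz_fourier_def by (rule integral_completion[OF m])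
    also have "\<dots> = (1 / 2) *\<^sub>R (of_real (2 * pi * normal_density 0 \<sigma> (c - x)) + of_real (2 * pi * normal_density 0 \<sigma> (- (c + x))))"
      unfolding eq integral_scaleR_right by (subst Bochner_Integration.integral_add[OF g1 g1]) (simp only: g2)
    finally show ?thesis unfolding N by (simp add: scaleR_conv_of_real algebra_simps)
  qed
  have TS: "schwartz_fourier S x = - \<i> * of_real (pi * (N c x - N (- c) x))" for x
  proof -
    have "sin (c * \<xi>) *\<^sub>R cis (- (\<xi> * x)) = (- \<i> / 2) * (cis ((c - x) * \<xi>) - cis (- (c + x) * \<xi>))" for \<xi>
      by (simp add: complex_eq_iff algebra_simps cos_diff cos_add sin_diff sin_add diff_divide_distrib add_divide_distrib)
    then have eq: "S \<xi> *\<^sub>R cis (- (\<xi> * x)) = (- \<i> / 2) * (?e \<xi> *\<^sub>R cis ((c - x) * \<xi>) - ?e \<xi> *\<^sub>R cis (- (c + x) * \<xi>))" for \<xi>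
      unfolding S by (simp only: scaleR_scaleR[symmetric]) (simp add: scaleR_conv_of_real algebra_simps)
    have m: "(\<lambda>\<xi>. S \<xi> *\<^sub>R cis (- (\<xi> * x))) \<in> borel_measurable lborel"
      unfolding eq by (rule borel_measurable_integrable[OF integrable_mult_right[OF Bochner_Integration.integrable_diff[OF g1 g1]]])
    have "schwartz_fourier S x = (LINT \<xi>|lborel. S \<xi> *\<^sub>R cis (- (\<xi> * x)))"
      unfolding schwartz_fourier_def by (rule integral_completion[OF m])
    also have "\<dots> = (- \<i> / 2) * (of_real (2 * pi * normal_density 0 \<sigma> (c - x)) - of_real (2 * pi * normal_density 0 \<sigma> (- (c + x))))"
      unfolding eq integral_mult_right_zero by (subst Bochner_Integration.integral_diff[OF g1 g1]) (simp only: g2)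
    finally show ?thesis unfolding N by (simp add: algebra_simps)
  qed
  have tf: "tempered_fun f" and tg: "tempered_fun g"
    and F: "\<And>\<psi>. schwartz \<psi> \<Longrightarrow> dist_of g \<psi> = (LINT x|lebesgue. f x *\<^sub>R schwartz_fourier \<psi> x)"
    using fg by (auto simp: has_fourier_def)
  have fN: "integrable lebesgue (\<lambda>x. N c x * f x)" for c
    using tf schwartz_normal_density[OF \<sigma>] unfolding tempered_fun_def N_def by auto
  have "dist_of g C = (LINT x|lebesgue. of_real (pi * (N c x * f x) + pi * (N (- c) x * f x)))"
    unfolding F[OF sch(1)] TC by (intro Bochner_Integration.integral_cong) (auto simp: scaleR_conv_of_real algebra_simps)
  also have "\<dots> = of_real (LINT x|lebesgue. pi * (N c x * f x) + pi * (N (- c) x * f x))"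
    by (rule integral_complex_of_real)
  also have "(LINT x|lebesgue. pi * (N c x * f x) + pi * (N (- c) x * f x))
      = pi * (LINT x|lebesgue. N c x * f x) + pi * (LINT x|lebesgue. N (- c) x * f x)"
    using fN by simp
  finally have dC: "dist_of g C = of_real (pi * (LINT x|lebesgue. N c x * f x) + pi * (LINT x|lebesgue. N (- c) x * f x))" .
  have "dist_of g S = (LINT x|lebesgue. - \<i> * of_real (pi * (N c x * f x) - pi * (N (- c) x * f x)))"
    unfolding F[OF sch(2)] TS by (intro Bochner_Integration.integral_cong) (auto simp: scaleR_conv_of_real algebra_simps)
  also have "\<dots> = - \<i> * of_real (LINT x|lebesgue. pi * (N c x * f x) - pi * (N (- c) x * f x))"
    by (simp only: integral_mult_right_zero integral_complex_of_real)
  also have "(LINT x|lebesgue. pi * (N c x * f x) - pi * (N (- c) x * f x))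
      = pi * (LINT x|lebesgue. N c x * f x) - pi * (LINT x|lebesgue. N (- c) x * f x)"
    using fN by simp
  finally have dS: "dist_of g S = - \<i> * of_real (pi * (LINT x|lebesgue. N c x * f x) - pi * (LINT x|lebesgue. N (- c) x * f x))" .
  have iC: "integrable lebesgue (\<lambda>\<xi>. C \<xi> *\<^sub>R g \<xi>)" and iS: "integrable lebesgue (\<lambda>\<xi>. S \<xi> *\<^sub>R g \<xi>)"
    using tg sch unfolding tempered_fun_def by auto
  \<comment> \<open>In cosine plus \<open>\<i>\<close> times sine the bumps at \<open>- c\<close>
    cancel and those at \<open>c\<close> add up.\<close>
  have eq: "?e \<xi> *\<^sub>R (g \<xi> * cis (c * \<xi>)) = C \<xi> *\<^sub>R g \<xi> + \<i> * (S \<xi> *\<^sub>R g \<xi>)" for \<xi>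
    unfolding C S by (simp add: complex_eq_iff algebra_simps)
  have "(LINT \<xi>|lebesgue. ?e \<xi> *\<^sub>R (g \<xi> * cis (c * \<xi>))) = dist_of g C + \<i> * dist_of g S"
    by (simp only: eq dist_of_def Bochner_Integration.integral_add[OF iC integrable_mult_right[OF iS]] integral_mult_right_zero)
  also have "\<dots> = of_real (2 * pi * (LINT x|lebesgue. N c x * f x))"
    unfolding dC dS by (simp add: algebra_simps)
  finally show ?thesis by (simp add: N_def)
qed

text \<open>Comparison with (1 + |x|)^(-2 \<alpha>), which has an explicit antiderivative on the
  half line, by way of (1 + |x|)^2 \<le> 2 (1 + x^2).\<close>

lemma integrable_japanese_bracket:
  fixes \<alpha> :: real
  assumes \<alpha>: "1 / 2 < \<alpha>"
  shows "integrable lborel (\<lambda>x::real. (1 + x\<^sup>2) powr (- \<alpha>))"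
proof -
  define h where "h x = (1 + \<bar>x\<bar>) powr (- 2 * \<alpha>)" for x :: real
  have [measurable]: "h \<in> borel_measurable borel" unfolding h_def[abs_def] by measurable
  have half: "(\<integral>\<^sup>+x. ennreal (h x) * indicator {0..} x \<partial>lborel) < \<infinity>"
  proof -
    let ?f = "\<lambda>x::real. (1 + x) powr (- 2 * \<alpha>)" and ?F = "\<lambda>x::real. (1 + x) powr (1 - 2 * \<alpha>) / (1 - 2 * \<alpha>)"
    have "(\<integral>\<^sup>+x. ennreal (?f x) * indicator {0..} x \<partial>lborel) = ennreal (0 - ?F 0)"
    proof (rule nn_integral_FTC_atLeast)
      fix x :: real assume "0 \<le> x"
      then have "((\<lambda>x. (1 + x) powr (1 - 2 * \<alpha>)) has_real_derivative (1 - 2 * \<alpha>) * (1 + x) powr (1 - 2 * \<alpha> - 1)) (at x)"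
        by (auto intro!: derivative_eq_intros)
      from DERIV_cdivide[OF this, of "1 - 2 * \<alpha>"]
      show "(?F has_real_derivative ?f x) (at x)"
        using \<alpha> by simp
    next
      have "((\<lambda>x::real. (1 + x) powr (1 - 2 * \<alpha>)) \<longlongrightarrow> 0) at_top"
        using \<alpha> by (intro tendsto_neg_powr filterlim_tendsto_add_at_top[OF tendsto_const] filterlim_ident) auto
      then show "(?F \<longlongrightarrow> 0) at_top" by (intro tendsto_divide_zero)
    qed auto
    moreover have "(\<integral>\<^sup>+x. ennreal (h x) * indicator {0..} x \<partial>lborel) = (\<integral>\<^sup>+x. ennreal (?f x) * indicator {0..} x \<partial>lborel)"
      by (intro nn_integral_cong) (auto simp: h_def indicator_def)
    ultimately show ?thesis by simp
  qed
  have "(\<integral>\<^sup>+x. ennreal (h x) \<partial>lborel) \<le> (\<integral>\<^sup>+x. ennreal (h x) * indicator {0..} x + ennreal (h (- x)) * indicator {0..} (- x) \<partial>lborel)"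
    by (intro nn_integral_mono) (auto simp: indicator_def h_def)
  also have "\<dots> = (\<integral>\<^sup>+x. ennreal (h x) * indicator {0..} x \<partial>lborel) + (\<integral>\<^sup>+x. ennreal (h (- x)) * indicator {0..} (- x) \<partial>lborel)"
    by (rule nn_integral_add) measurable
  also have "(\<integral>\<^sup>+x. ennreal (h (- x)) * indicator {0..} (- x) \<partial>lborel) = (\<integral>\<^sup>+x. ennreal (h x) * indicator {0..} x \<partial>lborel)"
    by (subst (2) nn_integral_real_affine[where c = "-1" and t = 0]) auto
  also have "\<dots> + \<dots> < \<infinity>" using half by simp
  finally have ih: "integrable lborel h" by (intro integrableI_bounded) (auto simp: h_def)
  show ?thesis
  proof (rule Bochner_Integration.integrable_bound[where f = "\<lambda>x. 2 powr \<alpha> * h x"])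
    show "AE x::real in lborel. norm ((1 + x\<^sup>2) powr (- \<alpha>)) \<le> norm (2 powr \<alpha> * h x)"
    proof (rule AE_I2)
      fix x :: real
      have "0 \<le> (1 - \<bar>x\<bar>)\<^sup>2" by simp
      then have 1: "(1 + \<bar>x\<bar>)\<^sup>2 / 2 \<le> 1 + x\<^sup>2" by (simp add: power2_eq_square algebra_simps)
      have "(1 + x\<^sup>2) powr (- \<alpha>) \<le> ((1 + \<bar>x\<bar>)\<^sup>2 / 2) powr (- \<alpha>)"
        using 1 \<alpha> by (intro powr_mono2') auto
      also have "\<dots> = 2 powr \<alpha> * ((1 + \<bar>x\<bar>)\<^sup>2) powr (- \<alpha>)"
        by (subst powr_divide) (auto simp: powr_minus divide_inverse mult.commute)
      also have "((1 + \<bar>x\<bar>)\<^sup>2) powr (- \<alpha>) = h x"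
      proof -
        have "(1 + \<bar>x\<bar>)\<^sup>2 = (1 + \<bar>x\<bar>) powr 2" by (simp add: powr_numeral)
        then show ?thesis unfolding h_def by (simp only: powr_powr) simp
      qed
      finally show "norm ((1 + x\<^sup>2) powr (- \<alpha>)) \<le> norm (2 powr \<alpha> * h x)" by (simp add: h_def)
    qed
    show "integrable lborel (\<lambda>x. 2 powr \<alpha> * h x)" using ih by (rule integrable_mult_right)
    show "(\<lambda>x::real. (1 + x\<^sup>2) powr (- \<alpha>)) \<in> borel_measurable lborel" by measurable
  qed
qed

text \<open>The inverse Fourier integral without the factor 1 / (2 pi). For the transform of a real
  function the whole integral is real, so taking the real part loses nothing and keeps derivatives
  and bounds real-valued.\<close>

definition fourier_int :: "(real \<Rightarrow> complex) \<Rightarrow> real \<Rightarrow> real" where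
  "fourier_int G c = (LINT \<xi>|lebesgue. Re (G \<xi> * cis (c * \<xi>)))"

lemma fourier_int_integrand:
  assumes G: "integrable lebesgue G"
  shows "integrable lebesgue (\<lambda>\<xi>. G \<xi> * cis (c * \<xi>))"
proof -
  have "(\<lambda>\<xi>::real. cis (c * \<xi>)) \<in> borel_measurable borel"
    by (intro borel_measurable_continuous_onI continuous_intros)
  then have m: "(\<lambda>\<xi>::real. cis (c * \<xi>)) \<in> borel_measurable lebesgue" by (intro measurable_completion) simp
  show ?thesis
  proof (rule Bochner_Integration.integrable_bound[OF G])
    show "AE \<xi> in lebesgue. norm (G \<xi> * cis (c * \<xi>)) \<le> norm (G \<xi>)" by (simp add: norm_mult)
    show "(\<lambda>\<xi>. G \<xi> * cis (c * \<xi>)) \<in> borel_measurable lebesgue"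
      by (rule borel_measurable_times[OF borel_measurable_integrable[OF G] m])
  qed
qed

lemma fourier_int_bound:
  assumes G: "integrable lebesgue G"
  shows "\<bar>fourier_int G c\<bar> \<le> (LINT \<xi>|lebesgue. norm (G \<xi>))"
proof -
  have "\<bar>fourier_int G c\<bar> \<le> (LINT \<xi>|lebesgue. norm (Re (G \<xi> * cis (c * \<xi>))))"
    unfolding fourier_int_def using integral_norm_bound[of lebesgue "\<lambda>\<xi>. Re (G \<xi> * cis (c * \<xi>))"] by simp
  also have "\<dots> \<le> (LINT \<xi>|lebesgue. norm (G \<xi>))"
    using G fourier_int_integrand[OF G, of c]
    by (intro integral_mono) (auto intro!: integrable_norm order_trans[OF abs_Re_le_cmod] simp: norm_mult simp del: times_complex.sel)
  finally show ?thesis .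
qed

lemma fourier_int_has_derivative:
  assumes G: "integrable lebesgue G" and G1: "integrable lebesgue (\<lambda>\<xi>. \<xi> *\<^sub>R G \<xi>)"
  shows "(fourier_int G has_real_derivative fourier_int (\<lambda>\<xi>. \<i> * of_real \<xi> * G \<xi>) c) (at c)"
  unfolding has_field_derivative_iff tendsto_at_iff_sequentially
proof (intro allI impI)
  fix X assume X: "\<forall>i. X i \<in> UNIV - {c}" "X \<longlonglongrightarrow> c"
  let ?r = "\<lambda>c \<xi>. Re (G \<xi> * cis (c * \<xi>))" and ?r' = "\<lambda>c \<xi>. Re (\<i> * of_real \<xi> * G \<xi> * cis (c * \<xi>))"
  have D: "((\<lambda>c. ?r c \<xi>) has_real_derivative ?r' c \<xi>) (at c)" for c \<xi>
    by (auto intro!: derivative_eq_intros simp: algebra_simps)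
  have ir: "integrable lebesgue (?r c)" for c by (rule integrable_Re[OF fourier_int_integrand[OF G]])
  have Lip: "\<bar>?r y \<xi> - ?r c \<xi>\<bar> \<le> norm (\<xi> *\<^sub>R G \<xi>) * \<bar>y - c\<bar>" for y \<xi>
  proof -
    have "norm (?r y \<xi> - ?r c \<xi>) \<le> norm (\<xi> *\<^sub>R G \<xi>) * norm (y - c)"
    proof (rule field_differentiable_bound[where S = UNIV])
      fix z
      have "norm (?r' z \<xi>) \<le> norm (\<i> * of_real \<xi> * G \<xi> * cis (z * \<xi>))" by (simp only: real_norm_def abs_Re_le_cmod)
      then show "norm (?r' z \<xi>) \<le> norm (\<xi> *\<^sub>R G \<xi>)" by (simp add: norm_mult)
    qed (use D in auto)
    then show ?thesis by simp
  qed
  have "(\<lambda>i. LINT \<xi>|lebesgue. (?r (X i) \<xi> - ?r c \<xi>) / (X i - c)) \<longlonglongrightarrow> (LINT \<xi>|lebesgue. ?r' c \<xi>)"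
  proof (rule integral_dominated_convergence[where w = "\<lambda>\<xi>. norm (\<xi> *\<^sub>R G \<xi>)"])
    have G2: "integrable lebesgue (\<lambda>\<xi>. \<i> * of_real \<xi> * G \<xi>)"
      using integrable_mult_right[OF G1, of \<i>] by (simp add: scaleR_conv_of_real mult.assoc)
    show "?r' c \<in> borel_measurable lebesgue"
      by (rule borel_measurable_integrable[OF integrable_Re[OF fourier_int_integrand[OF G2]]])
    show "(\<lambda>\<xi>. (?r (X i) \<xi> - ?r c \<xi>) / (X i - c)) \<in> borel_measurable lebesgue" for i
      by (intro borel_measurable_divide borel_measurable_diff borel_measurable_integrable[OF ir] borel_measurable_const)
    show "AE \<xi> in lebesgue. (\<lambda>i. (?r (X i) \<xi> - ?r c \<xi>) / (X i - c)) \<longlonglongrightarrow> ?r' c \<xi>"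
    proof (rule AE_I2)
      fix \<xi>
      have "((\<lambda>y. (?r y \<xi> - ?r c \<xi>) / (y - c)) \<longlongrightarrow> ?r' c \<xi>) (at c)" using D unfolding has_field_derivative_iff .
      then show "(\<lambda>i. (?r (X i) \<xi> - ?r c \<xi>) / (X i - c)) \<longlonglongrightarrow> ?r' c \<xi>"
        unfolding tendsto_at_iff_sequentially using X by (auto simp: o_def)
    qed
    show "AE \<xi> in lebesgue. norm ((?r (X i) \<xi> - ?r c \<xi>) / (X i - c)) \<le> norm (\<xi> *\<^sub>R G \<xi>)" for i
    proof (rule AE_I2)
      fix \<xi>
      have "X i \<noteq> c" using X by auto
      then show "norm ((?r (X i) \<xi> - ?r c \<xi>) / (X i - c)) \<le> norm (\<xi> *\<^sub>R G \<xi>)"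
        using Lip[where y = "X i" and \<xi> = \<xi>] by (simp add: pos_divide_le_eq abs_divide del: times_complex.sel)
    qed
  qed (use integrable_norm[OF G1] in simp)
  moreover have "(LINT \<xi>|lebesgue. (?r (X i) \<xi> - ?r c \<xi>) / (X i - c)) = (fourier_int G (X i) - fourier_int G c) / (X i - c)" for i
    unfolding fourier_int_def using ir[of "X i"] ir[of c] by (simp only: integral_divide_zero Bochner_Integration.integral_diff)
  ultimately show "((\<lambda>y. (fourier_int G y - fourier_int G c) / (y - c)) \<circ> X) \<longlonglongrightarrow> fourier_int (\<lambda>\<xi>. \<i> * of_real \<xi> * G \<xi>) c"
    by (simp only: o_def fourier_int_def)
qed

text \<open>Interpolation between the Lipschitz bound |a - b| for close arguments and the trivial
  bound 2 for distant ones.\<close>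

lemma cis_holder:
  assumes "0 < \<gamma>" "\<gamma> \<le> 1"
  shows "norm (cis a - cis b) \<le> 2 * \<bar>a - b\<bar> powr \<gamma>"
proof (cases "\<bar>a - b\<bar> \<le> 1")
  case True
  have "norm (cis a - cis b) = norm (cis b * (cis (a - b) - 1))" by (simp add: algebra_simps cis_mult)
  also have "\<dots> = norm (exp (\<i> * of_real (a - b)) - 1)" by (simp add: norm_mult cis_conv_exp)
  also have "\<dots> \<le> \<bar>a - b\<bar>"
    using iexp_approx1[of "a - b" 0] by simp
  also have "\<dots> \<le> \<bar>a - b\<bar> powr \<gamma>"
    using True assms powr_mono'[of \<gamma> 1 "\<bar>a - b\<bar>"] by (cases "a = b") auto
  also have "\<dots> \<le> 2 * \<bar>a - b\<bar> powr \<gamma>" by simp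
  finally show ?thesis .
next
  case False
  have "norm (cis a - cis b) \<le> 1 + 1" using norm_triangle_ineq4[of "cis a" "cis b"] by simp
  also have "\<dots> \<le> 2 * \<bar>a - b\<bar> powr \<gamma>" using False assms ge_one_powr_ge_zero[of "\<bar>a - b\<bar>" \<gamma>] by simp
  finally show ?thesis .
qed

lemma fourier_int_holder:
  assumes G: "integrable lebesgue G" and \<gamma>: "0 < \<gamma>" "\<gamma> \<le> 1"
    and Gg: "integrable lebesgue (\<lambda>\<xi>. \<bar>\<xi>\<bar> powr \<gamma> * norm (G \<xi>))"
  shows "\<bar>fourier_int G (c + h) - fourier_int G c\<bar> \<le> 2 * (LINT \<xi>|lebesgue. \<bar>\<xi>\<bar> powr \<gamma> * norm (G \<xi>)) * \<bar>h\<bar> powr \<gamma>"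
proof -
  have ir: "integrable lebesgue (\<lambda>\<xi>. Re (G \<xi> * cis (c * \<xi>)))" for c by (rule integrable_Re[OF fourier_int_integrand[OF G]])
  have "\<bar>fourier_int G (c + h) - fourier_int G c\<bar> \<le> (LINT \<xi>|lebesgue. \<bar>Re (G \<xi> * cis ((c + h) * \<xi>)) - Re (G \<xi> * cis (c * \<xi>))\<bar>)"
    unfolding fourier_int_def
    unfolding Bochner_Integration.integral_diff[OF ir ir, symmetric]
    using integral_norm_bound[of lebesgue "\<lambda>\<xi>. Re (G \<xi> * cis ((c + h) * \<xi>)) - Re (G \<xi> * cis (c * \<xi>))"] by simp
  also have "\<dots> \<le> (LINT \<xi>|lebesgue. (2 * \<bar>h\<bar> powr \<gamma>) * (\<bar>\<xi>\<bar> powr \<gamma> * norm (G \<xi>)))"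
  proof (rule integral_mono)
    show "integrable lebesgue (\<lambda>\<xi>. \<bar>Re (G \<xi> * cis ((c + h) * \<xi>)) - Re (G \<xi> * cis (c * \<xi>))\<bar>)"
      by (intro integrable_abs Bochner_Integration.integrable_diff ir)
    show "integrable lebesgue (\<lambda>\<xi>. (2 * \<bar>h\<bar> powr \<gamma>) * (\<bar>\<xi>\<bar> powr \<gamma> * norm (G \<xi>)))"
      by (intro integrable_mult_right Gg)
    fix \<xi>
    have "\<bar>Re (G \<xi> * cis ((c + h) * \<xi>)) - Re (G \<xi> * cis (c * \<xi>))\<bar> = \<bar>Re (G \<xi> * (cis ((c + h) * \<xi>) - cis (c * \<xi>)))\<bar>"
      by (simp only: right_diff_distrib minus_complex.sel)
    also have "\<dots> \<le> norm (G \<xi>) * norm (cis ((c + h) * \<xi>) - cis (c * \<xi>))"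
      using abs_Re_le_cmod[of "G \<xi> * (cis ((c + h) * \<xi>) - cis (c * \<xi>))"] by (simp only: norm_mult)
    also have "\<dots> \<le> norm (G \<xi>) * (2 * \<bar>(c + h) * \<xi> - c * \<xi>\<bar> powr \<gamma>)"
      by (intro mult_left_mono cis_holder \<gamma>) auto
    also have "\<bar>(c + h) * \<xi> - c * \<xi>\<bar> powr \<gamma> = \<bar>h\<bar> powr \<gamma> * \<bar>\<xi>\<bar> powr \<gamma>"
      by (simp add: algebra_simps abs_mult powr_mult)
    finally show "\<bar>Re (G \<xi> * cis ((c + h) * \<xi>)) - Re (G \<xi> * cis (c * \<xi>))\<bar> \<le> (2 * \<bar>h\<bar> powr \<gamma>) * (\<bar>\<xi>\<bar> powr \<gamma> * norm (G \<xi>))"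
      by (simp add: mult_ac)
  qed
  also have "\<dots> = 2 * (LINT \<xi>|lebesgue. \<bar>\<xi>\<bar> powr \<gamma> * norm (G \<xi>)) * \<bar>h\<bar> powr \<gamma>" by simp
  finally show ?thesis .
qed

text \<open>Cauchy-Schwarz: the Bessel weight of order \<open>s\<close> makes the transform square
  integrable, and the leftover factor of order \<open>\<beta> - s\<close> is square integrable
  exactly because \<open>s - \<beta>\<close> exceeds 1/2.\<close>

lemma Hs_norm_weighted_L1:
  assumes fg: "has_fourier f g0" and fin: "Hs_norm s f < \<infinity>" and \<beta>: "\<beta> < s - 1 / 2"
  shows "integrable lebesgue (\<lambda>\<xi>. (1 + \<xi>\<^sup>2) powr (\<beta> / 2) * norm (fourier f \<xi>))"
    and "(LINT \<xi>|lebesgue. (1 + \<xi>\<^sup>2) powr (\<beta> / 2) * norm (fourier f \<xi>))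
      \<le> sqrt (LINT \<xi>|lborel. (1 + \<xi>\<^sup>2) powr (\<beta> - s)) * enn2real (Hs_norm s f)"
proof -
  define g where "g = fourier f"
  have "has_fourier f g" unfolding g_def fourier_def using fg by (rule someI[where P = "has_fourier f"])
  then have gm: "g \<in> borel_measurable lebesgue" by (simp add: has_fourier_def tempered_fun_def)
  define q where "q \<xi> = (1 + \<xi>\<^sup>2) powr (s / 2) * norm (g \<xi>)" for \<xi> :: real
  define w where "w \<xi> = (1 + \<xi>\<^sup>2) powr ((\<beta> - s) / 2)" for \<xi> :: real
  have pos: "0 < 1 + \<xi>\<^sup>2" for \<xi> :: real by (simp add: add_pos_nonneg)
  have pm: "(\<lambda>\<xi>::real. (1 + \<xi>\<^sup>2) powr r) \<in> borel_measurable lebesgue" for r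
    by (rule measurable_completion) simp
  have qm: "q \<in> borel_measurable lebesgue"
    unfolding q_def using pm gm by (intro borel_measurable_times measurable_compose[OF gm borel_measurable_norm])
  have nb: "norm (bessel_fourier s f \<xi>) = q \<xi>" for \<xi> by (simp add: bessel_fourier_def q_def g_def)
  have H: "Hs_norm s f = (if integrable lebesgue (\<lambda>\<xi>. q \<xi> powr 2) then ennreal ((LINT \<xi>|lebesgue. q \<xi> powr 2) powr (1 / 2)) else \<infinity>)"
    unfolding Hs_norm_def Lp_norm_def nb by simp
  then have qi: "integrable lebesgue (\<lambda>\<xi>. q \<xi> powr 2)" using fin by (auto split: if_splits)
  have q0: "\<bar>q \<xi>\<bar> = q \<xi>" for \<xi> by (simp add: q_def)
  have w0: "\<bar>w \<xi>\<bar> = w \<xi>" for \<xi> by (simp add: w_def)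
  have H': "wnorm lebesgue 2 q = enn2real (Hs_norm s f)"
    using H qi unfolding wnorm_def q0 by simp
  have w2: "w \<xi> powr 2 = (1 + \<xi>\<^sup>2) powr (- (s - \<beta>))" for \<xi>
  proof -
    have "(\<beta> - s) / 2 * 2 = - (s - \<beta>)" by simp
    then show ?thesis unfolding w_def powr_powr by (simp only:)
  qed
  have jb: "integrable lborel (\<lambda>\<xi>::real. (1 + \<xi>\<^sup>2) powr (- (s - \<beta>)))"
    using \<beta> by (intro integrable_japanese_bracket) simp
  then have wi: "integrable lebesgue (\<lambda>\<xi>. \<bar>w \<xi>\<bar> powr 2)" unfolding w0 w2 by (subst integrable_completion) auto
  have W: "wnorm lebesgue 2 w = sqrt (LINT \<xi>|lborel. (1 + \<xi>\<^sup>2) powr (\<beta> - s))"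
    unfolding wnorm_def w0 w2 using jb by (subst integral_completion) (auto simp: powr_half_sqrt)
  have eq: "(1 + \<xi>\<^sup>2) powr (\<beta> / 2) * norm (fourier f \<xi>) = \<bar>q \<xi>\<bar> powr (2 - 1) * \<bar>w \<xi>\<bar>" for \<xi>
  proof -
    have "(1 + \<xi>\<^sup>2) powr (\<beta> / 2) = (1 + \<xi>\<^sup>2) powr (s / 2) * (1 + \<xi>\<^sup>2) powr ((\<beta> - s) / 2)"
      by (simp add: powr_add[symmetric] field_simps)
    then show ?thesis unfolding q0 w0 by (simp add: q_def w_def g_def)
  qed
  have wm: "w \<in> borel_measurable lebesgue" unfolding w_def by (rule pm)
  have qi': "integrable lebesgue (\<lambda>\<xi>. \<bar>q \<xi>\<bar> powr 2)" unfolding q0 by (rule qi)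
  note h = holder_wnorm[OF _ qm wm qi' wi]
  show "integrable lebesgue (\<lambda>\<xi>. (1 + \<xi>\<^sup>2) powr (\<beta> / 2) * norm (fourier f \<xi>))"
    unfolding eq by (rule h(1)) simp
  have "(LINT \<xi>|lebesgue. (1 + \<xi>\<^sup>2) powr (\<beta> / 2) * norm (fourier f \<xi>)) \<le> wnorm lebesgue 2 q powr (2 - 1) * wnorm lebesgue 2 w"
    unfolding eq by (rule h(2)) simp
  also have "\<dots> = sqrt (LINT \<xi>|lborel. (1 + \<xi>\<^sup>2) powr (\<beta> - s)) * enn2real (Hs_norm s f)"
    unfolding H'[symmetric] W using wnorm_nonneg[of lebesgue 2 q] by simp
  finally show "(LINT \<xi>|lebesgue. (1 + \<xi>\<^sup>2) powr (\<beta> / 2) * norm (fourier f \<xi>))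
      \<le> sqrt (LINT \<xi>|lborel. (1 + \<xi>\<^sup>2) powr (\<beta> - s)) * enn2real (Hs_norm s f)" .
qed

text \<open>By \<open>has_fourier_gauss\<close> the Gaussian averages of \<open>f\<close> are
  inverse Fourier integrals damped by a Gaussian. As \<open>g\<close> is integrable, dominated
  convergence removes the damping, and the averages determine \<open>f\<close> almost
  everywhere.\<close>

lemma fourier_inversion_AE:
  assumes fg: "has_fourier f g" and gi: "integrable lebesgue g"
    and cont: "continuous_on UNIV (fourier_int g)"
  shows "AE x in lebesgue. f x = fourier_int g x / (2 * pi)"
proof -
  have fm: "f \<in> borel_measurable lebesgue" using fg by (simp add: has_fourier_def tempered_fun_def)
  obtain d where d: "d \<in> borel_measurable borel" "AE x in lebesgue. f x = d x" using borel_version_lebesgue[OF fm] .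
  have dn: "integrable lborel (\<lambda>x. normal_density c \<sigma> x * d x)"
     "(LINT x|lborel. normal_density c \<sigma> x * d x)
      = fourier_int (\<lambda>\<xi>. exp (- (\<sigma>\<^sup>2 * \<xi>\<^sup>2 / 2)) *\<^sub>R g \<xi>) c / (2 * pi)" if \<sigma>: "0 < \<sigma>" for c \<sigma>
  proof -
    note nd = dist_of_borel_version[OF fm d schwartz_normal_density[OF \<sigma>, of c]]
    show "integrable lborel (\<lambda>x. normal_density c \<sigma> x * d x)"
      using fg nd(1) schwartz_normal_density[OF \<sigma>] by (auto simp: has_fourier_def tempered_fun_def)
    let ?G = "\<lambda>\<xi>. exp (- (\<sigma>\<^sup>2 * \<xi>\<^sup>2 / 2)) *\<^sub>R g \<xi>"
    have m: "(\<lambda>\<xi>. exp (- (\<sigma>\<^sup>2 * \<xi>\<^sup>2 / 2))) \<in> borel_measurable lebesgue" by (rule measurable_completion) simp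
    have iG: "integrable lebesgue ?G"
    proof (rule Bochner_Integration.integrable_bound[OF gi])
      show "?G \<in> borel_measurable lebesgue" by (rule borel_measurable_scaleR[OF m borel_measurable_integrable[OF gi]])
      show "AE \<xi> in lebesgue. norm (?G \<xi>) \<le> norm (g \<xi>)" by (simp add: mult_left_le_one_le)
    qed
    have "fourier_int ?G c = Re (LINT \<xi>|lebesgue. ?G \<xi> * cis (c * \<xi>))"
      unfolding fourier_int_def by (rule integral_Re[OF fourier_int_integrand[OF iG]])
    also have "(LINT \<xi>|lebesgue. ?G \<xi> * cis (c * \<xi>)) = (LINT \<xi>|lebesgue. exp (- (\<sigma>\<^sup>2 * \<xi>\<^sup>2 / 2)) *\<^sub>R (g \<xi> * cis (c * \<xi>)))"
      by simp
    also have "\<dots> = of_real (2 * pi * (LINT x|lebesgue. normal_density c \<sigma> x * f x))" by (rule has_fourier_gauss[OF fg \<sigma>])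
    also have "(LINT x|lebesgue. normal_density c \<sigma> x * f x) = (LINT x|lborel. normal_density c \<sigma> x * d x)"
      using nd(2) by (simp add: dist_of_def)
    finally show "(LINT x|lborel. normal_density c \<sigma> x * d x) = fourier_int ?G c / (2 * pi)" by simp
  qed
  have bd: "\<bar>Re ((exp (- (\<sigma>\<^sup>2 * \<xi>\<^sup>2 / 2)) *\<^sub>R g \<xi>) * cis (c * \<xi>))\<bar> \<le> norm (g \<xi>)" for \<sigma> \<xi> c
  proof -
    have "\<bar>Re ((exp (- (\<sigma>\<^sup>2 * \<xi>\<^sup>2 / 2)) *\<^sub>R g \<xi>) * cis (c * \<xi>))\<bar> \<le> norm ((exp (- (\<sigma>\<^sup>2 * \<xi>\<^sup>2 / 2)) *\<^sub>R g \<xi>) * cis (c * \<xi>))"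
      by (rule abs_Re_le_cmod)
    also have "\<dots> \<le> norm (g \<xi>)" by (simp add: norm_mult mult_left_le_one_le)
    finally show ?thesis .
  qed
  have mm: "(\<lambda>\<xi>. Re ((exp (- (\<sigma>\<^sup>2 * \<xi>\<^sup>2 / 2)) *\<^sub>R g \<xi>) * cis (c * \<xi>))) \<in> borel_measurable lebesgue" for \<sigma> c
  proof -
    have "(\<lambda>\<xi>. exp (- (\<sigma>\<^sup>2 * \<xi>\<^sup>2 / 2))) \<in> borel_measurable lebesgue" by (rule measurable_completion) simp
    then have "(\<lambda>\<xi>. exp (- (\<sigma>\<^sup>2 * \<xi>\<^sup>2 / 2)) * Re (g \<xi> * cis (c * \<xi>))) \<in> borel_measurable lebesgue"
      by (intro borel_measurable_times borel_measurable_integrable[OF integrable_Re[OF fourier_int_integrand[OF gi]]])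
    moreover have "Re ((exp (- (\<sigma>\<^sup>2 * \<xi>\<^sup>2 / 2)) *\<^sub>R g \<xi>) * cis (c * \<xi>)) = exp (- (\<sigma>\<^sup>2 * \<xi>\<^sup>2 / 2)) * Re (g \<xi> * cis (c * \<xi>))" for \<xi>
      by (simp add: algebra_simps)
    ultimately show ?thesis by (simp only:)
  qed
  have "AE x in lborel. d x = fourier_int g x / (2 * pi)"
  proof (rule mollifier_limit_AE)
    show "(\<lambda>x. fourier_int g x / (2 * pi)) \<in> borel_measurable borel"
      using borel_measurable_continuous_onI[OF cont] by simp
    show "integrable lborel (\<lambda>x. normal_density 0 2 x * d x)" by (rule dn) simp
    show "(\<lambda>n. LINT x|lborel. normal_density c (1 / real (Suc n)) x * d x) \<longlonglongrightarrow> fourier_int g c / (2 * pi)" for c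
    proof -
      have "(\<lambda>n. fourier_int (\<lambda>\<xi>. exp (- ((1 / real (Suc n))\<^sup>2 * \<xi>\<^sup>2 / 2)) *\<^sub>R g \<xi>) c) \<longlonglongrightarrow> fourier_int g c"
        unfolding fourier_int_def
      proof (rule integral_dominated_convergence[OF _ mm])
        show "(\<lambda>\<xi>. Re (g \<xi> * cis (c * \<xi>))) \<in> borel_measurable lebesgue"
          by (rule borel_measurable_integrable[OF integrable_Re[OF fourier_int_integrand[OF gi]]])
        show "integrable lebesgue (\<lambda>\<xi>. norm (g \<xi>))" by (rule integrable_norm[OF gi])
        show "AE \<xi> in lebesgue. (\<lambda>n. Re ((exp (- ((1 / real (Suc n))\<^sup>2 * \<xi>\<^sup>2 / 2)) *\<^sub>R g \<xi>) * cis (c * \<xi>))) \<longlonglongrightarrow> Re (g \<xi> * cis (c * \<xi>))"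
        proof (rule AE_I2)
          fix \<xi>
          have "(\<lambda>n. 1 / real (Suc n)) \<longlonglongrightarrow> 0" by (rule lim_inverse_n'[THEN LIMSEQ_Suc])
          then have "(\<lambda>n. exp (- ((1 / real (Suc n))\<^sup>2 * \<xi>\<^sup>2 / 2)) * Re (g \<xi> * cis (c * \<xi>))) \<longlonglongrightarrow> exp (- (0\<^sup>2 * \<xi>\<^sup>2 / 2)) * Re (g \<xi> * cis (c * \<xi>))"
            by (intro tendsto_intros) auto
          moreover have "Re ((exp (- (\<sigma>\<^sup>2 * \<xi>\<^sup>2 / 2)) *\<^sub>R g \<xi>) * cis (c * \<xi>)) = exp (- (\<sigma>\<^sup>2 * \<xi>\<^sup>2 / 2)) * Re (g \<xi> * cis (c * \<xi>))" for \<sigma>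
            by (simp add: algebra_simps)
          ultimately show "(\<lambda>n. Re ((exp (- ((1 / real (Suc n))\<^sup>2 * \<xi>\<^sup>2 / 2)) *\<^sub>R g \<xi>) * cis (c * \<xi>))) \<longlonglongrightarrow> Re (g \<xi> * cis (c * \<xi>))"
            by simp
        qed
        show "AE \<xi> in lebesgue. norm (Re ((exp (- ((1 / real (Suc n))\<^sup>2 * \<xi>\<^sup>2 / 2)) *\<^sub>R g \<xi>) * cis (c * \<xi>))) \<le> norm (g \<xi>)" for n
          unfolding real_norm_def by (rule AE_I2) (rule bd)
      qed
      then show ?thesis by (subst dn(2)) (auto intro!: tendsto_divide)
    qed
    show "\<exists>B. \<forall>n. \<forall>c\<in>{a..b}. \<bar>LINT x|lborel. normal_density c (1 / real (Suc n)) x * d x\<bar> \<le> B" for a b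
    proof (intro exI allI ballI)
      fix n c
      let ?G = "\<lambda>\<xi>. exp (- ((1 / real (Suc n))\<^sup>2 * \<xi>\<^sup>2 / 2)) *\<^sub>R g \<xi>"
      have "norm (LINT \<xi>|lebesgue. Re (?G \<xi> * cis (c * \<xi>))) \<le> (LINT \<xi>|lebesgue. norm (Re (?G \<xi> * cis (c * \<xi>))))"
        by (rule integral_norm_bound)
      also have "\<dots> \<le> (LINT \<xi>|lebesgue. norm (g \<xi>))"
      proof (rule integral_mono)
        show "integrable lebesgue (\<lambda>\<xi>. norm (Re (?G \<xi> * cis (c * \<xi>))))"
          by (rule Bochner_Integration.integrable_bound[OF integrable_norm[OF gi] measurable_compose[OF mm borel_measurable_norm]])
            (rule AE_I2, simp only: real_norm_def abs_abs abs_norm_cancel bd)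
        show "norm (Re (?G \<xi> * cis (c * \<xi>))) \<le> norm (g \<xi>)" for \<xi> unfolding real_norm_def by (rule bd)
      qed (rule integrable_norm[OF gi])
      finally have "\<bar>fourier_int ?G c\<bar> \<le> (LINT \<xi>|lebesgue. norm (g \<xi>))" by (simp only: fourier_int_def real_norm_def)
      then show "\<bar>LINT x|lborel. normal_density c (1 / real (Suc n)) x * d x\<bar> \<le> (LINT \<xi>|lebesgue. norm (g \<xi>)) / (2 * pi)"
        by (subst dn(2)) (auto simp: divide_right_mono abs_divide)
    qed
  qed (use d in simp)
  then have "AE x in lebesgue. d x = fourier_int g x / (2 * pi)" by (rule AE_completion)
  with d(2) show ?thesis by eventually_elim simp
qed

text \<open>The derivatives are inverse Fourier integrals of
  \<open>(\<i> * of_real \<xi>) ^ j\<close> times the transform. The constants are fixed before the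
  function, because the embedding will be applied to increments and difference quotients in time and
  must turn their small norms into small sup norms.\<close>

lemma sobolev_embedding:
  assumes k: "1 \<le> k" and s: "real k + 1 / 2 < s"
  shows "\<exists>K \<gamma>. 0 < \<gamma> \<and> 0 \<le> K \<and> (\<forall>f g0. has_fourier f g0 \<longrightarrow> Hs_norm s f < \<infinity> \<longrightarrow>
    (\<exists>F :: nat \<Rightarrow> real \<Rightarrow> real. (AE x in lebesgue. f x = F 0 x) \<and>
      (\<forall>j<k. \<forall>x. (F j has_real_derivative F (Suc j) x) (at x)) \<and>
      (\<forall>j\<le>k. \<forall>x. \<bar>F j x\<bar> \<le> K * enn2real (Hs_norm s f)) \<and>
      (\<forall>x h. \<bar>F k (x + h) - F k x\<bar> \<le> K * enn2real (Hs_norm s f) * \<bar>h\<bar> powr \<gamma>)))"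
proof -
  \<comment> \<open>Half of the room above \<open>k + 1/2\<close>, so that
    \<open>\<beta> = k + \<gamma>\<close> stays below \<open>s - 1/2\<close>; the cap 1 is the
    largest exponent \<open>cis_holder\<close> permits.\<close>
  define \<gamma> where "\<gamma> = min 1 ((s - real k - 1 / 2) / 2)"
  define \<beta> where "\<beta> = real k + \<gamma>"
  define K where "K = sqrt (LINT \<xi>|lborel. (1 + \<xi>\<^sup>2) powr (\<beta> - s))"
  have \<gamma>: "0 < \<gamma>" "\<gamma> \<le> 1" using s by (auto simp: \<gamma>_def)
  have \<beta>: "\<beta> < s - 1 / 2" using s unfolding \<beta>_def \<gamma>_def by (auto simp: min_def field_simps)
  have K0: "0 \<le> K" by (simp add: K_def)
  have main: "\<exists>F :: nat \<Rightarrow> real \<Rightarrow> real. (AE x in lebesgue. f x = F 0 x) \<and>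
      (\<forall>j<k. \<forall>x. (F j has_real_derivative F (Suc j) x) (at x)) \<and>
      (\<forall>j\<le>k. \<forall>x. \<bar>F j x\<bar> \<le> K * enn2real (Hs_norm s f)) \<and>
      (\<forall>x h. \<bar>F k (x + h) - F k x\<bar> \<le> K * enn2real (Hs_norm s f) * \<bar>h\<bar> powr \<gamma>)"
    if fg: "has_fourier f g0" and fin: "Hs_norm s f < \<infinity>" for f g0
  proof -
    define g where "g = fourier f"
    have hg: "has_fourier f g" unfolding g_def fourier_def using fg by (rule someI[where P = "has_fourier f"])
    then have gm: "g \<in> borel_measurable lebesgue" by (simp add: has_fourier_def tempered_fun_def)
    note w = Hs_norm_weighted_L1[OF fg fin \<beta>, folded g_def K_def]
    let ?H = "K * enn2real (Hs_norm s f)"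
    let ?I = "LINT \<xi>|lebesgue. (1 + \<xi>\<^sup>2) powr (\<beta> / 2) * norm (g \<xi>)"
    define G where "G j \<xi> = (\<i> * of_real \<xi>) ^ j * g \<xi>" for j \<xi>
    define F where "F j c = fourier_int (G j) c / (2 * pi)" for j c
    have pw: "\<bar>\<xi>\<bar> powr a \<le> (1 + \<xi>\<^sup>2) powr (\<beta> / 2)" if "0 \<le> a" "a \<le> \<beta>" for \<xi> a :: real
    proof (cases "\<xi> = 0")
      case False
      have "\<bar>\<xi>\<bar> powr a = (\<xi>\<^sup>2) powr (a / 2)"
      proof -
        have "\<xi>\<^sup>2 = \<bar>\<xi>\<bar> powr 2" using False by (simp add: powr_numeral)
        then show ?thesis by (simp only: powr_powr) simp
      qed
      also have "\<dots> \<le> (1 + \<xi>\<^sup>2) powr (a / 2)" using that by (intro powr_mono2) auto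
      also have "\<dots> \<le> (1 + \<xi>\<^sup>2) powr (\<beta> / 2)" using that by (intro powr_mono) auto
      finally show ?thesis .
    qed auto
    have \<xi>m: "(\<lambda>\<xi>::real. complex_of_real \<xi>) \<in> borel_measurable lebesgue" by (rule measurable_completion) simp
    have Gm: "G j \<in> borel_measurable lebesgue" for j
      unfolding G_def by (intro borel_measurable_times borel_measurable_power borel_measurable_const \<xi>m gm)
    have Gn: "norm (G j \<xi>) \<le> (1 + \<xi>\<^sup>2) powr (\<beta> / 2) * norm (g \<xi>)" if "j \<le> k" for j \<xi>
    proof -
      have "\<bar>\<xi>\<bar> ^ j \<le> (1 + \<xi>\<^sup>2) powr (\<beta> / 2)"
      proof (cases "\<xi> = 0")
        case True
        then show ?thesis by (cases j) auto
      next
        case False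
        have "real j \<le> \<beta>" using that \<gamma> by (simp add: \<beta>_def)
        then show ?thesis using pw[of "real j" \<xi>] False by (simp add: powr_realpow)
      qed
      then show ?thesis by (simp add: G_def norm_mult norm_power mult_right_mono)
    qed
    have Gi: "integrable lebesgue (G j)" if "j \<le> k" for j
      by (rule Bochner_Integration.integrable_bound[OF w(1) Gm]) (use Gn[OF that] in \<open>auto simp: abs_mult\<close>)
    have Gb: "(LINT \<xi>|lebesgue. norm (G j \<xi>)) \<le> ?H" if "j \<le> k" for j
      by (rule order_trans[OF integral_mono[OF integrable_norm[OF Gi[OF that]] w(1) Gn[OF that]] w(2)])
    have Gs: "(\<lambda>\<xi>. \<i> * of_real \<xi> * G j \<xi>) = G (Suc j)" for j by (auto simp: G_def)
    have F1: "(F j has_real_derivative F (Suc j) x) (at x)" if "j < k" for j x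
    proof -
      have "norm (\<xi> *\<^sub>R G j \<xi>) = norm (G (Suc j) \<xi>)" for \<xi> by (simp add: G_def norm_mult)
      moreover have "(\<lambda>\<xi>::real. \<xi>) \<in> borel_measurable lebesgue" by (rule measurable_completion) simp
      ultimately have i: "integrable lebesgue (\<lambda>\<xi>. \<xi> *\<^sub>R G j \<xi>)"
        using that Gm[of j]
        by (intro Bochner_Integration.integrable_bound[OF Gi[of "Suc j"]] borel_measurable_scaleR) auto
      have "(fourier_int (G j) has_real_derivative fourier_int (G (Suc j)) x) (at x)"
        using fourier_int_has_derivative[OF Gi i, unfolded Gs] that by simp
      from DERIV_cdivide[OF this, of "2 * pi"] show ?thesis unfolding F_def .
    qed
    \<comment> \<open>The normalisation 1 / (2 pi) absorbs both the constant 1 of the sup bounds and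
      the factor 2 of the Hoelder bound, so \<open>K\<close> serves for all of them.\<close>
    have pi1: "1 \<le> 2 * pi" "2 \<le> 2 * pi" using pi_gt3 by auto
    have F2: "\<bar>F j x\<bar> \<le> ?H" if "j \<le> k" for j x
    proof -
      have "\<bar>fourier_int (G j) x\<bar> \<le> ?H" using fourier_int_bound[OF Gi[OF that], of x] Gb[OF that] by simp
      also have "\<dots> \<le> ?H * (2 * pi)" using pi1 K0 mult_left_mono[of 1 "2 * pi" ?H] by simp
      finally show ?thesis unfolding F_def abs_divide using pi_gt_zero by (simp add: pos_divide_le_eq)
    qed
    have Hn: "\<bar>\<xi>\<bar> powr \<gamma> * norm (G k \<xi>) \<le> (1 + \<xi>\<^sup>2) powr (\<beta> / 2) * norm (g \<xi>)" for \<xi>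
    proof -
      have "\<bar>\<xi>\<bar> powr \<gamma> * \<bar>\<xi>\<bar> ^ k = \<bar>\<xi>\<bar> powr \<beta>"
        using \<gamma> k by (cases "\<xi> = 0") (auto simp: \<beta>_def powr_add powr_realpow)
      moreover have "0 \<le> \<beta>" using \<gamma> by (simp add: \<beta>_def)
      ultimately have "\<bar>\<xi>\<bar> powr \<gamma> * \<bar>\<xi>\<bar> ^ k \<le> (1 + \<xi>\<^sup>2) powr (\<beta> / 2)" using pw[of \<beta> \<xi>] by simp
      from mult_right_mono[OF this norm_ge_zero[of "g \<xi>"]]
      show ?thesis by (simp add: G_def norm_mult norm_power mult.assoc)
    qed
    have am: "(\<lambda>\<xi>::real. \<bar>\<xi>\<bar> powr \<gamma>) \<in> borel_measurable lebesgue" by (rule measurable_completion) simp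
    have Hi: "integrable lebesgue (\<lambda>\<xi>. \<bar>\<xi>\<bar> powr \<gamma> * norm (G k \<xi>))"
    proof (rule Bochner_Integration.integrable_bound[OF w(1)])
      show "(\<lambda>\<xi>. \<bar>\<xi>\<bar> powr \<gamma> * norm (G k \<xi>)) \<in> borel_measurable lebesgue"
        by (intro borel_measurable_times am measurable_compose[OF Gm borel_measurable_norm])
      show "AE \<xi> in lebesgue. norm (\<bar>\<xi>\<bar> powr \<gamma> * norm (G k \<xi>)) \<le> norm ((1 + \<xi>\<^sup>2) powr (\<beta> / 2) * norm (g \<xi>))"
        using Hn by simp
    qed
    have F3: "\<bar>F k (x + h) - F k x\<bar> \<le> ?H * \<bar>h\<bar> powr \<gamma>" for x h
    proof -
      have "(LINT \<xi>|lebesgue. \<bar>\<xi>\<bar> powr \<gamma> * norm (G k \<xi>)) \<le> ?H"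
        by (rule order_trans[OF integral_mono[OF Hi w(1) Hn] w(2)])
      then have "2 * (LINT \<xi>|lebesgue. \<bar>\<xi>\<bar> powr \<gamma> * norm (G k \<xi>)) * \<bar>h\<bar> powr \<gamma> \<le> 2 * ?H * \<bar>h\<bar> powr \<gamma>"
        by (intro mult_right_mono) auto
      also have "\<dots> \<le> (2 * pi) * ?H * \<bar>h\<bar> powr \<gamma>" using pi1 K0 by (intro mult_right_mono) auto
      finally have "\<bar>fourier_int (G k) (x + h) - fourier_int (G k) x\<bar> \<le> (2 * pi) * ?H * \<bar>h\<bar> powr \<gamma>"
        using fourier_int_holder[OF Gi[OF order_refl] \<gamma> Hi, of x h] by linarith
      then show ?thesis
        unfolding F_def diff_divide_distrib[symmetric] abs_divide using pi_gt_zero by (simp add: pos_divide_le_eq mult_ac)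
    qed
    have G0: "G 0 = g" by (auto simp: G_def)
    have "continuous_on UNIV (F 0)"
      using F1[of 0] k by (meson DERIV_isCont continuous_at_imp_continuous_on le_eq_less_or_eq less_numeral_extra(1) order_less_le_trans)
    then have "continuous_on UNIV (\<lambda>x. (2 * pi) * F 0 x)" by (intro continuous_intros)
    then have "continuous_on UNIV (fourier_int g)" by (simp add: F_def G0 pi_neq_zero)
    then have "AE x in lebesgue. f x = F 0 x"
      using fourier_inversion_AE[OF hg Gi[of 0, unfolded G0]] by (simp add: F_def G0)
    then show ?thesis using F1 F2 F3 by (intro exI[of _ F]) blast
  qed
  show ?thesis
    by (rule exI[of _ K], rule exI[of _ \<gamma>]) (use \<gamma> K0 main in blast)
qed

section \<open>The equation in integral form\<close>

lemma normal_density_approximate_identity: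
  fixes V :: "real \<Rightarrow> real"
  assumes V: "continuous_on UNIV V" "\<And>x. \<bar>V x\<bar> \<le> B"
  shows "(\<lambda>n. LINT x|lborel. normal_density c (1 / real (Suc n)) x * V x) \<longlonglongrightarrow> V c"
proof -
  have [measurable]: "V \<in> borel_measurable borel" by (rule borel_measurable_continuous_onI[OF V(1)])
  define h where "h n = 1 / real (Suc n)" for n
  have h0: "0 < h n" for n by (simp add: h_def)
  have hlim: "h \<longlonglongrightarrow> 0" unfolding h_def by (rule lim_inverse_n'[THEN LIMSEQ_Suc])
  have eq: "(LINT x|lborel. normal_density c (h n) x * V x) = (LINT z|lborel. std_normal_density z * V (c + h n * z))" for n
  proof -
    have "h n * normal_density c (h n) (c + h n * z) = std_normal_density z" for z
      using h0[of n] by (simp add: normal_density_def real_sqrt_mult power_mult_distrib)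
    then have "(LINT z|lborel. std_normal_density z * V (c + h n * z)) = (LINT z|lborel. h n * (normal_density c (h n) (c + h n * z) * V (c + h n * z)))"
      by (simp add: mult.assoc[symmetric])
    then show ?thesis using h0[of n] by (subst lborel_integral_real_affine[where c = "h n" and t = c]) auto
  qed
  have "(\<lambda>n. LINT z|lborel. std_normal_density z * V (c + h n * z)) \<longlonglongrightarrow> (LINT z|lborel. std_normal_density z * V c)"
  proof (rule integral_dominated_convergence[where w = "\<lambda>z. std_normal_density z * B"])
    show "AE z in lborel. (\<lambda>n. std_normal_density z * V (c + h n * z)) \<longlonglongrightarrow> std_normal_density z * V c"
    proof (rule AE_I2)
      fix z
      have "(\<lambda>n. c + h n * z) \<longlonglongrightarrow> c + 0 * z" by (intro tendsto_intros hlim)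
      moreover have "isCont V c" using V(1) by (simp add: continuous_on_eq_continuous_at)
      ultimately have "(\<lambda>n. V (c + h n * z)) \<longlonglongrightarrow> V c" by (intro isCont_tendsto_compose[where g = V]) auto
      then show "(\<lambda>n. std_normal_density z * V (c + h n * z)) \<longlonglongrightarrow> std_normal_density z * V c"
        by (intro tendsto_mult tendsto_const)
    qed
    show "AE z in lborel. norm (std_normal_density z * V (c + h n * z)) \<le> std_normal_density z * B" for n
      using V(2) by (intro AE_I2) (simp add: abs_mult mult_left_mono)
  qed auto
  moreover have "(LINT z|lborel. std_normal_density z * V c) = V c" by simp
  ultimately show ?thesis unfolding eq[symmetric] by (simp only: h_def)
qed

text \<open>Gaussians are used as test functions: their derivative in \<open>x\<close> is minus the
  derivative in the centre \<open>c\<close>. Integrating over \<open>c\<close> from \<open>a\<close>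
  to \<open>b\<close> shows that the averaged \<open>V\<close> increases by the integral of the
  averaged \<open>Q\<close>; as the width tends to 0 this becomes the fundamental theorem of
  calculus for \<open>V\<close> and \<open>Q\<close>.\<close>

lemma weak_derivative_continuous_imp_classical:
  fixes V Q :: "real \<Rightarrow> real"
  assumes V: "continuous_on UNIV V" "\<And>x. \<bar>V x\<bar> \<le> B" and Q: "continuous_on UNIV Q" "\<And>x. \<bar>Q x\<bar> \<le> B"
    and weak: "\<And>\<psi>. schwartz \<psi> \<Longrightarrow> (LINT x|lborel. deriv \<psi> x * V x) = - (LINT x|lborel. \<psi> x * Q x)"
  shows "(V has_real_derivative Q x) (at x)"
proof -
  have [measurable]: "V \<in> borel_measurable borel" "Q \<in> borel_measurable borel"
    using V Q by (auto intro: borel_measurable_continuous_onI)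
  have moll: "(LINT c|lborel. indicator {a..b} c * (LINT x|lborel. normal_density c \<sigma> x * Q x))
      = (LINT x|lborel. normal_density b \<sigma> x * V x) - (LINT x|lborel. normal_density a \<sigma> x * V x)"
    if ab: "a \<le> b" and \<sigma>: "0 < \<sigma>" for a b \<sigma>
  proof -
    let ?n' = "\<lambda>c x. normal_density c \<sigma> x * (x - c) / \<sigma>\<^sup>2"
    define k where "k = 1 / sqrt (2 * pi * \<sigma>\<^sup>2)"
    have nd: "normal_density c \<sigma> x = k * exp (- (x - c)\<^sup>2 / (2 * \<sigma>\<^sup>2))" for c x by (simp add: normal_density_def k_def)
    have dc: "((\<lambda>c. normal_density c \<sigma> x) has_real_derivative ?n' c x) (at c)" for c x
    proof -
      have "((\<lambda>c. - (x - c)\<^sup>2 / (2 * \<sigma>\<^sup>2)) has_real_derivative (x - c) / \<sigma>\<^sup>2) (at c)"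
        using \<sigma> by (auto intro!: derivative_eq_intros simp: field_simps power2_eq_square)
      from DERIV_cmult[OF DERIV_fun_exp[OF this], of k] show ?thesis unfolding nd by (simp add: mult.assoc)
    qed
    have dx: "deriv (normal_density c \<sigma>) x = - ?n' c x" for c x
    proof -
      have "((\<lambda>x. - (x - c)\<^sup>2 / (2 * \<sigma>\<^sup>2)) has_real_derivative - ((x - c) / \<sigma>\<^sup>2)) (at x)"
        using \<sigma> by (auto intro!: derivative_eq_intros simp: field_simps power2_eq_square)
      from DERIV_cmult[OF DERIV_fun_exp[OF this], of k]
      have "((\<lambda>x. normal_density c \<sigma> x) has_real_derivative - ?n' c x) (at x)" unfolding nd by (simp add: mult.assoc)
      then show ?thesis by (rule DERIV_imp_deriv)
    qed
    let ?f = "\<lambda>c x. indicator {a..b} c * ?n' c x * V x"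
    have q: "(LINT x|lborel. normal_density c \<sigma> x * Q x) = (LINT x|lborel. ?n' c x * V x)" for c
      using weak[OF schwartz_normal_density[OF \<sigma>, of c]] by (simp add: dx)
    have ni: "integrable lborel (\<lambda>x. normal_density c \<sigma> x * \<bar>x - c\<bar>)" for c
      using integrable_normal_moment_abs[of \<sigma> c 1] \<sigma> by simp
    \<comment> \<open>The first absolute moment does not depend on the centre, which gives the
      uniform bound required by Fubini.\<close>
    define K where "K = (LINT x|lborel. normal_density 0 \<sigma> x * \<bar>x\<bar>)"
    have nK: "(LINT x|lborel. normal_density c \<sigma> x * \<bar>x - c\<bar>) = K" for c
    proof -
      have "(LINT x|lborel. normal_density c \<sigma> x * \<bar>x - c\<bar>) = (LINT x|lborel. normal_density c \<sigma> (c + 1 * x) * \<bar>c + 1 * x - c\<bar>)"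
        by (subst lborel_integral_real_affine[where c = 1 and t = c]) auto
      also have "\<dots> = K" unfolding K_def by (simp add: normal_density_def)
      finally show ?thesis .
    qed
    have fb: "norm (?f c x) \<le> B / \<sigma>\<^sup>2 * indicator {a..b} c * (normal_density c \<sigma> x * \<bar>x - c\<bar>)" for c x
    proof -
      have "(indicator {a..b} c * (normal_density c \<sigma> x * \<bar>x - c\<bar>) / \<sigma>\<^sup>2) * \<bar>V x\<bar> \<le> (indicator {a..b} c * (normal_density c \<sigma> x * \<bar>x - c\<bar>) / \<sigma>\<^sup>2) * B"
        by (intro mult_left_mono V(2)) auto
      then show ?thesis by (simp add: abs_mult mult_ac)
    qed
    have "integrable (lborel \<Otimes>\<^sub>M lborel) (case_prod ?f)"
    proof (rule lborel_pair.Fubini_integrable)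
      show "case_prod ?f \<in> borel_measurable (lborel \<Otimes>\<^sub>M lborel)" by measurable
      have i: "integrable lborel (?f c)" for c
      proof (rule Bochner_Integration.integrable_bound)
        show "integrable lborel (\<lambda>x. B / \<sigma>\<^sup>2 * indicator {a..b} c * (normal_density c \<sigma> x * \<bar>x - c\<bar>))"
          by (intro integrable_mult_right ni)
        show "AE x in lborel. norm (?f c x) \<le> norm (B / \<sigma>\<^sup>2 * indicator {a..b} c * (normal_density c \<sigma> x * \<bar>x - c\<bar>))"
          by (intro AE_I2 order_trans[OF fb]) (simp only: real_norm_def abs_ge_self)
      qed measurable
      then show "AE c in lborel. integrable lborel (\<lambda>x. case (c, x) of (c, x) \<Rightarrow> ?f c x)" by simp
      have B0: "0 \<le> B" using V(2)[of 0] by linarith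
      have K0: "0 \<le> K" unfolding K_def by (intro integral_nonneg_AE) auto
      have "(LINT x|lborel. norm (?f c x)) \<le> B / \<sigma>\<^sup>2 * indicator {a..b} c * K" for c
        unfolding nK[of c, symmetric] integral_mult_right_zero[symmetric]
        by (rule integral_mono[OF integrable_norm[OF i] _ fb]) (use ni in auto)
      moreover have "0 \<le> (LINT x|lborel. norm (?f c x))" for c by (intro integral_nonneg_AE) auto
      ultimately have nb: "norm (LINT x|lborel. norm (?f c x)) \<le> norm (B / \<sigma>\<^sup>2 * K * indicator {a..b} c :: real)" for c
        using B0 K0 by (simp add: mult_ac)
      show "integrable lborel (\<lambda>c. LINT x|lborel. norm (case (c, x) of (c, x) \<Rightarrow> ?f c x))"
        unfolding prod.case
      proof (rule Bochner_Integration.integrable_bound[where f = "\<lambda>c. B / \<sigma>\<^sup>2 * K * indicator {a..b} c :: real"])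
        show "integrable lborel (\<lambda>c. B / \<sigma>\<^sup>2 * K * indicator {a..b} c :: real)"
          by (intro integrable_mult_right integrable_real_indicator) (auto simp: emeasure_lborel_Icc_eq)
        show "(\<lambda>c. LINT x|lborel. norm (?f c x)) \<in> borel_measurable lborel" by measurable
      qed (use nb in auto)
    qed
    from lborel_pair.Fubini_integral[OF this]
    have E: "(LINT x|lborel. LINT c|lborel. ?f c x) = (LINT c|lborel. LINT x|lborel. ?f c x)" .
    have A1: "(LINT x|lborel. ?f c x) = indicator {a..b} c * (LINT x|lborel. normal_density c \<sigma> x * Q x)" for c
      unfolding q by (simp add: mult.assoc)
    have A2: "(LINT c|lborel. ?f c x) = normal_density b \<sigma> x * V x - normal_density a \<sigma> x * V x" for x
    proof -
      have "(LINT c|lborel. indicator {a..b} c *\<^sub>R ?n' c x) = normal_density b \<sigma> x - normal_density a \<sigma> x"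
      proof (rule integral_FTC_Icc[OF ab])
        show "((\<lambda>c. normal_density c \<sigma> x) has_vector_derivative ?n' c x) (at c within {a..b})" for c
          using has_field_derivative_at_within[OF dc] by (simp add: has_real_derivative_iff_has_vector_derivative)
        show "continuous_on {a..b} (\<lambda>c. ?n' c x)"
          unfolding normal_density_def using \<sigma> by (intro continuous_intros) auto
      qed
      then have "(LINT c|lborel. indicator {a..b} c * ?n' c x) * V x = (normal_density b \<sigma> x - normal_density a \<sigma> x) * V x" by simp
      then show ?thesis by (simp add: left_diff_distrib)
    qed
    have nV: "integrable lborel (\<lambda>x. normal_density c \<sigma> x * V x)" for c
      by (rule schwartz_mult_integrable[OF schwartz_normal_density[OF \<sigma>] _ V(2)]) simp
    show ?thesis using E unfolding A1 A2 using nV by simp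
  qed
  have FTC: "V b - V a = integral {a..b} Q" if ab: "a \<le> b" for a b
  proof -
    have s0: "0 < 1 / real (Suc n)" for n by simp
    have l1: "(\<lambda>n. (LINT x|lborel. normal_density b (1 / real (Suc n)) x * V x) - (LINT x|lborel. normal_density a (1 / real (Suc n)) x * V x)) \<longlonglongrightarrow> V b - V a"
      by (intro tendsto_diff normal_density_approximate_identity[OF V])
    have "(\<lambda>n. LINT c|lborel. indicator {a..b} c * (LINT x|lborel. normal_density c (1 / real (Suc n)) x * Q x)) \<longlonglongrightarrow> (LINT c|lborel. indicator {a..b} c * Q c)"
    proof (rule integral_dominated_convergence[where w = "\<lambda>c. B * indicator {a..b} c"])
      show "integrable lborel (\<lambda>c. B * indicator {a..b} c)"
        by (intro integrable_mult_right integrable_real_indicator) (auto simp: emeasure_lborel_Icc_eq)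
      show "AE c in lborel. (\<lambda>n. indicator {a..b} c * (LINT x|lborel. normal_density c (1 / real (Suc n)) x * Q x)) \<longlonglongrightarrow> indicator {a..b} c * Q c"
        by (intro AE_I2 tendsto_mult tendsto_const normal_density_approximate_identity[OF Q])
      have "\<bar>LINT x|lborel. normal_density c (1 / real (Suc n)) x * Q x\<bar> \<le> B" for c n
      proof -
        have i: "integrable lborel (\<lambda>x. normal_density c (1 / real (Suc n)) x * Q x)"
          by (rule schwartz_mult_integrable[OF schwartz_normal_density[OF s0] _ Q(2)]) simp
        have "\<bar>LINT x|lborel. normal_density c (1 / real (Suc n)) x * Q x\<bar> \<le> (LINT x|lborel. \<bar>normal_density c (1 / real (Suc n)) x * Q x\<bar>)"
          by (rule integral_abs_bound)
        also have "\<dots> \<le> (LINT x|lborel. normal_density c (1 / real (Suc n)) x * B)"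
          by (rule integral_mono[OF integrable_abs[OF i]]) (use Q(2) in \<open>auto simp: abs_mult mult_left_mono\<close>)
        also have "\<dots> = B" by simp
        finally show ?thesis .
      qed
      then show "AE c in lborel. norm (indicator {a..b} c * (LINT x|lborel. normal_density c (1 / real (Suc n)) x * Q x)) \<le> B * indicator {a..b} c" for n
        by (intro AE_I2) (auto simp: indicator_def)
      show "(\<lambda>c. indicator {a..b} c * (LINT x|lborel. normal_density c (1 / real (Suc n)) x * Q x)) \<in> borel_measurable lborel" for n
        by measurable
    qed simp
    then have l2: "(\<lambda>n. (LINT x|lborel. normal_density b (1 / real (Suc n)) x * V x) - (LINT x|lborel. normal_density a (1 / real (Suc n)) x * V x)) \<longlonglongrightarrow> (LINT c|lborel. indicator {a..b} c * Q c)"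
      unfolding moll[OF ab s0] .
    have "set_integrable lborel {a..b} Q"
      by (rule borel_integrable_atLeastAtMost') (rule continuous_on_subset[OF Q(1)], simp)
    then have "(LINT c|lborel. indicator {a..b} c * Q c) = integral {a..b} Q"
      using set_borel_integral_eq_integral(2)[of "{a..b}" Q] by (simp add: set_lebesgue_integral_def)
    with LIMSEQ_unique[OF l1 l2] show ?thesis by simp
  qed
  have "((\<lambda>y. integral {x - 1..y} Q) has_real_derivative Q x) (at x within {x - 1..x + 1})"
    by (rule integral_has_real_derivative) (auto intro: continuous_on_subset[OF Q(1)])
  then have "((\<lambda>y. V y - V (x - 1)) has_real_derivative Q x) (at x within {x - 1..x + 1})"
    by (rule has_field_derivative_transform_within[where d = 1]) (auto simp: FTC)
  from DERIV_add[OF this DERIV_const[of "V (x - 1)"]]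
  have "(V has_real_derivative Q x) (at x within {x - 1..x + 1})" by simp
  then show ?thesis by (simp add: at_within_Icc_at)
qed

section \<open>Inversion of 1 - d^2/dx^2 on bounded functions\<close>

definition green :: "(real \<Rightarrow> real) \<Rightarrow> real \<Rightarrow> real" where
  "green h x = (LINT y|lborel. exp (- \<bar>x - y\<bar>) / 2 * h y)"

lemma
  fixes x :: real
  shows exp_abs_integrable: "integrable lborel (\<lambda>y. exp (- \<bar>x - y\<bar>))"
    and exp_abs_integral: "(LINT y|lborel. exp (- \<bar>x - y\<bar>)) = 2"
proof -
  have half: "(\<integral>\<^sup>+y. ennreal (exp (- y)) * indicator {0..} y \<partial>lborel) = 1"
  proof -
    have "((\<lambda>y::real. - exp (- y)) \<longlongrightarrow> - 0) at_top"
      by (intro tendsto_minus filterlim_compose[OF exp_at_bot] filterlim_uminus_at_bot_at_top)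
    then have lim: "((\<lambda>y::real. - exp (- y)) \<longlongrightarrow> 0) at_top" by simp
    have "(\<integral>\<^sup>+y. ennreal (exp (- y)) * indicator {0..} y \<partial>lborel) = ennreal (0 - - exp (- 0))"
      by (rule nn_integral_FTC_atLeast[where F = "\<lambda>y. - exp (- y)"]) (use lim in \<open>auto intro!: derivative_eq_intros\<close>)
    then show ?thesis by simp
  qed
  have "(\<integral>\<^sup>+y. ennreal (exp (- \<bar>y\<bar>)) \<partial>lborel)
      = (\<integral>\<^sup>+y. ennreal (exp (- y)) * indicator {0..} y + ennreal (exp (- (- y))) * indicator {0..} (- y) \<partial>lborel)"
    by (rule nn_integral_cong_AE, use AE_lborel_singleton[of "0::real"] in eventually_elim) (auto simp: indicator_def)
  also have "\<dots> = (\<integral>\<^sup>+y. ennreal (exp (- y)) * indicator {0..} y \<partial>lborel) + (\<integral>\<^sup>+y. ennreal (exp (- (- y))) * indicator {0..} (- y) \<partial>lborel)"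
    by (rule nn_integral_add) measurable
  also have "(\<integral>\<^sup>+y. ennreal (exp (- (- y))) * indicator {0..} (- y) \<partial>lborel) = (\<integral>\<^sup>+y. ennreal (exp (- y)) * indicator {0..} y \<partial>lborel)"
    by (subst (2) nn_integral_real_affine[where c = "-1" and t = 0]) auto
  finally have n: "(\<integral>\<^sup>+y. ennreal (exp (- \<bar>y\<bar>)) \<partial>lborel) = ennreal 2" unfolding half by simp
  then have i0: "integrable lborel (\<lambda>y::real. exp (- \<bar>y\<bar>))" by (intro integrableI_bounded) auto
  show "integrable lborel (\<lambda>y::real. exp (- \<bar>x - y\<bar>))"
    using lborel_integrable_real_affine[OF i0, of "-1" x] by simp
  have "(LINT y|lborel. exp (- \<bar>x - y\<bar>)) = (LINT y|lborel. exp (- \<bar>y\<bar>))"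
    using lborel_integral_real_affine[of "-1" "\<lambda>y. exp (- \<bar>y\<bar>)" x] by simp
  also have "\<dots> = 2" using n by (intro integral_eq_nn_integral[THEN trans]) auto
  finally show "(LINT y|lborel. exp (- \<bar>x - y\<bar>)) = 2" .
qed

lemma green_integrable:
  fixes h :: "real \<Rightarrow> real" and x B :: real
  assumes [measurable]: "h \<in> borel_measurable borel" and h: "\<And>x. \<bar>h x\<bar> \<le> B"
  shows "integrable lborel (\<lambda>y. exp (- \<bar>x - y\<bar>) * h y)"
proof (rule Bochner_Integration.integrable_bound[where f = "\<lambda>y. exp (- \<bar>x - y\<bar>) * B"])
  have "\<bar>h y\<bar> \<le> \<bar>B\<bar>" for y using h[of y] by simp
  then show "AE y in lborel. norm (exp (- \<bar>x - y\<bar>) * h y) \<le> norm (exp (- \<bar>x - y\<bar>) * B)"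
    by (intro AE_I2) (simp add: abs_mult mult_left_mono)
  show "integrable lborel (\<lambda>y. exp (- \<bar>x - y\<bar>) * B)" by (rule integrable_mult_left[OF exp_abs_integrable])
  show "(\<lambda>y. exp (- \<bar>x - y\<bar>) * h y) \<in> borel_measurable lborel" by measurable
qed

text \<open>The first-order factor 1 - d/dx: the derivative of exp(x - y) P(y) in \<open>y\<close>
  is -exp(x - y) f(y). Integrating from \<open>x\<close> to \<open>b\<close>, the boundary term
  vanishes as \<open>b\<close> tends to infinity because \<open>P\<close> is bounded.\<close>

lemma half_line_bound:
  fixes P f :: "real \<Rightarrow> real"
  assumes P: "\<And>x. (P has_real_derivative P x - f x) (at x)" "\<And>x. \<bar>P x\<bar> \<le> B"
    and f: "continuous_on UNIV f" "\<And>x. \<bar>f x\<bar> \<le> C"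
  shows "\<bar>P x\<bar> \<le> (LINT y|lborel. indicator {x..} y * (exp (- \<bar>x - y\<bar>) * \<bar>f y\<bar>))"
proof -
  let ?I = "LINT y|lborel. indicator {x..} y * (exp (- \<bar>x - y\<bar>) * \<bar>f y\<bar>)"
  have [measurable]: "f \<in> borel_measurable borel" by (rule borel_measurable_continuous_onI[OF f(1)])
  have fi: "integrable lborel (\<lambda>y. exp (- \<bar>x - y\<bar>) * \<bar>f y\<bar>)" by (rule green_integrable) (use f(2) in auto)
  have fiI: "integrable lborel (\<lambda>y. indicator S y * (exp (- \<bar>x - y\<bar>) * \<bar>f y\<bar>))" if "S \<in> sets borel" for S
    using integrable_mult_indicator[OF _ fi, of S] that by simp
  have bnd: "\<bar>P x\<bar> \<le> exp (x - b) * B + ?I" if b: "x \<le> b" for b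
  proof -
    have "(LINT y|lborel. indicator {x..b} y *\<^sub>R (- exp (x - y) * f y)) = exp (x - b) * P b - exp (x - x) * P x"
    proof (rule integral_FTC_Icc[OF b])
      fix y
      have "((\<lambda>y. exp (x - y) * P y) has_real_derivative - exp (x - y) * f y) (at y)"
        by (auto intro!: derivative_eq_intros P simp: algebra_simps)
      then show "((\<lambda>y. exp (x - y) * P y) has_vector_derivative - exp (x - y) * f y) (at y within {x..b})"
        using has_field_derivative_at_within by (simp add: has_real_derivative_iff_has_vector_derivative[symmetric]) blast
    next
      show "continuous_on {x..b} (\<lambda>y. - exp (x - y) * f y)"
        by (intro continuous_intros continuous_on_subset[OF f(1)]) auto
    qed
    then have Px: "P x = exp (x - b) * P b - (LINT y|lborel. indicator {x..b} y *\<^sub>R (- exp (x - y) * f y))" by simp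
    have "\<bar>LINT y|lborel. indicator {x..b} y *\<^sub>R (- exp (x - y) * f y)\<bar> \<le> (LINT y|lborel. \<bar>indicator {x..b} y *\<^sub>R (- exp (x - y) * f y)\<bar>)"
      by (rule integral_abs_bound)
    also have "\<dots> = (LINT y|lborel. indicator {x..b} y * (exp (- \<bar>x - y\<bar>) * \<bar>f y\<bar>))"
      by (intro Bochner_Integration.integral_cong) (auto simp: abs_mult indicator_def)
    also have "\<dots> \<le> ?I"
      by (intro integral_mono fiI) (auto simp: indicator_def)
    finally have "\<bar>LINT y|lborel. indicator {x..b} y *\<^sub>R (- exp (x - y) * f y)\<bar> \<le> ?I" .
    moreover have "\<bar>exp (x - b) * P b\<bar> \<le> exp (x - b) * B" using P(2) by (simp add: abs_mult)
    ultimately show ?thesis unfolding Px by linarith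
  qed
  have "((\<lambda>b. exp (x - b) * B + ?I) \<longlongrightarrow> 0 * B + ?I) at_top"
  proof (intro tendsto_intros)
    have "filterlim (\<lambda>b. - x + b) at_top at_top"
      by (rule filterlim_tendsto_add_at_top[OF tendsto_const filterlim_ident])
    then have "filterlim (\<lambda>b. x - b) at_bot at_top" unfolding filterlim_uminus_at_bot by simp
    then show "((\<lambda>b. exp (x - b)) \<longlongrightarrow> 0) at_top" by (rule filterlim_compose[OF exp_at_bot])
  qed
  then have "\<bar>P x\<bar> \<le> 0 * B + ?I"
    by (rule tendsto_lowerbound) (auto intro!: eventually_at_top_linorderI[of x] bnd)
  then show ?thesis by simp
qed

text \<open>The operator factors as (1 - d/dx)(1 + d/dx): \<open>Y + V\<close> is controlled by
  \<open>f\<close> to the right of \<open>x\<close> and \<open>Y - V\<close> by \<open>f\<close> to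
  the left. Half the sum of the two bounds is the convolution and dominates both |Y| and |V|, so the
  derivative of the kernel never appears.\<close>

lemma green_bound:
  fixes Y V f :: "real \<Rightarrow> real"
  assumes Y: "\<And>x. (Y has_real_derivative V x) (at x)" "\<And>x. \<bar>Y x\<bar> \<le> B"
    and V: "\<And>x. (V has_real_derivative Y x - f x) (at x)" "\<And>x. \<bar>V x\<bar> \<le> B"
    and f: "continuous_on UNIV f" "\<And>x. \<bar>f x\<bar> \<le> C"
  shows "\<bar>Y x\<bar> \<le> green (\<lambda>y. \<bar>f y\<bar>) x" "\<bar>V x\<bar> \<le> green (\<lambda>y. \<bar>f y\<bar>) x"
proof -
  have [measurable]: "f \<in> borel_measurable borel" by (rule borel_measurable_continuous_onI[OF f(1)])
  have fi: "integrable lborel (\<lambda>y. exp (- \<bar>x - y\<bar>) * \<bar>f y\<bar>)" by (rule green_integrable) (use f(2) in auto)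
  have fiI: "integrable lborel (\<lambda>y. indicator S y * (exp (- \<bar>x - y\<bar>) * \<bar>f y\<bar>))" if "S \<in> sets borel" for S
    using integrable_mult_indicator[OF _ fi, of S] that by simp
  have p: "\<bar>Y x + V x\<bar> \<le> (LINT y|lborel. indicator {x..} y * (exp (- \<bar>x - y\<bar>) * \<bar>f y\<bar>))"
  proof (rule half_line_bound)
    show "((\<lambda>x. Y x + V x) has_real_derivative Y x + V x - f x) (at x)" for x
      by (rule DERIV_cong[OF DERIV_add[OF Y(1) V(1)]]) simp
    show "\<bar>Y x + V x\<bar> \<le> B + B" for x using Y(2)[of x] V(2)[of x] by linarith
  qed (use f in auto)
  \<comment> \<open>Reflection at the origin changes the sign of the derivative and turns the left
    half line into the right one.\<close>
  have "\<bar>Y (- (- x)) - V (- (- x))\<bar> \<le> (LINT y|lborel. indicator {- x..} y * (exp (- \<bar>- x - y\<bar>) * \<bar>f (- y)\<bar>))"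
  proof (rule half_line_bound)
    show "((\<lambda>x. Y (- x) - V (- x)) has_real_derivative (Y (- x) - V (- x)) - f (- x)) (at x)" for x
    proof -
      have "((\<lambda>x. Y x - V x) has_real_derivative (V (- x) - (Y (- x) - f (- x)))) (at (- x))"
        by (rule DERIV_diff[OF Y(1) V(1)])
      from DERIV_chain2[OF this DERIV_minus[OF DERIV_ident]]
      show ?thesis by (rule DERIV_cong) simp
    qed
    show "\<bar>Y (- x) - V (- x)\<bar> \<le> B + B" for x using Y(2)[of "- x"] V(2)[of "- x"] by linarith
    show "continuous_on UNIV (\<lambda>x. f (- x))" by (rule continuous_on_compose2[OF f(1)]) (auto intro!: continuous_intros)
    show "\<bar>f (- x)\<bar> \<le> C" for x by (rule f(2))
  qed
  also have "\<dots> = (LINT y|lborel. indicator {..x} y * (exp (- \<bar>x - y\<bar>) * \<bar>f y\<bar>))"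
    by (subst (2) lborel_integral_real_affine[where c = "-1" and t = 0])
      (auto intro!: Bochner_Integration.integral_cong simp: indicator_def abs_minus_commute add.commute)
  finally have m: "\<bar>Y x - V x\<bar> \<le> (LINT y|lborel. indicator {..x} y * (exp (- \<bar>x - y\<bar>) * \<bar>f y\<bar>))" by simp
  have "(LINT y|lborel. indicator {x..} y * (exp (- \<bar>x - y\<bar>) * \<bar>f y\<bar>)) + (LINT y|lborel. indicator {..x} y * (exp (- \<bar>x - y\<bar>) * \<bar>f y\<bar>))
      = (LINT y|lborel. indicator {x..} y * (exp (- \<bar>x - y\<bar>) * \<bar>f y\<bar>) + indicator {..x} y * (exp (- \<bar>x - y\<bar>) * \<bar>f y\<bar>))"
    by (rule Bochner_Integration.integral_add[symmetric]) (auto intro!: fiI)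
  also have "\<dots> = (LINT y|lborel. exp (- \<bar>x - y\<bar>) * \<bar>f y\<bar>)"
    by (rule integral_cong_AE) (use AE_lborel_singleton[of x] in \<open>auto elim!: eventually_mono simp: indicator_def\<close>)
  also have "\<dots> = 2 * green (\<lambda>y. \<bar>f y\<bar>) x" by (simp add: green_def)
  finally show "\<bar>Y x\<bar> \<le> green (\<lambda>y. \<bar>f y\<bar>) x" "\<bar>V x\<bar> \<le> green (\<lambda>y. \<bar>f y\<bar>) x"
    using p m by linarith+
qed

text \<open>Here \<open>R1\<close> contains u_xx and \<open>U1\<close> is only continuous, so
  neither is differentiated by itself. Their sum has a continuous weak derivative by the equation,
  and hence a classical one; then \<open>Y = U0 + R\<close> and \<open>V = U1 + R1\<close> satisfy
  the hypotheses of \<open>green_bound\<close>.\<close>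

lemma pde_at_classical:
  fixes u ut f0 f1 f2 U0 U1 :: "real \<Rightarrow> real"
  assumes um: "u \<in> borel_measurable lebesgue" "AE x in lebesgue. u x = f0 x"
    and utm: "ut \<in> borel_measurable lebesgue" "AE x in lebesgue. ut x = U0 x"
    and f0: "\<And>x. (f0 has_real_derivative f1 x) (at x)" and f1: "\<And>x. (f1 has_real_derivative f2 x) (at x)"
    and f2: "continuous_on UNIV f2" and fB: "\<And>x. \<bar>f0 x\<bar> \<le> B" "\<And>x. \<bar>f1 x\<bar> \<le> B" "\<And>x. \<bar>f2 x\<bar> \<le> B"
    and U0: "\<And>x. (U0 has_real_derivative U1 x) (at x)" and U1: "continuous_on UNIV U1"
    and UB: "\<And>x. \<bar>U0 x\<bar> \<le> B" "\<And>x. \<bar>U1 x\<bar> \<le> B"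
    and pde: "pde_at u ut"
  defines "R \<equiv> \<lambda>x. (2 * f0 x - f1 x)\<^sup>2" and "R1 \<equiv> \<lambda>x. 2 * (2 * f0 x - f1 x) * (2 * f1 x - f2 x)"
  shows "((\<lambda>x. U1 x + R1 x) has_real_derivative (U0 x + R x) - (R x + 2 * R1 x)) (at x)"
    and "\<bar>U0 x + R x\<bar> \<le> green (\<lambda>y. \<bar>R y + 2 * R1 y\<bar>) x" "\<bar>U1 x + R1 x\<bar> \<le> green (\<lambda>y. \<bar>R y + 2 * R1 y\<bar>) x"
proof -
  have c: "continuous_on UNIV f0" "continuous_on UNIV f1" "continuous_on UNIV U0"
    using f0 f1 U0 by (meson DERIV_isCont continuous_at_imp_continuous_on)+
  have Rc: "continuous_on UNIV R" "continuous_on UNIV R1" unfolding R_def R1_def by (intro continuous_intros c f2)+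
  have Rd: "(R has_real_derivative R1 x) (at x)" for x
    unfolding R_def R1_def by (auto intro!: derivative_eq_intros f0 f1 simp: algebra_simps)
  have B0: "0 \<le> B" using fB(1)[of 0] by linarith
  have d1: "\<bar>2 * f0 x - f1 x\<bar> \<le> 3 * B" "\<bar>2 * f1 x - f2 x\<bar> \<le> 3 * B" for x using fB[of x] by linarith+
  have RB: "\<bar>R x\<bar> \<le> 18 * B\<^sup>2" "\<bar>R1 x\<bar> \<le> 18 * B\<^sup>2" for x
  proof -
    have "\<bar>2 * f0 x - f1 x\<bar> * \<bar>2 * f0 x - f1 x\<bar> \<le> (3 * B) * (3 * B)" "\<bar>2 * f0 x - f1 x\<bar> * \<bar>2 * f1 x - f2 x\<bar> \<le> (3 * B) * (3 * B)"
      by (rule mult_mono; use d1[of x] B0 in simp)+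
    moreover have "(3 * B) * (3 * B) \<le> 18 * B\<^sup>2" "2 * ((3 * B) * (3 * B)) = 18 * B\<^sup>2" by (simp_all add: power2_eq_square)
    moreover have "\<bar>R x\<bar> = \<bar>2 * f0 x - f1 x\<bar> * \<bar>2 * f0 x - f1 x\<bar>" by (simp only: R_def power2_eq_square abs_mult)
    moreover have "\<bar>R1 x\<bar> = 2 * (\<bar>2 * f0 x - f1 x\<bar> * \<bar>2 * f1 x - f2 x\<bar>)" by (simp only: R1_def abs_mult abs_numeral mult.assoc)
    ultimately show "\<bar>R x\<bar> \<le> 18 * B\<^sup>2" "\<bar>R1 x\<bar> \<le> 18 * B\<^sup>2" by linarith+
  qed
  have wd: "AE x in lebesgue. weak_deriv u x = f1 x" "weak_deriv u \<in> borel_measurable lebesgue"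
    using weak_deriv_classical[OF um f0 c(2) fB(1,2)] by auto
  let ?R = "\<lambda>x. (2 * u x - weak_deriv u x)\<^sup>2"
  have Rm: "?R \<in> borel_measurable lebesgue"
    by (intro borel_measurable_power borel_measurable_diff borel_measurable_times borel_measurable_const um(1) wd(2))
  have Rae: "AE x in lebesgue. ?R x = R x" using um(2) wd(1) by eventually_elim (simp add: R_def)
  note bm = borel_measurable_continuous_onI
  \<comment> \<open>Writing the equation as u_t - 2 R_x = (u_tx + R_x)_x, the left side is
    continuous and serves as the derivative sought.\<close>
  define Q where "Q x = U0 x - 2 * R1 x" for x
  have weak: "(LINT x|lborel. deriv \<psi> x * (U1 x + R1 x)) = - (LINT x|lborel. \<psi> x * Q x)" if \<psi>: "schwartz \<psi>" for \<psi>
  proof -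
    note \<psi>1 = schwartz_deriv[OF \<psi>] and \<psi>2 = schwartz_deriv[OF schwartz_deriv[OF \<psi>]]
    have "dist_of ut \<psi> - dist_of ut (deriv (deriv \<psi>)) = - (2 * dist_of ?R (deriv \<psi>)) + dist_of ?R (deriv (deriv \<psi>))"
      using pde \<psi> unfolding pde_at_def Let_def dist_deriv_def by simp
    then have "(LINT x|lborel. \<psi> x * U0 x) - (LINT x|lborel. deriv (deriv \<psi>) x * U0 x)
        = - (2 * (LINT x|lborel. deriv \<psi> x * R x)) + (LINT x|lborel. deriv (deriv \<psi>) x * R x)"
      by (simp only: dist_of_borel_version(2)[OF utm(1) bm[OF c(3)] utm(2) \<psi>] dist_of_borel_version(2)[OF utm(1) bm[OF c(3)] utm(2) \<psi>2]
        dist_of_borel_version(2)[OF Rm bm[OF Rc(1)] Rae \<psi>1] dist_of_borel_version(2)[OF Rm bm[OF Rc(1)] Rae \<psi>2])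
    moreover have "(LINT x|lborel. deriv \<psi> x * U1 x) = - (LINT x|lborel. deriv (deriv \<psi>) x * U0 x)"
      by (rule schwartz_integration_by_parts[OF \<psi>1 U0 U1 UB])
    moreover have "(LINT x|lborel. deriv \<psi> x * R1 x) = - (LINT x|lborel. deriv (deriv \<psi>) x * R x)"
      by (rule schwartz_integration_by_parts[OF \<psi>1 Rd Rc(2) RB])
    moreover have "(LINT x|lborel. \<psi> x * R1 x) = - (LINT x|lborel. deriv \<psi> x * R x)"
      by (rule schwartz_integration_by_parts[OF \<psi> Rd Rc(2) RB])
    moreover have i: "integrable lborel (\<lambda>x. deriv \<psi> x * U1 x)" "integrable lborel (\<lambda>x. deriv \<psi> x * R1 x)"
       "integrable lborel (\<lambda>x. \<psi> x * U0 x)" "integrable lborel (\<lambda>x. \<psi> x * R1 x)"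
      using schwartz_mult_integrable[OF \<psi>1 bm[OF U1] UB(2)] schwartz_mult_integrable[OF \<psi>1 bm[OF Rc(2)] RB(2)]
        schwartz_mult_integrable[OF \<psi> bm[OF c(3)] UB(1)] schwartz_mult_integrable[OF \<psi> bm[OF Rc(2)] RB(2)] by auto
    moreover have "(LINT x|lborel. deriv \<psi> x * (U1 x + R1 x)) = (LINT x|lborel. deriv \<psi> x * U1 x) + (LINT x|lborel. deriv \<psi> x * R1 x)"
      unfolding distrib_left by (rule Bochner_Integration.integral_add[OF i(1,2)])
    moreover have "(LINT x|lborel. \<psi> x * Q x) = (LINT x|lborel. \<psi> x * U0 x) - 2 * (LINT x|lborel. \<psi> x * R1 x)"
    proof -
      have "(LINT x|lborel. \<psi> x * Q x) = (LINT x|lborel. \<psi> x * U0 x - 2 * (\<psi> x * R1 x))"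
        by (simp add: Q_def algebra_simps)
      then show ?thesis using i(3,4) by simp
    qed
    ultimately show ?thesis by linarith
  qed
  have Qc: "continuous_on UNIV Q" unfolding Q_def by (intro continuous_intros c Rc)
  have V': "((\<lambda>x. U1 x + R1 x) has_real_derivative Q x) (at x)" for x
  proof (rule weak_derivative_continuous_imp_classical[OF _ _ Qc _ weak])
    show "continuous_on UNIV (\<lambda>x. U1 x + R1 x)" by (intro continuous_intros U1 Rc)
    show "\<bar>U1 x + R1 x\<bar> \<le> B + 36 * B\<^sup>2" "\<bar>Q x\<bar> \<le> B + 36 * B\<^sup>2" for x
      using UB[of x] RB[of x] zero_le_power2[of B] unfolding Q_def by linarith+
  qed
  have Qeq: "Q x = (U0 x + R x) - (R x + 2 * R1 x)" for x by (simp add: Q_def)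
  show "((\<lambda>x. U1 x + R1 x) has_real_derivative (U0 x + R x) - (R x + 2 * R1 x)) (at x)"
    using V'[of x] unfolding Qeq .
  have "continuous_on UNIV (\<lambda>x. R x + 2 * R1 x)" by (intro continuous_intros Rc)
  moreover have "\<bar>R x + 2 * R1 x\<bar> \<le> 54 * B\<^sup>2" for x using RB[of x] by linarith
  moreover have "\<bar>U0 x + R x\<bar> \<le> B + 18 * B\<^sup>2" "\<bar>U1 x + R1 x\<bar> \<le> B + 18 * B\<^sup>2" for x
    using UB[of x] RB[of x] by linarith+
  ultimately show "\<bar>U0 x + R x\<bar> \<le> green (\<lambda>y. \<bar>R y + 2 * R1 y\<bar>) x" "\<bar>U1 x + R1 x\<bar> \<le> green (\<lambda>y. \<bar>R y + 2 * R1 y\<bar>) x"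
    using green_bound[of "\<lambda>x. U0 x + R x" "\<lambda>x. U1 x + R1 x" "B + 18 * B\<^sup>2" "\<lambda>x. R x + 2 * R1 x" "54 * B\<^sup>2" x]
      DERIV_add[OF U0 Rd] V'[unfolded Qeq] by blast+
qed

section \<open>Gronwall's lemma and weighted norms of the Green convolution\<close>

lemma gronwall_differential:
  fixes S :: "real \<Rightarrow> real"
  assumes der: "\<And>t. t \<in> {0..T} \<Longrightarrow> \<exists>D\<le>K * S t. (S has_real_derivative D) (at t within {0..T})" and t: "t \<in> {0..T}"
  shows "S t \<le> S 0 * exp (K * t)"
proof -
  obtain D where D: "\<And>t. t \<in> {0..T} \<Longrightarrow> D t \<le> K * S t" "\<And>t. t \<in> {0..T} \<Longrightarrow> (S has_real_derivative D t) (at t within {0..T})"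
    using der by metis
  define f where "f t = S t * exp (- (K * t))" for t
  define f' where "f' t = (D t - K * S t) * exp (- (K * t))" for t
  have f: "(f has_real_derivative f' r) (at r within {0..T})" if "r \<in> {0..T}" for r
    unfolding f_def f'_def by (auto intro!: derivative_eq_intros D(2) that simp: algebra_simps)
  have f'0: "f' r \<le> 0" if "r \<in> {0..T}" for r
    unfolding f'_def using D(1)[OF that] by (simp add: mult_nonpos_nonneg)
  have "f t \<le> f 0"
  proof (cases "t = 0")
    case False
    then have t0: "0 < t" using t by simp
    have "\<exists>x\<in>{0<..<t}. f t - f 0 = (\<lambda>h. f' x * h) (t - 0)"
    proof (rule mvt_simple[OF t0])
      fix x assume "0 \<le> x" "x \<le> t"
      then show "(f has_derivative (\<lambda>h. f' x * h)) (at x within {0..t})"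
        using f[of x] t by (auto simp: has_field_derivative_def intro: has_derivative_subset)
    qed
    then obtain x where x: "x \<in> {0<..<t}" "f t - f 0 = f' x * t" by auto
    then have "f' x * t \<le> 0" using f'0[of x] t by (auto intro!: mult_nonpos_nonneg)
    with x(2) show ?thesis by simp
  qed simp
  then show ?thesis by (simp add: f_def exp_minus field_simps)
qed

lemma wnorm_density:
  assumes [measurable]: "f \<in> borel_measurable borel" "\<rho> \<in> borel_measurable borel" and "\<And>x. 0 \<le> \<rho> x"
  shows "wnorm (density lborel (\<lambda>x. ennreal (\<rho> x))) p f = (LINT x|lborel. \<bar>f x\<bar> powr p * \<rho> x) powr (1 / p)"
  unfolding wnorm_def using assms by (subst integral_density) (auto simp: mult.commute)

lemma finite_measure_density:
  assumes "integrable lborel \<rho>" "\<And>x. 0 \<le> \<rho> x"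
  shows "finite_measure (density lborel (\<lambda>x. ennreal (\<rho> x)))"
proof (rule finite_measureI)
  have [measurable]: "\<rho> \<in> borel_measurable borel" using assms by auto
  have "emeasure (density lborel (\<lambda>x. ennreal (\<rho> x))) (space (density lborel (\<lambda>x. ennreal (\<rho> x)))) = (\<integral>\<^sup>+x. ennreal (\<rho> x) \<partial>lborel)"
    by (simp add: emeasure_density)
  also have "\<dots> < \<infinity>" using assms by (subst nn_integral_eq_integral) auto
  finally show "emeasure (density lborel (\<lambda>x. ennreal (\<rho> x))) (space (density lborel (\<lambda>x. ennreal (\<rho> x)))) \<noteq> \<infinity>" by simp
qed

lemma green_nonneg: "(\<And>x. 0 \<le> h x) \<Longrightarrow> 0 \<le> green h x"
  unfolding green_def by (intro integral_nonneg_AE) auto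

lemma green_mono:
  fixes f g :: "real \<Rightarrow> real"
  assumes "f \<in> borel_measurable borel" "g \<in> borel_measurable borel" "\<And>x. \<bar>f x\<bar> \<le> B" "\<And>x. \<bar>g x\<bar> \<le> B" "\<And>x. f x \<le> g x"
  shows "green f x \<le> green g x"
proof -
  have i: "integrable lborel (\<lambda>y. exp (- \<bar>x - y\<bar>) / 2 * h y)" if "h \<in> borel_measurable borel" "\<And>x. \<bar>h x\<bar> \<le> B" for h
    using integrable_divide_zero[OF green_integrable[OF that, of x], of 2] by simp
  show ?thesis unfolding green_def by (intro integral_mono i assms mult_left_mono) auto
qed

lemma green_cmult: "green (\<lambda>y. c * h y) x = c * green h x"
  unfolding green_def by (subst integral_mult_right_zero[symmetric]) (simp add: mult.left_commute)

lemma green_le_sup: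
  fixes h :: "real \<Rightarrow> real"
  assumes "h \<in> borel_measurable borel" "\<And>x. \<bar>h x\<bar> \<le> B"
  shows "\<bar>green h x\<bar> \<le> B"
proof -
  have i: "integrable lborel (\<lambda>y. exp (- \<bar>x - y\<bar>) / 2 * h y)"
    using integrable_divide_zero[OF green_integrable[OF assms, of x], of 2] by simp
  have "\<bar>green h x\<bar> \<le> (LINT y|lborel. \<bar>exp (- \<bar>x - y\<bar>) / 2 * h y\<bar>)" unfolding green_def by (rule integral_abs_bound)
  also have "\<dots> \<le> (LINT y|lborel. exp (- \<bar>x - y\<bar>) * (B / 2))"
    using exp_abs_integrable[of x] assms(2) by (intro integral_mono integrable_abs i) (auto simp: abs_mult mult_left_mono)
  also have "\<dots> = B" using exp_abs_integrable[of x] by (simp add: exp_abs_integral)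
  finally show ?thesis .
qed

text \<open>Convolution commutes with translation, and the kernel is nonnegative of mass 1, so an
  additive error passes through unchanged.\<close>

lemma green_shift_le:
  fixes h :: "real \<Rightarrow> real"
  assumes hm: "h \<in> borel_measurable borel" "\<And>x. \<bar>h x\<bar> \<le> B" and sh: "\<And>x. h (x + s) \<le> h x + e"
  shows "green h (x + s) \<le> green h x + e"
proof -
  have [measurable]: "h \<in> borel_measurable borel" by (rule hm)
  have i: "integrable lborel (\<lambda>y. exp (- \<bar>x - y\<bar>) / 2 * h' y)" if "h' \<in> borel_measurable borel" "\<And>x. \<bar>h' x\<bar> \<le> C" for h' C
    using integrable_divide_zero[OF green_integrable[OF that, of x], of 2] by simp
  have "green h (x + s) = (LINT y|lborel. exp (- \<bar>x - y\<bar>) / 2 * h (y + s))"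
    unfolding green_def by (subst lborel_integral_real_affine[where c = 1 and t = s]) (auto simp: add.commute)
  also have "\<dots> \<le> (LINT y|lborel. exp (- \<bar>x - y\<bar>) / 2 * h y + exp (- \<bar>x - y\<bar>) / 2 * e)"
  proof (rule integral_mono)
    show "integrable lborel (\<lambda>y. exp (- \<bar>x - y\<bar>) / 2 * h (y + s))" by (rule i) (use hm(2) in auto)
    show "integrable lborel (\<lambda>y. exp (- \<bar>x - y\<bar>) / 2 * h y + exp (- \<bar>x - y\<bar>) / 2 * e)"
      by (intro Bochner_Integration.integrable_add i[of _ B] i[of _ "\<bar>e\<bar>"]) (use hm in auto)
    fix y
    have "exp (- \<bar>x - y\<bar>) / 2 * h (y + s) \<le> exp (- \<bar>x - y\<bar>) / 2 * (h y + e)" by (intro mult_left_mono sh) auto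
    then show "exp (- \<bar>x - y\<bar>) / 2 * h (y + s) \<le> exp (- \<bar>x - y\<bar>) / 2 * h y + exp (- \<bar>x - y\<bar>) / 2 * e"
      by (simp only: distrib_left)
  qed
  also have "\<dots> = green h x + (LINT y|lborel. exp (- \<bar>x - y\<bar>) / 2 * e)"
    unfolding green_def by (intro Bochner_Integration.integral_add i[of _ B] i[of _ "\<bar>e\<bar>"]) (use hm in auto)
  also have "(LINT y|lborel. exp (- \<bar>x - y\<bar>) / 2 * e) = e" using exp_abs_integrable[of x] by (simp add: exp_abs_integral)
  finally show ?thesis .
qed

lemma green_measurable[measurable (raw)]:
  assumes [measurable]: "h \<in> borel_measurable borel"
  shows "green h \<in> borel_measurable borel"
  unfolding green_def[abs_def] by measurable

text \<open>The hypothesis \<open>mod\<close> is moderateness in the form needed for convolutions: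
  it moves the weight from the point \<open>x\<close> to \<open>y\<close> at the price of replacing
  the Green kernel by \<kappa>. Young's inequality with the mass \<open>J\<close> of \<kappa> does
  the rest. It is asked only for almost every \<open>y\<close>, since \<kappa> will come from a
  Borel version.\<close>

lemma wnorm_green_le:
  fixes w \<kappa> n :: "real \<Rightarrow> real"
  assumes p: "1 < p" and J: "0 < J" and km: "\<kappa> \<in> borel_measurable borel" and k0: "\<And>x. 0 \<le> \<kappa> x"
    and kJ: "(\<integral>\<^sup>+x. ennreal (\<kappa> x) \<partial>lborel) \<le> ennreal J"
    and mod: "\<And>x. AE y in lborel. exp (- \<bar>x - y\<bar>) / 2 * w x \<le> \<kappa> (x - y) * w y"
    and w0: "\<And>x. 0 < w x" and wB: "\<And>x. w x \<le> C" and wm: "w \<in> borel_measurable borel"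
    and wi: "integrable lborel (\<lambda>x. w x powr p)"
    and nm: "n \<in> borel_measurable borel" and n0: "\<And>x. 0 \<le> n x" and nB: "\<And>x. n x \<le> D"
  shows "wnorm (density lborel (\<lambda>x. ennreal (w x powr p))) p (green n)
    \<le> J * wnorm (density lborel (\<lambda>x. ennreal (w x powr p))) p n"
proof -
  note [measurable] = km wm nm
  have D0: "0 \<le> D" using n0[of 0] nB[of 0] by linarith
  have nabs: "\<bar>n x\<bar> \<le> D" for x using n0[of x] nB[of x] by simp
  define F where "F y = n y * w y" for y
  have [measurable]: "F \<in> borel_measurable borel" unfolding F_def[abs_def] by measurable
  have F0: "0 \<le> F y" for y using n0[of y] w0[of y] by (simp add: F_def)
  have FB: "F y \<le> D * C" for y unfolding F_def using n0 nB[of y] wB[of y] w0[of y] D0 by (intro mult_mono) auto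
  note cp = convolution_powr_bound[OF p J km _ k0 F0 FB kJ]
  define A where "A x = (LINT y|lborel. \<kappa> (x - y) * F y)" for x
  have Am[measurable]: "A \<in> borel_measurable borel" unfolding A_def[abs_def] by measurable
  have gA: "green n x * w x \<le> A x" for x
  proof -
    have "green n x * w x = (LINT y|lborel. exp (- \<bar>x - y\<bar>) / 2 * n y * w x)" unfolding green_def by simp
    also have "\<dots> \<le> A x"
      unfolding A_def
    proof (rule integral_mono_AE)
      show "integrable lborel (\<lambda>y. exp (- \<bar>x - y\<bar>) / 2 * n y * w x)"
        using integrable_mult_left[OF green_integrable[OF nm nabs, of x], of "w x / 2"] by (simp add: mult_ac)
      show "integrable lborel (\<lambda>y. \<kappa> (x - y) * F y)" by (rule cp(1)) simp
      show "AE y in lborel. exp (- \<bar>x - y\<bar>) / 2 * n y * w x \<le> \<kappa> (x - y) * F y"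
        using mod[of x]
      proof eventually_elim
        case (elim y)
        from mult_right_mono[OF this n0[of y]] show ?case by (simp add: F_def mult_ac)
      qed
    qed
    finally show ?thesis .
  qed
  have g0: "0 \<le> green n x" for x by (rule green_nonneg[OF n0])
  have gm: "green n \<in> borel_measurable borel" by (rule green_measurable[OF nm])
  have gabs: "\<bar>green n x\<bar> \<le> D" for x by (rule green_le_sup[OF nm nabs])
  have int: "integrable lborel (\<lambda>x. \<bar>h x\<bar> powr p * w x powr p)" if [measurable]: "h \<in> borel_measurable borel" and "\<And>x. \<bar>h x\<bar> \<le> D" for h
  proof (rule Bochner_Integration.integrable_bound[where f = "\<lambda>x. D powr p * w x powr p"])
    show "AE x in lborel. norm (\<bar>h x\<bar> powr p * w x powr p) \<le> norm (D powr p * w x powr p)"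
      using that(2) p by (intro AE_I2) (auto simp: abs_mult intro!: mult_right_mono powr_mono2)
    show "integrable lborel (\<lambda>x. D powr p * w x powr p)" by (rule integrable_mult_right[OF wi])
  qed measurable
  have "ennreal (LINT x|lborel. \<bar>green n x\<bar> powr p * w x powr p) = (\<integral>\<^sup>+x. ennreal (\<bar>green n x\<bar> powr p * w x powr p) \<partial>lborel)"
    by (rule nn_integral_eq_integral[symmetric, OF int[OF gm gabs]]) auto
  also have "\<dots> \<le> (\<integral>\<^sup>+x. ennreal (A x powr p) \<partial>lborel)"
  proof (intro nn_integral_mono ennreal_leI)
    fix x
    have "\<bar>green n x\<bar> powr p * w x powr p = (green n x * w x) powr p"
      using g0[of x] w0[of x] by (simp add: powr_mult)
    also have "\<dots> \<le> A x powr p" using g0[of x] w0[of x] gA[of x] p by (intro powr_mono2) (auto intro: less_imp_le)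
    finally show "\<bar>green n x\<bar> powr p * w x powr p \<le> A x powr p" .
  qed
  also have "\<dots> \<le> ennreal (J powr p) * (\<integral>\<^sup>+x. ennreal (F x powr p) \<partial>lborel)"
    unfolding A_def by (rule cp(2)) simp
  also have "(\<integral>\<^sup>+x. ennreal (F x powr p) \<partial>lborel) = ennreal (LINT x|lborel. \<bar>n x\<bar> powr p * w x powr p)"
  proof -
    have eq: "F x powr p = \<bar>n x\<bar> powr p * w x powr p" for x
      unfolding F_def using n0[of x] w0[of x] by (simp add: powr_mult)
    show ?thesis unfolding eq by (rule nn_integral_eq_integral[OF int[OF nm nabs]]) auto
  qed
  also have "ennreal (J powr p) * \<dots> = ennreal (J powr p * (LINT x|lborel. \<bar>n x\<bar> powr p * w x powr p))"
    by (rule ennreal_mult'[symmetric]) simp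
  finally have "(LINT x|lborel. \<bar>green n x\<bar> powr p * w x powr p) \<le> J powr p * (LINT x|lborel. \<bar>n x\<bar> powr p * w x powr p)"
    by (subst (asm) ennreal_le_iff) (auto intro!: mult_nonneg_nonneg integral_nonneg_AE)
  then have "(LINT x|lborel. \<bar>green n x\<bar> powr p * w x powr p) powr (1 / p) \<le> (J powr p * (LINT x|lborel. \<bar>n x\<bar> powr p * w x powr p)) powr (1 / p)"
    using p by (intro powr_mono2) (auto intro!: integral_nonneg_AE)
  also have "\<dots> = J * (LINT x|lborel. \<bar>n x\<bar> powr p * w x powr p) powr (1 / p)"
    using J p by (subst powr_mult) (auto intro!: integral_nonneg_AE simp: powr_powr)
  finally show ?thesis by (subst (1 2) wnorm_density) (use gm in auto)
qed

section \<open>Weighted estimates for classical solutions\<close>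

definition source :: "real \<Rightarrow> real \<Rightarrow> real" where
  "source a b = (2 * a - b)\<^sup>2"

definition source_deriv :: "real \<Rightarrow> real \<Rightarrow> real \<Rightarrow> real" where
  "source_deriv a b c = 2 * (2 * a - b) * (2 * b - c)"

text \<open>Here \<open>f0, f1, f2, U0, U1\<close> stand for \<open>u, u\<^sub>x, u\<^sub>x\<^sub>x, u\<^sub>t, u\<^sub>t\<^sub>x\<close>.  With \<open>R = (2 u - u\<^sub>x)\<^sup>2\<close> the equation reads
  \<open>(1 - \<partial>\<^sub>x\<^sup>2) (u\<^sub>t + R) = R + 2 R\<^sub>x\<close>, which is \<open>V_deriv\<close>; the bounds \<open>Y_green\<close> and \<open>V_green\<close> come from
  inverting \<open>1 - \<partial>\<^sub>x\<^sup>2\<close>.\<close>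

locale classical_solution =
  fixes T M H \<gamma> :: real and f0 f1 f2 U0 U1 :: "real \<Rightarrow> real \<Rightarrow> real"
  assumes T: "0 < T" and \<gamma>: "0 < \<gamma>" and H: "0 \<le> H"
    and f0_deriv: "\<And>t x. t \<in> {0..T} \<Longrightarrow> (f0 t has_real_derivative f1 t x) (at x)"
    and f1_deriv: "\<And>t x. t \<in> {0..T} \<Longrightarrow> (f1 t has_real_derivative f2 t x) (at x)"
    and f2_holder: "\<And>t x h. t \<in> {0..T} \<Longrightarrow> \<bar>f2 t (x + h) - f2 t x\<bar> \<le> H * \<bar>h\<bar> powr \<gamma>"
    and sum_bound: "\<And>t x. t \<in> {0..T} \<Longrightarrow> \<bar>f0 t x\<bar> + \<bar>f1 t x\<bar> + \<bar>f2 t x\<bar> \<le> M"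
    and U0_deriv: "\<And>t x. t \<in> {0..T} \<Longrightarrow> (U0 t has_real_derivative U1 t x) (at x)"
    and U1_cont: "\<And>t. t \<in> {0..T} \<Longrightarrow> continuous_on UNIV (U1 t)"
    and U_bdd: "\<And>t. t \<in> {0..T} \<Longrightarrow> \<exists>B. \<forall>x. \<bar>U0 t x\<bar> \<le> B \<and> \<bar>U1 t x\<bar> \<le> B"
    and f0_time: "\<And>t x. t \<in> {0..T} \<Longrightarrow> ((\<lambda>\<tau>. f0 \<tau> x) has_real_derivative U0 t x) (at t within {0..T})"
    and f1_time: "\<And>t x. t \<in> {0..T} \<Longrightarrow> ((\<lambda>\<tau>. f1 \<tau> x) has_real_derivative U1 t x) (at t within {0..T})"
    and time_lip: "\<And>t. t \<in> {0..T} \<Longrightarrow> \<exists>L. \<forall>\<tau>\<in>{0..T}. \<forall>x.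
      \<bar>f0 \<tau> x - f0 t x\<bar> \<le> L * \<bar>\<tau> - t\<bar> \<and> \<bar>f1 \<tau> x - f1 t x\<bar> \<le> L * \<bar>\<tau> - t\<bar>"
    and V_deriv: "\<And>t x. t \<in> {0..T} \<Longrightarrow> ((\<lambda>x. U1 t x + source_deriv (f0 t x) (f1 t x) (f2 t x)) has_real_derivative
      (U0 t x + source (f0 t x) (f1 t x)) - (source (f0 t x) (f1 t x) + 2 * source_deriv (f0 t x) (f1 t x) (f2 t x))) (at x)"
    and Y_green: "\<And>t x. t \<in> {0..T} \<Longrightarrow> \<bar>U0 t x + source (f0 t x) (f1 t x)\<bar>
      \<le> green (\<lambda>y. \<bar>source (f0 t y) (f1 t y) + 2 * source_deriv (f0 t y) (f1 t y) (f2 t y)\<bar>) x"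
    and V_green: "\<And>t x. t \<in> {0..T} \<Longrightarrow> \<bar>U1 t x + source_deriv (f0 t x) (f1 t x) (f2 t x)\<bar>
      \<le> green (\<lambda>y. \<bar>source (f0 t y) (f1 t y) + 2 * source_deriv (f0 t y) (f1 t y) (f2 t y)\<bar>) x"
begin

definition amplitude :: "real \<Rightarrow> real \<Rightarrow> real" where
  "amplitude t x = \<bar>f0 t x\<bar> + \<bar>f1 t x\<bar> + \<bar>f2 t x\<bar>"

definition speed :: "real \<Rightarrow> real \<Rightarrow> real" where
  "speed t x = 4 * f0 t x - 2 * f1 t x"

text \<open>\<open>u\<^sub>x\<^sub>x\<close> has no classical time derivative, so the energy estimate is run for a spatial difference
  quotient of \<open>u\<^sub>x\<close>, which solves a transport equation with velocity \<open>speed\<close> and right-hand side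
  \<open>forcing\<close>, and the step \<open>h\<close> tends to 0 afterwards.\<close>

definition quot :: "real \<Rightarrow> real \<Rightarrow> real \<Rightarrow> real" where
  "quot h t x = (f1 t (x + h) - f1 t x) / h"

definition quot_deriv :: "real \<Rightarrow> real \<Rightarrow> real \<Rightarrow> real" where
  "quot_deriv h t x = (f2 t (x + h) - f2 t x) / h"

definition forcing :: "real \<Rightarrow> real \<Rightarrow> real \<Rightarrow> real" where
  "forcing h t x = (U1 t (x + h) - U1 t x) / h - speed t x * quot_deriv h t x"

text \<open>The largest possible change of \<open>amplitude\<close> over a distance
  \<open>h\<close>: u and u_x are Lipschitz with constant \<open>M\<close>, whence
  \<open>2 * M * h\<close>, and u_xx is Hoelder.\<close>

definition modulus :: "real \<Rightarrow> real" where
  "modulus h = 2 * M * h + H * h powr \<gamma>"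

lemma amplitude_nonneg: "0 \<le> amplitude t x" and amplitude_le: "t \<in> {0..T} \<Longrightarrow> amplitude t x \<le> M"
  using sum_bound[of t x] by (auto simp: amplitude_def)

lemma f_le_amplitude: "0 \<le> \<bar>f0 t x\<bar>" "0 \<le> \<bar>f1 t x\<bar>" "\<bar>f0 t x\<bar> \<le> amplitude t x" "\<bar>f1 t x\<bar> \<le> amplitude t x" "\<bar>f2 t x\<bar> \<le> amplitude t x"
  by (simp_all add: amplitude_def)

lemma amplitude_split: "\<bar>f0 t x\<bar> + \<bar>f1 t x\<bar> \<le> amplitude t x" "\<bar>f1 t x\<bar> + \<bar>f2 t x\<bar> \<le> amplitude t x"
  by (simp_all add: amplitude_def)

lemma M_nonneg: "0 \<le> M"
  using amplitude_nonneg[of 0 0] amplitude_le[of 0 0] T by (auto intro: order_trans)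

lemma f_bound: "t \<in> {0..T} \<Longrightarrow> \<bar>f0 t x\<bar> \<le> M" "t \<in> {0..T} \<Longrightarrow> \<bar>f1 t x\<bar> \<le> M" "t \<in> {0..T} \<Longrightarrow> \<bar>f2 t x\<bar> \<le> M"
  using sum_bound[of t x] by linarith+

lemma f0_cont: "t \<in> {0..T} \<Longrightarrow> continuous_on UNIV (f0 t)"
  by (meson DERIV_isCont continuous_at_imp_continuous_on f0_deriv)

lemma f1_cont: "t \<in> {0..T} \<Longrightarrow> continuous_on UNIV (f1 t)"
  by (meson DERIV_isCont continuous_at_imp_continuous_on f1_deriv)

lemma U0_cont: "t \<in> {0..T} \<Longrightarrow> continuous_on UNIV (U0 t)"
  by (meson DERIV_isCont continuous_at_imp_continuous_on U0_deriv)

lemma f2_cont: "t \<in> {0..T} \<Longrightarrow> continuous_on UNIV (f2 t)"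
proof -
  assume t: "t \<in> {0..T}"
  have "isCont (f2 t) x" for x
  proof -
    have "((\<lambda>h. H * \<bar>h\<bar> powr \<gamma>) \<longlongrightarrow> H * \<bar>0\<bar> powr \<gamma>) (at 0)"
      using \<gamma> by (intro tendsto_intros tendsto_powr2) (auto intro!: always_eventually)
    then have 1: "((\<lambda>h. H * \<bar>h\<bar> powr \<gamma>) \<longlongrightarrow> 0) (at 0)" using \<gamma> by simp
    have 2: "\<forall>\<^sub>F h in at 0. norm (f2 t (x + h) - f2 t x) \<le> H * \<bar>h\<bar> powr \<gamma>"
      by (rule always_eventually) (simp add: f2_holder[OF t])
    have "((\<lambda>h. f2 t (x + h) - f2 t x) \<longlongrightarrow> 0) (at 0)" by (rule Lim_null_comparison[OF 2 1])
    then show ?thesis unfolding isCont_iff by (simp add: LIM_zero_iff)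
  qed
  then show ?thesis by (simp add: continuous_at_imp_continuous_on)
qed

lemma amplitude_cont: "t \<in> {0..T} \<Longrightarrow> continuous_on UNIV (amplitude t)"
  unfolding amplitude_def by (intro continuous_intros f0_cont f1_cont f2_cont)

lemma amplitude_measurable: "t \<in> {0..T} \<Longrightarrow> amplitude t \<in> borel_measurable borel"
  by (rule borel_measurable_continuous_onI[OF amplitude_cont])

lemma amplitude_abs: "t \<in> {0..T} \<Longrightarrow> \<bar>amplitude t x\<bar> \<le> M"
  using amplitude_nonneg[of t x] amplitude_le[of t x] by simp

text \<open>Each term is a product of two linear expressions; the first is bounded by
  \<open>2 * M\<close>, the second by twice the amplitude. This asymmetric treatment makes the rate
  linear in \<open>M\<close>.\<close>

lemma source_bounds:
  assumes t: "t \<in> {0..T}"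
  shows "\<bar>source (f0 t x) (f1 t x)\<bar> \<le> 4 * M * amplitude t x"
    and "\<bar>source_deriv (f0 t x) (f1 t x) (f2 t x)\<bar> \<le> 8 * M * amplitude t x"
    and "\<bar>source (f0 t x) (f1 t x) + 2 * source_deriv (f0 t x) (f1 t x) (f2 t x)\<bar> \<le> 20 * M * amplitude t x"
proof -
  have d1: "\<bar>2 * f0 t x - f1 t x\<bar> \<le> 2 * amplitude t x"
    using abs_triangle_ineq4[of "2 * f0 t x" "f1 t x"] f_le_amplitude[of t x] amplitude_split[of t x] by (simp add: abs_mult)
  have d2: "\<bar>2 * f1 t x - f2 t x\<bar> \<le> 2 * amplitude t x"
    using abs_triangle_ineq4[of "2 * f1 t x" "f2 t x"] f_le_amplitude[of t x] amplitude_split[of t x] by (simp add: abs_mult)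
  note d = d1 d2
  have dM: "\<bar>2 * f0 t x - f1 t x\<bar> \<le> 2 * M" using d(1) amplitude_le[OF t, of x] by linarith
  have "\<bar>2 * f0 t x - f1 t x\<bar> * \<bar>2 * f0 t x - f1 t x\<bar> \<le> (2 * M) * (2 * amplitude t x)"
    using d dM M_nonneg by (intro mult_mono) auto
  then show 1: "\<bar>source (f0 t x) (f1 t x)\<bar> \<le> 4 * M * amplitude t x"
    by (simp add: source_def power2_eq_square abs_mult)
  have "\<bar>2 * f0 t x - f1 t x\<bar> * \<bar>2 * f1 t x - f2 t x\<bar> \<le> (2 * M) * (2 * amplitude t x)"
    using d dM M_nonneg by (intro mult_mono) auto
  moreover have "\<bar>source_deriv (f0 t x) (f1 t x) (f2 t x)\<bar> = 2 * (\<bar>2 * f0 t x - f1 t x\<bar> * \<bar>2 * f1 t x - f2 t x\<bar>)"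
    by (simp only: source_deriv_def abs_mult abs_numeral mult.assoc)
  ultimately show 2: "\<bar>source_deriv (f0 t x) (f1 t x) (f2 t x)\<bar> \<le> 8 * M * amplitude t x" by simp
  show "\<bar>source (f0 t x) (f1 t x) + 2 * source_deriv (f0 t x) (f1 t x) (f2 t x)\<bar> \<le> 20 * M * amplitude t x"
    using 1 2 by linarith
qed

lemma green_source_le:
  assumes t: "t \<in> {0..T}"
  shows "green (\<lambda>y. \<bar>source (f0 t y) (f1 t y) + 2 * source_deriv (f0 t y) (f1 t y) (f2 t y)\<bar>) x \<le> 20 * M * green (amplitude t) x"
proof -
  let ?s = "\<lambda>y. \<bar>source (f0 t y) (f1 t y) + 2 * source_deriv (f0 t y) (f1 t y) (f2 t y)\<bar>"
  have "continuous_on UNIV ?s"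
    unfolding source_def source_deriv_def by (intro continuous_intros f0_cont f1_cont f2_cont t)
  then have "?s \<in> borel_measurable borel" by (rule borel_measurable_continuous_onI)
  moreover have b: "20 * M * amplitude t y \<le> 20 * M * M" for y using amplitude_le[OF t, of y] M_nonneg by (intro mult_left_mono) auto
  moreover have "\<bar>?s y\<bar> \<le> 20 * M * M" for y using source_bounds(3)[OF t, of y] b[of y] by linarith
  moreover have "\<bar>20 * M * amplitude t y\<bar> \<le> 20 * M * M" for y using b[of y] amplitude_nonneg[of t y] M_nonneg by simp
  moreover have "(\<lambda>y. 20 * M * amplitude t y) \<in> borel_measurable borel"
    by (intro borel_measurable_times borel_measurable_const amplitude_measurable t)
  ultimately have "green ?s x \<le> green (\<lambda>y. 20 * M * amplitude t y) x"
    using source_bounds(3)[OF t] by (intro green_mono[where B = "20 * M * M"]) auto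
  then show ?thesis by (simp add: green_cmult)
qed

text \<open>The nonlocal part costs \<open>20 * M\<close> times the convolution and the subtracted
  source at most \<open>8 * M\<close> times the amplitude. The coefficient 40 is generous so that
  the same bound also covers \<open>forcing_bound\<close>.\<close>

lemma U_bounds:
  assumes t: "t \<in> {0..T}"
  shows "\<bar>U0 t x\<bar> \<le> 40 * M * amplitude t x + 20 * M * green (amplitude t) x"
    and "\<bar>U1 t x\<bar> \<le> 40 * M * amplitude t x + 20 * M * green (amplitude t) x"
proof -
  have "0 \<le> M * amplitude t x" using M_nonneg amplitude_nonneg by simp
  then show "\<bar>U0 t x\<bar> \<le> 40 * M * amplitude t x + 20 * M * green (amplitude t) x"
    "\<bar>U1 t x\<bar> \<le> 40 * M * amplitude t x + 20 * M * green (amplitude t) x"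
    using Y_green[OF t, of x] V_green[OF t, of x] green_source_le[OF t, of x] source_bounds[OF t, of x] by linarith+
qed

lemma speed_bound: "t \<in> {0..T} \<Longrightarrow> \<bar>speed t x\<bar> \<le> 4 * M"
  using sum_bound[of t x] unfolding speed_def by linarith

lemma speed_deriv: "t \<in> {0..T} \<Longrightarrow> (speed t has_real_derivative 4 * f1 t x - 2 * f2 t x) (at x)"
  unfolding speed_def by (auto intro!: derivative_eq_intros f0_deriv f1_deriv)

lemma speed_deriv_bound: "t \<in> {0..T} \<Longrightarrow> \<bar>4 * f1 t x - 2 * f2 t x\<bar> \<le> 4 * M"
  using sum_bound[of t x] by linarith

lemma speed_lip: "t \<in> {0..T} \<Longrightarrow> \<bar>speed t x - speed t y\<bar> \<le> 4 * M * \<bar>x - y\<bar>"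
  using field_differentiable_bound[of UNIV "speed t" "\<lambda>x. 4 * f1 t x - 2 * f2 t x" "4 * M" x y] speed_deriv speed_deriv_bound by auto

lemma f_lip:
  assumes t: "t \<in> {0..T}"
  shows "\<bar>f0 t x - f0 t y\<bar> \<le> M * \<bar>x - y\<bar>" "\<bar>f1 t x - f1 t y\<bar> \<le> M * \<bar>x - y\<bar>"
  using field_differentiable_bound[of UNIV "f0 t" "f1 t" M x y] field_differentiable_bound[of UNIV "f1 t" "f2 t" M x y]
    f0_deriv[OF t] f1_deriv[OF t] f_bound[OF t] by auto

lemma modulus_nonneg: "0 \<le> h \<Longrightarrow> 0 \<le> modulus h"
  using M_nonneg H by (simp add: modulus_def)

lemma amplitude_shift:
  assumes t: "t \<in> {0..T}" and h: "0 \<le> s" "s \<le> h"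
  shows "amplitude t (x + s) \<le> amplitude t x + modulus h"
proof -
  have 1: "\<bar>f0 t (x + s) - f0 t x\<bar> \<le> M * h" "\<bar>f1 t (x + s) - f1 t x\<bar> \<le> M * h"
    using f_lip[OF t, of "x + s" x] h mult_left_mono[OF h(2) M_nonneg] by auto
  have "H * \<bar>s\<bar> powr \<gamma> \<le> H * h powr \<gamma>" using h \<gamma> H by (intro mult_left_mono powr_mono2) auto
  then have 2: "\<bar>f2 t (x + s) - f2 t x\<bar> \<le> H * h powr \<gamma>" using f2_holder[OF t, of x s] by linarith
  show ?thesis unfolding amplitude_def modulus_def using 1 2 by linarith
qed

lemma green_amplitude_shift:
  assumes t: "t \<in> {0..T}" and h: "0 \<le> s" "s \<le> h"
  shows "green (amplitude t) (x + s) \<le> green (amplitude t) x + modulus h"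
  by (rule green_shift_le[OF amplitude_measurable[OF t] amplitude_abs[OF t] amplitude_shift[OF t h]])

lemma quot_close:
  assumes t: "t \<in> {0..T}" and h: "0 < h"
  shows "\<bar>quot h t x - f2 t x\<bar> \<le> modulus h"
proof -
  obtain z where z: "x < z" "z < x + h" "f1 t (x + h) - f1 t x = (x + h - x) * f2 t z"
    using MVT2[of x "x + h" "f1 t" "f2 t"] f1_deriv[OF t] h by auto
  then have "quot h t x = f2 t z" using h by (simp add: quot_def)
  moreover have "\<bar>f2 t (x + (z - x)) - f2 t x\<bar> \<le> H * \<bar>z - x\<bar> powr \<gamma>" by (rule f2_holder[OF t])
  moreover have "H * \<bar>z - x\<bar> powr \<gamma> \<le> H * h powr \<gamma>" using z \<gamma> H by (intro mult_left_mono powr_mono2) auto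
  moreover have "0 \<le> 2 * M * h" using M_nonneg h by simp
  ultimately show ?thesis by (simp add: modulus_def)
qed

text \<open>\<open>U1\<close> and \<open>speed * f2\<close> have no x-derivative of their own, but
  their difference does: R_x = speed * (2 u_x - u_xx), so the difference equals V - 2 speed u_x, in
  which u_xx occurs only inside V. The mean value theorem bounds its difference quotient
  independently of \<open>h\<close>, up to the shift error \<open>modulus h\<close>.\<close>

lemma forcing_bound:
  assumes t: "t \<in> {0..T}" and h: "0 < h"
  shows "\<bar>forcing h t x\<bar> \<le> 40 * M * amplitude t x + 20 * M * green (amplitude t) x + 60 * M * modulus h"
proof -
  define k where "k x = U1 t x - speed t x * f2 t x" for x
  define V where "V x = U1 t x + source_deriv (f0 t x) (f1 t x) (f2 t x)" for x
  define V' where "V' x = (U0 t x + source (f0 t x) (f1 t x)) - (source (f0 t x) (f1 t x) + 2 * source_deriv (f0 t x) (f1 t x) (f2 t x))" for x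
  define k' where "k' x = V' x - 2 * ((4 * f1 t x - 2 * f2 t x) * f1 t x + speed t x * f2 t x)" for x
  \<comment> \<open>The u_xx terms of \<open>U1 - speed * f2\<close> are hidden in \<open>V\<close>;
    what remains is differentiable.\<close>
  have kV: "k = (\<lambda>x. V x - 2 * (speed t x * f1 t x))"
    by (rule ext) (simp add: k_def V_def source_deriv_def speed_def algebra_simps)
  have "((\<lambda>x. V x - 2 * (speed t x * f1 t x)) has_real_derivative k' x) (at x)" for x
  proof -
    have "(V has_real_derivative V' x) (at x)" unfolding V_def V'_def by (rule V_deriv[OF t])
    moreover have "((\<lambda>x. speed t x * f1 t x) has_real_derivative (4 * f1 t x - 2 * f2 t x) * f1 t x + speed t x * f2 t x) (at x)"
      by (rule DERIV_cong[OF DERIV_mult[OF speed_deriv[OF t] f1_deriv[OF t]]]) (simp add: algebra_simps)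
    ultimately show ?thesis unfolding k'_def by (intro DERIV_diff DERIV_cmult)
  qed
  then have k_deriv: "(k has_real_derivative k' x) (at x)" for x unfolding kV .
  have k'_bound: "\<bar>k' x\<bar> \<le> 36 * M * amplitude t x + 20 * M * green (amplitude t) x" for x
  proof -
    have b1: "\<bar>(4 * f1 t x - 2 * f2 t x) * f1 t x\<bar> \<le> 4 * M * amplitude t x"
      unfolding abs_mult using speed_deriv_bound[OF t, of x] M_nonneg by (intro mult_mono) (auto simp: amplitude_def)
    have b2: "\<bar>speed t x * f2 t x\<bar> \<le> 4 * M * amplitude t x"
      unfolding abs_mult using speed_bound[OF t, of x] M_nonneg by (intro mult_mono) (auto simp: amplitude_def)
    have "\<bar>y - s - 2 * (b + c)\<bar> \<le> \<bar>y\<bar> + \<bar>s\<bar> + 2 * \<bar>b\<bar> + 2 * \<bar>c\<bar>" for y s b c :: real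
      by (smt (verit))
    note this[of "U0 t x + source (f0 t x) (f1 t x)" "source (f0 t x) (f1 t x) + 2 * source_deriv (f0 t x) (f1 t x) (f2 t x)"
      "(4 * f1 t x - 2 * f2 t x) * f1 t x" "speed t x * f2 t x"]
    then have "\<bar>k' x\<bar> \<le> \<bar>U0 t x + source (f0 t x) (f1 t x)\<bar>
        + \<bar>source (f0 t x) (f1 t x) + 2 * source_deriv (f0 t x) (f1 t x) (f2 t x)\<bar>
        + 2 * \<bar>(4 * f1 t x - 2 * f2 t x) * f1 t x\<bar> + 2 * \<bar>speed t x * f2 t x\<bar>"
      unfolding k'_def V'_def .
    moreover note b1 b2 Y_green[OF t, of x] green_source_le[OF t, of x] source_bounds(3)[OF t, of x]
    ultimately show ?thesis by linarith
  qed
  obtain z where z: "x < z" "z < x + h" "k (x + h) - k x = (x + h - x) * k' z"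
    using MVT2[of x "x + h" k k'] k_deriv h by auto
  \<comment> \<open>Discrete product rule: the quotient of \<open>speed * f2\<close> is
    \<open>speed\<close> at \<open>x\<close> times the quotient of \<open>f2\<close>, plus the
    quotient of \<open>speed\<close> times \<open>f2\<close> at \<open>x + h\<close>. Since
    \<open>speed\<close> is Lipschitz, this commutator is bounded.\<close>
  have "forcing h t x = (k (x + h) - k x) / h + (speed t (x + h) - speed t x) / h * f2 t (x + h)"
    using h unfolding forcing_def quot_deriv_def k_def by (simp add: field_simps)
  also have "(k (x + h) - k x) / h = k' z" using z h by simp
  finally have forcing: "forcing h t x = k' z + (speed t (x + h) - speed t x) / h * f2 t (x + h)" .
  have nz: "amplitude t z \<le> amplitude t x + modulus h" "green (amplitude t) z \<le> green (amplitude t) x + modulus h"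
    using amplitude_shift[OF t, of "z - x" h x] green_amplitude_shift[OF t, of "z - x" h x] z by auto
  have "36 * M * amplitude t z \<le> 36 * M * (amplitude t x + modulus h)" "20 * M * green (amplitude t) z \<le> 20 * M * (green (amplitude t) x + modulus h)"
    using nz M_nonneg by (auto intro!: mult_left_mono)
  then have 1: "\<bar>k' z\<bar> \<le> 36 * M * (amplitude t x + modulus h) + 20 * M * (green (amplitude t) x + modulus h)" using k'_bound[of z] by linarith
  have "\<bar>(speed t (x + h) - speed t x) / h\<bar> \<le> 4 * M"
    using speed_lip[OF t, of "x + h" x] h by (simp add: abs_divide pos_divide_le_eq)
  moreover have "\<bar>f2 t (x + h)\<bar> \<le> amplitude t x + modulus h"
    using amplitude_shift[OF t, of h h x] h order_trans[OF f_le_amplitude(5)] by simp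
  ultimately have 2: "\<bar>(speed t (x + h) - speed t x) / h * f2 t (x + h)\<bar> \<le> 4 * M * (amplitude t x + modulus h)"
    unfolding abs_mult using M_nonneg by (intro mult_mono) auto
  \<comment> \<open>The coefficient 36 collects 20 from the source and 8 from each of the two
    products in \<open>k'\<close>; the commutator adds 4. The shift error occurs with 36 + 20 +
    4.\<close>
  have 3: "36 * M * (amplitude t x + modulus h) + 20 * M * (green (amplitude t) x + modulus h) + 4 * M * (amplitude t x + modulus h)
      = 40 * M * amplitude t x + 20 * M * green (amplitude t) x + 60 * M * modulus h" by (simp add: algebra_simps)
  show ?thesis unfolding forcing 3[symmetric] by (intro order_trans[OF abs_triangle_ineq] add_mono 1 2)
qed

lemma quot_cont: "t \<in> {0..T} \<Longrightarrow> continuous_on UNIV (quot h t)"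
  unfolding quot_def divide_inverse
  by (intro continuous_intros f1_cont continuous_on_compose2[OF f1_cont]) auto

lemma quot_deriv_cont: "t \<in> {0..T} \<Longrightarrow> continuous_on UNIV (quot_deriv h t)"
  unfolding quot_deriv_def divide_inverse
  by (intro continuous_intros f2_cont continuous_on_compose2[OF f2_cont]) auto

lemma forcing_cont: "t \<in> {0..T} \<Longrightarrow> continuous_on UNIV (forcing h t)"
  unfolding forcing_def speed_def divide_inverse
  by (intro continuous_intros f0_cont f1_cont U1_cont quot_deriv_cont continuous_on_compose2[OF U1_cont]) auto

lemma quot_bound: "t \<in> {0..T} \<Longrightarrow> 0 < h \<Longrightarrow> \<bar>quot h t x\<bar> \<le> M"
  using f_lip(2)[of t "x + h" x] by (simp add: quot_def abs_divide pos_divide_le_eq)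

lemma quot_deriv_bound: "t \<in> {0..T} \<Longrightarrow> 0 < h \<Longrightarrow> \<bar>quot_deriv h t x\<bar> \<le> 2 * M / h"
  using f_bound(3)[of t "x + h"] f_bound(3)[of t x] by (simp add: quot_deriv_def abs_divide divide_right_mono)

lemma quot_deriv: "t \<in> {0..T} \<Longrightarrow> (quot h t has_real_derivative quot_deriv h t x) (at x)"
  unfolding quot_def quot_deriv_def
  by (intro DERIV_cdivide DERIV_diff f1_deriv) (auto simp: DERIV_shift[symmetric] f1_deriv)

lemma quot_time: "t \<in> {0..T} \<Longrightarrow> ((\<lambda>\<tau>. quot h \<tau> x) has_real_derivative speed t x * quot_deriv h t x + forcing h t x) (at t within {0..T})"
proof -
  assume t: "t \<in> {0..T}"
  have "((\<lambda>\<tau>. quot h \<tau> x) has_real_derivative (U1 t (x + h) - U1 t x) / h) (at t within {0..T})"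
    unfolding quot_def by (intro DERIV_cdivide DERIV_diff f1_time t)
  then show ?thesis by (simp add: forcing_def)
qed

lemma quot_time_lip:
  assumes t: "t \<in> {0..T}" and h: "0 < h"
  shows "\<exists>L. \<forall>\<tau>\<in>{0..T}. \<forall>x. \<bar>quot h \<tau> x - quot h t x\<bar> \<le> L * \<bar>\<tau> - t\<bar>"
proof -
  obtain L where L: "\<And>\<tau> x. \<tau> \<in> {0..T} \<Longrightarrow> \<bar>f1 \<tau> x - f1 t x\<bar> \<le> L * \<bar>\<tau> - t\<bar>" using time_lip[OF t] by blast
  have "\<bar>quot h \<tau> x - quot h t x\<bar> \<le> 2 * L / h * \<bar>\<tau> - t\<bar>" if \<tau>: "\<tau> \<in> {0..T}" for \<tau> x
  proof -
    have "quot h \<tau> x - quot h t x = ((f1 \<tau> (x + h) - f1 t (x + h)) - (f1 \<tau> x - f1 t x)) / h"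
      using h by (simp add: quot_def diff_divide_distrib)
    moreover have "\<bar>(f1 \<tau> (x + h) - f1 t (x + h)) - (f1 \<tau> x - f1 t x)\<bar> \<le> 2 * L * \<bar>\<tau> - t\<bar>"
      using L[OF \<tau>, of x] L[OF \<tau>, of "x + h"] by linarith
    ultimately show ?thesis using h by (simp add: abs_divide divide_right_mono)
  qed
  then show ?thesis by blast
qed

text \<open>The estimate for a fixed finite exponent and a weight with integrable
  \<open>p\<close>-th power. Energies of u, u_x and the quotient of u_x are added and Gronwall is
  applied to their roots. Two perturbations are present, the shift \<open>d\<close> under the root
  and the step \<open>h\<close> of the quotient; neither affects the rate \<open>K\<close>, so first
  \<open>d\<close> and then \<open>h\<close> can tend to 0.\<close>

lemma weighted_estimate:
  fixes w \<kappa> :: "real \<Rightarrow> real"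
  assumes p: "1 < p" and J: "0 < J" and km: "\<kappa> \<in> borel_measurable borel" and k0: "\<And>x. 0 \<le> \<kappa> x"
    and kJ: "(\<integral>\<^sup>+x. ennreal (\<kappa> x) \<partial>lborel) \<le> ennreal J"
    and mod: "\<And>x. AE y in lborel. exp (- \<bar>x - y\<bar>) / 2 * w x \<le> \<kappa> (x - y) * w y"
    and w0: "\<And>x. 0 < w x" and wB: "\<And>x. w x \<le> C" and wm: "w \<in> borel_measurable borel"
    and wi: "integrable lborel (\<lambda>x. w x powr p)"
    and B: "0 \<le> B" and wq: "\<And>x y. w x \<le> exp (B * \<bar>x - y\<bar>) * w y" and t: "t \<in> {0..T}"
  defines "Mw \<equiv> density lborel (\<lambda>x. ennreal (w x powr p))"
  shows "wnorm Mw p (f0 t) + wnorm Mw p (f1 t) + wnorm Mw p (f2 t)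
    \<le> (wnorm Mw p (f0 0) + wnorm Mw p (f1 0) + wnorm Mw p (f2 0)) * exp (200 * (1 + B) * (1 + J) * M * t)"
proof -
  let ?wn = "wnorm Mw p"
  have \<rho>0: "0 < w x powr p" for x using w0[of x] by simp
  have \<rho>q: "w x powr p \<le> exp (p * B * \<bar>x - y\<bar>) * w y powr p" for x y
  proof -
    have "w x powr p \<le> (exp (B * \<bar>x - y\<bar>) * w y) powr p" using wq[of x y] w0[of x] p by (intro powr_mono2) auto
    also have "\<dots> = exp (B * \<bar>x - y\<bar>) powr p * w y powr p" by (simp add: powr_mult)
    also have "exp (B * \<bar>x - y\<bar>) powr p = exp (p * B * \<bar>x - y\<bar>)" by (simp add: exp_powr_real mult_ac)
    finally show ?thesis .
  qed
  have fin: "finite_measure Mw" unfolding Mw_def by (rule finite_measure_density[OF wi]) simp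
  have sM[simp]: "borel_measurable Mw = (borel_measurable borel :: (real \<Rightarrow> real) set)" by (simp add: Mw_def measurable_def)
  have cm: "continuous_on UNIV f \<Longrightarrow> f \<in> borel_measurable borel" for f :: "real \<Rightarrow> real"
    by (rule borel_measurable_continuous_onI)
  have int: "integrable Mw (\<lambda>x. \<bar>f x\<bar> powr p)" if "f \<in> borel_measurable borel" "\<And>x. \<bar>f x\<bar> \<le> D" for f and D :: real
    by (rule wnorm_integrable_bounded[OF p fin _ that(2)]) (simp add: that(1))
  have mink: "?wn (\<lambda>x. f x + g x) \<le> ?wn f + ?wn g"
    if "f \<in> borel_measurable borel" "\<And>x. \<bar>f x\<bar> \<le> D" "g \<in> borel_measurable borel" "\<And>x. \<bar>g x\<bar> \<le> E" for f g and D E :: real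
    using minkowski_wnorm(2)[OF p _ _ int[OF that(1,2)] int[OF that(3,4)]] that by simp
  have wn_abs: "?wn (\<lambda>x. \<bar>f x\<bar>) = ?wn f" for f by (simp add: wnorm_def)
  have wn_cmult: "?wn (\<lambda>x. c * f x) = \<bar>c\<bar> * ?wn f" for c f using p by (intro wnorm_cmult) simp
  \<comment> \<open>Norm of the constant 1, finite because the weighted measure is finite; pointwise
    errors of size \<open>modulus h\<close> enter the norms with this factor.\<close>
  define N1 where "N1 = ?wn (\<lambda>x. 1)"
  have N1: "0 \<le> N1" unfolding N1_def by (rule wnorm_nonneg)
  have wn_const: "?wn (\<lambda>x. c) = \<bar>c\<bar> * N1" for c using wn_cmult[of c "\<lambda>x. 1"] by (simp add: N1_def)
  define N where "N t = ?wn (f0 t) + ?wn (f1 t) + ?wn (f2 t)" for t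
  have N0: "0 \<le> N t" for t unfolding N_def using wnorm_nonneg[of Mw p] by (simp add: add_nonneg_nonneg)
  have Gm: "green (amplitude t) \<in> borel_measurable borel" if "t \<in> {0..T}" for t by (rule green_measurable[OF amplitude_measurable[OF that]])
  have Gb: "\<bar>green (amplitude t) x\<bar> \<le> M" if "t \<in> {0..T}" for t x by (rule green_le_sup[OF amplitude_measurable[OF that] amplitude_abs[OF that]])
  have nN: "?wn (amplitude t) \<le> N t" if t: "t \<in> {0..T}" for t
  proof -
    have "?wn (amplitude t) = ?wn (\<lambda>x. (\<bar>f0 t x\<bar> + \<bar>f1 t x\<bar>) + \<bar>f2 t x\<bar>)" by (simp add: amplitude_def[abs_def])
    also have "\<dots> \<le> ?wn (\<lambda>x. \<bar>f0 t x\<bar> + \<bar>f1 t x\<bar>) + ?wn (\<lambda>x. \<bar>f2 t x\<bar>)"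
    proof (rule mink)
      show "\<bar>\<bar>f0 t x\<bar> + \<bar>f1 t x\<bar>\<bar> \<le> M + M" for x using f_bound[OF t, of x] by linarith
      show "\<bar>\<bar>f2 t x\<bar>\<bar> \<le> M" for x using f_bound[OF t, of x] by linarith
    qed (intro cm continuous_intros f0_cont f1_cont f2_cont t)+
    also have "?wn (\<lambda>x. \<bar>f0 t x\<bar> + \<bar>f1 t x\<bar>) \<le> ?wn (\<lambda>x. \<bar>f0 t x\<bar>) + ?wn (\<lambda>x. \<bar>f1 t x\<bar>)"
    proof (rule mink)
      show "\<bar>\<bar>f0 t x\<bar>\<bar> \<le> M" "\<bar>\<bar>f1 t x\<bar>\<bar> \<le> M" for x using f_bound[OF t, of x] by linarith+
    qed (intro cm continuous_intros f0_cont f1_cont f2_cont t)+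
    finally show ?thesis unfolding wn_abs N_def by simp
  qed
  have GN: "?wn (green (amplitude t)) \<le> J * N t" if t: "t \<in> {0..T}" for t
  proof -
    have "?wn (green (amplitude t)) \<le> J * ?wn (amplitude t)"
      unfolding Mw_def by (rule wnorm_green_le[OF p J km k0 kJ mod w0 wB wm wi amplitude_measurable[OF t] amplitude_nonneg amplitude_le[OF t]])
    also have "\<dots> \<le> J * N t" using nN[OF t] J by simp
    finally show ?thesis .
  qed
  \<comment> \<open>One bound for the three right-hand sides: the amplitude contributes
    \<open>40 * M * N\<close>, its convolution \<open>20 * M * J * N\<close>, and \<open>e\<close>
    is the shift error of the quotient.\<close>
  define \<theta> where "\<theta> e t = 40 * M * (1 + J) * N t + 60 * M * e * N1" for e t
  have \<theta>: "?wn F \<le> \<theta> e t"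
    if t: "t \<in> {0..T}" and F: "continuous_on UNIV F" and e: "0 \<le> e"
      and le: "\<And>x. \<bar>F x\<bar> \<le> 40 * M * amplitude t x + 20 * M * green (amplitude t) x + 60 * M * e" for F e t
  proof -
    note nm = amplitude_measurable[OF t]
    have b1: "\<bar>40 * M * amplitude t x\<bar> \<le> 40 * M * M" "\<bar>20 * M * green (amplitude t) x\<bar> \<le> 20 * M * M" for x
      using amplitude_abs[OF t, of x] Gb[OF t, of x] M_nonneg by (simp_all add: abs_mult mult_left_mono)
    have m1: "(\<lambda>x. 40 * M * amplitude t x) \<in> borel_measurable borel" "(\<lambda>x. 20 * M * green (amplitude t) x) \<in> borel_measurable borel"
      using nm Gm[OF t] by auto
    have b2: "\<bar>40 * M * amplitude t x + 20 * M * green (amplitude t) x\<bar> \<le> 40 * M * M + 20 * M * M" for x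
      using b1[of x] by (intro order_trans[OF abs_triangle_ineq]) linarith
    have m2: "(\<lambda>x. 40 * M * amplitude t x + 20 * M * green (amplitude t) x) \<in> borel_measurable borel" using m1 by auto
    have b3: "\<bar>60 * M * e\<bar> \<le> 60 * M * e" using M_nonneg e by simp
    let ?R = "\<lambda>x. (40 * M * amplitude t x + 20 * M * green (amplitude t) x) + 60 * M * e"
    have R0: "0 \<le> ?R x" for x using le[of x] abs_ge_zero[of "F x"] by linarith
    have m3: "?R \<in> borel_measurable borel" using m2 by auto
    have b4: "\<bar>?R x\<bar> \<le> (40 * M * M + 20 * M * M) + 60 * M * e" for x
      using b2[of x] b3 by (intro order_trans[OF abs_triangle_ineq]) linarith
    have FR: "\<bar>F x\<bar> \<le> \<bar>?R x\<bar>" for x using le[of x] R0[of x] by simp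
    have "?wn F \<le> ?wn ?R"
      by (rule wnorm_mono[OF p int[OF cm[OF F]] int[OF m3 b4] FR]) (rule order_trans[OF FR b4])
    also have "\<dots> \<le> ?wn (\<lambda>x. 40 * M * amplitude t x + 20 * M * green (amplitude t) x) + ?wn (\<lambda>x. 60 * M * e)"
      by (rule mink[OF m2 b2 _ b3]) simp
    also have "?wn (\<lambda>x. 40 * M * amplitude t x + 20 * M * green (amplitude t) x) \<le> ?wn (\<lambda>x. 40 * M * amplitude t x) + ?wn (\<lambda>x. 20 * M * green (amplitude t) x)"
      by (rule mink[OF m1(1) b1(1) m1(2) b1(2)])
    also have "?wn (\<lambda>x. 40 * M * amplitude t x) = 40 * M * ?wn (amplitude t)" using wn_cmult[of "40 * M" "amplitude t"] M_nonneg by simp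
    also have "?wn (\<lambda>x. 20 * M * green (amplitude t) x) = 20 * M * ?wn (green (amplitude t))" using wn_cmult[of "20 * M" "green (amplitude t)"] M_nonneg by simp
    also have "?wn (\<lambda>x. 60 * M * e) = 60 * M * e * N1" using wn_const[of "60 * M * e"] M_nonneg e by simp
    finally have "?wn F \<le> 40 * M * ?wn (amplitude t) + 20 * M * ?wn (green (amplitude t)) + 60 * M * e * N1" by simp
    also have "40 * M * ?wn (amplitude t) \<le> 40 * M * N t" using nN[OF t] M_nonneg by (intro mult_left_mono) auto
    also have "20 * M * ?wn (green (amplitude t)) \<le> 40 * M * (J * N t)"
      using GN[OF t] M_nonneg J N0[of t] by (intro mult_mono) (auto simp: wnorm_nonneg)
    finally show ?thesis by (simp add: \<theta>_def algebra_simps)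
  qed
  define K where "K = 200 * (1 + B) * (1 + J) * M"
  have Epow: "(LINT x|Mw. \<bar>f x\<bar> powr p) powr ((p - 1) / p) = ?wn f powr (p - 1)" for f
    unfolding wnorm_def by (simp add: powr_powr)
  \<comment> \<open>All three components are covered by one statement with velocity
    \<open>b\<close>; for u and u_x it is used with velocity 0, for the quotient with
    \<open>speed\<close>.\<close>
  have comp: "\<exists>D'\<le>4 * M * (1 + B) * ?wn (F t) + \<theta> e t. ((\<lambda>t. ((LINT x|Mw. \<bar>F t x\<bar> powr p) + d) powr (1 / p)) has_real_derivative D') (at t within {0..T})"
    if t: "t \<in> {0..T}" and d: "0 < d" and e: "0 \<le> e"
      and Fc: "\<And>\<tau>. \<tau> \<in> {0..T} \<Longrightarrow> continuous_on UNIV (F \<tau>)" and FB: "\<And>\<tau> x. \<tau> \<in> {0..T} \<Longrightarrow> \<bar>F \<tau> x\<bar> \<le> M"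
      and FL: "\<exists>L. \<forall>\<tau>\<in>{0..T}. \<forall>x. \<bar>F \<tau> x - F t x\<bar> \<le> L * \<bar>\<tau> - t\<bar>"
      and FD: "\<And>x. ((\<lambda>\<tau>. F \<tau> x) has_real_derivative b x * Fx x + G x) (at t within {0..T})"
      and Fx: "\<And>x. (F t has_real_derivative Fx x) (at x)" "\<And>x. \<bar>Fx x\<bar> \<le> Lx" "continuous_on UNIV Fx"
      and b: "\<And>x. \<bar>b x\<bar> \<le> 4 * M" "\<And>x y. \<bar>b x - b y\<bar> \<le> 4 * M * \<bar>x - y\<bar>"
      and G: "continuous_on UNIV G" "\<And>x. \<bar>G x\<bar> \<le> 40 * M * amplitude t x + 20 * M * green (amplitude t) x + 60 * M * e"
    for F b Fx G Lx d e t
  proof -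
    obtain L where L: "\<And>\<tau> x. \<tau> \<in> {0..T} \<Longrightarrow> \<bar>F \<tau> x - F t x\<bar> \<le> L * \<bar>\<tau> - t\<bar>" using FL by blast
    have GB: "\<bar>G x\<bar> \<le> 40 * M * M + 20 * M * M + 60 * M * e" for x
    proof -
      have "40 * M * amplitude t x \<le> 40 * M * M" "20 * M * green (amplitude t) x \<le> 20 * M * M"
        using amplitude_le[OF t, of x] Gb[OF t, of x] M_nonneg by (auto intro!: mult_left_mono)
      then show ?thesis using G(2)[of x] by linarith
    qed
    obtain D where D: "((\<lambda>\<tau>. LINT x|Mw. \<bar>F \<tau> x\<bar> powr p) has_real_derivative D) (at t within {0..T})"
      "D \<le> p * ?wn (F t) powr (p - 1) * ((4 * M + B * (4 * M)) * ?wn (F t) + ?wn G)"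
      using transport_energy_derivative[OF p t Fc FB L FD Fx(1,2,3) G(1) GB b \<rho>0 \<rho>q B wi] unfolding Mw_def by blast
    have th: "?wn G \<le> \<theta> e t" by (rule \<theta>[OF t G(1) e G(2)])
    have "\<exists>D'\<le>(4 * M + B * (4 * M)) * ?wn (F t) + ?wn G. ((\<lambda>t. ((LINT x|Mw. \<bar>F t x\<bar> powr p) + d) powr (1 / p)) has_real_derivative D') (at t within {0..T})"
    proof (rule abs_powr_deriv_le_imp[OF d p D(1)])
      show "0 \<le> (LINT x|Mw. \<bar>F t x\<bar> powr p)" by (intro integral_nonneg_AE) auto
      show "D \<le> p * (LINT x|Mw. \<bar>F t x\<bar> powr p) powr ((p - 1) / p) * ((4 * M + B * (4 * M)) * ?wn (F t) + ?wn G)"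
        unfolding Epow by (rule D(2))
      show "0 \<le> (4 * M + B * (4 * M)) * ?wn (F t) + ?wn G"
        using M_nonneg B wnorm_nonneg[of Mw p] by (intro add_nonneg_nonneg mult_nonneg_nonneg) auto
    qed
    moreover have "(4 * M + B * (4 * M)) * ?wn (F t) + ?wn G \<le> 4 * M * (1 + B) * ?wn (F t) + \<theta> e t"
      using th by (simp add: algebra_simps)
    ultimately show ?thesis by (meson order_trans)
  qed
  have wn_le: "?wn f \<le> ((LINT x|Mw. \<bar>f x\<bar> powr p) + d) powr (1 / p)" if "0 < d" for f d
    unfolding wnorm_def using that p by (intro powr_mono2) (auto intro!: integral_nonneg_AE)
  have f2W: "?wn (f2 t) \<le> ?wn (quot h t) + modulus h * N1" "?wn (quot h t) \<le> ?wn (f2 t) + modulus h * N1"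
    if t: "t \<in> {0..T}" and h: "0 < h" for t h
  proof -
    have mh: "0 \<le> modulus h" using h by (intro modulus_nonneg) simp
    have tri: "?wn F \<le> ?wn G + modulus h * N1"
      if F: "continuous_on UNIV F" "\<And>x. \<bar>F x\<bar> \<le> M" and G: "continuous_on UNIV G" "\<And>x. \<bar>G x\<bar> \<le> M"
        and le: "\<And>x. \<bar>F x - G x\<bar> \<le> modulus h" for F G
    proof -
      have Dc: "continuous_on UNIV (\<lambda>x. F x - G x)" by (intro continuous_intros F G)
      have "?wn F = ?wn (\<lambda>x. G x + (F x - G x))" by simp
      also have "\<dots> \<le> ?wn G + ?wn (\<lambda>x. F x - G x)" by (rule mink[OF cm[OF G(1)] G(2) cm[OF Dc] le])
      also have "?wn (\<lambda>x. F x - G x) \<le> ?wn (\<lambda>x. modulus h)"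
        by (rule wnorm_mono[OF p int[OF cm[OF Dc] le] int[where D = "modulus h"]]) (use le mh in auto)
      also have "\<dots> = modulus h * N1" using wn_const[of "modulus h"] mh by simp
      finally show ?thesis by simp
    qed
    show "?wn (f2 t) \<le> ?wn (quot h t) + modulus h * N1"
      by (rule tri) (use quot_close[OF t h] f2_cont[OF t] quot_cont[OF t] f_bound(3)[OF t] quot_bound[OF t h] in \<open>auto simp: abs_minus_commute\<close>)
    show "?wn (quot h t) \<le> ?wn (f2 t) + modulus h * N1"
      by (rule tri) (use quot_close[OF t h] f2_cont[OF t] quot_cont[OF t] f_bound(3)[OF t] quot_bound[OF t h] in auto)
  qed
  have step: "N t \<le> (((LINT x|Mw. \<bar>f0 0 x\<bar> powr p) + d) powr (1 / p) + ((LINT x|Mw. \<bar>f1 0 x\<bar> powr p) + d) powr (1 / p)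
      + ((LINT x|Mw. \<bar>quot h 0 x\<bar> powr p) + d) powr (1 / p) + 2 * modulus h * N1) * exp (K * t)"
    if d: "0 < d" and h: "0 < h" for d h
  proof -
    define e where "e = modulus h"
    have e: "0 \<le> e" unfolding e_def using h by (intro modulus_nonneg) simp
    define E0 where "E0 t = ((LINT x|Mw. \<bar>f0 t x\<bar> powr p) + d) powr (1 / p)" for t
    define E1 where "E1 t = ((LINT x|Mw. \<bar>f1 t x\<bar> powr p) + d) powr (1 / p)" for t
    define E2 where "E2 t = ((LINT x|Mw. \<bar>quot h t x\<bar> powr p) + d) powr (1 / p)" for t
    have El: "?wn (f0 t) \<le> E0 t" "?wn (f1 t) \<le> E1 t" "?wn (quot h t) \<le> E2 t" for t
      unfolding E0_def E1_def E2_def by (rule wn_le[OF d])+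
    \<comment> \<open>Of the two copies of \<open>e * N1\<close>, one pays for replacing u_xx by its
      quotient, so that \<open>N t \<le> S t - e * N1\<close>; the other keeps
      \<open>e * N1 \<le> S t\<close>, so that the inhomogeneous forcing error is absorbed and the
      inequality becomes homogeneous.\<close>
    define S where "S t = E0 t + E1 t + E2 t + 2 * e * N1" for t
    have NS: "N t \<le> S t - e * N1" if "t \<in> {0..T}" for t
      using El[of t] f2W(1)[OF that h] unfolding N_def S_def e_def by linarith
    have "S t \<le> S 0 * exp (K * t)"
    proof (rule gronwall_differential[OF _ t])
      fix t assume t: "t \<in> {0..T}"
      have me: "0 \<le> 60 * M * e" using M_nonneg e by simp
      obtain BU where BU: "\<And>x. \<bar>U0 t x\<bar> \<le> BU" "\<And>x. \<bar>U1 t x\<bar> \<le> BU" using U_bdd[OF t] by blast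
      have "\<exists>D'\<le>4 * M * (1 + B) * ?wn (f0 t) + \<theta> e t. (E0 has_real_derivative D') (at t within {0..T})"
        unfolding E0_def
      proof (rule comp[OF t d e])
        show "((\<lambda>\<tau>. f0 \<tau> x) has_real_derivative 0 * f1 t x + U0 t x) (at t within {0..T})" for x using f0_time[OF t] by simp
        show "\<bar>f1 t x\<bar> \<le> M" for x by (rule f_bound[OF t])
        show "\<bar>U0 t x\<bar> \<le> 40 * M * amplitude t x + 20 * M * green (amplitude t) x + 60 * M * e" for x
          using U_bounds(1)[OF t, of x] me by linarith
        show "\<exists>L. \<forall>\<tau>\<in>{0..T}. \<forall>x. \<bar>f0 \<tau> x - f0 t x\<bar> \<le> L * \<bar>\<tau> - t\<bar>" using time_lip[OF t] by blast
      qed (use f0_cont f_bound f0_deriv f1_cont U0_cont t M_nonneg in auto)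
      then obtain D0 where D0: "D0 \<le> 4 * M * (1 + B) * ?wn (f0 t) + \<theta> e t" "(E0 has_real_derivative D0) (at t within {0..T})" by blast
      have "\<exists>D'\<le>4 * M * (1 + B) * ?wn (f1 t) + \<theta> e t. (E1 has_real_derivative D') (at t within {0..T})"
        unfolding E1_def
      proof (rule comp[OF t d e])
        show "((\<lambda>\<tau>. f1 \<tau> x) has_real_derivative 0 * f2 t x + U1 t x) (at t within {0..T})" for x using f1_time[OF t] by simp
        show "\<bar>f2 t x\<bar> \<le> M" for x by (rule f_bound[OF t])
        show "\<bar>U1 t x\<bar> \<le> 40 * M * amplitude t x + 20 * M * green (amplitude t) x + 60 * M * e" for x
          using U_bounds(2)[OF t, of x] me by linarith
        show "\<exists>L. \<forall>\<tau>\<in>{0..T}. \<forall>x. \<bar>f1 \<tau> x - f1 t x\<bar> \<le> L * \<bar>\<tau> - t\<bar>" using time_lip[OF t] by blast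
      qed (use f1_cont f_bound f1_deriv f2_cont U1_cont t M_nonneg in auto)
      then obtain D1 where D1: "D1 \<le> 4 * M * (1 + B) * ?wn (f1 t) + \<theta> e t" "(E1 has_real_derivative D1) (at t within {0..T})" by blast
      have "\<exists>D'\<le>4 * M * (1 + B) * ?wn (quot h t) + \<theta> e t. (E2 has_real_derivative D') (at t within {0..T})"
        unfolding E2_def
        by (rule comp[OF t d e quot_cont quot_bound[OF _ h] quot_time_lip[OF t h] quot_time[OF t] quot_deriv[OF t] quot_deriv_bound[OF t h] quot_deriv_cont[OF t]
          speed_bound[OF t] speed_lip[OF t] forcing_cont[OF t] forcing_bound[OF t h, folded e_def]])
      then obtain D2 where D2: "D2 \<le> 4 * M * (1 + B) * ?wn (quot h t) + \<theta> e t" "(E2 has_real_derivative D2) (at t within {0..T})" by blast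
      have der: "(S has_real_derivative D0 + D1 + D2 + 0) (at t within {0..T})"
        unfolding S_def by (intro DERIV_add D0 D1 D2 DERIV_const)
      have "D0 + D1 + D2 + 0 \<le> 4 * M * (1 + B) * (?wn (f0 t) + ?wn (f1 t) + ?wn (quot h t)) + 3 * \<theta> e t"
        using D0(1) D1(1) D2(1) by (simp add: algebra_simps)
      also have "4 * M * (1 + B) * (?wn (f0 t) + ?wn (f1 t) + ?wn (quot h t)) \<le> 4 * M * (1 + B) * (S t - 2 * e * N1)"
        using El[of t] M_nonneg B by (intro mult_left_mono) (auto simp: S_def)
      also have "3 * \<theta> e t \<le> 120 * M * (1 + J) * (S t - e * N1) + 180 * M * e * N1"
      proof -
        have "120 * M * (1 + J) * N t \<le> 120 * M * (1 + J) * (S t - e * N1)"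
          using NS[OF t] M_nonneg J by (intro mult_left_mono) auto
        then show ?thesis by (simp add: \<theta>_def)
      qed
      \<comment> \<open>With \<open>q\<close> as common majorant, the transport gives 4, the three
        forcings give 3 times 40, and at most 60 remain from \<open>180 * M * e * N1\<close> after
        the subtracted \<open>e * N1\<close>. The sum 184 is rounded up to 200.\<close>
      also have "4 * M * (1 + B) * (S t - 2 * e * N1) + (120 * M * (1 + J) * (S t - e * N1) + 180 * M * e * N1) \<le> K * S t"
      proof -
        have S0: "0 \<le> S t - e * N1" using NS[OF t] N0[of t] by linarith
        have eN: "0 \<le> e * N1" using e N1 by simp
        define q where "q = M * ((1 + B) * (1 + J))"
        have BJ: "(1 + B) \<le> (1 + B) * (1 + J)" "(1 + J) \<le> (1 + B) * (1 + J)" "1 \<le> (1 + B) * (1 + J)"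
          using B J mult_mono[of 1 "1 + B" 1 "1 + J"] by (auto simp: algebra_simps)
        have q: "M * (1 + B) \<le> q" "M * (1 + J) \<le> q" "M \<le> q"
          unfolding q_def using BJ M_nonneg mult_left_mono[OF BJ(3) M_nonneg] by (auto intro: mult_left_mono)
        have "(M * (1 + B)) * (S t - 2 * e * N1) \<le> q * S t"
        proof -
          have "(M * (1 + B)) * (S t - 2 * e * N1) \<le> (M * (1 + B)) * S t"
            using e N1 M_nonneg B by (intro mult_left_mono) auto
          also have "\<dots> \<le> q * S t" using q S0 eN by (intro mult_right_mono) auto
          finally show ?thesis .
        qed
        moreover have "(M * (1 + J)) * (S t - e * N1) \<le> q * S t - q * (e * N1)" unfolding right_diff_distrib[symmetric] using q S0 by (intro mult_right_mono) auto
        moreover have "M * (e * N1) \<le> q * (e * N1)" using q eN by (intro mult_right_mono) auto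
        moreover have "q * (e * N1) \<le> q * S t" using S0 q M_nonneg by (intro mult_left_mono) auto
        moreover have "0 \<le> q * S t" using S0 eN q M_nonneg by (intro mult_nonneg_nonneg) auto
        moreover have "K * S t = 200 * (q * S t)" by (simp add: K_def q_def)
        moreover have "4 * M * (1 + B) * (S t - 2 * e * N1) + (120 * M * (1 + J) * (S t - e * N1) + 180 * M * e * N1)
            = 4 * ((M * (1 + B)) * (S t - 2 * e * N1)) + 120 * ((M * (1 + J)) * (S t - e * N1)) + 180 * (M * (e * N1))"
          by (simp only: mult.assoc add.assoc)
        ultimately show ?thesis by linarith
      qed
      finally show "\<exists>D\<le>K * S t. (S has_real_derivative D) (at t within {0..T})" using der by (intro exI[of _ "D0 + D1 + D2 + 0"]) simp
    qed
    moreover have "N t \<le> S t" using NS[OF t] e N1 by (smt (verit) mult_nonneg_nonneg)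
    ultimately show ?thesis unfolding S_def E0_def E1_def E2_def e_def by linarith
  qed
  have lim_d: "((\<lambda>d. ((LINT x|Mw. \<bar>f x\<bar> powr p) + d) powr (1 / p)) \<longlongrightarrow> ?wn f) (at_right 0)" for f
  proof -
    have "((\<lambda>d. ((LINT x|Mw. \<bar>f x\<bar> powr p) + d) powr (1 / p)) \<longlongrightarrow> ((LINT x|Mw. \<bar>f x\<bar> powr p) + 0) powr (1 / p)) (at_right 0)"
      using p by (intro tendsto_powr2 tendsto_intros) (auto intro!: eventually_at_rightI[of 0 1] add_nonneg_nonneg integral_nonneg_AE)
    then show ?thesis by (simp add: wnorm_def)
  qed
  \<comment> \<open>At time 0 the quotient is exchanged for u_xx at the cost of one further
    \<open>modulus h * N1\<close>.\<close>
  have step2: "N t \<le> (N 0 + 3 * modulus h * N1) * exp (K * t)" if h: "0 < h" for h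
  proof -
    have "N t \<le> (?wn (f0 0) + ?wn (f1 0) + ?wn (quot h 0) + 2 * modulus h * N1) * exp (K * t)"
    proof (rule tendsto_lowerbound)
      show "((\<lambda>d. (((LINT x|Mw. \<bar>f0 0 x\<bar> powr p) + d) powr (1 / p) + ((LINT x|Mw. \<bar>f1 0 x\<bar> powr p) + d) powr (1 / p)
          + ((LINT x|Mw. \<bar>quot h 0 x\<bar> powr p) + d) powr (1 / p) + 2 * modulus h * N1) * exp (K * t))
          \<longlongrightarrow> (?wn (f0 0) + ?wn (f1 0) + ?wn (quot h 0) + 2 * modulus h * N1) * exp (K * t)) (at_right 0)"
        by (intro tendsto_intros lim_d)
      show "\<forall>\<^sub>F d in at_right 0. N t \<le> (((LINT x|Mw. \<bar>f0 0 x\<bar> powr p) + d) powr (1 / p) + ((LINT x|Mw. \<bar>f1 0 x\<bar> powr p) + d) powr (1 / p)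
          + ((LINT x|Mw. \<bar>quot h 0 x\<bar> powr p) + d) powr (1 / p) + 2 * modulus h * N1) * exp (K * t)"
        by (rule eventually_at_rightI[of 0 1]) (auto intro: step h)
    qed simp
    also have "\<dots> \<le> (N 0 + 3 * modulus h * N1) * exp (K * t)"
    proof (rule mult_right_mono)
      have "?wn (quot h 0) \<le> ?wn (f2 0) + modulus h * N1" using f2W(2)[of 0 h] h T by simp
      then show "?wn (f0 0) + ?wn (f1 0) + ?wn (quot h 0) + 2 * modulus h * N1 \<le> N 0 + 3 * modulus h * N1"
        unfolding N_def by linarith
    qed simp
    finally show ?thesis .
  qed
  have "((\<lambda>h. (N 0 + 3 * modulus h * N1) * exp (K * t)) \<longlongrightarrow> (N 0 + 3 * (2 * M * 0 + H * 0 powr \<gamma>) * N1) * exp (K * t)) (at_right 0)"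
    unfolding modulus_def using \<gamma> by (intro tendsto_intros tendsto_powr2) (auto intro!: eventually_at_rightI[of 0 1])
  then have "((\<lambda>h. (N 0 + 3 * modulus h * N1) * exp (K * t)) \<longlongrightarrow> N 0 * exp (K * t)) (at_right 0)"
    using \<gamma> by simp
  then have "N t \<le> N 0 * exp (K * t)"
    by (rule tendsto_lowerbound) (auto intro!: eventually_at_rightI[of 0 1] step2)
  then show ?thesis unfolding N_def K_def .
qed

end

section \<open>Classical representatives of strong solutions\<close>

lemma continuous_AE_eq:
  fixes F G :: "real \<Rightarrow> real"
  assumes "continuous_on UNIV F" "continuous_on UNIV G" "AE x in lebesgue. F x = G x"
  shows "F x = G x"
proof -
  have "x \<in> {x. F x = G x}"
    by (rule mem_closed_if_AE_lebesgue) (use assms in \<open>auto intro: closed_Collect_eq\<close>)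
  then show ?thesis by simp
qed

text \<open>Additivity of the pairing in \<open>has_fourier\<close> requires each part to be
  integrable. For bounded \<open>f\<close> it suffices that the transform of \<psi> decays like 1 /
  (1 + x^2), which two integrations by parts provide.\<close>

lemma schwartz_fourier_integrable:
  fixes f :: "real \<Rightarrow> real"
  assumes \<psi>: "schwartz \<psi>" and f: "f \<in> borel_measurable lebesgue" "AE x in lebesgue. \<bar>f x\<bar> \<le> B"
  shows "integrable lebesgue (\<lambda>x. f x *\<^sub>R schwartz_fourier \<psi> x)"
proof -
  note \<psi>1 = schwartz_deriv[OF \<psi>] and \<psi>2 = schwartz_deriv[OF schwartz_deriv[OF \<psi>]]
  have int1: "integrable lborel (\<lambda>\<xi>. \<eta> \<xi> * cos (x * \<xi>))" if "schwartz \<eta>" for \<eta> x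
    by (rule schwartz_mult_integrable[OF that, where B = 1]) simp_all
  have int2: "integrable lborel (\<lambda>\<xi>. \<eta> \<xi> * sin (x * \<xi>))" if "schwartz \<eta>" for \<eta> x
    by (rule schwartz_mult_integrable[OF that, where B = 1]) simp_all
  note int = int1 int2
  define C where "C \<eta> x = (LINT \<xi>|lborel. \<eta> \<xi> * cos (x * \<xi>))" for \<eta> :: "real \<Rightarrow> real" and x
  define S where "S \<eta> x = (LINT \<xi>|lborel. \<eta> \<xi> * sin (x * \<xi>))" for \<eta> :: "real \<Rightarrow> real" and x
  \<comment> \<open>Differentiating the test function multiplies its transform by the frequency; in
    real form this exchanges the cosine and sine parts, up to sign.\<close>
  have CS': "C (deriv \<eta>) x = x * S \<eta> x" "S (deriv \<eta>) x = - (x * C \<eta> x)" if \<eta>: "schwartz \<eta>" for \<eta> x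
  proof -
    have "(LINT \<xi>|lborel. \<eta> \<xi> * (- sin (x * \<xi>) * x)) = - C (deriv \<eta>) x"
      unfolding C_def
    proof (rule schwartz_integration_by_parts[OF \<eta>])
      show "((\<lambda>\<xi>. cos (x * \<xi>)) has_real_derivative - sin (x * \<xi>) * x) (at \<xi>)" for \<xi>
        by (auto intro!: derivative_eq_intros)
      show "continuous_on UNIV (\<lambda>\<xi>. - sin (x * \<xi>) * x)" by (intro continuous_intros)
      show "\<bar>cos (x * \<xi>)\<bar> \<le> 1" for \<xi> by simp
      show "\<bar>- sin (x * \<xi>) * x\<bar> \<le> 1 * \<bar>x\<bar>" for \<xi> unfolding abs_mult by (intro mult_right_mono) auto
    qed
    moreover have "(LINT \<xi>|lborel. \<eta> \<xi> * (cos (x * \<xi>) * x)) = - S (deriv \<eta>) x"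
      unfolding S_def
    proof (rule schwartz_integration_by_parts[OF \<eta>])
      show "((\<lambda>\<xi>. sin (x * \<xi>)) has_real_derivative cos (x * \<xi>) * x) (at \<xi>)" for \<xi>
        by (auto intro!: derivative_eq_intros)
      show "continuous_on UNIV (\<lambda>\<xi>. cos (x * \<xi>) * x)" by (intro continuous_intros)
      show "\<bar>sin (x * \<xi>)\<bar> \<le> 1" for \<xi> by simp
      show "\<bar>cos (x * \<xi>) * x\<bar> \<le> 1 * \<bar>x\<bar>" for \<xi> unfolding abs_mult by (intro mult_right_mono) auto
    qed
    moreover have "(LINT \<xi>|lborel. \<eta> \<xi> * (- sin (x * \<xi>) * x)) = - x * S \<eta> x"
    proof -
      have "\<eta> \<xi> * (- sin (x * \<xi>) * x) = - x * (\<eta> \<xi> * sin (x * \<xi>))" for \<xi> by simp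
      then show ?thesis by (simp only: S_def integral_mult_right_zero)
    qed
    moreover have "(LINT \<xi>|lborel. \<eta> \<xi> * (cos (x * \<xi>) * x)) = x * C \<eta> x"
    proof -
      have "\<eta> \<xi> * (cos (x * \<xi>) * x) = x * (\<eta> \<xi> * cos (x * \<xi>))" for \<xi> by simp
      then show ?thesis by (simp only: C_def integral_mult_right_zero)
    qed
    ultimately show "C (deriv \<eta>) x = x * S \<eta> x" "S (deriv \<eta>) x = - (x * C \<eta> x)" by auto
  qed
  have bound: "\<exists>K. \<forall>x. \<bar>C \<eta> x\<bar> \<le> K \<and> \<bar>S \<eta> x\<bar> \<le> K" if \<eta>: "schwartz \<eta>" for \<eta>
  proof -
    have i: "integrable lborel (\<lambda>\<xi>. \<bar>\<eta> \<xi>\<bar>)" using int(1)[OF \<eta>, of 0] by simp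
    have "\<bar>C \<eta> x\<bar> \<le> (LINT \<xi>|lborel. \<bar>\<eta> \<xi>\<bar>)" for x
      unfolding C_def by (intro order_trans[OF integral_abs_bound] integral_mono integrable_abs int[OF \<eta>] i)
        (simp add: abs_mult mult_left_le)
    moreover have "\<bar>S \<eta> x\<bar> \<le> (LINT \<xi>|lborel. \<bar>\<eta> \<xi>\<bar>)" for x
      unfolding S_def by (intro order_trans[OF integral_abs_bound] integral_mono integrable_abs int[OF \<eta>] i)
        (simp add: abs_mult mult_left_le)
    ultimately show ?thesis by blast
  qed
  obtain K where K: "\<And>x. \<bar>C \<psi> x\<bar> \<le> K" "\<And>x. \<bar>S \<psi> x\<bar> \<le> K" using bound[OF \<psi>] by blast
  obtain L where L: "\<And>x. \<bar>C (deriv (deriv \<psi>)) x\<bar> \<le> L" "\<And>x. \<bar>S (deriv (deriv \<psi>)) x\<bar> \<le> L" using bound[OF \<psi>2] by blast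
  have decay: "\<bar>C \<psi> x\<bar> \<le> (K + L) * inverse (1 + x\<^sup>2)" "\<bar>S \<psi> x\<bar> \<le> (K + L) * inverse (1 + x\<^sup>2)" for x
  proof -
    have "C (deriv (deriv \<psi>)) x = - (x\<^sup>2 * C \<psi> x)" "S (deriv (deriv \<psi>)) x = - (x\<^sup>2 * S \<psi> x)"
      using CS'[OF \<psi>1, of x] CS'[OF \<psi>, of x] by (simp_all add: power2_eq_square)
    then have "x\<^sup>2 * \<bar>C \<psi> x\<bar> \<le> L" "x\<^sup>2 * \<bar>S \<psi> x\<bar> \<le> L" using L[of x] by (simp_all add: abs_mult)
    then have "\<bar>C \<psi> x\<bar> * (1 + x\<^sup>2) \<le> K + L" "\<bar>S \<psi> x\<bar> * (1 + x\<^sup>2) \<le> K + L" using K[of x] by (simp_all add: algebra_simps)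
    moreover have "0 < 1 + x\<^sup>2" by (simp add: add_pos_nonneg)
    ultimately show "\<bar>C \<psi> x\<bar> \<le> (K + L) * inverse (1 + x\<^sup>2)" "\<bar>S \<psi> x\<bar> \<le> (K + L) * inverse (1 + x\<^sup>2)"
      by (simp_all add: field_simps)
  qed
  have [measurable]: "\<psi> \<in> borel_measurable borel" by (rule schwartz_measurable[OF \<psi>])
  have eq: "schwartz_fourier \<psi> x = Complex (C \<psi> x) (- S \<psi> x)" for x
  proof -
    have ci: "(\<lambda>\<xi>. \<psi> \<xi> *\<^sub>R cis (- (\<xi> * x))) = (\<lambda>\<xi>. complex_of_real (\<psi> \<xi> * cos (x * \<xi>)) - \<i> * complex_of_real (\<psi> \<xi> * sin (x * \<xi>)))"
      by (rule ext) (simp add: complex_eq_iff mult.commute)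
    have i1: "integrable lborel (\<lambda>\<xi>. complex_of_real (\<psi> \<xi> * cos (x * \<xi>)))" by (intro integrable_of_real int \<psi>)
    have i2: "integrable lborel (\<lambda>\<xi>. \<i> * complex_of_real (\<psi> \<xi> * sin (x * \<xi>)))" by (intro integrable_mult_right integrable_of_real int \<psi>)
    have m: "(\<lambda>\<xi>. \<psi> \<xi> *\<^sub>R cis (- (\<xi> * x))) \<in> borel_measurable lborel"
      unfolding ci by (rule borel_measurable_integrable[OF Bochner_Integration.integrable_diff[OF i1 i2]])
    have "schwartz_fourier \<psi> x = (LINT \<xi>|lborel. \<psi> \<xi> *\<^sub>R cis (- (\<xi> * x)))"
      unfolding schwartz_fourier_def by (rule integral_completion[OF m])
    also have "\<dots> = complex_of_real (C \<psi> x) - \<i> * complex_of_real (S \<psi> x)"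
      unfolding ci Bochner_Integration.integral_diff[OF i1 i2] integral_mult_right_zero integral_complex_of_real C_def S_def ..
    finally show ?thesis by (simp add: complex_eq_iff)
  qed
  have "C \<psi> \<in> borel_measurable borel" "S \<psi> \<in> borel_measurable borel"
    unfolding C_def[abs_def] S_def[abs_def] by measurable
  then have Cm: "C \<psi> \<in> borel_measurable lebesgue" and Sm: "S \<psi> \<in> borel_measurable lebesgue"
    by (auto intro: measurable_completion)
  have Fi: "integrable lebesgue (\<lambda>x. f x * T x)"
    if T: "T \<in> borel_measurable lebesgue" "\<And>x. \<bar>T x\<bar> \<le> (K + L) * inverse (1 + x\<^sup>2)" for T
  proof (rule Bochner_Integration.integrable_bound)
    have "integrable lborel (\<lambda>x. (B * (K + L)) * inverse (1 + x\<^sup>2))"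
      by (rule integrable_mult_right[OF integrable_inverse_1_plus_square_lborel])
    then show "integrable lebesgue (\<lambda>x::real. (B * (K + L)) * inverse (1 + x\<^sup>2))"
      by (subst integrable_completion) auto
    show "AE x in lebesgue. norm (f x * T x) \<le> norm ((B * (K + L)) * inverse (1 + x\<^sup>2))"
      using f(2)
    proof eventually_elim
      case (elim x)
      have "\<bar>f x\<bar> * \<bar>T x\<bar> \<le> B * ((K + L) * inverse (1 + x\<^sup>2))"
        by (rule mult_mono[OF elim T(2)]) (use elim in auto)
      also have "\<dots> = (B * (K + L)) * inverse (1 + x\<^sup>2)" by (rule mult.assoc[symmetric])
      also have "\<dots> \<le> norm ((B * (K + L)) * inverse (1 + x\<^sup>2))" by (simp only: real_norm_def abs_ge_self)
      finally show ?case by (simp only: real_norm_def abs_mult)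
    qed
    show "(\<lambda>x. f x * T x) \<in> borel_measurable lebesgue" by (rule borel_measurable_times[OF f(1) T(1)])
  qed
  have "integrable lebesgue (\<lambda>x. complex_of_real (f x * C \<psi> x) - \<i> * complex_of_real (f x * S \<psi> x))"
    by (intro Bochner_Integration.integrable_diff integrable_mult_right integrable_of_real Fi Cm Sm decay)
  moreover have "f x *\<^sub>R schwartz_fourier \<psi> x = complex_of_real (f x * C \<psi> x) - \<i> * complex_of_real (f x * S \<psi> x)" for x
    unfolding eq by (simp add: complex_eq_iff)
  ultimately show ?thesis by simp
qed

text \<open>Supplies transforms of u(\<tau>) - u(t) and of difference quotients in time, which the
  Sobolev embedding needs as input. Boundedness is available there, since the embedding has already
  been applied to the individual functions.\<close>

lemma has_fourier_lincomb:
  assumes f: "has_fourier f g" "AE x in lebesgue. \<bar>f x\<bar> \<le> B" and f': "has_fourier f' g'" "AE x in lebesgue. \<bar>f' x\<bar> \<le> B'"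
  shows "has_fourier (\<lambda>x. a * f x + b * f' x) (\<lambda>\<xi>. a *\<^sub>R g \<xi> + b *\<^sub>R g' \<xi>)"
proof -
  have m: "f \<in> borel_measurable lebesgue" "f' \<in> borel_measurable lebesgue" "g \<in> borel_measurable lebesgue" "g' \<in> borel_measurable lebesgue"
    using f(1) f'(1) by (auto simp: has_fourier_def tempered_fun_def)
  show ?thesis unfolding has_fourier_def
  proof (intro conjI allI impI)
    have i: "integrable lebesgue (\<lambda>x. \<psi> x *\<^sub>R f x)" "integrable lebesgue (\<lambda>x. \<psi> x *\<^sub>R f' x)"
      "integrable lebesgue (\<lambda>x. \<psi> x *\<^sub>R g x)" "integrable lebesgue (\<lambda>x. \<psi> x *\<^sub>R g' x)" if "schwartz \<psi>" for \<psi>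
      using f(1) f'(1) that by (auto simp: has_fourier_def tempered_fun_def)
    have eq1: "\<psi> x *\<^sub>R (a * f x + b * f' x) = a *\<^sub>R (\<psi> x *\<^sub>R f x) + b *\<^sub>R (\<psi> x *\<^sub>R f' x)" for \<psi> x by (simp add: algebra_simps)
    have eq2: "\<psi> x *\<^sub>R (a *\<^sub>R g x + b *\<^sub>R g' x) = a *\<^sub>R (\<psi> x *\<^sub>R g x) + b *\<^sub>R (\<psi> x *\<^sub>R g' x)" for \<psi> x by (simp add: algebra_simps)
    show "tempered_fun (\<lambda>x. a * f x + b * f' x)"
      unfolding tempered_fun_def eq1
    proof (intro conjI allI impI)
      show "(\<lambda>x. a * f x + b * f' x) \<in> borel_measurable lebesgue"
        by (intro borel_measurable_add borel_measurable_times borel_measurable_const m)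
    qed (intro Bochner_Integration.integrable_add integrable_scaleR_right i)
    show "tempered_fun (\<lambda>\<xi>. a *\<^sub>R g \<xi> + b *\<^sub>R g' \<xi>)"
      unfolding tempered_fun_def eq2
    proof (intro conjI allI impI)
      show "(\<lambda>\<xi>. a *\<^sub>R g \<xi> + b *\<^sub>R g' \<xi>) \<in> borel_measurable lebesgue"
        by (intro borel_measurable_add borel_measurable_scaleR borel_measurable_const m)
    qed (intro Bochner_Integration.integrable_add integrable_scaleR_right i)
    fix \<psi> assume \<psi>: "schwartz \<psi>"
    have F: "dist_of g \<psi> = (LINT x|lebesgue. f x *\<^sub>R schwartz_fourier \<psi> x)" "dist_of g' \<psi> = (LINT x|lebesgue. f' x *\<^sub>R schwartz_fourier \<psi> x)"
      using f(1) f'(1) \<psi> by (auto simp: has_fourier_def)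
    note j = schwartz_fourier_integrable[OF \<psi> m(1) f(2)] schwartz_fourier_integrable[OF \<psi> m(2) f'(2)]
    have "dist_of (\<lambda>\<xi>. a *\<^sub>R g \<xi> + b *\<^sub>R g' \<xi>) \<psi> = a *\<^sub>R dist_of g \<psi> + b *\<^sub>R dist_of g' \<psi>"
      unfolding dist_of_def eq2 using i(3,4)[OF \<psi>]
      by (simp only: Bochner_Integration.integral_add integrable_scaleR_right integral_scaleR_right)
    also have "\<dots> = (LINT x|lebesgue. a *\<^sub>R (f x *\<^sub>R schwartz_fourier \<psi> x) + b *\<^sub>R (f' x *\<^sub>R schwartz_fourier \<psi> x))"
      unfolding F using j by (simp only: Bochner_Integration.integral_add integrable_scaleR_right integral_scaleR_right)
    also have "\<dots> = (LINT x|lebesgue. (a * f x + b * f' x) *\<^sub>R schwartz_fourier \<psi> x)"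
      by (simp only: scaleR_scaleR scaleR_add_left)
    finally show "dist_of (\<lambda>\<xi>. a *\<^sub>R g \<xi> + b *\<^sub>R g' \<xi>) \<psi> = (LINT x|lebesgue. (a * f x + b * f' x) *\<^sub>R schwartz_fourier \<psi> x)" .
  qed
qed

text \<open>Compactness of the time interval: finitely many local constants suffice, and
  monotonicity of \<open>Q\<close> in the constant allows their maximum.\<close>

lemma uniform_bound_interval:
  fixes Q :: "real \<Rightarrow> real \<Rightarrow> bool"
  assumes loc: "\<And>t. t \<in> {0..T} \<Longrightarrow> \<exists>d>0. \<exists>C. \<forall>\<tau>\<in>{0..T}. \<bar>\<tau> - t\<bar> < d \<longrightarrow> Q \<tau> C"
    and mono: "\<And>\<tau> C C'. Q \<tau> C \<Longrightarrow> C \<le> C' \<Longrightarrow> Q \<tau> C'"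
  shows "\<exists>C. \<forall>\<tau>\<in>{0..T}. Q \<tau> C"
proof -
  obtain d C where dC: "\<And>t. t \<in> {0..T} \<Longrightarrow> d t > 0 \<and> (\<forall>\<tau>\<in>{0..T}. \<bar>\<tau> - t\<bar> < d t \<longrightarrow> Q \<tau> (C t))"
    using loc by metis
  have "compact {0..T}" by simp
  moreover have "{0..T} \<subseteq> (\<Union>t\<in>{0..T}. ball t (d t))" using dC by force
  ultimately obtain F where F: "F \<subseteq> {0..T}" "finite F" "{0..T} \<subseteq> (\<Union>t\<in>F. ball t (d t))"
    using compactE_image[of "{0..T}" "{0..T}" "\<lambda>t. ball t (d t)"] by auto
  have "Q \<tau> (Max (insert 0 (C ` F)))" if \<tau>: "\<tau> \<in> {0..T}" for \<tau>
  proof -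
    obtain t where t: "t \<in> F" "\<tau> \<in> ball t (d t)" using F(3) \<tau> by blast
    then have "Q \<tau> (C t)" using dC[of t] F(1) \<tau> by (auto simp: dist_real_def abs_minus_commute)
    then show ?thesis by (rule mono) (use t F(2) in auto)
  qed
  then show ?thesis by blast
qed

lemma Lp_norm_infinity_le:
  assumes "f \<in> borel_measurable lebesgue" "AE x in lebesgue. f x = F x" "\<And>x. \<bar>F x\<bar> \<le> (B::real)"
  shows "Lp_norm \<infinity> f \<le> ennreal B"
proof -
  have "(\<lambda>x. ennreal (norm (f x))) \<in> borel_measurable lebesgue" using assms(1) by measurable
  moreover have "AE x in lebesgue. ennreal (norm (f x)) \<le> ennreal B"
    using assms(2) by eventually_elim (use assms(3) in \<open>auto intro!: ennreal_leI\<close>)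
  ultimately show ?thesis unfolding Lp_norm_def by auto
qed

text \<open>For a continuous representative the set where the essential bound holds is closed and of
  full measure, hence everything.\<close>

lemma continuous_le_Lp_norm_infinity:
  fixes f F :: "real \<Rightarrow> real"
  assumes "AE x in lebesgue. f x = F x" "continuous_on UNIV F"
  shows "ennreal \<bar>F x\<bar> \<le> Lp_norm \<infinity> f"
proof -
  have "AE x in lebesgue. ennreal (norm (f x)) \<le> Lp_norm \<infinity> f"
    unfolding Lp_norm_def using esssup_AE[where M = lebesgue and f = "\<lambda>x. ennreal (norm (f x))"] by simp
  with assms(1) have "AE x in lebesgue. x \<in> {x. ennreal \<bar>F x\<bar> \<le> Lp_norm \<infinity> f}"
    by eventually_elim simp
  moreover have "closed {x. ennreal \<bar>F x\<bar> \<le> Lp_norm \<infinity> f}"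
    by (intro closed_Collect_le continuous_intros continuous_on_ennreal assms)
  ultimately show ?thesis using mem_closed_if_AE_lebesgue by blast
qed

text \<open>The case of two derivatives, for u(t) and its increments in time, measured in
  H^s.\<close>

lemma sobolev_two:
  assumes s: "5 / 2 < s"
  shows "\<exists>K \<gamma>. 0 < \<gamma> \<and> 0 \<le> K \<and> (\<forall>f g. has_fourier f g \<longrightarrow> Hs_norm s f < \<infinity> \<longrightarrow>
    (\<exists>F0 F1 F2. (AE x in lebesgue. f x = F0 x) \<and> (\<forall>x. (F0 has_real_derivative F1 x) (at x)) \<and>
      (\<forall>x. (F1 has_real_derivative F2 x) (at x)) \<and>
      (\<forall>x. \<bar>F0 x\<bar> \<le> K * enn2real (Hs_norm s f)) \<and> (\<forall>x. \<bar>F1 x\<bar> \<le> K * enn2real (Hs_norm s f)) \<and>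
      (\<forall>x. \<bar>F2 x\<bar> \<le> K * enn2real (Hs_norm s f)) \<and>
      (\<forall>x h. \<bar>F2 (x + h) - F2 x\<bar> \<le> K * enn2real (Hs_norm s f) * \<bar>h\<bar> powr \<gamma>)))"
proof -
  have k: "real 2 + 1 / 2 < s" using s by simp
  obtain K \<gamma> where K: "0 < \<gamma>" "0 \<le> K" and E: "\<forall>f g0. has_fourier f g0 \<longrightarrow> Hs_norm s f < \<infinity> \<longrightarrow>
    (\<exists>F :: nat \<Rightarrow> real \<Rightarrow> real. (AE x in lebesgue. f x = F 0 x) \<and>
      (\<forall>j<2. \<forall>x. (F j has_real_derivative F (Suc j) x) (at x)) \<and>
      (\<forall>j\<le>2. \<forall>x. \<bar>F j x\<bar> \<le> K * enn2real (Hs_norm s f)) \<and>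
      (\<forall>x h. \<bar>F 2 (x + h) - F 2 x\<bar> \<le> K * enn2real (Hs_norm s f) * \<bar>h\<bar> powr \<gamma>))"
    using sobolev_embedding[OF one_le_numeral k] by (elim exE conjE) (rule that)
  show ?thesis
  proof (rule exI[of _ K], rule exI[of _ \<gamma>], intro conjI K allI impI)
    fix f g assume "has_fourier f g" "Hs_norm s f < \<infinity>"
    from E[rule_format, OF this] obtain F :: "nat \<Rightarrow> real \<Rightarrow> real" where F1: "AE x in lebesgue. f x = F 0 x"
      and F2: "\<forall>j<2. \<forall>x. (F j has_real_derivative F (Suc j) x) (at x)"
      and F3: "\<forall>j\<le>2. \<forall>x. \<bar>F j x\<bar> \<le> K * enn2real (Hs_norm s f)"
      and F4: "\<forall>x h. \<bar>F 2 (x + h) - F 2 x\<bar> \<le> K * enn2real (Hs_norm s f) * \<bar>h\<bar> powr \<gamma>"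
      by (elim exE conjE) (rule that)
    note F = F1 F2[rule_format] F3[rule_format] F4[rule_format]
    have d: "(F 0 has_real_derivative F 1 x) (at x)" "(F 1 has_real_derivative F 2 x) (at x)" for x
      using F(2)[of 0 x] F(2)[of 1 x] by (simp_all add: numeral_2_eq_2)
    have b: "\<bar>F 0 x\<bar> \<le> K * enn2real (Hs_norm s f)" "\<bar>F 1 x\<bar> \<le> K * enn2real (Hs_norm s f)" "\<bar>F 2 x\<bar> \<le> K * enn2real (Hs_norm s f)" for x
      by (rule F(3); simp)+
    show "\<exists>F0 F1 F2. (AE x in lebesgue. f x = F0 x) \<and> (\<forall>x. (F0 has_real_derivative F1 x) (at x)) \<and>
      (\<forall>x. (F1 has_real_derivative F2 x) (at x)) \<and>
      (\<forall>x. \<bar>F0 x\<bar> \<le> K * enn2real (Hs_norm s f)) \<and> (\<forall>x. \<bar>F1 x\<bar> \<le> K * enn2real (Hs_norm s f)) \<and>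
      (\<forall>x. \<bar>F2 x\<bar> \<le> K * enn2real (Hs_norm s f)) \<and>
      (\<forall>x h. \<bar>F2 (x + h) - F2 x\<bar> \<le> K * enn2real (Hs_norm s f) * \<bar>h\<bar> powr \<gamma>)"
      by (rule exI[of _ "F 0"], rule exI[of _ "F 1"], rule exI[of _ "F 2"])
        (intro conjI allI F(1,4) d b)
  qed
qed

text \<open>The case of one derivative, for u_t and the time difference quotients, measured in
  H^(s-1). Of the Hoelder bound only continuity of the derivative is retained.\<close>

lemma sobolev_one:
  assumes s: "3 / 2 < s"
  shows "\<exists>K. 0 \<le> K \<and> (\<forall>f g. has_fourier f g \<longrightarrow> Hs_norm s f < \<infinity> \<longrightarrow>
    (\<exists>F0 F1. (AE x in lebesgue. f x = F0 x) \<and> (\<forall>x. (F0 has_real_derivative F1 x) (at x)) \<and> continuous_on UNIV F1 \<and>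
      (\<forall>x. \<bar>F0 x\<bar> \<le> K * enn2real (Hs_norm s f)) \<and> (\<forall>x. \<bar>F1 x\<bar> \<le> K * enn2real (Hs_norm s f))))"
proof -
  have k: "real 1 + 1 / 2 < s" using s by simp
  obtain K \<gamma> where K: "0 < \<gamma>" "0 \<le> K" and E: "\<forall>f g0. has_fourier f g0 \<longrightarrow> Hs_norm s f < \<infinity> \<longrightarrow>
    (\<exists>F :: nat \<Rightarrow> real \<Rightarrow> real. (AE x in lebesgue. f x = F 0 x) \<and>
      (\<forall>j<1. \<forall>x. (F j has_real_derivative F (Suc j) x) (at x)) \<and>
      (\<forall>j\<le>1. \<forall>x. \<bar>F j x\<bar> \<le> K * enn2real (Hs_norm s f)) \<and>
      (\<forall>x h. \<bar>F 1 (x + h) - F 1 x\<bar> \<le> K * enn2real (Hs_norm s f) * \<bar>h\<bar> powr \<gamma>))"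
    using sobolev_embedding[OF order_refl k] by (elim exE conjE) (rule that)
  show ?thesis
  proof (rule exI[of _ K], intro conjI K allI impI)
    fix f g assume "has_fourier f g" "Hs_norm s f < \<infinity>"
    from E[rule_format, OF this] obtain F :: "nat \<Rightarrow> real \<Rightarrow> real" where F1: "AE x in lebesgue. f x = F 0 x"
      and F2: "\<forall>j<1. \<forall>x. (F j has_real_derivative F (Suc j) x) (at x)"
      and F3: "\<forall>j\<le>1. \<forall>x. \<bar>F j x\<bar> \<le> K * enn2real (Hs_norm s f)"
      and F4: "\<forall>x h. \<bar>F 1 (x + h) - F 1 x\<bar> \<le> K * enn2real (Hs_norm s f) * \<bar>h\<bar> powr \<gamma>"
      by (elim exE conjE) (rule that)
    note F = F1 F2[rule_format] F3[rule_format] F4[rule_format]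
    have "isCont (F 1) x" for x
    proof -
      let ?H = "K * enn2real (Hs_norm s f)"
      have "((\<lambda>h. ?H * \<bar>h\<bar> powr \<gamma>) \<longlongrightarrow> ?H * \<bar>0\<bar> powr \<gamma>) (at 0)"
        using K by (intro tendsto_intros tendsto_powr2) (auto intro!: always_eventually)
      then have 1: "((\<lambda>h. ?H * \<bar>h\<bar> powr \<gamma>) \<longlongrightarrow> 0) (at 0)" using K by simp
      have 2: "\<forall>\<^sub>F h in at 0. norm (F 1 (x + h) - F 1 x) \<le> ?H * \<bar>h\<bar> powr \<gamma>"
        by (rule always_eventually) (simp only: real_norm_def F(4) simp_thms)
      have "((\<lambda>h. F 1 (x + h) - F 1 x) \<longlongrightarrow> 0) (at 0)" by (rule Lim_null_comparison[OF 2 1])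
      then show ?thesis unfolding isCont_iff by (simp add: LIM_zero_iff)
    qed
    then have c: "continuous_on UNIV (F 1)" by (simp add: continuous_at_imp_continuous_on)
    have d: "(F 0 has_real_derivative F 1 x) (at x)" for x using F(2)[of 0 x] by simp
    have b: "\<bar>F 0 x\<bar> \<le> K * enn2real (Hs_norm s f)" "\<bar>F 1 x\<bar> \<le> K * enn2real (Hs_norm s f)" for x
      by (rule F(3); simp)+
    show "\<exists>F0 F1. (AE x in lebesgue. f x = F0 x) \<and> (\<forall>x. (F0 has_real_derivative F1 x) (at x)) \<and> continuous_on UNIV F1 \<and>
      (\<forall>x. \<bar>F0 x\<bar> \<le> K * enn2real (Hs_norm s f)) \<and> (\<forall>x. \<bar>F1 x\<bar> \<le> K * enn2real (Hs_norm s f))"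
      by (rule exI[of _ "F 0"], rule exI[of _ "F 1"]) (intro conjI allI F(1) d b c)
  qed
qed

text \<open>The embedding chooses representatives separately for each function; this identifies
  those chosen for a difference with the differences of those chosen for its terms.\<close>

lemma derivative_AE_unique:
  fixes F G F' G' :: "real \<Rightarrow> real"
  assumes "AE x in lebesgue. F x = G x" "\<And>x. (F has_real_derivative F' x) (at x)" "\<And>x. (G has_real_derivative G' x) (at x)"
  shows "F x = G x" "F' x = G' x"
proof -
  have c: "continuous_on UNIV F" "continuous_on UNIV G" using assms by (meson DERIV_isCont continuous_at_imp_continuous_on)+
  have eq: "F = G" using continuous_AE_eq[OF c assms(1)] by blast
  then show "F x = G x" by simp
  show "F' x = G' x" using assms(2)[of x] assms(3)[of x] eq by (metis DERIV_unique)
qed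

definition sup_M :: "real \<Rightarrow> (real \<Rightarrow> real \<Rightarrow> real) \<Rightarrow> ennreal" where
  "sup_M T u = (SUP t\<in>{0..T}. Lp_norm \<infinity> (u t) + Lp_norm \<infinity> (weak_deriv (u t)) + Lp_norm \<infinity> (weak_deriv (weak_deriv (u t))))"

text \<open>The uniform constants of the embedding turn statements in Sobolev norms into statements
  uniform in \<open>x\<close>: continuity in H^s gives common bounds over the time interval, and
  differentiability in H^(s-1) gives classical time derivatives of u and u_x. For u_xx no time
  derivative is obtained, as H^(s-1) controls only one derivative.\<close>

lemma strong_solution_classical:
  assumes T: "0 < T" and s: "5 / 2 < s" and sol: "strong_solution T s u u0"
  shows "sup_M T u < \<infinity>"
    and "\<exists>f0 f1 f2 U0 U1 H \<gamma>. classical_solution T (enn2real (sup_M T u)) H \<gamma> f0 f1 f2 U0 U1 \<and>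
      (\<forall>t\<in>{0..T}. u t \<in> borel_measurable lebesgue \<and> weak_deriv (u t) \<in> borel_measurable lebesgue \<and>
        weak_deriv (weak_deriv (u t)) \<in> borel_measurable lebesgue \<and>
        (AE x in lebesgue. u t x = f0 t x) \<and> (AE x in lebesgue. weak_deriv (u t) x = f1 t x) \<and>
        (AE x in lebesgue. weak_deriv (weak_deriv (u t)) x = f2 t x))"
proof -
  obtain ut where uc: "continuous_Hs s T u" and utc: "continuous_Hs (s - 1) T ut" and td: "has_time_deriv_Hs (s - 1) T u ut"
    and pde: "\<And>t. t \<in> {0..T} \<Longrightarrow> pde_at (u t) (ut t)"
    using sol unfolding strong_solution_def by blast
  obtain K \<gamma> where \<gamma>: "0 < \<gamma>" and K: "0 \<le> K" and S2: "\<forall>f g. has_fourier f g \<longrightarrow> Hs_norm s f < \<infinity> \<longrightarrow>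
    (\<exists>F0 F1 F2. (AE x in lebesgue. f x = F0 x) \<and> (\<forall>x. (F0 has_real_derivative F1 x) (at x)) \<and>
      (\<forall>x. (F1 has_real_derivative F2 x) (at x)) \<and>
      (\<forall>x. \<bar>F0 x\<bar> \<le> K * enn2real (Hs_norm s f)) \<and> (\<forall>x. \<bar>F1 x\<bar> \<le> K * enn2real (Hs_norm s f)) \<and>
      (\<forall>x. \<bar>F2 x\<bar> \<le> K * enn2real (Hs_norm s f)) \<and>
      (\<forall>x h. \<bar>F2 (x + h) - F2 x\<bar> \<le> K * enn2real (Hs_norm s f) * \<bar>h\<bar> powr \<gamma>))"
    using sobolev_two[OF s] by (elim exE conjE) (rule that)
  note S2 = S2[rule_format]
  have s1: "3 / 2 < s - 1" using s by simp
  obtain K1 where K1: "0 \<le> K1" and S1: "\<forall>f g. has_fourier f g \<longrightarrow> Hs_norm (s - 1) f < \<infinity> \<longrightarrow>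
    (\<exists>F0 F1. (AE x in lebesgue. f x = F0 x) \<and> (\<forall>x. (F0 has_real_derivative F1 x) (at x)) \<and> continuous_on UNIV F1 \<and>
      (\<forall>x. \<bar>F0 x\<bar> \<le> K1 * enn2real (Hs_norm (s - 1) f)) \<and> (\<forall>x. \<bar>F1 x\<bar> \<le> K1 * enn2real (Hs_norm (s - 1) f)))"
    using sobolev_one[OF s1] by (elim exE conjE) (rule that)
  note S1 = S1[rule_format]
  have uH: "\<exists>g. has_fourier (u t) g" "Hs_norm s (u t) < \<infinity>" if "t \<in> {0..T}" for t
    using uc that by (auto simp: continuous_Hs_def Hs_def Hs_norm_def Lp_def)
  have utH: "\<exists>g. has_fourier (ut t) g" "Hs_norm (s - 1) (ut t) < \<infinity>" if "t \<in> {0..T}" for t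
    using utc that by (auto simp: continuous_Hs_def Hs_def Hs_norm_def Lp_def)
  define A where "A t = K * enn2real (Hs_norm s (u t))" for t
  \<comment> \<open>Bundles all properties of the representatives at time \<open>t\<close>, so that
    the three functions are chosen together.\<close>
  define P where "P t F0 F1 F2 \<longleftrightarrow> (AE x in lebesgue. u t x = F0 x) \<and> (\<forall>x. (F0 has_real_derivative F1 x) (at x)) \<and>
      (\<forall>x. (F1 has_real_derivative F2 x) (at x)) \<and> (\<forall>x. \<bar>F0 x\<bar> \<le> A t) \<and> (\<forall>x. \<bar>F1 x\<bar> \<le> A t) \<and>
      (\<forall>x. \<bar>F2 x\<bar> \<le> A t) \<and> (\<forall>x h. \<bar>F2 (x + h) - F2 x\<bar> \<le> A t * \<bar>h\<bar> powr \<gamma>)" for t F0 F1 F2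
  have "\<exists>F0 F1 F2. P t F0 F1 F2" if t: "t \<in> {0..T}" for t
  proof -
    obtain g where g: "has_fourier (u t) g" using uH(1)[OF t] by (elim exE)
    show ?thesis using S2[OF g uH(2)[OF t]] by (simp only: P_def A_def)
  qed
  then obtain f0 f1 f2 where fP: "\<And>t. t \<in> {0..T} \<Longrightarrow> P t (f0 t) (f1 t) (f2 t)" by metis
  note f = 
    fP[unfolded P_def, THEN conjunct1]
    fP[unfolded P_def, THEN conjunct2, THEN conjunct1, rule_format]
    fP[unfolded P_def, THEN conjunct2, THEN conjunct2, THEN conjunct1, rule_format]
    fP[unfolded P_def, THEN conjunct2, THEN conjunct2, THEN conjunct2, THEN conjunct1, rule_format]
    fP[unfolded P_def, THEN conjunct2, THEN conjunct2, THEN conjunct2, THEN conjunct2, THEN conjunct1, rule_format]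
    fP[unfolded P_def, THEN conjunct2, THEN conjunct2, THEN conjunct2, THEN conjunct2, THEN conjunct2, THEN conjunct1, rule_format]
    fP[unfolded P_def, THEN conjunct2, THEN conjunct2, THEN conjunct2, THEN conjunct2, THEN conjunct2, THEN conjunct2, rule_format]
  define A1 where "A1 t = K1 * enn2real (Hs_norm (s - 1) (ut t))" for t
  define P1 where "P1 t F0 F1 \<longleftrightarrow> (AE x in lebesgue. ut t x = F0 x) \<and> (\<forall>x. (F0 has_real_derivative F1 x) (at x)) \<and>
      continuous_on UNIV F1 \<and> (\<forall>x. \<bar>F0 x\<bar> \<le> A1 t) \<and> (\<forall>x. \<bar>F1 x\<bar> \<le> A1 t)" for t F0 F1
  have "\<exists>F0 F1. P1 t F0 F1" if t: "t \<in> {0..T}" for t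
  proof -
    obtain g where g: "has_fourier (ut t) g" using utH(1)[OF t] by (elim exE)
    show ?thesis using S1[OF g utH(2)[OF t]] by (simp only: P1_def A1_def)
  qed
  then obtain U0 U1 where UP: "\<And>t. t \<in> {0..T} \<Longrightarrow> P1 t (U0 t) (U1 t)" by metis
  note U =
    UP[unfolded P1_def, THEN conjunct1]
    UP[unfolded P1_def, THEN conjunct2, THEN conjunct1, rule_format]
    UP[unfolded P1_def, THEN conjunct2, THEN conjunct2, THEN conjunct1]
    UP[unfolded P1_def, THEN conjunct2, THEN conjunct2, THEN conjunct2, THEN conjunct1, rule_format]
    UP[unfolded P1_def, THEN conjunct2, THEN conjunct2, THEN conjunct2, THEN conjunct2, rule_format]
  have f1c: "continuous_on UNIV (f1 t)" if "t \<in> {0..T}" for t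
    using f(3)[OF that] by (meson DERIV_isCont continuous_at_imp_continuous_on)
  have f0c: "continuous_on UNIV (f0 t)" if "t \<in> {0..T}" for t
    using f(2)[OF that] by (meson DERIV_isCont continuous_at_imp_continuous_on)
  have f2c: "continuous_on UNIV (f2 t)" if t: "t \<in> {0..T}" for t
  proof -
    have "isCont (f2 t) x" for x
    proof -
      have "((\<lambda>h. A t * \<bar>h\<bar> powr \<gamma>) \<longlongrightarrow> A t * \<bar>0\<bar> powr \<gamma>) (at 0)"
        using \<gamma> by (intro tendsto_intros tendsto_powr2) (auto intro!: always_eventually)
      then have 1: "((\<lambda>h. A t * \<bar>h\<bar> powr \<gamma>) \<longlongrightarrow> 0) (at 0)" using \<gamma> by simp
      have 2: "\<forall>\<^sub>F h in at 0. norm (f2 t (x + h) - f2 t x) \<le> A t * \<bar>h\<bar> powr \<gamma>"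
        by (rule always_eventually) (simp add: f(7)[OF t])
      have "((\<lambda>h. f2 t (x + h) - f2 t x) \<longlongrightarrow> 0) (at 0)" by (rule Lim_null_comparison[OF 2 1])
      then show ?thesis unfolding isCont_iff by (simp add: LIM_zero_iff)
    qed
    then show ?thesis by (simp add: continuous_at_imp_continuous_on)
  qed
  have um: "u t \<in> borel_measurable lebesgue" if "t \<in> {0..T}" for t
    using uH(1)[OF that] by (auto simp: has_fourier_def tempered_fun_def)
  have utm: "ut t \<in> borel_measurable lebesgue" if "t \<in> {0..T}" for t
    using utH(1)[OF that] by (auto simp: has_fourier_def tempered_fun_def)
  have ub: "AE x in lebesgue. \<bar>u t x\<bar> \<le> A t" if "t \<in> {0..T}" for t
    using f(1)[OF that] by eventually_elim (simp add: f(4)[OF that])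
  have utb: "AE x in lebesgue. \<bar>ut t x\<bar> \<le> A1 t" if "t \<in> {0..T}" for t
    using U(1)[OF that] by eventually_elim (simp add: U(4)[OF that])
  have hf_diff: "\<exists>g. has_fourier (\<lambda>x. u \<tau> x - u t x) g" if t: "t \<in> {0..T}" "\<tau> \<in> {0..T}" for t \<tau>
  proof -
    obtain g g' where "has_fourier (u \<tau>) g" "has_fourier (u t) g'" using uH(1) t by blast
    from has_fourier_lincomb[OF this(1) ub[OF t(2)] this(2) ub[OF t(1)], of 1 "-1"]
    show ?thesis by auto
  qed
  have diff: "\<bar>f0 \<tau> x - f0 t x\<bar> \<le> K * enn2real (Hs_norm s (\<lambda>x. u \<tau> x - u t x))"
      "\<bar>f1 \<tau> x - f1 t x\<bar> \<le> K * enn2real (Hs_norm s (\<lambda>x. u \<tau> x - u t x))"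
      "\<bar>f2 \<tau> x - f2 t x\<bar> \<le> K * enn2real (Hs_norm s (\<lambda>x. u \<tau> x - u t x))"
      "\<bar>(f2 \<tau> (x + h) - f2 t (x + h)) - (f2 \<tau> x - f2 t x)\<bar> \<le> K * enn2real (Hs_norm s (\<lambda>x. u \<tau> x - u t x)) * \<bar>h\<bar> powr \<gamma>"
    if t: "t \<in> {0..T}" "\<tau> \<in> {0..T}" and fin: "Hs_norm s (\<lambda>x. u \<tau> x - u t x) < \<infinity>" for t \<tau> x h
  proof -
    let ?c = "K * enn2real (Hs_norm s (\<lambda>x. u \<tau> x - u t x))"
    obtain g where g: "has_fourier (\<lambda>x. u \<tau> x - u t x) g" using hf_diff[OF t] by blast
    obtain D0 D1 D2 where Dae: "AE x in lebesgue. u \<tau> x - u t x = D0 x" and Da: "\<forall>x. (D0 has_real_derivative D1 x) (at x)"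
      and Db: "\<forall>x. (D1 has_real_derivative D2 x) (at x)" and Dc: "\<forall>x. \<bar>D0 x\<bar> \<le> ?c" and Dd: "\<forall>x. \<bar>D1 x\<bar> \<le> ?c" and De: "\<forall>x. \<bar>D2 x\<bar> \<le> ?c"
      and Df: "\<forall>x h. \<bar>D2 (x + h) - D2 x\<bar> \<le> ?c * \<bar>h\<bar> powr \<gamma>"
      using S2[OF g fin] by (elim exE conjE) (rule that)
    note D = Dae Da[rule_format] Db[rule_format] Dc[rule_format] Dd[rule_format] De[rule_format] Df[rule_format]
    have ae: "AE x in lebesgue. D0 x = f0 \<tau> x - f0 t x"
      using D(1) f(1)[OF t(1)] f(1)[OF t(2)] by eventually_elim simp
    have e0: "D0 x = f0 \<tau> x - f0 t x" "D1 x = f1 \<tau> x - f1 t x" for x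
      using derivative_AE_unique[OF ae D(2), of "\<lambda>x. f1 \<tau> x - f1 t x" x] DERIV_diff[OF f(2)[OF t(2)] f(2)[OF t(1)]] by auto
    have e2: "D2 x = f2 \<tau> x - f2 t x" for x
    proof (rule DERIV_unique[OF D(3)])
      have "D1 = (\<lambda>x. f1 \<tau> x - f1 t x)" using e0 by blast
      then show "(D1 has_real_derivative f2 \<tau> x - f2 t x) (at x)"
        using DERIV_diff[OF f(3)[OF t(2)] f(3)[OF t(1)]] by simp
    qed
    show "\<bar>f0 \<tau> x - f0 t x\<bar> \<le> ?c" "\<bar>f1 \<tau> x - f1 t x\<bar> \<le> ?c" "\<bar>f2 \<tau> x - f2 t x\<bar> \<le> ?c"
      using D(4,5,6)[of x] unfolding e0 e2 by auto
    show "\<bar>(f2 \<tau> (x + h) - f2 t (x + h)) - (f2 \<tau> x - f2 t x)\<bar> \<le> ?c * \<bar>h\<bar> powr \<gamma>"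
      using D(7)[of x h] unfolding e2 .
  qed
  have lim_u: "((\<lambda>\<tau>. Hs_norm s (\<lambda>x. u \<tau> x - u t x)) \<longlongrightarrow> 0) (at t within {0..T})" if "t \<in> {0..T}" for t
    using uc that by (auto simp: continuous_Hs_def)
  \<comment> \<open>Sup bounds and Hoelder bound share one constant, so a single compactness
    argument yields both. Near \<open>t\<close> the constant \<open>A t + K\<close> works, because
    the increment has H^s norm below 1.\<close>
  define Q where "Q \<tau> C \<longleftrightarrow> (\<forall>x. \<bar>f0 \<tau> x\<bar> \<le> C \<and> \<bar>f1 \<tau> x\<bar> \<le> C \<and> \<bar>f2 \<tau> x\<bar> \<le> C) \<and> (\<forall>x h. \<bar>f2 \<tau> (x + h) - f2 \<tau> x\<bar> \<le> C * \<bar>h\<bar> powr \<gamma>)" for \<tau> C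
  have "\<exists>C. \<forall>\<tau>\<in>{0..T}. Q \<tau> C"
  proof (rule uniform_bound_interval)
    fix \<tau> C C' assume QC: "Q \<tau> C" and CC: "C \<le> C'"
    have "C * \<bar>h\<bar> powr \<gamma> \<le> C' * \<bar>h\<bar> powr \<gamma>" for h using CC by (intro mult_right_mono) auto
    then show "Q \<tau> C'" using QC CC unfolding Q_def by (meson order_trans)
  next
    fix t assume t: "t \<in> {0..T}"
    have "\<forall>\<^sub>F \<tau> in at t within {0..T}. Hs_norm s (\<lambda>x. u \<tau> x - u t x) < 1"
      using order_tendstoD(2)[OF lim_u[OF t], of 1] by simp
    then obtain d where d: "0 < d" "\<And>\<tau>. \<tau> \<in> {0..T} \<Longrightarrow> \<tau> \<noteq> t \<Longrightarrow> dist \<tau> t < d \<Longrightarrow> Hs_norm s (\<lambda>x. u \<tau> x - u t x) < 1"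
      unfolding eventually_at by blast
    have "Q \<tau> (A t + K)" if \<tau>: "\<tau> \<in> {0..T}" "\<bar>\<tau> - t\<bar> < d" for \<tau>
    proof (cases "\<tau> = t")
      case True
      have "A t * \<bar>h\<bar> powr \<gamma> \<le> (A t + K) * \<bar>h\<bar> powr \<gamma>" for h using K by (intro mult_right_mono) auto
      then have "\<bar>f2 t (x + h) - f2 t x\<bar> \<le> (A t + K) * \<bar>h\<bar> powr \<gamma>" for x h using f(7)[OF t] by (meson order_trans)
      moreover have "\<bar>f0 t x\<bar> \<le> A t + K" "\<bar>f1 t x\<bar> \<le> A t + K" "\<bar>f2 t x\<bar> \<le> A t + K" for x
        using f(4,5,6)[OF t, of x] K by linarith+
      ultimately show ?thesis unfolding Q_def True by blast
    next
      case False
      then have n1: "Hs_norm s (\<lambda>x. u \<tau> x - u t x) < 1" using d(2)[OF \<tau>(1)] \<tau>(2) by (simp add: dist_real_def)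
      then have fin: "Hs_norm s (\<lambda>x. u \<tau> x - u t x) < \<infinity>" by (metis ennreal_one_less_top infinity_ennreal_def order_less_trans)
      have "enn2real (Hs_norm s (\<lambda>x. u \<tau> x - u t x)) \<le> 1" using n1 by (metis enn2real_leI ennreal_1 less_imp_le zero_le_one)
      then have c: "K * enn2real (Hs_norm s (\<lambda>x. u \<tau> x - u t x)) \<le> K" using K by (simp add: mult_left_le)
      note df = diff[OF t \<tau>(1) fin]
      have "\<bar>f0 \<tau> x\<bar> \<le> A t + K" "\<bar>f1 \<tau> x\<bar> \<le> A t + K" "\<bar>f2 \<tau> x\<bar> \<le> A t + K" for x
        using df(1-3)[of x] f(4,5,6)[OF t, of x] c by linarith+
      moreover have "\<bar>f2 \<tau> (x + h) - f2 \<tau> x\<bar> \<le> (A t + K) * \<bar>h\<bar> powr \<gamma>" for x h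
      proof -
        have "K * enn2real (Hs_norm s (\<lambda>x. u \<tau> x - u t x)) * \<bar>h\<bar> powr \<gamma> \<le> K * \<bar>h\<bar> powr \<gamma>"
          using c by (intro mult_right_mono) auto
        then have "\<bar>f2 \<tau> (x + h) - f2 \<tau> x\<bar> \<le> A t * \<bar>h\<bar> powr \<gamma> + K * \<bar>h\<bar> powr \<gamma>"
          using df(4)[of x h] f(7)[OF t, of x h] by linarith
        then show ?thesis by (simp add: distrib_right)
      qed
      ultimately show ?thesis unfolding Q_def by blast
    qed
    then show "\<exists>d>0. \<exists>C. \<forall>\<tau>\<in>{0..T}. \<bar>\<tau> - t\<bar> < d \<longrightarrow> Q \<tau> C" using d(1) by blast
  qed
  then obtain C where "\<And>t. t \<in> {0..T} \<Longrightarrow> Q t C" by blast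
  then have C: "\<And>t x. t \<in> {0..T} \<Longrightarrow> \<bar>f0 t x\<bar> \<le> C" "\<And>t x. t \<in> {0..T} \<Longrightarrow> \<bar>f1 t x\<bar> \<le> C" "\<And>t x. t \<in> {0..T} \<Longrightarrow> \<bar>f2 t x\<bar> \<le> C"
    "\<And>t x h. t \<in> {0..T} \<Longrightarrow> \<bar>f2 t (x + h) - f2 t x\<bar> \<le> C * \<bar>h\<bar> powr \<gamma>"
    unfolding Q_def by blast+
  have C0: "0 \<le> C" using C(1)[of 0 0] T by auto
  have w1: "AE x in lebesgue. weak_deriv (u t) x = f1 t x" "weak_deriv (u t) \<in> borel_measurable lebesgue" if t: "t \<in> {0..T}" for t
    using weak_deriv_classical[OF um[OF t] f(1,2)[OF t] f1c[OF t] C(1,2)[OF t]] by auto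
  have w2: "AE x in lebesgue. weak_deriv (weak_deriv (u t)) x = f2 t x" "weak_deriv (weak_deriv (u t)) \<in> borel_measurable lebesgue" if t: "t \<in> {0..T}" for t
    using weak_deriv_classical[OF w1(2)[OF t] w1(1)[OF t] f(3)[OF t] f2c[OF t] C(2,3)[OF t]] by auto
  have "sup_M T u \<le> ennreal (3 * C)"
    unfolding sup_M_def
  proof (rule SUP_least)
    fix t assume t: "t \<in> {0..T}"
    have "Lp_norm \<infinity> (u t) + Lp_norm \<infinity> (weak_deriv (u t)) + Lp_norm \<infinity> (weak_deriv (weak_deriv (u t))) \<le> ennreal C + ennreal C + ennreal C"
      by (intro add_mono Lp_norm_infinity_le[OF um[OF t] f(1)[OF t] C(1)[OF t]]
        Lp_norm_infinity_le[OF w1(2)[OF t] w1(1)[OF t] C(2)[OF t]] Lp_norm_infinity_le[OF w2(2)[OF t] w2(1)[OF t] C(3)[OF t]])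
    also have "\<dots> = ennreal (3 * C)" using C0 by (simp flip: ennreal_plus)
    finally show "Lp_norm \<infinity> (u t) + Lp_norm \<infinity> (weak_deriv (u t)) + Lp_norm \<infinity> (weak_deriv (weak_deriv (u t))) \<le> ennreal (3 * C)" .
  qed
  then show Mfin: "sup_M T u < \<infinity>" by (metis ennreal_less_top infinity_ennreal_def order_le_less_trans)
  have sumb: "\<bar>f0 t x\<bar> + \<bar>f1 t x\<bar> + \<bar>f2 t x\<bar> \<le> enn2real (sup_M T u)" if t: "t \<in> {0..T}" for t x
  proof -
    have "ennreal (\<bar>f0 t x\<bar> + \<bar>f1 t x\<bar> + \<bar>f2 t x\<bar>) = ennreal \<bar>f0 t x\<bar> + ennreal \<bar>f1 t x\<bar> + ennreal \<bar>f2 t x\<bar>"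
      by (simp add: ennreal_plus)
    also have "\<dots> \<le> Lp_norm \<infinity> (u t) + Lp_norm \<infinity> (weak_deriv (u t)) + Lp_norm \<infinity> (weak_deriv (weak_deriv (u t)))"
      by (intro add_mono continuous_le_Lp_norm_infinity f0c f1c f2c f(1) w1 w2 t)
    also have "\<dots> \<le> sup_M T u" unfolding sup_M_def by (rule SUP_upper[OF t])
    also have "\<dots> = ennreal (enn2real (sup_M T u))" using Mfin by simp
    finally show ?thesis by (simp only: ennreal_le_iff[OF enn2real_nonneg])
  qed
  \<comment> \<open>The H^(s-1) distance of the difference quotient from u_t; up to
    \<open>K1\<close> it bounds the pointwise errors for u and u_x uniformly in
    \<open>x\<close>.\<close>
  define qn where "qn t \<tau> = Hs_norm (s - 1) (\<lambda>x. (u \<tau> x - u t x) / (\<tau> - t) - ut t x)" for t \<tau>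
  have quot: "\<bar>(f0 \<tau> x - f0 t x) / (\<tau> - t) - U0 t x\<bar> \<le> K1 * enn2real (qn t \<tau>)"
      "\<bar>(f1 \<tau> x - f1 t x) / (\<tau> - t) - U1 t x\<bar> \<le> K1 * enn2real (qn t \<tau>)"
    if t: "t \<in> {0..T}" "\<tau> \<in> {0..T}" and ne: "\<tau> \<noteq> t" and fin: "qn t \<tau> < \<infinity>" for t \<tau> x
  proof -
    obtain g g' where g: "has_fourier (\<lambda>x. u \<tau> x - u t x) g" "has_fourier (ut t) g'" using hf_diff[OF t] utH(1)[OF t(1)] by blast
    have db: "AE x in lebesgue. \<bar>u \<tau> x - u t x\<bar> \<le> A \<tau> + A t"
      using ub[OF t(1)] ub[OF t(2)] by eventually_elim linarith
    have "has_fourier (\<lambda>x. (u \<tau> x - u t x) / (\<tau> - t) - ut t x) (\<lambda>\<xi>. (1 / (\<tau> - t)) *\<^sub>R g \<xi> + (-1) *\<^sub>R g' \<xi>)"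
      using has_fourier_lincomb[OF g(1) db g(2) utb[OF t(1)], of "1 / (\<tau> - t)" "-1"] by simp
    note hq = this
    obtain D0 D1 where Dae: "AE x in lebesgue. (u \<tau> x - u t x) / (\<tau> - t) - ut t x = D0 x"
      and Da: "\<forall>x. (D0 has_real_derivative D1 x) (at x)" and Db: "continuous_on UNIV D1"
      and Dc: "\<forall>x. \<bar>D0 x\<bar> \<le> K1 * enn2real (qn t \<tau>)" and Dd: "\<forall>x. \<bar>D1 x\<bar> \<le> K1 * enn2real (qn t \<tau>)"
      using S1[OF hq fin[unfolded qn_def], folded qn_def[of t \<tau>]] by (elim exE conjE) (rule that)
    note D = Dae Da[rule_format] Dc[rule_format] Dd[rule_format]
    have ae: "AE x in lebesgue. D0 x = (f0 \<tau> x - f0 t x) / (\<tau> - t) - U0 t x"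
      using D(1) f(1)[OF t(1)] f(1)[OF t(2)] U(1)[OF t(1)] by eventually_elim simp
    have "D0 x = (f0 \<tau> x - f0 t x) / (\<tau> - t) - U0 t x" "D1 x = (f1 \<tau> x - f1 t x) / (\<tau> - t) - U1 t x" for x
      using derivative_AE_unique[OF ae D(2), of "\<lambda>x. (f1 \<tau> x - f1 t x) / (\<tau> - t) - U1 t x" x]
        DERIV_diff[OF DERIV_cdivide[OF DERIV_diff[OF f(2)[OF t(2)] f(2)[OF t(1)]]] U(2)[OF t(1)]] by auto
    then show "\<bar>(f0 \<tau> x - f0 t x) / (\<tau> - t) - U0 t x\<bar> \<le> K1 * enn2real (qn t \<tau>)"
      "\<bar>(f1 \<tau> x - f1 t x) / (\<tau> - t) - U1 t x\<bar> \<le> K1 * enn2real (qn t \<tau>)"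
      using D(3,4)[of x] by auto
  qed
  have lim_q: "((\<lambda>\<tau>. qn t \<tau>) \<longlongrightarrow> 0) (at t within {0..T})" if "t \<in> {0..T}" for t
    using td that by (auto simp: has_time_deriv_Hs_def qn_def)
  have ev: "\<forall>\<^sub>F \<tau> in at t within {0..T}. \<tau> \<in> {0..T} \<and> \<tau> \<noteq> t \<and> qn t \<tau> < 1" if t: "t \<in> {0..T}" for t
    using order_tendstoD(2)[OF lim_q[OF t], of 1] unfolding eventually_at_filter by (auto elim: eventually_mono)
  have q1: "qn t \<tau> < \<infinity>" if "qn t \<tau> < 1" for t \<tau> using that by (metis ennreal_one_less_top infinity_ennreal_def order_less_trans)
  have q0: "((\<lambda>\<tau>. K1 * enn2real (qn t \<tau>)) \<longlongrightarrow> 0) (at t within {0..T})" if t: "t \<in> {0..T}" for t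
  proof -
    have "((\<lambda>\<tau>. enn2real (qn t \<tau>)) \<longlongrightarrow> 0) (at t within {0..T})"
      using lim_q[OF t] by (intro tendsto_enn2real) (simp_all flip: ennreal_0)
    then show ?thesis by (rule tendsto_mult_right_zero)
  qed
  have time_d: "((\<lambda>\<tau>. f0 \<tau> x) has_real_derivative U0 t x) (at t within {0..T})"
      "((\<lambda>\<tau>. f1 \<tau> x) has_real_derivative U1 t x) (at t within {0..T})" if t: "t \<in> {0..T}" for t x
  proof -
    have "((\<lambda>\<tau>. (f0 \<tau> x - f0 t x) / (\<tau> - t) - U0 t x) \<longlongrightarrow> 0) (at t within {0..T})"
    proof (rule Lim_null_comparison[OF _ q0[OF t]])
      show "\<forall>\<^sub>F \<tau> in at t within {0..T}. norm ((f0 \<tau> x - f0 t x) / (\<tau> - t) - U0 t x) \<le> K1 * enn2real (qn t \<tau>)"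
        using ev[OF t] by eventually_elim (use quot(1)[OF t] q1 in auto)
    qed
    then show "((\<lambda>\<tau>. f0 \<tau> x) has_real_derivative U0 t x) (at t within {0..T})"
      unfolding has_field_derivative_iff by (rule LIM_zero_cancel)
    have "((\<lambda>\<tau>. (f1 \<tau> x - f1 t x) / (\<tau> - t) - U1 t x) \<longlongrightarrow> 0) (at t within {0..T})"
    proof (rule Lim_null_comparison[OF _ q0[OF t]])
      show "\<forall>\<^sub>F \<tau> in at t within {0..T}. norm ((f1 \<tau> x - f1 t x) / (\<tau> - t) - U1 t x) \<le> K1 * enn2real (qn t \<tau>)"
        using ev[OF t] by eventually_elim (use quot(2)[OF t] q1 in auto)
    qed
    then show "((\<lambda>\<tau>. f1 \<tau> x) has_real_derivative U1 t x) (at t within {0..T})"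
      unfolding has_field_derivative_iff by (rule LIM_zero_cancel)
  qed
  have time_l: "\<exists>L. \<forall>\<tau>\<in>{0..T}. \<forall>x. \<bar>f0 \<tau> x - f0 t x\<bar> \<le> L * \<bar>\<tau> - t\<bar> \<and> \<bar>f1 \<tau> x - f1 t x\<bar> \<le> L * \<bar>\<tau> - t\<bar>"
    if t: "t \<in> {0..T}" for t
  proof -
    obtain d where d: "0 < d" "\<And>\<tau>. \<tau> \<in> {0..T} \<Longrightarrow> \<tau> \<noteq> t \<Longrightarrow> dist \<tau> t < d \<Longrightarrow> qn t \<tau> < 1"
      using ev[OF t] unfolding eventually_at by blast
    have A10: "0 \<le> A1 t" using U(4)[OF t, of 0] by linarith
    \<comment> \<open>Close to \<open>t\<close> the difference quotients stay within
      \<open>K1\<close> of the derivative, which is at most \<open>A1 t\<close>. At distance at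
      least \<open>d\<close> the increment is at most \<open>2 * C\<close>, hence at most
      \<open>2 * C / d\<close> times the distance.\<close>
    define L where "L = (K1 + A1 t) + 2 * C / d"
    have L: "K1 + A1 t \<le> L" "2 * C / d \<le> L" "0 \<le> L" using K1 A10 C0 d(1) by (auto simp: L_def)
    have "\<bar>w \<tau> x - w t x\<bar> \<le> L * \<bar>\<tau> - t\<bar>"
      if \<tau>: "\<tau> \<in> {0..T}" and wq: "\<tau> \<noteq> t \<Longrightarrow> qn t \<tau> < \<infinity> \<Longrightarrow> \<bar>(w \<tau> x - w t x) / (\<tau> - t) - W t x\<bar> \<le> K1 * enn2real (qn t \<tau>)"
        and wC: "\<bar>w \<tau> x\<bar> \<le> C" "\<bar>w t x\<bar> \<le> C" and WA: "\<bar>W t x\<bar> \<le> A1 t" for \<tau> x and w W :: "real \<Rightarrow> real \<Rightarrow> real"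
    proof (cases "\<tau> = t")
      case False
      show ?thesis
      proof (cases "\<bar>\<tau> - t\<bar> < d")
        case True
        have n1: "qn t \<tau> < 1" using d(2)[OF \<tau> False] True by (simp add: dist_real_def)
        have "enn2real (qn t \<tau>) \<le> 1" using n1 by (metis enn2real_leI ennreal_1 less_imp_le zero_le_one)
        then have "K1 * enn2real (qn t \<tau>) \<le> K1" using K1 by (simp add: mult_left_le)
        then have "\<bar>(w \<tau> x - w t x) / (\<tau> - t)\<bar> \<le> L" using wq[OF False q1[OF n1]] WA L(1) by linarith
        then show ?thesis using False by (simp add: abs_divide pos_divide_le_eq)
      next
        case F2: False
        have "2 * C = 2 * C / d * d" using d(1) by simp
        also have "\<dots> \<le> L * \<bar>\<tau> - t\<bar>" using L(2,3) F2 C0 d(1) by (intro mult_mono) auto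
        finally show ?thesis using wC by linarith
      qed
    qed simp
    note W = this
    show ?thesis
    proof (intro exI[of _ L] ballI allI conjI)
      fix \<tau> x assume \<tau>: "\<tau> \<in> {0..T}"
      show "\<bar>f0 \<tau> x - f0 t x\<bar> \<le> L * \<bar>\<tau> - t\<bar>" by (rule W[where w = f0 and W = U0, OF \<tau> quot(1)[OF t \<tau>] C(1)[OF \<tau>] C(1)[OF t] U(4)[OF t]])
      show "\<bar>f1 \<tau> x - f1 t x\<bar> \<le> L * \<bar>\<tau> - t\<bar>" by (rule W[where w = f1 and W = U1, OF \<tau> quot(2)[OF t \<tau>] C(2)[OF \<tau>] C(2)[OF t] U(5)[OF t]])
    qed
  qed
  have B: "\<bar>f0 t x\<bar> \<le> C + A1 t" "\<bar>f1 t x\<bar> \<le> C + A1 t" "\<bar>f2 t x\<bar> \<le> C + A1 t" "\<bar>U0 t x\<bar> \<le> C + A1 t" "\<bar>U1 t x\<bar> \<le> C + A1 t"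
    if t: "t \<in> {0..T}" for t x
    using C(1,2,3)[OF t, of x] U(4,5)[OF t, of x] C0 by linarith+
  note pc = pde_at_classical[OF um f(1) utm U(1) f(2) f(3) f2c B(1,2,3) U(2,3) B(4,5) pde]
  have "classical_solution T (enn2real (sup_M T u)) C \<gamma> f0 f1 f2 U0 U1"
  proof
    show "0 < T" "0 < \<gamma>" "0 \<le> C" using T \<gamma> C0 by auto
    fix t assume t: "t \<in> {0..T}"
    note p = pc[OF t t t t t t t t t t t t t t t, folded source_def source_deriv_def]
    show "\<exists>B. \<forall>x. \<bar>U0 t x\<bar> \<le> B \<and> \<bar>U1 t x\<bar> \<le> B" using U(4,5)[OF t] by blast
    fix x
    show "((\<lambda>x. U1 t x + source_deriv (f0 t x) (f1 t x) (f2 t x)) has_real_derivative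
      (U0 t x + source (f0 t x) (f1 t x)) - (source (f0 t x) (f1 t x) + 2 * source_deriv (f0 t x) (f1 t x) (f2 t x))) (at x)"
      by (rule p(1))
    show "\<bar>U0 t x + source (f0 t x) (f1 t x)\<bar>
      \<le> green (\<lambda>y. \<bar>source (f0 t y) (f1 t y) + 2 * source_deriv (f0 t y) (f1 t y) (f2 t y)\<bar>) x" by (rule p(2))
    show "\<bar>U1 t x + source_deriv (f0 t x) (f1 t x) (f2 t x)\<bar>
      \<le> green (\<lambda>y. \<bar>source (f0 t y) (f1 t y) + 2 * source_deriv (f0 t y) (f1 t y) (f2 t y)\<bar>) x" by (rule p(3))
  qed (use f(2,3) C(4) sumb U(2,3) time_d time_l in auto)
  note cs = this
  show "\<exists>f0 f1 f2 U0 U1 H \<gamma>. classical_solution T (enn2real (sup_M T u)) H \<gamma> f0 f1 f2 U0 U1 \<and>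
      (\<forall>t\<in>{0..T}. u t \<in> borel_measurable lebesgue \<and> weak_deriv (u t) \<in> borel_measurable lebesgue \<and>
        weak_deriv (weak_deriv (u t)) \<in> borel_measurable lebesgue \<and>
        (AE x in lebesgue. u t x = f0 t x) \<and> (AE x in lebesgue. weak_deriv (u t) x = f1 t x) \<and>
        (AE x in lebesgue. weak_deriv (weak_deriv (u t)) x = f2 t x))"
    by (rule exI[of _ f0], rule exI[of _ f1], rule exI[of _ f2], rule exI[of _ U0], rule exI[of _ U1], rule exI[of _ C], rule exI[of _ \<gamma>])
      (intro conjI ballI cs um w1 w2 f(1))
qed

section \<open>Truncated weights and passage to the limit\<close>

lemma admissible_weightD:
  assumes "admissible_weight \<phi> v C0 A"
  shows "0 < \<phi> x" "0 < A" "0 < C0" "0 \<le> v x" "\<phi> x \<le> C0 * v (x - y) * \<phi> y"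
    "\<phi> x \<le> exp (A * \<bar>x - y\<bar>) * \<phi> y" "continuous_on UNIV \<phi>"
    "integrable lebesgue (\<lambda>x. v x / exp \<bar>x\<bar>)"
proof -
  have m: "moderate v C0 \<phi>" and a: "locally_absolutely_continuous \<phi>" and A: "0 < A" and w: "weight_function v"
    and d: "AE x in lebesgue. \<exists>D. (\<phi> has_real_derivative D) (at x) \<and> \<bar>D\<bar> \<le> A * \<bar>\<phi> x\<bar>"
    and i: "integrable lebesgue (\<lambda>x. v x / exp \<bar>x\<bar>)"
    using assms by (simp_all add: admissible_weight_def)
  have pos: "0 < \<phi> x" for x using m by (simp add: moderate_def)
  have g: "\<phi> x \<le> exp (A * \<bar>x - y\<bar>) * \<phi> y" for x y by (rule weight_exp_growth[OF a pos A d])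
  show "0 < \<phi> x" "0 < A" "0 < C0" "0 \<le> v x" "\<phi> x \<le> exp (A * \<bar>x - y\<bar>) * \<phi> y" "integrable lebesgue (\<lambda>x. v x / exp \<bar>x\<bar>)"
    using pos A m w g i by (simp_all add: moderate_def weight_function_def)
  have "\<phi> ((x - y) + y) \<le> C0 * v (x - y) * \<phi> y" using m unfolding moderate_def by blast
  then show "\<phi> x \<le> C0 * v (x - y) * \<phi> y" by simp
  \<comment> \<open>Continuity is read off from the exponential growth bound, which used in both
    directions squeezes \<phi> near \<open>y\<close>.\<close>
  have "\<phi> \<midarrow>y\<rightarrow> \<phi> y" for y
  proof (rule tendsto_sandwich)
    show "\<forall>\<^sub>F x in at y. exp (- (A * \<bar>y - x\<bar>)) * \<phi> y \<le> \<phi> x"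
    proof (rule always_eventually, rule allI)
      fix x
      have "exp (- (A * \<bar>y - x\<bar>)) * \<phi> y \<le> exp (- (A * \<bar>y - x\<bar>)) * (exp (A * \<bar>y - x\<bar>) * \<phi> x)"
        using g[of y x] by (intro mult_left_mono) auto
      also have "\<dots> = \<phi> x" by (simp add: mult.assoc[symmetric] exp_add[symmetric])
      finally show "exp (- (A * \<bar>y - x\<bar>)) * \<phi> y \<le> \<phi> x" .
    qed
    show "\<forall>\<^sub>F x in at y. \<phi> x \<le> exp (A * \<bar>x - y\<bar>) * \<phi> y" using g by (intro always_eventually) auto
    have "(\<lambda>x. exp (- (A * \<bar>y - x\<bar>)) * \<phi> y) \<midarrow>y\<rightarrow> exp (- (A * \<bar>y - y\<bar>)) * \<phi> y" by (intro tendsto_intros)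
    then show "(\<lambda>x. exp (- (A * \<bar>y - x\<bar>)) * \<phi> y) \<midarrow>y\<rightarrow> \<phi> y" by simp
    have "(\<lambda>x. exp (A * \<bar>x - y\<bar>) * \<phi> y) \<midarrow>y\<rightarrow> exp (A * \<bar>y - y\<bar>) * \<phi> y" by (intro tendsto_intros)
    then show "(\<lambda>x. exp (A * \<bar>x - y\<bar>) * \<phi> y) \<midarrow>y\<rightarrow> \<phi> y" by simp
  qed
  then show "continuous_on UNIV \<phi>" by (simp add: continuous_on_def)
qed

text \<open>The cut-off puts the weight in every \<open>L\<^sup>q\<close>.  It preserves moderateness uniformly in \<open>n\<close>, because
  \<open>e\<^sup>-\<^sup>|\<^sup>x\<^sup>|\<^sup>/\<^sup>2\<close> is moderate with respect to \<open>e\<^sup>|\<^sup>x\<^sup>|\<^sup>/\<^sup>2\<close>, which is still integrable against the Green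
  kernel.\<close>

definition truncated_weight :: "(real \<Rightarrow> real) \<Rightarrow> nat \<Rightarrow> real \<Rightarrow> real" where
  "truncated_weight \<phi> n x = min (\<phi> x) (real (Suc n) * exp (- \<bar>x\<bar> / 2))"

lemma half_exp_abs:
  shows "integrable lborel (\<lambda>z::real. exp (- \<bar>z\<bar> / 2))" "(LINT z|lborel. exp (- \<bar>z::real\<bar> / 2)) = 4"
proof -
  have e: "(\<lambda>x::real. exp (- \<bar>x\<bar> / 2)) = (\<lambda>x. (\<lambda>y. exp (- \<bar>0 - y\<bar>)) (0 + (1 / 2) * x))"
    by (auto simp: abs_mult)
  show "integrable lborel (\<lambda>z::real. exp (- \<bar>z\<bar> / 2))"
    unfolding e by (rule lborel_integrable_real_affine[OF exp_abs_integrable]) simp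
  show "(LINT z|lborel. exp (- \<bar>z::real\<bar> / 2)) = 4"
    unfolding e using lborel_integral_real_affine[of "1/2" "\<lambda>y::real. exp (- \<bar>0 - y\<bar>)" 0] exp_abs_integral[of 0] by simp
qed

lemma truncated_weight_le: "truncated_weight \<phi> n x \<le> \<phi> x"
  by (simp add: truncated_weight_def)

lemma truncated_weight_pos: "0 < \<phi> x \<Longrightarrow> 0 < truncated_weight \<phi> n x"
  by (simp add: truncated_weight_def)

lemma truncated_weight_le_exp: "truncated_weight \<phi> n x \<le> real (Suc n) * exp (- \<bar>x\<bar> / 2)"
  by (simp add: truncated_weight_def)

lemma truncated_weight_mono: "m \<le> n \<Longrightarrow> truncated_weight \<phi> m x \<le> truncated_weight \<phi> n x"
  unfolding truncated_weight_def by (intro min.mono mult_right_mono) auto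

lemma truncated_weight_eventually:
  "\<forall>\<^sub>F n in sequentially. truncated_weight \<phi> n x = \<phi> x"
proof (rule eventually_sequentiallyI)
  fix n assume "nat \<lceil>\<phi> x * exp (\<bar>x\<bar> / 2)\<rceil> \<le> n"
  then have "\<phi> x * exp (\<bar>x\<bar> / 2) \<le> real (Suc n)" by linarith
  then have "\<phi> x * exp (\<bar>x\<bar> / 2) * exp (- \<bar>x\<bar> / 2) \<le> real (Suc n) * exp (- \<bar>x\<bar> / 2)" by (intro mult_right_mono) auto
  then show "truncated_weight \<phi> n x = \<phi> x" by (simp add: truncated_weight_def mult.assoc exp_add[symmetric])
qed

lemma truncated_weight_continuous: "continuous_on UNIV \<phi> \<Longrightarrow> continuous_on UNIV (truncated_weight \<phi> n)"
  unfolding truncated_weight_def[abs_def] by (intro continuous_intros) auto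

text \<open>A minimum inherits the larger of the two growth rates, \<open>A\<close> for \<phi> and
  1/2 for the cut-off, whatever the level \<open>n\<close>.\<close>

lemma truncated_weight_growth:
  assumes "\<phi> x \<le> exp (A * \<bar>x - y\<bar>) * \<phi> y" "0 < \<phi> y"
  shows "truncated_weight \<phi> n x \<le> exp (max A (1 / 2) * \<bar>x - y\<bar>) * truncated_weight \<phi> n y"
proof -
  let ?E = "exp (max A (1 / 2) * \<bar>x - y\<bar>)"
  have "exp (A * \<bar>x - y\<bar>) * \<phi> y \<le> ?E * \<phi> y" using assms(2) by (intro mult_right_mono) (auto intro!: mult_right_mono)
  then have 1: "\<phi> x \<le> ?E * \<phi> y" using assms(1) by linarith
  have t: "\<bar>y\<bar> \<le> \<bar>x\<bar> + \<bar>x - y\<bar>" by linarith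
  have "1 / 2 * \<bar>x - y\<bar> \<le> max A (1 / 2) * \<bar>x - y\<bar>" by (intro mult_right_mono) auto
  then have "- \<bar>x\<bar> / 2 \<le> max A (1 / 2) * \<bar>x - y\<bar> + - \<bar>y\<bar> / 2" using t by linarith
  then have "exp (- \<bar>x\<bar> / 2) \<le> ?E * exp (- \<bar>y\<bar> / 2)" by (simp add: exp_add[symmetric])
  then have "real (Suc n) * exp (- \<bar>x\<bar> / 2) \<le> real (Suc n) * (?E * exp (- \<bar>y\<bar> / 2))" by (intro mult_left_mono) auto
  then have 2: "real (Suc n) * exp (- \<bar>x\<bar> / 2) \<le> ?E * (real (Suc n) * exp (- \<bar>y\<bar> / 2))" by (simp add: mult_ac)
  have "truncated_weight \<phi> n x \<le> min (?E * \<phi> y) (?E * (real (Suc n) * exp (- \<bar>y\<bar> / 2)))"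
    unfolding truncated_weight_def by (rule min.mono[OF 1 2])
  also have "\<dots> = ?E * truncated_weight \<phi> n y" unfolding truncated_weight_def by (simp add: min_mult_distrib_left)
  finally show ?thesis .
qed

text \<open>For exponents at least 2 the power of the cut-off is dominated by a multiple of
  exp(-|x|).\<close>

lemma truncated_weight_powr_integrable:
  assumes "continuous_on UNIV \<phi>" "\<And>x. 0 < \<phi> x" "2 \<le> q"
  shows "integrable lborel (\<lambda>x. truncated_weight \<phi> n x powr q)"
proof (rule Bochner_Integration.integrable_bound)
  show "integrable lborel (\<lambda>x::real. real (Suc n) powr q * exp (- \<bar>0 - x\<bar>))" by (intro integrable_mult_right exp_abs_integrable)
  have "truncated_weight \<phi> n \<in> borel_measurable borel"
    by (rule borel_measurable_continuous_onI[OF truncated_weight_continuous[OF assms(1)]])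
  then show "(\<lambda>x. truncated_weight \<phi> n x powr q) \<in> borel_measurable lborel" by measurable
  show "AE x in lborel. norm (truncated_weight \<phi> n x powr q) \<le> norm (real (Suc n) powr q * exp (- \<bar>0 - x\<bar>))"
  proof (rule AE_I2)
    fix x
    have "truncated_weight \<phi> n x powr q \<le> (real (Suc n) * exp (- \<bar>x\<bar> / 2)) powr q"
      using truncated_weight_le_exp[of \<phi> n x] truncated_weight_pos[where \<phi> = \<phi> and x = x and n = n, OF assms(2)] assms(3) by (intro powr_mono2) auto
    also have "\<dots> = real (Suc n) powr q * exp (- \<bar>x\<bar> / 2 * q)" by (simp add: powr_mult exp_powr_real)
    also have "\<bar>x\<bar> / 2 * 2 \<le> \<bar>x\<bar> / 2 * q" using assms(3) by (intro mult_left_mono) auto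
    then have "exp (- \<bar>x\<bar> / 2 * q) \<le> exp (- \<bar>0 - x\<bar>)" by simp
    finally show "norm (truncated_weight \<phi> n x powr q) \<le> norm (real (Suc n) powr q * exp (- \<bar>0 - x\<bar>))"
      by (simp add: mult_left_mono)
  qed
qed

text \<open>The minimum of \<phi> and the cut-off is moderate with respect to the sum of the two
  moderating functions. Multiplying this sum by the Green kernel gives one \<kappa> for all
  \<open>n\<close>, with mass at most \<open>C0 * I + 4\<close>.\<close>

lemma admissible_weight_kernel:
  assumes adm: "admissible_weight \<phi> v C0 A"
  defines "I \<equiv> (LINT x|lebesgue. v x / exp \<bar>x\<bar>)"
  obtains \<kappa> where "\<kappa> \<in> borel_measurable borel" "\<And>x. 0 \<le> \<kappa> x" "(\<integral>\<^sup>+x. ennreal (\<kappa> x) \<partial>lborel) \<le> ennreal (C0 * I + 4)"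
    "\<And>n x. AE y in lborel. exp (- \<bar>x - y\<bar>) / 2 * truncated_weight \<phi> n x \<le> \<kappa> (x - y) * truncated_weight \<phi> n y"
    "0 \<le> I"
proof -
  note W = admissible_weightD[OF adm]
  let ?g = "\<lambda>x. v x / exp \<bar>x\<bar>"
  have I0: "0 \<le> I" unfolding I_def using W(4) by (intro Bochner_Integration.integral_nonneg) auto
  have gm: "?g \<in> borel_measurable lebesgue" using W(8) by (rule borel_measurable_integrable)
  obtain g0 where g0: "g0 \<in> borel_measurable borel" "AE x in lebesgue. ?g x = g0 x" by (rule borel_version_lebesgue[OF gm])
  note iv = integral_lebesgue_borel_version[OF gm g0]
  have g0i: "integrable lborel g0" "(LINT x|lborel. g0 x) = I" using iv W(8) by (auto simp: I_def)
  have g0AE: "AE x in lborel. ?g x = g0 x" using g0(2) by (simp add: AE_completion_iff)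
  \<comment> \<open>The Green kernel times \<open>C0 * v z + exp (\<bar>z\<bar> / 2)\<close>, with a
    Borel version in place of v(z) / exp |z|. Its mass is \<open>C0 / 2 * I + 2\<close>, later
    rounded up. The version may be negative on a null set, which is why the final kernel is the
    maximum with 0.\<close>
  define k where "k x = C0 / 2 * g0 x + exp (- \<bar>x\<bar> / 2) / 2" for x
  have ki: "integrable lborel k" unfolding k_def[abs_def]
    by (intro Bochner_Integration.integrable_add integrable_mult_right g0i integrable_divide half_exp_abs)
  have km: "k \<in> borel_measurable borel" using ki by (simp add: borel_measurable_integrable[of lborel k, simplified])
  have kI: "(LINT x|lborel. k x) = C0 / 2 * I + 2"
    unfolding k_def using g0i half_exp_abs by (subst Bochner_Integration.integral_add) auto
  have k0: "AE x in lborel. 0 \<le> k x" using g0AE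
  proof eventually_elim
    fix x assume "?g x = g0 x"
    then have "0 \<le> g0 x" using W(4)[of x] by (metis divide_nonneg_pos exp_gt_zero)
    then show "0 \<le> k x" using W(3) by (simp add: k_def)
  qed
  show ?thesis
  proof (rule that[of "\<lambda>x. max 0 (k x)"])
    show "(\<lambda>x. max 0 (k x)) \<in> borel_measurable borel" using km by (intro borel_measurable_max) auto
    show "0 \<le> max 0 (k x)" for x by simp
    have "(\<integral>\<^sup>+x. ennreal (max 0 (k x)) \<partial>lborel) = (\<integral>\<^sup>+x. ennreal (k x) \<partial>lborel)" by (intro nn_integral_cong) (simp add: max_def ennreal_neg)
    also have "\<dots> = ennreal (C0 / 2 * I + 2)" using nn_integral_eq_integral[OF ki k0] kI by simp
    also have "\<dots> \<le> ennreal (C0 * I + 4)" using I0 W(3) by (intro ennreal_leI add_mono mult_right_mono) auto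
    finally show "(\<integral>\<^sup>+x. ennreal (max 0 (k x)) \<partial>lborel) \<le> ennreal (C0 * I + 4)" .
    show "0 \<le> I" by (rule I0)
    obtain N where N: "N \<in> sets borel" "\<And>z. z \<notin> N \<Longrightarrow> ?g z = g0 z" "emeasure lborel N = 0"
    proof -
      from g0AE obtain N where "{x \<in> space lborel. \<not> ?g x = g0 x} \<subseteq> N" "emeasure lborel N = 0" "N \<in> sets lborel" by (rule AE_E)
      then show ?thesis by (intro that[of N]) auto
    qed
    have NAE: "AE z in lborel. z \<notin> N" using N(1,3) by (intro AE_not_in null_setsI) auto
    fix n x
    \<comment> \<open>The exceptional set of the Borel version is reflected and translated: for
      fixed \<open>x\<close> the difference x - y avoids it for almost every
      \<open>y\<close>.\<close>
    have "AE y in lborel. x + (-1) * y \<notin> N"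
      by (rule AE_borel_affine[where P = "\<lambda>z. z \<notin> N"]) (use N(1) NAE in auto)
    then show "AE y in lborel. exp (- \<bar>x - y\<bar>) / 2 * truncated_weight \<phi> n x \<le> max 0 (k (x - y)) * truncated_weight \<phi> n y"
    proof eventually_elim
      fix y assume y: "x + (-1) * y \<notin> N"
      define z where "z = x - y"
      define S where "S = C0 * v z + exp (\<bar>z\<bar> / 2)"
      have g: "g0 z = v z / exp \<bar>z\<bar>" using N(2)[of z] y by (simp add: z_def)
      have p: "0 \<le> C0 * v z" using W(3) W(4)[of z] by simp
      have 1: "\<phi> x \<le> S * \<phi> y"
      proof -
        have "\<phi> x \<le> C0 * v z * \<phi> y" using W(5)[of x y] by (simp only: z_def)
        also have "\<dots> \<le> S * \<phi> y" unfolding S_def using W(1)[of y] by (intro mult_right_mono) auto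
        finally show ?thesis .
      qed
      have 2: "real (Suc n) * exp (- \<bar>x\<bar> / 2) \<le> S * (real (Suc n) * exp (- \<bar>y\<bar> / 2))"
      proof -
        have "- \<bar>x\<bar> / 2 \<le> \<bar>z\<bar> / 2 + - \<bar>y\<bar> / 2" unfolding z_def using abs_triangle_ineq2_sym[of y x] by (simp add: field_simps)
        then have "exp (- \<bar>x\<bar> / 2) \<le> exp (\<bar>z\<bar> / 2) * exp (- \<bar>y\<bar> / 2)" by (simp add: exp_add[symmetric])
        also have "\<dots> \<le> S * exp (- \<bar>y\<bar> / 2)" unfolding S_def using p by (intro mult_right_mono) auto
        finally have "real (Suc n) * exp (- \<bar>x\<bar> / 2) \<le> real (Suc n) * (S * exp (- \<bar>y\<bar> / 2))" by (intro mult_left_mono) auto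
        then show ?thesis by (simp add: mult_ac)
      qed
      have S0: "0 \<le> S" using p by (simp add: S_def)
      have "truncated_weight \<phi> n x \<le> min (S * \<phi> y) (S * (real (Suc n) * exp (- \<bar>y\<bar> / 2)))"
        unfolding truncated_weight_def by (rule min.mono[OF 1 2])
      also have "\<dots> = S * truncated_weight \<phi> n y" unfolding truncated_weight_def using S0 by (simp add: min_mult_distrib_left)
      finally have "exp (- \<bar>z\<bar>) / 2 * truncated_weight \<phi> n x \<le> exp (- \<bar>z\<bar>) / 2 * (S * truncated_weight \<phi> n y)"
        by (intro mult_left_mono) auto
      also have "\<dots> = k z * truncated_weight \<phi> n y"
      proof -
        have "exp (- \<bar>z\<bar>) * exp (\<bar>z\<bar> / 2) = exp (- \<bar>z\<bar> / 2)" by (simp add: exp_add[symmetric])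
        then have "exp (- \<bar>z\<bar>) / 2 * S = k z" unfolding S_def k_def g
          by (simp add: distrib_left exp_minus field_simps)
        then show ?thesis by (metis mult.assoc)
      qed
      also have "\<dots> \<le> max 0 (k z) * truncated_weight \<phi> n y" using truncated_weight_pos[where \<phi> = \<phi> and x = y and n = n, OF W(1)] by (intro mult_right_mono) auto
      finally show "exp (- \<bar>x - y\<bar>) / 2 * truncated_weight \<phi> n x \<le> max 0 (k (x - y)) * truncated_weight \<phi> n y" by (simp add: z_def)
    qed
  qed
qed

text \<open>The constants \<open>1 / 2\<close> and \<open>4\<close> account for the cut-off \<open>e\<^sup>-\<^sup>|\<^sup>x\<^sup>|\<^sup>/\<^sup>2\<close>; the absolute value only serves
  to make the rate positive at all arguments.\<close>

definition growth_rate :: "real \<Rightarrow> real \<Rightarrow> real \<Rightarrow> real \<Rightarrow> real" where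
  "growth_rate a b c d = 200 * (1 + max a (1 / 2)) * (1 + (\<bar>b * d\<bar> + 4))"

lemma growth_rate_pos: "0 < growth_rate a b c d"
  unfolding growth_rate_def by (intro mult_pos_pos) (auto simp: max_def)

text \<open>With \<open>J = C0 * I + 4\<close>, where \<open>I\<close> is the integral of the
  moderating weight, and \<open>B = max A (1 / 2)\<close>, the rate of
  \<open>weighted_estimate\<close> becomes \<open>growth_rate\<close>, the same for all levels
  \<open>j\<close> and exponents \<open>q\<close>.\<close>

lemma (in classical_solution) truncated_estimate:
  fixes j :: nat
  assumes adm: "admissible_weight \<phi> v C0 A" and q: "2 \<le> q" and t: "t \<in> {0..T}"
  defines "nrm \<equiv> \<lambda>f. wnorm lborel q (\<lambda>x. f x * truncated_weight \<phi> j x)"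
  shows "nrm (f0 t) + nrm (f1 t) + nrm (f2 t)
    \<le> (nrm (f0 0) + nrm (f1 0) + nrm (f2 0)) * exp (growth_rate A C0 c (LINT x|lebesgue. v x / exp \<bar>x\<bar>) * M * t)"
proof -
  note D = admissible_weightD[OF adm]
  let ?w = "truncated_weight \<phi> j" and ?I = "LINT x|lebesgue. v x / exp \<bar>x\<bar>"
  obtain \<kappa> where k: "\<kappa> \<in> borel_measurable borel" "\<And>x. 0 \<le> \<kappa> x" "(\<integral>\<^sup>+x. ennreal (\<kappa> x) \<partial>lborel) \<le> ennreal (C0 * ?I + 4)"
    "\<And>i x. AE y in lborel. exp (- \<bar>x - y\<bar>) / 2 * truncated_weight \<phi> i x \<le> \<kappa> (x - y) * truncated_weight \<phi> i y"
    "0 \<le> ?I"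
    by (rule admissible_weight_kernel[OF adm]) blast
  have wm: "?w \<in> borel_measurable borel" by (rule borel_measurable_continuous_onI[OF truncated_weight_continuous[OF D(7)]])
  have wp: "0 < ?w x" for x by (rule truncated_weight_pos) (rule D(1))
  have wB: "?w x \<le> real (Suc j)" for x
    by (rule order_trans[OF truncated_weight_le_exp]) (auto intro!: mult_left_le)
  have CI: "0 \<le> C0 * ?I" using k(5) D(3) by simp
  have e: "200 * (1 + max A (1 / 2)) * (1 + (C0 * ?I + 4)) = growth_rate A C0 c ?I" using CI by (simp add: growth_rate_def)
  \<comment> \<open>The weight passes from the density into the function, the form in which the
    truncation can be removed.\<close>
  have d: "wnorm (density lborel (\<lambda>x. ennreal (?w x powr q))) q f = nrm f" if "f \<in> borel_measurable borel" for f
  proof -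
    have "(\<lambda>x. ?w x powr q) \<in> borel_measurable borel" using wm by measurable
    from wnorm_density[OF that this, of q] show ?thesis
      unfolding nrm_def wnorm_def using wp by (simp add: abs_mult powr_mult less_imp_le)
  qed
  have fm: "f0 \<tau> \<in> borel_measurable borel" "f1 \<tau> \<in> borel_measurable borel" "f2 \<tau> \<in> borel_measurable borel" if "\<tau> \<in> {0..T}" for \<tau>
    using that by (auto intro!: borel_measurable_continuous_onI f0_cont f1_cont f2_cont)
  have z: "0 \<in> {0..T}" using T by simp
  have J: "0 < C0 * ?I + 4" using CI by simp
  have q1: "1 < q" and B: "0 \<le> max A (1 / 2)" using q by auto
  note est = weighted_estimate[OF q1 J k(1,2,3) k(4)[of _ j] wp wB wm truncated_weight_powr_integrable[OF D(7,1) q]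
      B truncated_weight_growth[OF D(6,1)] t]
  show ?thesis using est unfolding d[OF fm(1)[OF t]] d[OF fm(2)[OF t]] d[OF fm(3)[OF t]] d[OF fm(1)[OF z]] d[OF fm(2)[OF z]] d[OF fm(3)[OF z]] e .
qed

section \<open>Removing the truncation and letting the exponent tend to infinity\<close>

lemma truncated_powr_integrable:
  fixes g \<phi> :: "real \<Rightarrow> real"
  assumes "continuous_on UNIV \<phi>" "\<And>x. 0 < \<phi> x" "continuous_on UNIV g" "\<And>x. \<bar>g x\<bar> \<le> D" "2 \<le> q"
  shows "integrable lborel (\<lambda>x. \<bar>g x * truncated_weight \<phi> n x\<bar> powr q)"
proof (rule Bochner_Integration.integrable_bound)
  show "integrable lborel (\<lambda>x. D powr q * truncated_weight \<phi> n x powr q)"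
    by (intro integrable_mult_right truncated_weight_powr_integrable assms)
  have "(\<lambda>x. g x * truncated_weight \<phi> n x) \<in> borel_measurable borel"
    by (intro borel_measurable_continuous_onI continuous_intros assms truncated_weight_continuous)
  then show "(\<lambda>x. \<bar>g x * truncated_weight \<phi> n x\<bar> powr q) \<in> borel_measurable lborel" by measurable
  show "AE x in lborel. norm (\<bar>g x * truncated_weight \<phi> n x\<bar> powr q) \<le> norm (D powr q * truncated_weight \<phi> n x powr q)"
  proof (rule AE_I2)
    fix x
    have w: "0 < truncated_weight \<phi> n x" by (rule truncated_weight_pos) (rule assms)
    have "\<bar>g x\<bar> powr q \<le> D powr q" using assms(4)[of x] assms(5) by (intro powr_mono2) auto
    then show "norm (\<bar>g x * truncated_weight \<phi> n x\<bar> powr q) \<le> norm (D powr q * truncated_weight \<phi> n x powr q)"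
      using mult_right_mono[of "\<bar>g x\<bar> powr q" "D powr q" "truncated_weight \<phi> n x powr q"] w by (simp add: abs_mult powr_mult)
  qed
qed

text \<open>Monotone convergence in the truncation level. The uniform bound \<open>R\<close> is what
  makes the limit integrable, so membership in the weighted space at later times is a
  conclusion.\<close>

lemma wnorm_truncated_tendsto:
  fixes g \<phi> :: "real \<Rightarrow> real"
  assumes \<phi>: "continuous_on UNIV \<phi>" "\<And>x. 0 < \<phi> x" and g: "continuous_on UNIV g" "\<And>x. \<bar>g x\<bar> \<le> D" and q: "2 \<le> q"
    and R: "\<And>n. wnorm lborel q (\<lambda>x. g x * truncated_weight \<phi> n x) \<le> R"
  shows "integrable lborel (\<lambda>x. \<bar>g x * \<phi> x\<bar> powr q)"
    and "(\<lambda>n. wnorm lborel q (\<lambda>x. g x * truncated_weight \<phi> n x)) \<longlonglongrightarrow> wnorm lborel q (\<lambda>x. g x * \<phi> x)"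
proof -
  let ?f = "\<lambda>n x. \<bar>g x * truncated_weight \<phi> n x\<bar> powr q"
  note fi = truncated_powr_integrable[OF \<phi> g q]
  have mono: "?f m x \<le> ?f n x" if "m \<le> n" for m n x
  proof (intro powr_mono2)
    have "0 < truncated_weight \<phi> m x" "0 < truncated_weight \<phi> n x" by (rule truncated_weight_pos, rule \<phi>)+
    then show "\<bar>g x * truncated_weight \<phi> m x\<bar> \<le> \<bar>g x * truncated_weight \<phi> n x\<bar>"
      using truncated_weight_mono[OF that, of \<phi> x] by (simp add: abs_mult mult_left_mono)
  qed (use q in auto)
  have lim: "(\<lambda>n. ?f n x) \<longlonglongrightarrow> \<bar>g x * \<phi> x\<bar> powr q" for x
    by (rule tendsto_eventually) (use truncated_weight_eventually[of \<phi> x] in eventually_elim, simp)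
  have bd: "(LINT x|lborel. ?f n x) \<le> R powr q" for n
  proof -
    have "(LINT x|lborel. ?f n x) = wnorm lborel q (\<lambda>x. g x * truncated_weight \<phi> n x) powr q" using q by (subst wnorm_powr) auto
    also have "\<dots> \<le> R powr q" using R q by (intro powr_mono2 wnorm_nonneg) auto
    finally show ?thesis .
  qed
  have inc: "incseq (\<lambda>n. LINT x|lborel. ?f n x)"
    by (intro incseq_SucI integral_mono fi mono) auto
  obtain a where a: "(\<lambda>n. LINT x|lborel. ?f n x) \<longlonglongrightarrow> a" using incseq_convergent[OF inc] bd by blast
  have m: "(\<lambda>x. \<bar>g x * \<phi> x\<bar> powr q) \<in> borel_measurable lborel"
  proof -
    have "(\<lambda>x. g x * \<phi> x) \<in> borel_measurable borel" by (intro borel_measurable_continuous_onI continuous_intros \<phi> g)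
    then show ?thesis by measurable
  qed
  have mo: "AE x in lborel. mono (\<lambda>n. ?f n x)" by (intro AE_I2 monoI mono)
  note mc = integrable_monotone_convergence[OF fi mo AE_I2[OF lim] a m] integral_monotone_convergence[OF fi mo AE_I2[OF lim] a m]
  show "integrable lborel (\<lambda>x. \<bar>g x * \<phi> x\<bar> powr q)" by (rule mc(1))
  show "(\<lambda>n. wnorm lborel q (\<lambda>x. g x * truncated_weight \<phi> n x)) \<longlonglongrightarrow> wnorm lborel q (\<lambda>x. g x * \<phi> x)"
    unfolding wnorm_def
  proof (rule tendsto_powr2[OF _ tendsto_const])
    show "(\<lambda>n. LINT x|lborel. ?f n x) \<longlonglongrightarrow> (LINT x|lborel. \<bar>g x * \<phi> x\<bar> powr q)" using a unfolding mc(2) .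
    show "\<forall>\<^sub>F n in sequentially. 0 \<le> (LINT x|lborel. ?f n x)" by (intro always_eventually allI Bochner_Integration.integral_nonneg) simp
    show "0 < 1 / q" using q by simp
  qed
qed

text \<open>By continuity |F| exceeds \<eta> on an interval of some length \<open>m\<close> around
  \<open>x\<close>. As \<open>m\<close> does not depend on \<open>q\<close>, the factor
  \<open>m powr (1 / q)\<close> tends to 1 and the norms recover the value at
  \<open>x\<close>.\<close>

lemma wnorm_lower_bound:
  fixes F :: "real \<Rightarrow> real"
  assumes F: "continuous_on UNIV F" and \<eta>: "\<eta> < \<bar>F x\<bar>"
  shows "\<exists>m>0. \<forall>q\<ge>2. integrable lborel (\<lambda>x. \<bar>F x\<bar> powr q) \<longrightarrow> \<eta> * m powr (1 / q) \<le> wnorm lborel q F"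
proof (cases "\<eta> \<le> 0")
  case True
  then have "\<eta> * 1 powr (1 / q) \<le> wnorm lborel q F" for q using wnorm_nonneg[of lborel q F] by simp
  then show ?thesis by (intro exI[of _ 1]) auto
next
  case False
  have "isCont F x" using F by (simp add: continuous_on_eq_continuous_at)
  then have "(\<lambda>y. \<bar>F y\<bar>) \<midarrow>x\<rightarrow> \<bar>F x\<bar>" by (intro tendsto_rabs) (simp add: isCont_def)
  then have "\<forall>\<^sub>F y in at x. \<eta> < \<bar>F y\<bar>" using \<eta> by (rule order_tendstoD(1))
  then obtain d where d: "0 < d" "\<And>y. y \<noteq> x \<Longrightarrow> dist y x < d \<Longrightarrow> \<eta> < \<bar>F y\<bar>" unfolding eventually_at by auto
  have near: "\<eta> \<le> \<bar>F y\<bar>" if "y \<in> {x - d<..<x + d}" for y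
  proof (cases "y = x")
    case False
    have "dist y x < d" using that by (simp add: dist_real_def abs_less_iff)
    then show ?thesis using d(2)[OF False] by simp
  qed (use \<eta> in simp)
  show ?thesis
  proof (intro exI[of _ "2 * d"] conjI allI impI)
    show "0 < 2 * d" using d by simp
    fix q :: real assume q: "2 \<le> q" and i: "integrable lborel (\<lambda>x. \<bar>F x\<bar> powr q)"
    have em: "emeasure lborel {x - d<..<x + d} < \<infinity>" using d by simp
    have "\<eta> powr q * (2 * d) = (LINT y|lborel. \<eta> powr q * indicator {x - d<..<x + d} y)" using d by simp
    also have "\<dots> \<le> (LINT y|lborel. \<bar>F y\<bar> powr q)"
    proof (rule integral_mono)
      show "integrable lborel (\<lambda>y. \<eta> powr q * indicator {x - d<..<x + d} y)" using em by (intro integrable_mult_right integrable_real_indicator) auto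
      show "\<eta> powr q * indicator {x - d<..<x + d} y \<le> \<bar>F y\<bar> powr q" for y
        using near[of y] False q by (auto simp: indicator_def intro!: powr_mono2)
    qed (rule i)
    finally have "(\<eta> powr q * (2 * d)) powr (1 / q) \<le> wnorm lborel q F"
      unfolding wnorm_def using d q by (intro powr_mono2) auto
    then show "\<eta> * (2 * d) powr (1 / q) \<le> wnorm lborel q F" using d q False by (simp add: powr_mult powr_powr)
  qed
qed

text \<open>Interpolation between L^2 and the sup norm. Adding 1 keeps the base of the last power
  positive, so that this power tends to 1 even if \<open>F\<close> vanishes.\<close>

lemma wnorm_upper_bound:
  fixes F :: "real \<Rightarrow> real"
  assumes "2 \<le> q" "0 < c" "\<And>x. \<bar>F x\<bar> \<le> c" "integrable lborel (\<lambda>x. \<bar>F x\<bar> powr 2)" "integrable lborel (\<lambda>x. \<bar>F x\<bar> powr q)"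
  shows "wnorm lborel q F \<le> c powr (1 - 2 / q) * ((LINT x|lborel. \<bar>F x\<bar> powr 2) + 1) powr (1 / q)"
proof -
  let ?N = "LINT x|lborel. \<bar>F x\<bar> powr 2"
  have N: "0 \<le> ?N" by simp
  have "(LINT x|lborel. \<bar>F x\<bar> powr q) \<le> (LINT x|lborel. c powr (q - 2) * \<bar>F x\<bar> powr 2)"
  proof (rule integral_mono)
    fix x
    have "\<bar>F x\<bar> powr q = \<bar>F x\<bar> powr (q - 2) * \<bar>F x\<bar> powr 2" using powr_add[of "\<bar>F x\<bar>" "q - 2" 2] by (simp only: diff_add_cancel)
    also have "\<dots> \<le> c powr (q - 2) * \<bar>F x\<bar> powr 2" using assms by (intro mult_right_mono powr_mono2) auto
    finally show "\<bar>F x\<bar> powr q \<le> c powr (q - 2) * \<bar>F x\<bar> powr 2" .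
  qed (use assms in auto)
  also have "\<dots> = c powr (q - 2) * ?N" by simp
  also have "\<dots> \<le> c powr (q - 2) * (?N + 1)" by (intro mult_left_mono) auto
  finally have "wnorm lborel q F \<le> (c powr (q - 2) * (?N + 1)) powr (1 / q)"
    unfolding wnorm_def using assms(1) by (intro powr_mono2) auto
  also have "\<dots> = c powr ((q - 2) / q) * (?N + 1) powr (1 / q)" using N by (simp add: powr_mult powr_powr)
  also have "(q - 2) / q = 1 - 2 / q" using assms(1) by (simp add: field_simps)
  finally show ?thesis .
qed

lemma powr_inverse_tendsto:
  assumes "0 < (c::real)"
  shows "(\<lambda>k. c powr (1 / (real k + 2))) \<longlonglongrightarrow> 1" "(\<lambda>k. c powr (1 - 2 / (real k + 2))) \<longlonglongrightarrow> c"
proof -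
  have t: "(\<lambda>k. a / (real k + 2)) \<longlonglongrightarrow> 0" for a :: real by real_asymp
  show "(\<lambda>k. c powr (1 / (real k + 2))) \<longlonglongrightarrow> 1"
    using tendsto_powr[OF tendsto_const[of c] t[of 1]] assms by simp
  show "(\<lambda>k. c powr (1 - 2 / (real k + 2))) \<longlonglongrightarrow> c"
    using tendsto_powr[OF tendsto_const[of c] tendsto_diff[OF tendsto_const[of 1] t[of 2]]] assms by simp
qed

text \<open>Initially the truncated norms lie below the full ones, which gives a right-hand side
  independent of the level; the left-hand side then converges monotonically.\<close>

lemma (in classical_solution) weighted_Lp_estimate:
  assumes adm: "admissible_weight \<phi> v C0 A" and q: "2 \<le> q" and t: "t \<in> {0..T}"
    and i: "integrable lborel (\<lambda>x. \<bar>f0 0 x * \<phi> x\<bar> powr q)" "integrable lborel (\<lambda>x. \<bar>f1 0 x * \<phi> x\<bar> powr q)"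
      "integrable lborel (\<lambda>x. \<bar>f2 0 x * \<phi> x\<bar> powr q)"
  shows "integrable lborel (\<lambda>x. \<bar>f0 t x * \<phi> x\<bar> powr q)" "integrable lborel (\<lambda>x. \<bar>f1 t x * \<phi> x\<bar> powr q)"
      "integrable lborel (\<lambda>x. \<bar>f2 t x * \<phi> x\<bar> powr q)"
    and "wnorm lborel q (\<lambda>x. f0 t x * \<phi> x) + wnorm lborel q (\<lambda>x. f1 t x * \<phi> x) + wnorm lborel q (\<lambda>x. f2 t x * \<phi> x)
      \<le> (wnorm lborel q (\<lambda>x. f0 0 x * \<phi> x) + wnorm lborel q (\<lambda>x. f1 0 x * \<phi> x) + wnorm lborel q (\<lambda>x. f2 0 x * \<phi> x))
        * exp (growth_rate A C0 c (LINT x|lebesgue. v x / exp \<bar>x\<bar>) * M * t)"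
proof -
  note D = admissible_weightD[OF adm]
  let ?E = "exp (growth_rate A C0 c (LINT x|lebesgue. v x / exp \<bar>x\<bar>) * M * t)"
  let ?nn = "\<lambda>f k. wnorm lborel q (\<lambda>x. f x * truncated_weight \<phi> k x)"
  let ?nl = "\<lambda>f. wnorm lborel q (\<lambda>x. f x * \<phi> x)"
  let ?R = "(?nl (f0 0) + ?nl (f1 0) + ?nl (f2 0)) * ?E"
  have z: "0 \<in> {0..T}" using T by simp
  have init: "?nn f k \<le> ?nl f" if "continuous_on UNIV f" "\<And>x. \<bar>f x\<bar> \<le> M" "integrable lborel (\<lambda>x. \<bar>f x * \<phi> x\<bar> powr q)" for f k
  proof (rule wnorm_mono)
    show "1 < q" using q by simp
    show "integrable lborel (\<lambda>x. \<bar>f x * truncated_weight \<phi> k x\<bar> powr q)" by (rule truncated_powr_integrable[OF D(7,1) that(1,2) q])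
    show "integrable lborel (\<lambda>x. \<bar>f x * \<phi> x\<bar> powr q)" by (rule that(3))
    fix x
    have "0 < truncated_weight \<phi> k x" by (rule truncated_weight_pos) (rule D)
    then show "\<bar>f x * truncated_weight \<phi> k x\<bar> \<le> \<bar>f x * \<phi> x\<bar>"
      using truncated_weight_le[of \<phi> k x] by (simp add: abs_mult mult_left_mono)
  qed
  have le: "?nn (f0 t) k + ?nn (f1 t) k + ?nn (f2 t) k \<le> ?R" for k
  proof -
    have "?nn (f0 t) k + ?nn (f1 t) k + ?nn (f2 t) k \<le> (?nn (f0 0) k + ?nn (f1 0) k + ?nn (f2 0) k) * ?E"
      by (rule truncated_estimate[OF adm q t])
    also have "\<dots> \<le> ?R"
      by (intro mult_right_mono add_mono init f0_cont f1_cont f2_cont f_bound z i) auto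
    finally show ?thesis .
  qed
  have nn0: "0 \<le> ?nn f k" for f k by (rule wnorm_nonneg)
  have R: "?nn (f0 t) k \<le> ?R" "?nn (f1 t) k \<le> ?R" "?nn (f2 t) k \<le> ?R" for k
    by (rule order_trans[OF _ le[of k]], use nn0[of "f0 t" k] nn0[of "f1 t" k] nn0[of "f2 t" k] in simp)+
  note l0 = wnorm_truncated_tendsto[OF D(7,1) f0_cont[OF t] f_bound(1)[OF t] q R(1)]
  note l1 = wnorm_truncated_tendsto[OF D(7,1) f1_cont[OF t] f_bound(2)[OF t] q R(2)]
  note l2 = wnorm_truncated_tendsto[OF D(7,1) f2_cont[OF t] f_bound(3)[OF t] q R(3)]
  show "integrable lborel (\<lambda>x. \<bar>f0 t x * \<phi> x\<bar> powr q)" "integrable lborel (\<lambda>x. \<bar>f1 t x * \<phi> x\<bar> powr q)"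
      "integrable lborel (\<lambda>x. \<bar>f2 t x * \<phi> x\<bar> powr q)" by (rule l0(1) l1(1) l2(1))+
  show "?nl (f0 t) + ?nl (f1 t) + ?nl (f2 t) \<le> ?R"
    by (rule LIMSEQ_le_const2[OF tendsto_add[OF tendsto_add[OF l0(2) l1(2)] l2(2)]]) (intro exI allI impI, rule le)
qed

text \<open>The limit \<open>q \<rightarrow> \<infinity>\<close> is taken for the truncated weights, since the untruncated product need not lie
  in any \<open>L\<^sup>q\<close> with \<open>q < \<infinity>\<close>.\<close>

lemma (in classical_solution) weighted_sup_estimate:
  assumes adm: "admissible_weight \<phi> v C0 A" and t: "t \<in> {0..T}"
    and c: "\<And>x. \<bar>f0 0 x * \<phi> x\<bar> \<le> c0" "\<And>x. \<bar>f1 0 x * \<phi> x\<bar> \<le> c1" "\<And>x. \<bar>f2 0 x * \<phi> x\<bar> \<le> c2"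
  shows "\<bar>f0 t x * \<phi> x\<bar> + \<bar>f1 t y * \<phi> y\<bar> + \<bar>f2 t z * \<phi> z\<bar>
    \<le> (c0 + c1 + c2) * exp (growth_rate A C0 c (LINT x|lebesgue. v x / exp \<bar>x\<bar>) * M * t)"
proof -
  note D = admissible_weightD[OF adm]
  let ?E = "exp (growth_rate A C0 c (LINT x|lebesgue. v x / exp \<bar>x\<bar>) * M * t)"
  have zT: "0 \<in> {0..T}" using T by simp
  have wpos: "0 < truncated_weight \<phi> k x" for k x by (rule truncated_weight_pos) (rule D)
  \<comment> \<open>Three independent points are kept so that three separate suprema can be formed
    afterwards. The slack \<epsilon> makes the lower bounds strict and the bases
    \<open>c0 + \<epsilon>\<close>, \<open>c1 + \<epsilon>\<close>, \<open>c2 + \<epsilon>\<close>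
    positive; the exponents run through \<open>real j + 2\<close>.\<close>
  have step: "(\<bar>f0 t x * truncated_weight \<phi> k x\<bar> - \<epsilon>) + (\<bar>f1 t y * truncated_weight \<phi> k y\<bar> - \<epsilon>) + (\<bar>f2 t z * truncated_weight \<phi> k z\<bar> - \<epsilon>)
    \<le> ((c0 + \<epsilon>) + (c1 + \<epsilon>) + (c2 + \<epsilon>)) * ?E" (is "?l0 + ?l1 + ?l2 \<le> _") if \<epsilon>: "0 < \<epsilon>" for \<epsilon> k
  proof -
    let ?w = "truncated_weight \<phi> k"
    have cont: "continuous_on UNIV (\<lambda>x. f x * ?w x)" if "continuous_on UNIV f" for f
      by (intro continuous_intros that truncated_weight_continuous D)
    have int: "integrable lborel (\<lambda>x. \<bar>f x * ?w x\<bar> powr q)"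
      if "continuous_on UNIV f" "\<And>x. \<bar>f x\<bar> \<le> M" "2 \<le> q" for f q
      by (rule truncated_powr_integrable[OF D(7,1) that])
    have low: "\<exists>m>0. \<forall>q\<ge>2. (\<bar>f x * ?w x\<bar> - \<epsilon>) * m powr (1 / q) \<le> wnorm lborel q (\<lambda>x. f x * ?w x)"
      if f: "continuous_on UNIV f" "\<And>x. \<bar>f x\<bar> \<le> M" for f x
    proof -
      have "\<bar>f x * ?w x\<bar> - \<epsilon> < \<bar>f x * ?w x\<bar>" using \<epsilon> by simp
      from wnorm_lower_bound[OF cont[OF f(1)] this] show ?thesis
        by (elim exE conjE, intro exI conjI allI impI) (assumption, elim allE impE, assumption, rule int[OF f], assumption+)
    qed
    have up: "wnorm lborel q (\<lambda>x. f x * ?w x) \<le> (d + \<epsilon>) powr (1 - 2 / q) * ((LINT x|lborel. \<bar>f x * ?w x\<bar> powr 2) + 1) powr (1 / q)"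
      if f: "continuous_on UNIV f" "\<And>x. \<bar>f x\<bar> \<le> M" and d: "\<And>x. \<bar>f x * \<phi> x\<bar> \<le> d" and q: "2 \<le> q" for f d q
    proof (rule wnorm_upper_bound[OF q])
      have "0 \<le> d" using d[of 0] by linarith
      then show "0 < d + \<epsilon>" using \<epsilon> by simp
      fix x
      have "\<bar>f x * ?w x\<bar> \<le> \<bar>f x * \<phi> x\<bar>" using wpos[of k x] truncated_weight_le[of \<phi> k x] by (simp add: abs_mult mult_left_mono)
      then show "\<bar>f x * ?w x\<bar> \<le> d + \<epsilon>" using d[of x] \<epsilon> by linarith
    qed (rule int[OF f order_refl], rule int[OF f q])
    have P: "0 < (LINT x|lborel. \<bar>f x * ?w x\<bar> powr 2) + 1" for f by (rule add_nonneg_pos) auto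
    have d0: "0 < c0 + \<epsilon>" "0 < c1 + \<epsilon>" "0 < c2 + \<epsilon>" using c(1)[of 0] c(2)[of 0] c(3)[of 0] \<epsilon> by linarith+
    obtain m0 where m0: "0 < m0" "\<And>q. 2 \<le> q \<Longrightarrow> ?l0 * m0 powr (1 / q) \<le> wnorm lborel q (\<lambda>x. f0 t x * ?w x)"
      using low[OF f0_cont[OF t] f_bound(1)[OF t], of x] by (elim exE conjE) (rule that, assumption, simp)
    obtain m1 where m1: "0 < m1" "\<And>q. 2 \<le> q \<Longrightarrow> ?l1 * m1 powr (1 / q) \<le> wnorm lborel q (\<lambda>x. f1 t x * ?w x)"
      using low[OF f1_cont[OF t] f_bound(2)[OF t], of y] by (elim exE conjE) (rule that, assumption, simp)
    obtain m2 where m2: "0 < m2" "\<And>q. 2 \<le> q \<Longrightarrow> ?l2 * m2 powr (1 / q) \<le> wnorm lborel q (\<lambda>x. f2 t x * ?w x)"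
      using low[OF f2_cont[OF t] f_bound(3)[OF t], of z] by (elim exE conjE) (rule that, assumption, simp)
    let ?N0 = "(LINT x|lborel. \<bar>f0 0 x * ?w x\<bar> powr 2) + 1"
    let ?N1 = "(LINT x|lborel. \<bar>f1 0 x * ?w x\<bar> powr 2) + 1"
    let ?N2 = "(LINT x|lborel. \<bar>f2 0 x * ?w x\<bar> powr 2) + 1"
    define lhs where "lhs j = ?l0 * m0 powr (1 / (real j + 2)) + ?l1 * m1 powr (1 / (real j + 2)) + ?l2 * m2 powr (1 / (real j + 2))" for j :: nat
    define rhs where "rhs j = ((c0 + \<epsilon>) powr (1 - 2 / (real j + 2)) * ?N0 powr (1 / (real j + 2))
      + (c1 + \<epsilon>) powr (1 - 2 / (real j + 2)) * ?N1 powr (1 / (real j + 2))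
      + (c2 + \<epsilon>) powr (1 - 2 / (real j + 2)) * ?N2 powr (1 / (real j + 2))) * ?E" for j :: nat
    have le: "lhs j \<le> rhs j" for j
    proof -
      have q: "2 \<le> real j + 2" by simp
      have "lhs j \<le> wnorm lborel (real j + 2) (\<lambda>x. f0 t x * ?w x) + wnorm lborel (real j + 2) (\<lambda>x. f1 t x * ?w x)
          + wnorm lborel (real j + 2) (\<lambda>x. f2 t x * ?w x)"
        unfolding lhs_def by (intro add_mono m0(2)[OF q] m1(2)[OF q] m2(2)[OF q])
      also have "\<dots> \<le> (wnorm lborel (real j + 2) (\<lambda>x. f0 0 x * ?w x) + wnorm lborel (real j + 2) (\<lambda>x. f1 0 x * ?w x)
          + wnorm lborel (real j + 2) (\<lambda>x. f2 0 x * ?w x)) * ?E" by (rule truncated_estimate[OF adm q t])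
      also have "\<dots> \<le> rhs j" unfolding rhs_def
        by (intro mult_right_mono add_mono up[OF f0_cont[OF zT] f_bound(1)[OF zT] c(1) q]
          up[OF f1_cont[OF zT] f_bound(2)[OF zT] c(2) q] up[OF f2_cont[OF zT] f_bound(3)[OF zT] c(3) q]) auto
      finally show ?thesis .
    qed
    have "lhs \<longlonglongrightarrow> ?l0 * 1 + ?l1 * 1 + ?l2 * 1" unfolding lhs_def
      by (intro tendsto_add tendsto_mult tendsto_const powr_inverse_tendsto m0 m1 m2)
    moreover have "rhs \<longlonglongrightarrow> ((c0 + \<epsilon>) * 1 + (c1 + \<epsilon>) * 1 + (c2 + \<epsilon>) * 1) * ?E" unfolding rhs_def
      by (intro tendsto_add tendsto_mult tendsto_const powr_inverse_tendsto d0 P)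
    ultimately have "?l0 * 1 + ?l1 * 1 + ?l2 * 1 \<le> ((c0 + \<epsilon>) * 1 + (c1 + \<epsilon>) * 1 + (c2 + \<epsilon>) * 1) * ?E"
      by (rule LIMSEQ_le) (intro exI allI impI, rule le)
    then show ?thesis by simp
  qed
  \<comment> \<open>At the three given points the truncation is already inactive for some level, so
    no limit in the level has to be taken.\<close>
  have "\<forall>\<^sub>F k in sequentially. truncated_weight \<phi> k x = \<phi> x \<and> truncated_weight \<phi> k y = \<phi> y \<and> truncated_weight \<phi> k z = \<phi> z"
    by (intro eventually_conj truncated_weight_eventually)
  then obtain k where k: "truncated_weight \<phi> k x = \<phi> x" "truncated_weight \<phi> k y = \<phi> y" "truncated_weight \<phi> k z = \<phi> z"
    using eventually_happens[of _ sequentially] by auto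
  show ?thesis
  proof (rule field_le_epsilon)
    fix e :: real assume e: "0 < e"
    define \<epsilon> where "\<epsilon> = e / (3 + 3 * ?E)"
    have E: "0 < 3 + 3 * ?E" by (intro add_pos_pos) auto
    have \<epsilon>: "0 < \<epsilon>" using e E by (simp add: \<epsilon>_def)
    have "\<epsilon> * (3 + 3 * ?E) = e" using E by (simp add: \<epsilon>_def)
    then have "3 * \<epsilon> + 3 * \<epsilon> * ?E = e" by (simp add: algebra_simps)
    moreover have "\<bar>f0 t x * \<phi> x\<bar> + \<bar>f1 t y * \<phi> y\<bar> + \<bar>f2 t z * \<phi> z\<bar> - 3 * \<epsilon> \<le> (c0 + c1 + c2) * ?E + 3 * \<epsilon> * ?E"
      using step[OF \<epsilon>, of k] unfolding k by (simp add: algebra_simps)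
    ultimately show "\<bar>f0 t x * \<phi> x\<bar> + \<bar>f1 t y * \<phi> y\<bar> + \<bar>f2 t z * \<phi> z\<bar> \<le> (c0 + c1 + c2) * ?E + e" by linarith
  qed
qed

section \<open>From representatives back to the norms of the solution\<close>

lemma Lp_norm_borel_version:
  fixes f F :: "real \<Rightarrow> real"
  assumes "f \<in> borel_measurable lebesgue" "F \<in> borel_measurable borel" "AE x in lebesgue. f x = F x" "0 < q"
  shows "Lp_norm (ennreal q) f = (if integrable lborel (\<lambda>x. \<bar>F x\<bar> powr q) then ennreal (wnorm lborel q F) else \<infinity>)"
proof -
  have f: "(\<lambda>x. norm (f x) powr q) \<in> borel_measurable lebesgue" using assms(1) by measurable
  have F: "(\<lambda>x. \<bar>F x\<bar> powr q) \<in> borel_measurable borel" using assms(2) by measurable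
  have e: "AE x in lebesgue. norm (f x) powr q = \<bar>F x\<bar> powr q" using assms(3) by eventually_elim simp
  show ?thesis
    unfolding Lp_norm_def using assms(4) integral_lebesgue_borel_version[OF f F e] by (simp add: wnorm_def)
qed

text \<open>The predicate under the choice depends only on the class of \<open>f\<close> modulo null
  sets, so functions equal almost everywhere have literally the same \<open>weak_deriv\<close>. This
  transfers the hypotheses on the initial datum to the solution at time 0.\<close>

lemma has_weak_deriv_cong:
  assumes f: "f \<in> borel_measurable lebesgue" and f': "f' \<in> borel_measurable lebesgue" and e: "AE x in lebesgue. f x = f' x"
  shows "has_weak_deriv f = has_weak_deriv f'"
proof -
  have pm: "(\<lambda>x. \<psi> x *\<^sub>R g x) \<in> borel_measurable lebesgue" if "schwartz \<psi>" "g \<in> borel_measurable lebesgue" for \<psi> and g :: "real \<Rightarrow> real"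
    using measurable_completion[of \<psi> lborel borel] schwartz_measurable[OF that(1)] that(2) by (intro borel_measurable_scaleR) auto
  have pe: "AE x in lebesgue. \<psi> x *\<^sub>R f x = \<psi> x *\<^sub>R f' x" for \<psi> using e by eventually_elim simp
  have t: "tempered_fun f \<longleftrightarrow> tempered_fun f'"
    unfolding tempered_fun_def using f f' integrable_cong_AE[OF pm[OF _ f] pm[OF _ f'] pe] by blast
  have d: "dist_of f \<psi> = dist_of f' \<psi>" if "schwartz \<psi>" for \<psi>
    unfolding dist_of_def by (rule integral_cong_AE[OF pm[OF that f] pm[OF that f'] pe])
  show ?thesis
  proof (rule ext)
    fix g
    show "has_weak_deriv f g = has_weak_deriv f' g"
      unfolding has_weak_deriv_def dist_deriv_def t by (intro conj_cong refl all_cong1 imp_cong) (simp add: d[OF schwartz_deriv])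
  qed
qed

lemma weak_deriv_cong:
  assumes "f \<in> borel_measurable lebesgue" "f' \<in> borel_measurable lebesgue" "AE x in lebesgue. f x = f' x"
  shows "weak_deriv f = weak_deriv f'"
  unfolding weak_deriv_def has_weak_deriv_cong[OF assms] ..

text \<open>A bound on the sum at three independent points bounds the sum of the suprema: they are
  taken one after the other, with the remaining points held fixed.\<close>

lemma sum_bound_split:
  fixes a b c :: "real \<Rightarrow> real"
  assumes le: "\<And>x y z. a x + b y + c z \<le> R"
  shows "\<exists>A B C. (\<forall>x. a x \<le> A) \<and> (\<forall>x. b x \<le> B) \<and> (\<forall>x. c x \<le> C) \<and> A + B + C \<le> R"
proof -
  have "bdd_above (range a)" by (rule bdd_aboveI2[of _ _ "R - b 0 - c 0"]) (use le[of _ 0 0] in \<open>simp add: algebra_simps\<close>)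
  moreover have "bdd_above (range b)" by (rule bdd_aboveI2[of _ _ "R - a 0 - c 0"]) (use le[of 0 _ 0] in \<open>simp add: algebra_simps\<close>)
  moreover have "bdd_above (range c)" by (rule bdd_aboveI2[of _ _ "R - a 0 - b 0"]) (use le[of 0 0] in \<open>simp add: algebra_simps\<close>)
  ultimately have bdd: "bdd_above (range a)" "bdd_above (range b)" "bdd_above (range c)" by auto
  have 1: "(SUP x. a x) \<le> R - b y - c z" for y z
    by (rule cSUP_least) (use le[of _ y z] in \<open>auto simp: algebra_simps\<close>)
  have 2: "(SUP y. b y) \<le> R - (SUP x. a x) - c z" for z
    by (rule cSUP_least) (use 1[of _ z] in \<open>auto simp: algebra_simps\<close>)
  have 3: "(SUP z. c z) \<le> R - (SUP x. a x) - (SUP y. b y)"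
    by (rule cSUP_least) (use 2 in \<open>auto simp: algebra_simps\<close>)
  have ub: "a x \<le> (SUP x. a x)" "b x \<le> (SUP x. b x)" "c x \<le> (SUP x. c x)" for x
    using bdd by (simp_all add: cSUP_upper)
  show ?thesis
    by (rule exI[of _ "SUP x. a x"], rule exI[of _ "SUP x. b x"], rule exI[of _ "SUP x. c x"])
      (intro conjI allI ub, use 3 in simp)
qed

text \<open>Restates the estimates in the extended norm for arbitrary almost everywhere
  representatives. The case of infinite exponent rests on the pointwise estimate at three points,
  the other on the finite-exponent limit, whose integrability part rules out the value
  \<open>\<infinity>\<close> on the left.\<close>

lemma (in classical_solution) weighted_Lp_norm_estimate:
  assumes adm: "admissible_weight \<phi> v C0 A" and p: "2 \<le> p" and t: "t \<in> {0..T}"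
    and um: "u \<in> borel_measurable lebesgue" "u' \<in> borel_measurable lebesgue" "u'' \<in> borel_measurable lebesgue"
    and ue: "AE x in lebesgue. u x = f0 t x" "AE x in lebesgue. u' x = f1 t x" "AE x in lebesgue. u'' x = f2 t x"
    and wm: "w \<in> borel_measurable lebesgue" "w' \<in> borel_measurable lebesgue" "w'' \<in> borel_measurable lebesgue"
    and we: "AE x in lebesgue. w x = f0 0 x" "AE x in lebesgue. w' x = f1 0 x" "AE x in lebesgue. w'' x = f2 0 x"
    and fin: "Lp_norm p (\<lambda>x. w x * \<phi> x) < \<infinity>" "Lp_norm p (\<lambda>x. w' x * \<phi> x) < \<infinity>" "Lp_norm p (\<lambda>x. w'' x * \<phi> x) < \<infinity>"
  shows "Lp_norm p (\<lambda>x. u x * \<phi> x) + Lp_norm p (\<lambda>x. u' x * \<phi> x) + Lp_norm p (\<lambda>x. u'' x * \<phi> x)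
    \<le> (Lp_norm p (\<lambda>x. w x * \<phi> x) + Lp_norm p (\<lambda>x. w' x * \<phi> x) + Lp_norm p (\<lambda>x. w'' x * \<phi> x))
      * ennreal (exp (growth_rate A C0 c (LINT x|lebesgue. v x / exp \<bar>x\<bar>) * M * t))"
proof -
  note D = admissible_weightD[OF adm]
  let ?E = "exp (growth_rate A C0 c (LINT x|lebesgue. v x / exp \<bar>x\<bar>) * M * t)"
  have z: "0 \<in> {0..T}" using T by simp
  have \<phi>m: "\<phi> \<in> borel_measurable lebesgue"
    using borel_measurable_continuous_onI[OF D(7)] by (simp add: measurable_completion)
  have m: "(\<lambda>x. g x * \<phi> x) \<in> borel_measurable lebesgue" if "g \<in> borel_measurable lebesgue" for g
    using that \<phi>m by (rule borel_measurable_times)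
  have ae: "AE x in lebesgue. g x * \<phi> x = G x * \<phi> x" if "AE x in lebesgue. g x = G x" for g G :: "real \<Rightarrow> real"
    using that by eventually_elim simp
  have cont: "continuous_on UNIV (\<lambda>x. G x * \<phi> x)" if "continuous_on UNIV G" for G
    by (intro continuous_intros that D)
  have mul: "(ennreal a + ennreal b + ennreal c) * ennreal ?E = ennreal ((a + b + c) * ?E)"
    if "0 \<le> a" "0 \<le> b" "0 \<le> c" for a b c
    using that by (simp add: ennreal_plus ennreal_mult)
  show ?thesis
  proof (cases "p = \<infinity>")
    case True
    have bd: "\<bar>G x * \<phi> x\<bar> \<le> enn2real (Lp_norm p (\<lambda>x. g x * \<phi> x))"
      if G: "continuous_on UNIV G" "AE x in lebesgue. g x = G x" "Lp_norm p (\<lambda>x. g x * \<phi> x) < \<infinity>" for g G x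
    proof -
      have "ennreal \<bar>G x * \<phi> x\<bar> \<le> Lp_norm p (\<lambda>x. g x * \<phi> x)"
        unfolding True by (rule continuous_le_Lp_norm_infinity[OF ae[OF G(2)] cont[OF G(1)]])
      then have "enn2real (ennreal \<bar>G x * \<phi> x\<bar>) \<le> enn2real (Lp_norm p (\<lambda>x. g x * \<phi> x))"
        using G(3) by (intro enn2real_mono) simp_all
      then show ?thesis by simp
    qed
    let ?c0 = "enn2real (Lp_norm p (\<lambda>x. w x * \<phi> x))"
    let ?c1 = "enn2real (Lp_norm p (\<lambda>x. w' x * \<phi> x))"
    let ?c2 = "enn2real (Lp_norm p (\<lambda>x. w'' x * \<phi> x))"
    note est = weighted_sup_estimate[where c = c, OF adm t bd[OF f0_cont[OF z] we(1) fin(1)] bd[OF f1_cont[OF z] we(2) fin(2)] bd[OF f2_cont[OF z] we(3) fin(3)]]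
    obtain B0 B1 B2 where B': "\<forall>x. \<bar>f0 t x * \<phi> x\<bar> \<le> B0" "\<forall>x. \<bar>f1 t x * \<phi> x\<bar> \<le> B1" "\<forall>x. \<bar>f2 t x * \<phi> x\<bar> \<le> B2"
      "B0 + B1 + B2 \<le> (?c0 + ?c1 + ?c2) * ?E"
      using sum_bound_split[where a = "\<lambda>x. \<bar>f0 t x * \<phi> x\<bar>" and b = "\<lambda>x. \<bar>f1 t x * \<phi> x\<bar>" and c = "\<lambda>x. \<bar>f2 t x * \<phi> x\<bar>", OF est] by (elim exE conjE) (rule that)
    note B = B'(1-3)[rule_format] B'(4)
    have B0: "0 \<le> B0" "0 \<le> B1" "0 \<le> B2" using B(1)[of 0] B(2)[of 0] B(3)[of 0] by linarith+
    have "Lp_norm p (\<lambda>x. u x * \<phi> x) + Lp_norm p (\<lambda>x. u' x * \<phi> x) + Lp_norm p (\<lambda>x. u'' x * \<phi> x)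
      \<le> ennreal B0 + ennreal B1 + ennreal B2"
      unfolding True
      by (intro add_mono Lp_norm_infinity_le[OF m[OF um(1)] ae[OF ue(1)] B(1)]
        Lp_norm_infinity_le[OF m[OF um(2)] ae[OF ue(2)] B(2)] Lp_norm_infinity_le[OF m[OF um(3)] ae[OF ue(3)] B(3)])
    also have "\<dots> = ennreal (B0 + B1 + B2)" using B0 by (simp add: ennreal_plus)
    also have "\<dots> \<le> ennreal ((?c0 + ?c1 + ?c2) * ?E)" by (rule ennreal_leI[OF B(4)])
    also have "\<dots> = (ennreal ?c0 + ennreal ?c1 + ennreal ?c2) * ennreal ?E" by (rule mul[symmetric]) auto
    also have "\<dots> = (Lp_norm p (\<lambda>x. w x * \<phi> x) + Lp_norm p (\<lambda>x. w' x * \<phi> x) + Lp_norm p (\<lambda>x. w'' x * \<phi> x)) * ennreal ?E"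
      using fin by simp
    finally show ?thesis .
  next
    case False
    define q where "q = enn2real p"
    have pq: "p = ennreal q" using False by (simp add: q_def less_top[symmetric])
    have q: "2 \<le> q" using p unfolding pq by (metis ennreal_le_iff2 ennreal_numeral not_numeral_le_zero order_trans zero_le_numeral)
    have q0: "0 < q" using q by simp
    have nrm: "Lp_norm p (\<lambda>x. g x * \<phi> x) = (if integrable lborel (\<lambda>x. \<bar>G x * \<phi> x\<bar> powr q) then ennreal (wnorm lborel q (\<lambda>x. G x * \<phi> x)) else \<infinity>)"
      if "g \<in> borel_measurable lebesgue" "continuous_on UNIV G" "AE x in lebesgue. g x = G x" for g G
      unfolding pq by (rule Lp_norm_borel_version[OF m[OF that(1)] borel_measurable_continuous_onI[OF cont[OF that(2)]] ae[OF that(3)] q0])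
    have i: "integrable lborel (\<lambda>x. \<bar>G x * \<phi> x\<bar> powr q)"
      if "g \<in> borel_measurable lebesgue" "continuous_on UNIV G" "AE x in lebesgue. g x = G x" "Lp_norm p (\<lambda>x. g x * \<phi> x) < \<infinity>" for g G
      using that(4) unfolding nrm[OF that(1-3)] by (simp split: if_splits)
    note ii = i[OF wm(1) f0_cont[OF z] we(1) fin(1)] i[OF wm(2) f1_cont[OF z] we(2) fin(2)] i[OF wm(3) f2_cont[OF z] we(3) fin(3)]
    note int = weighted_Lp_estimate(1-3)[OF adm q t ii] and est = weighted_Lp_estimate(4)[where c = c, OF adm q t ii]
    note L = nrm[OF um(1) f0_cont[OF t] ue(1)] nrm[OF um(2) f1_cont[OF t] ue(2)] nrm[OF um(3) f2_cont[OF t] ue(3)]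
    note R = nrm[OF wm(1) f0_cont[OF z] we(1)] nrm[OF wm(2) f1_cont[OF z] we(2)] nrm[OF wm(3) f2_cont[OF z] we(3)]
    have "ennreal (wnorm lborel q (\<lambda>x. f0 t x * \<phi> x)) + ennreal (wnorm lborel q (\<lambda>x. f1 t x * \<phi> x)) + ennreal (wnorm lborel q (\<lambda>x. f2 t x * \<phi> x))
      = ennreal (wnorm lborel q (\<lambda>x. f0 t x * \<phi> x) + wnorm lborel q (\<lambda>x. f1 t x * \<phi> x) + wnorm lborel q (\<lambda>x. f2 t x * \<phi> x))"
      by (simp add: ennreal_plus wnorm_nonneg)
    also have "\<dots> \<le> (ennreal (wnorm lborel q (\<lambda>x. f0 0 x * \<phi> x)) + ennreal (wnorm lborel q (\<lambda>x. f1 0 x * \<phi> x))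
        + ennreal (wnorm lborel q (\<lambda>x. f2 0 x * \<phi> x))) * ennreal ?E"
      unfolding mul[OF wnorm_nonneg wnorm_nonneg wnorm_nonneg] by (rule ennreal_leI[OF est])
    finally show ?thesis unfolding L R using int ii by simp
  qed
qed

theorem theorem3p4:
  shows "\<exists>C :: real \<Rightarrow> real \<Rightarrow> real \<Rightarrow> real \<Rightarrow> real.
    (\<forall>a b c d. 0 < C a b c d) \<and>
    (\<forall>(T::real) (s::real) (p::ennreal) (u :: real \<Rightarrow> real \<Rightarrow> real) (u0 :: real \<Rightarrow> real)
      (\<phi> :: real \<Rightarrow> real) (v :: real \<Rightarrow> real) (C0::real) (A::real).
      0 < T \<longrightarrow> 5 / 2 < s \<longrightarrow> 2 \<le> p \<longrightarrow>
      admissible_weight \<phi> v C0 A \<longrightarrow>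
      strong_solution T s u u0 \<longrightarrow>
      (\<lambda>x. u0 x * \<phi> x) \<in> Lp p \<longrightarrow>
      (\<lambda>x. weak_deriv u0 x * \<phi> x) \<in> Lp p \<longrightarrow>
      (\<lambda>x. weak_deriv (weak_deriv u0) x * \<phi> x) \<in> Lp p \<longrightarrow>
      (let M = (SUP t\<in>{0..T}. Lp_norm \<infinity> (u t) + Lp_norm \<infinity> (weak_deriv (u t))
                              + Lp_norm \<infinity> (weak_deriv (weak_deriv (u t))));
           K = C A C0 (INF x. v x) (LINT x|lebesgue. v x / exp \<bar>x\<bar>)
       in M < \<infinity> \<and>
          (\<forall>t\<in>{0..T}.
             Lp_norm p (\<lambda>x. u t x * \<phi> x)
             + Lp_norm p (\<lambda>x. weak_deriv (u t) x * \<phi> x)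
             + Lp_norm p (\<lambda>x. weak_deriv (weak_deriv (u t)) x * \<phi> x)
             \<le> (Lp_norm p (\<lambda>x. u0 x * \<phi> x)
                 + Lp_norm p (\<lambda>x. weak_deriv u0 x * \<phi> x)
                 + Lp_norm p (\<lambda>x. weak_deriv (weak_deriv u0) x * \<phi> x))
               * ennreal (exp (K * enn2real M * t)))))"
  unfolding Let_def sup_M_def[symmetric]
proof (rule exI[of _ growth_rate], intro conjI allI impI ballI growth_rate_pos)
  fix T s :: real and p :: ennreal and u :: "real \<Rightarrow> real \<Rightarrow> real" and u0 \<phi> v :: "real \<Rightarrow> real" and C0 A :: real
  assume T: "0 < T" and s: "5 / 2 < s" and p: "2 \<le> p" and adm: "admissible_weight \<phi> v C0 A"
    and sol: "strong_solution T s u u0"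
    and L0: "(\<lambda>x. u0 x * \<phi> x) \<in> Lp p" and L1: "(\<lambda>x. weak_deriv u0 x * \<phi> x) \<in> Lp p"
    and L2: "(\<lambda>x. weak_deriv (weak_deriv u0) x * \<phi> x) \<in> Lp p"
  note sc = strong_solution_classical[OF T s sol]
  note D = admissible_weightD[OF adm]
  show "sup_M T u < \<infinity>" by (rule sc(1))
  fix t assume t: "t \<in> {0..T}"
  obtain f0 f1 f2 U0 U1 H \<gamma> where cs: "classical_solution T (enn2real (sup_M T u)) H \<gamma> f0 f1 f2 U0 U1"
    and f: "\<forall>t\<in>{0..T}. u t \<in> borel_measurable lebesgue \<and> weak_deriv (u t) \<in> borel_measurable lebesgue \<and>
        weak_deriv (weak_deriv (u t)) \<in> borel_measurable lebesgue \<and>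
        (AE x in lebesgue. u t x = f0 t x) \<and> (AE x in lebesgue. weak_deriv (u t) x = f1 t x) \<and>
        (AE x in lebesgue. weak_deriv (weak_deriv (u t)) x = f2 t x)"
    using sc(2) by (elim exE conjE) (rule that)
  have z: "0 \<in> {0..T}" using T by simp
  note ft = f[rule_format, OF t] and fz = f[rule_format, OF z]
  have \<phi>m: "\<phi> \<in> borel_measurable lebesgue"
    using borel_measurable_continuous_onI[OF D(7)] by (simp add: measurable_completion)
  have "(\<lambda>x. u0 x * \<phi> x) \<in> borel_measurable lebesgue" using L0 by (simp add: Lp_def)
  \<comment> \<open>Measurability of the initial datum is recovered from that of its product with
    \<phi>, since \<phi> is positive and measurable.\<close>
  then have "(\<lambda>x. (u0 x * \<phi> x) / \<phi> x) \<in> borel_measurable lebesgue" using \<phi>m by (rule borel_measurable_divide)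
  moreover have "(\<lambda>x. (u0 x * \<phi> x) / \<phi> x) = u0" using D(1) by (auto simp: less_imp_neq[symmetric])
  ultimately have u0m: "u0 \<in> borel_measurable lebesgue" by simp
  have e: "AE x in lebesgue. u 0 x = u0 x" using sol by (simp add: strong_solution_def)
  \<comment> \<open>An equality of functions, so the second weak derivatives agree as well without a
    further almost everywhere argument.\<close>
  have w: "weak_deriv u0 = weak_deriv (u 0)" using weak_deriv_cong[OF _ u0m e] fz by simp
  have e0: "AE x in lebesgue. u0 x = f0 0 x"
    using e fz[THEN conjunct2, THEN conjunct2, THEN conjunct2, THEN conjunct1] by eventually_elim simp
  have fin: "Lp_norm p (\<lambda>x. u0 x * \<phi> x) < \<infinity>" "Lp_norm p (\<lambda>x. weak_deriv (u 0) x * \<phi> x) < \<infinity>"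
    "Lp_norm p (\<lambda>x. weak_deriv (weak_deriv (u 0)) x * \<phi> x) < \<infinity>" using L0 L1 L2 by (simp_all add: Lp_def w)
  show "Lp_norm p (\<lambda>x. u t x * \<phi> x) + Lp_norm p (\<lambda>x. weak_deriv (u t) x * \<phi> x)
      + Lp_norm p (\<lambda>x. weak_deriv (weak_deriv (u t)) x * \<phi> x)
    \<le> (Lp_norm p (\<lambda>x. u0 x * \<phi> x) + Lp_norm p (\<lambda>x. weak_deriv u0 x * \<phi> x)
        + Lp_norm p (\<lambda>x. weak_deriv (weak_deriv u0) x * \<phi> x))
      * ennreal (exp (growth_rate A C0 (INF x. v x) (LINT x|lebesgue. v x / exp \<bar>x\<bar>) * enn2real (sup_M T u) * t))"
    unfolding w
    by (rule classical_solution.weighted_Lp_norm_estimate[OF cs adm p t])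
      (use ft fz u0m e0 fin in \<open>simp_all\<close>)
qed

end
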